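(* Let $\alpha>0$, $0<q\leq 2$, $x\in\mathbb{R}$, let $w_x$ be a function of modulus of continuity type, and let $f\in\Omega_{\alpha,1,2}(w_x)$. Let $A=(a_{n,k})_{n,k\geq 0}$ be an infinite matrix of nonnegative real numbers such that $\sum_{k=0}^{\infty}a_{n,k}=1$ for every $n=0,1,2,\dots$, $\lim_{n\to\infty}a_{n,0}=0$, and for every $n$ the sequence $(a_{n,k})_{k=0}^{\infty}$ is nonincreasing in $k$. Then there is a constant $K>0$ independent of $n$ such that for all $n=0,1,2,\dots$ $$\left\{\sum_{k=0}^{\infty}a_{n,k}\left|S_{\frac{\alpha k}{2}}f(x)-f(x)\right|^{q}\right\}^{1/q}\leq K\left\{\sum_{k=0}^{\infty}a_{n,k}\left[w_x\left(\frac{\pi}{k+1}\right)+E_{\frac{\alpha k}{2}}(f)_{S^1}\right]^{q}\right\}^{1/q}.$$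
   Context: Notation: $[y]$ is the integer part of $y$; $\mathbb{N}=\{1,2,3,\dots\}$. $S^1$ is the class of all (complex-valued) functions on $\mathbb{R}$ that are almost periodic in the sense of Stepanov, with norm $\|f\|_{S^1}=\sup_{u\in\mathbb{R}}\frac1\pi\int_u^{u+\pi}|f(t)|\,dt$. The Fourier series of $f\in S^1$ is assumed to have the form $\sum_{\nu=-\infty}^{\infty}A_\nu(f)e^{i\lambda_\nu x}$, where $A_\nu(f)=\lim_{L\to\infty}\frac1L\int_0^L f(t)e^{-i\lambda_\nu t}\,dt$, and where the Fourier exponents satisfy $0=\lambda_0<\lambda_\nu<\lambda_{\nu+1}$ for $\nu\in\mathbb{N}$, $\lim_{\nu\to\infty}\lambda_\nu=\infty$, $\lambda_{-\nu}=-\lambda_\nu$, and $|A_\nu(f)|+|A_{-\nu}(f)|>0$ for $\nu\in\mathbb{N}$. (All frequencies with nonzero Fourier coefficient are among the $\lambda_\nu$.) Partial sums: $S_{\gamma}f(x)=\sum_{|\lambda_\nu|\leq\gamma}A_\nu(f)e^{i\lambda_\nu x}$ for $\gamma\ge 0$. $\Omega_{\alpha,1}$ (with $\alpha>0$ fixed) is the set of functions $f\in S^1$ that are bounded on $\mathbb{R}$ and whose Fourier exponents satisfy $\lambda_{\nu+1}-\lambda_\nu\geq\alpha$ for all $\nu\in\mathbb{N}$. Best approximation: for $\sigma\geq0$, $E_\sigma(f)_{S^1}=\inf_{g}\|f-g\|_{S^1}$, the infimum taken over the class $B_\sigma$ of entire functions $g$ of exponential type (at most) $\sigma$ that are bounded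 on the real axis. For fixed $x$, $\varphi_x(t)=f(x+t)+f(x-t)-2f(x)$, and for $\delta>0$ $$G_xf(\delta)_{2,1}=\left\{\sum_{k=0}^{[\pi/(\alpha\delta)]}\left(\frac{1}{(k+1)\delta}\int_{k\delta}^{(k+1)\delta}|\varphi_x(t)|\,dt\right)^{2}\right\}^{1/2}.$$ A function $w_x:[0,\infty)\to[0,\infty)$ is of modulus of continuity type if it is nondecreasing, continuous, $w_x(0)=0$, and $w_x(\delta_1+\delta_2)\leq w_x(\delta_1)+w_x(\delta_2)$ for all $\delta_1,\delta_2\geq0$. $\Omega_{\alpha,1,2}(w_x)$ is the set of $f\in\Omega_{\alpha,1}$ for which there is a constant $C>0$ such that for all $\gamma,\delta>0$ (and both choices of sign) $$\frac1\delta\int_0^\delta|\varphi_x(t)-\varphi_x(t\pm\gamma)|\,dt\leq C\,w_x(\gamma)\quad\text{and}\quad G_xf(\delta)_{2,1}\leq C\,w_x(\delta).$$ *)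

theory Defs
  imports "HOL-Complex_Analysis.Complex_Analysis"
begin

definition stepanov_norm :: "(real \<Rightarrow> complex) \<Rightarrow> real" where
  "stepanov_norm f = (SUP u. 1 / pi * integral {u..u + pi} (\<lambda>t. norm (f t)))"

text \<open>
  Almost periodicity in the sense of Stepanov: local Lebesgue integrability, and for every
  \<open>\<epsilon> > 0\<close> a relatively dense set of \<open>\<epsilon>\<close>-translation numbers with respect to the Stepanov norm.
  The bound on the norm of the difference is written out as a bound for every window, so that it
  does not depend on the value of a supremum of a possibly unbounded set.
\<close>

definition stepanov_translation_number :: "(real \<Rightarrow> complex) \<Rightarrow> real \<Rightarrow> real \<Rightarrow> bool" where
  "stepanov_translation_number f \<epsilon> \<tau> \<longleftrightarrow>
     (\<forall>u. 1 / pi * integral {u..u + pi} (\<lambda>t. norm (f (t + \<tau>) - f t)) \<le> \<epsilon>)"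

definition stepanov_ap :: "(real \<Rightarrow> complex) set" where
  "stepanov_ap = {f.
     (\<forall>a b. f absolutely_integrable_on {a..b}) \<and>
     (\<forall>\<epsilon>>0. \<exists>l>0. \<forall>a. \<exists>\<tau>\<in>{a..a + l}. stepanov_translation_number f \<epsilon> \<tau>)}"

definition fourier_coeff :: "(real \<Rightarrow> complex) \<Rightarrow> real \<Rightarrow> complex" where
  "fourier_coeff f \<mu> =
     Lim at_top (\<lambda>L::real. of_real (1 / L) * integral {0..L} (\<lambda>t. f t * cis (- \<mu> * t)))"

text \<open>The sequence \<open>\<Lambda>\<close> is indexed by all integers; it is determined by \<open>f\<close>.\<close>

definition fourier_exponents :: "(real \<Rightarrow> complex) \<Rightarrow> (int \<Rightarrow> real) \<Rightarrow> bool" where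
  "fourier_exponents f \<Lambda> \<longleftrightarrow>
     \<Lambda> 0 = 0 \<and>
     (\<forall>\<nu>\<ge>1. 0 < \<Lambda> \<nu> \<and> \<Lambda> \<nu> < \<Lambda> (\<nu> + 1)) \<and>
     filterlim \<Lambda> at_top at_top \<and>
     (\<forall>\<nu>. \<Lambda> (- \<nu>) = - \<Lambda> \<nu>) \<and>
     (\<forall>\<nu>\<ge>1. norm (fourier_coeff f (\<Lambda> \<nu>)) + norm (fourier_coeff f (\<Lambda> (- \<nu>))) > 0) \<and>
     (\<forall>\<mu>. fourier_coeff f \<mu> \<noteq> 0 \<longrightarrow> \<mu> \<in> range \<Lambda>)"

definition fourier_partial_sum ::
    "(real \<Rightarrow> complex) \<Rightarrow> (int \<Rightarrow> real) \<Rightarrow> real \<Rightarrow> real \<Rightarrow> complex" where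
  "fourier_partial_sum f \<Lambda> \<gamma> x =
     (\<Sum>\<nu> | \<bar>\<Lambda> \<nu>\<bar> \<le> \<gamma>. fourier_coeff f (\<Lambda> \<nu>) * cis (\<Lambda> \<nu> * x))"

lemma finite_fourier_partial_sum_index:
  assumes "fourier_exponents f \<Lambda>"
  shows "finite {\<nu>. \<bar>\<Lambda> \<nu>\<bar> \<le> \<gamma>}"
proof -
  have lim: "filterlim \<Lambda> at_top at_top" and odd: "\<And>\<nu>. \<Lambda> (- \<nu>) = - \<Lambda> \<nu>"
    using assms by (auto simp: fourier_exponents_def)
  obtain N where N: "\<And>\<nu>. \<nu> \<ge> N \<Longrightarrow> \<Lambda> \<nu> > \<gamma>"
    using filterlim_at_top_dense[THEN iffD1, OF lim, rule_format, of \<gamma>]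
    unfolding eventually_at_top_linorder by auto
  have "{\<nu>. \<bar>\<Lambda> \<nu>\<bar> \<le> \<gamma>} \<subseteq> {- \<bar>N\<bar>..\<bar>N\<bar>}"
  proof
    fix \<nu> assume "\<nu> \<in> {\<nu>. \<bar>\<Lambda> \<nu>\<bar> \<le> \<gamma>}"
    then have "\<not> \<Lambda> \<nu> > \<gamma>" "\<not> \<Lambda> (- \<nu>) > \<gamma>" by (auto simp: odd)
    then have "\<not> \<nu> \<ge> N" "\<not> - \<nu> \<ge> N" using N by blast+
    then show "\<nu> \<in> {- \<bar>N\<bar>..\<bar>N\<bar>}" by auto
  qed
  then show ?thesis by (rule finite_subset) simp
qed

text \<open>The class \<open>\<Omega>\<^sub>\<alpha>\<^sub>,\<^sub>1\<close>. The gap condition does not concern \<open>\<Lambda>\<^sub>1 - \<Lambda>\<^sub>0\<close>.\<close>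

definition Omega1 :: "real \<Rightarrow> (real \<Rightarrow> complex) set" where
  "Omega1 \<alpha> = {f \<in> stepanov_ap. bounded (range f) \<and>
     (\<exists>\<Lambda>. fourier_exponents f \<Lambda> \<and> (\<forall>\<nu>\<ge>1. \<Lambda> (\<nu> + 1) - \<Lambda> \<nu> \<ge> \<alpha>))}"

definition exp_type_bounded :: "real \<Rightarrow> (complex \<Rightarrow> complex) set" where
  "exp_type_bounded \<sigma> = {g. g holomorphic_on UNIV \<and>
     (\<forall>\<epsilon>>0. \<exists>C. \<forall>z. norm (g z) \<le> C * exp ((\<sigma> + \<epsilon>) * norm z)) \<and>
     bounded (range (\<lambda>t::real. g (of_real t)))}"

definition best_approx :: "real \<Rightarrow> (real \<Rightarrow> complex) \<Rightarrow> real" where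
  "best_approx \<sigma> f =
     (INF g\<in>exp_type_bounded \<sigma>. stepanov_norm (\<lambda>t. f t - g (of_real t)))"

definition second_diff :: "(real \<Rightarrow> complex) \<Rightarrow> real \<Rightarrow> real \<Rightarrow> complex" where
  "second_diff f x t = f (x + t) + f (x - t) - 2 * f x"

text \<open>\<open>G\<^sub>x f(\<delta>)\<^sub>2\<^sub>,\<^sub>1\<close>, with its dependence on \<open>\<alpha>\<close> made explicit.\<close>

definition G21 :: "real \<Rightarrow> (real \<Rightarrow> complex) \<Rightarrow> real \<Rightarrow> real \<Rightarrow> real" where
  "G21 \<alpha> f x \<delta> = sqrt (\<Sum>k = 0..nat \<lfloor>pi / (\<alpha> * \<delta>)\<rfloor>.
     (1 / ((real k + 1) * \<delta>) *
        integral {real k * \<delta>..(real k + 1) * \<delta>} (\<lambda>t. norm (second_diff f x t)))\<^sup>2)"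

definition modulus_type :: "(real \<Rightarrow> real) \<Rightarrow> bool" where
  "modulus_type w \<longleftrightarrow>
     (\<forall>\<delta>\<ge>0. w \<delta> \<ge> 0) \<and> mono_on {0..} w \<and> continuous_on {0..} w \<and> w 0 = 0 \<and>
     (\<forall>\<delta>1\<ge>0. \<forall>\<delta>2\<ge>0. w (\<delta>1 + \<delta>2) \<le> w \<delta>1 + w \<delta>2)"

definition Omega12 :: "real \<Rightarrow> real \<Rightarrow> (real \<Rightarrow> real) \<Rightarrow> (real \<Rightarrow> complex) set" where
  "Omega12 \<alpha> x w = {f \<in> Omega1 \<alpha>. \<exists>C>0. \<forall>\<gamma>>0. \<forall>\<delta>>0.
     1 / \<delta> * integral {0..\<delta>} (\<lambda>t. norm (second_diff f x t - second_diff f x (t + \<gamma>))) \<le> C * w \<gamma> \<and>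
     1 / \<delta> * integral {0..\<delta>} (\<lambda>t. norm (second_diff f x t - second_diff f x (t - \<gamma>))) \<le> C * w \<gamma> \<and>
     G21 \<alpha> f x \<delta> \<le> C * w \<delta>}"

end

theory Submission
  imports Defs "HOL-Probability.Sinc_Integral"
begin

text \<open>
  Convolving \<open>f\<close> with the de la Vallee Poussin kernel \<open>\<Psi>\<^sub>k\<close>, whose Fourier transform is the trapezoid
  that equals \<open>1\<close> up to \<open>\<alpha> k / 2\<close> and vanishes beyond \<open>\<alpha> (k + 1) / 2\<close>, gives the partial sum of order
  \<open>\<alpha> k / 2\<close> up to the terms of at most one pair of exponents, and each Fourier coefficient beyond \<open>\<sigma>\<close> is at
  most the best approximation of order \<open>\<sigma>\<close>. The identity at the point \<open>x\<close> rests on the uniqueness theorem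
  for almost periodic functions.

  The deviation of the convolution from \<open>f x\<close> is the integral of the second difference \<open>\<phi>\<close> against \<open>\<Psi>\<^sub>k\<close>
  over the positive half line. Up to \<open>pi / \<alpha>\<close>, a large sieve inequality bounds the sum over \<open>m \<le> k \<le> 2 m\<close>
  of its squares by the quadratic mean \<open>G21\<close>. Beyond \<open>pi / \<alpha>\<close> the kernel decays like \<open>1 / t\<^sup>2\<close> and
  oscillates, and a shift by half a period turns the translation condition on \<open>\<phi>\<close> into a bound by the modulus
  of continuity. Hence the quadratic means over the blocks \<open>m \<le> k \<le> 2 m\<close> are controlled by the right hand
  side at \<open>m\<close>; since the weights are nonincreasing, dyadic blocks give the theorem.
\<close>

section \<open>Entire functions of exponential type in a quadrant\<close>

text \<open>The L1 norm of \<open>vp_kernel\<close> at order \<alpha> k / 2 grows like log k,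
  because the slopes of its trapezoid keep the width \<alpha> / 2. Estimating a single k by absolute
  values therefore loses a logarithm. Averaging squares over a block of k does not, and this is
  where q <= 2 comes from.

  An approximant of exponential type \<sigma> is only bounded on the real axis and need not have
  Fourier coefficients. What replaces their vanishing beyond \<sigma> is that its integral against
  \<open>cis (- \<mu> * t)\<close> over [0, L] stays bounded in L. This comes from moving the path
  into a half plane where the exponential decays; Phragmen-Lindelof controls the growth there.

  Integrals see f only up to null sets, while the statement concerns its value at the single point
  x. Every integral is therefore taken over a bounded Borel representative, and the number
  \<open>f x\<close> is kept.\<close>

lemma frontier_quarter_bound:
  fixes S :: "complex set"
  assumes S: "S = {z. 0 < Im z \<and> Im z < Re z \<and> norm z < R}" and z: "z \<in> frontier S"
  shows "0 \<le> Im z \<and> Im z \<le> Re z \<and> norm z \<le> R \<and> (Im z = 0 \<or> Im z = Re z \<or> norm z = R)"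
proof -
  have "open S"
  proof -
    have "S = {z. 0 < Im z} \<inter> {z. Im z < Re z} \<inter> {z. norm z < R}" by (auto simp: S)
    moreover have "open {z. 0 < Im z}" "open {z. Im z < Re z}" "open {z::complex. norm z < R}"
      by (intro open_Collect_less continuous_intros)+
    ultimately show ?thesis by auto
  qed
  have "closed {z. 0 \<le> Im z \<and> Im z \<le> Re z \<and> norm z \<le> R}"
    by (intro closed_Collect_conj closed_Collect_le continuous_intros)
  moreover have "S \<subseteq> {z. 0 \<le> Im z \<and> Im z \<le> Re z \<and> norm z \<le> R}" by (auto simp: S)
  ultimately have "closure S \<subseteq> {z. 0 \<le> Im z \<and> Im z \<le> Re z \<and> norm z \<le> R}"
    by (rule closure_minimal[rotated])
  moreover have "z \<in> closure S" "z \<notin> S" using z \<open>open S\<close> by (auto simp: frontier_def interior_open)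
  ultimately show ?thesis by (auto simp: S)
qed

text \<open>The factor 1 - 2 i has argument about -63 degrees and z ^ 3 has argument between 0 and
  135 degrees, so the product stays strictly inside the right half plane; a positive real factor
  would fail near the diagonal. In the proof, 1.42 is just above sqrt 2 and 1.42 ^ 3 is below
  3.\<close>

lemma Re_cube_sector:
  assumes "0 \<le> Im z" "Im z \<le> Re z"
  shows "Re (Complex 1 (-2) * z ^ 3) \<ge> norm z ^ 3 / 3"
proof -
  define p q where "p = Re z" and "q = Im z"
  have pq: "0 \<le> q" "q \<le> p" using assms by (auto simp: p_def q_def)
  have z: "z = Complex p q" by (simp add: p_def q_def)
  have "Re (Complex 1 (-2) * z ^ 3) = p^3 + 6*p\<^sup>2*q - 3*p*q\<^sup>2 - 2*q^3"
    by (simp add: z power3_eq_cube power2_eq_square algebra_simps)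
  also have "\<dots> \<ge> p ^ 3"
  proof -
    have "p*q\<^sup>2 \<le> p\<^sup>2*q" "q^3 \<le> p\<^sup>2*q"
      using mult_left_mono[OF pq(2), of "p * q"] mult_mono[OF pq(2) pq(2)] mult_right_mono[of "q * q" "p * p" q] pq
      by (auto simp: power2_eq_square power3_eq_cube algebra_simps)
    moreover have "p\<^sup>2*q \<ge> 0" using pq by auto
    ultimately show ?thesis by linarith
  qed
  finally have 1: "Re (Complex 1 (-2) * z ^ 3) \<ge> p ^ 3" .
  have "norm z ^ 2 \<le> 2 * p\<^sup>2"
    using power_mono[OF pq(2,1), of 2] by (simp add: z cmod_power2)
  also have "\<dots> \<le> (3/2 * p)\<^sup>2 * (8/9)" by (simp add: power2_eq_square)
  also have "\<dots> \<le> (1.42 * p)\<^sup>2" by (simp add: power2_eq_square)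
  finally have "norm z \<le> 1.42 * p" by (rule power2_le_imp_le) (use pq in auto)
  then have "norm z ^ 3 \<le> (1.42 * p) ^ 3" by (intro power_mono) auto
  also have "\<dots> \<le> 3 * p ^ 3" using pq by (simp add: power3_eq_cube)
  finally show ?thesis using 1 by linarith
qed

text \<open>Phragmen-Lindelof in the open fourth quadrant, pulled back along \<open>z = - i \<zeta>\<^sup>2\<close>: the
  auxiliary factor \<open>exp (- \<delta> (1 - 2 i) \<zeta>\<^sup>3)\<close> is then a polynomial expression, and it beats
  the growth \<open>exp (c \<bar>\<zeta>\<bar>\<^sup>2)\<close>.\<close>

lemma Phragmen_Lindelof_sector:
  fixes F :: "complex \<Rightarrow> complex"
  assumes hol: "F holomorphic_on UNIV"
    and grow: "\<And>z. norm (F z) \<le> C * exp (c * norm z ^ 2)"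
    and b1: "\<And>t. t \<ge> 0 \<Longrightarrow> norm (F (of_real t)) \<le> M"
    and b2: "\<And>t. t \<ge> 0 \<Longrightarrow> norm (F (Complex t t)) \<le> M"
    and z: "0 \<le> Im z" "Im z \<le> Re z"
  shows "norm (F z) \<le> M"
proof (cases "Im z = 0 \<or> Im z = Re z")
  case True
  then show ?thesis using b1[of "Re z"] b2[of "Re z"] z
    by (metis complex_eq_iff complex_of_real_def complex_surj order_trans)
next
  case False
  have M0: "M \<ge> 0" using b1[of 0] norm_ge_zero order_trans by blast
  have C0: "C \<ge> 0" using order_trans[OF norm_ge_zero grow[of 0]] by simp
  have main: "norm (F z * exp (- of_real \<delta> * (Complex 1 (-2) * z ^ 3))) \<le> M" if d: "\<delta> > 0" for \<delta> :: real
  proof -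
    define H where "H = (\<lambda>z. F z * exp (- of_real \<delta> * (Complex 1 (-2) * z ^ 3)))"
    have lim: "((\<lambda>R. C * exp (c * R ^ 2 - \<delta> * R ^ 3 / 3)) \<longlongrightarrow> 0) at_top" using d by real_asymp
    have Hn: "norm (H z) \<le> norm (F z) * exp (- \<delta> * norm z ^ 3 / 3)" if "0 \<le> Im z" "Im z \<le> Re z" for z
    proof -
      have "norm (H z) = norm (F z) * exp (- \<delta> * Re (Complex 1 (-2) * z ^ 3))"
        by (simp add: H_def norm_mult)
      also have "\<dots> \<le> norm (F z) * exp (- \<delta> * (norm z ^ 3 / 3))"
        using Re_cube_sector[OF that] d by (intro mult_left_mono) (simp_all)
      finally show ?thesis by simp
    qed
    have Hz: "norm (H z) \<le> M + e" if e: "e > 0" for e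
    proof -
      \<comment> \<open>The cube beats the square, so on the arc of radius R the function is below
        e; R also exceeds \<open>norm z\<close>, which puts z inside.\<close>
      have "eventually (\<lambda>R. C * exp (c * R ^ 2 - \<delta> * R ^ 3 / 3) < e) at_top"
        using order_tendstoD(2)[OF lim e] .
      moreover have "eventually (\<lambda>R. R > norm z) at_top" by (rule eventually_gt_at_top)
      ultimately have "eventually (\<lambda>R. C * exp (c * R ^ 2 - \<delta> * R ^ 3 / 3) < e \<and> R > norm z) at_top"
        by eventually_elim auto
      from eventually_happens'[OF trivial_limit_at_top_linorder this]
      obtain R where R: "C * exp (c * R ^ 2 - \<delta> * R ^ 3 / 3) < e" "R > norm z" by auto
      define S where "S = {z. 0 < Im z \<and> Im z < Re z \<and> norm z < R}"
      show ?thesis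
      proof (rule maximum_modulus_frontier[of H S])
        show "H holomorphic_on interior S"
          unfolding H_def by (intro holomorphic_intros holomorphic_on_subset[OF hol]) auto
        show "continuous_on (closure S) H"
          unfolding H_def by (intro continuous_intros holomorphic_on_imp_continuous_on
            holomorphic_on_subset[OF hol]) auto
        show "bounded S" by (rule boundedI[of _ R]) (auto simp: S_def)
        show "z \<in> S" using z False R by (auto simp: S_def)
        fix v assume "v \<in> frontier S"
        note v = frontier_quarter_bound[OF S_def this]
        then consider "Im v = 0" "Re v \<ge> 0" | "Im v = Re v" "Re v \<ge> 0" | "norm v = R" by force
        then show "norm (H v) \<le> M + e"
        proof cases
          case 3
          have "norm (H v) \<le> norm (F v) * exp (- \<delta> * norm v ^ 3 / 3)" using Hn v by blast
          also have "\<dots> \<le> C * exp (c * norm v ^ 2) * exp (- \<delta> * norm v ^ 3 / 3)"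
            by (intro mult_right_mono grow) auto
          also have "\<dots> = C * exp (c * R ^ 2 - \<delta> * R ^ 3 / 3)"
            using 3 by (simp flip: exp_add)
          finally show ?thesis using R M0 by linarith
        next
          case 1
          then have "v = of_real (Re v)" by (simp add: complex_eq_iff)
          then have "norm (F v) \<le> M" using b1[of "Re v"] 1 by metis
          moreover have "norm (H v) \<le> norm (F v) * 1"
            using Hn[of v] v d by (intro order_trans[OF Hn] mult_left_mono) auto
          ultimately show ?thesis using e by simp
        next
          case 2
          then have "v = Complex (Re v) (Re v)" by (simp add: complex_eq_iff)
          then have "norm (F v) \<le> M" using b2[of "Re v"] 2 by metis
          moreover have "norm (H v) \<le> norm (F v) * 1"
            using Hn[of v] v d by (intro order_trans[OF Hn] mult_left_mono) auto
          ultimately show ?thesis using e by simp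
        qed
      qed
    qed
    then show ?thesis unfolding H_def by (rule field_le_epsilon)
  qed
  \<comment> \<open>The bound M does not depend on \<delta>, so at the fixed point z the auxiliary
    factor may tend to 1.\<close>
  have "((\<lambda>\<delta>. norm (F z * exp (- of_real \<delta> * (Complex 1 (-2) * z ^ 3)))) \<longlongrightarrow>
        norm (F z * exp (- of_real 0 * (Complex 1 (-2) * z ^ 3)))) (at_right 0)"
    by (intro tendsto_intros)
  then have "((\<lambda>\<delta>. norm (F z * exp (- of_real \<delta> * (Complex 1 (-2) * z ^ 3)))) \<longlongrightarrow> norm (F z)) (at_right 0)"
    by simp
  moreover have "eventually (\<lambda>\<delta>. norm (F z * exp (- of_real \<delta> * (Complex 1 (-2) * z ^ 3))) \<le> M) (at_right 0)"
    by (rule eventually_mono[OF eventually_at_right_less]) (use main in blast)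
  ultimately show ?thesis by (rule tendsto_upperbound) simp
qed

text \<open>On the negative imaginary axis the growth condition alone gives C exp (s y), so g z *
  exp (- i s z) is bounded on both edges of the quadrant, by C and by B. A quadrant admits
  Phragmen-Lindelof for orders below 2, and here the order is 1. The map v to - i v ^ 2 takes the
  sector 0 <= arg v <= pi / 4 onto the quadrant, the real ray to the imaginary edge and the diagonal
  to the real edge.\<close>

lemma exp_type_quadrant_bound:
  assumes g: "g holomorphic_on UNIV" "\<And>z. norm (g z) \<le> C * exp (s * norm z)"
    and b: "\<And>t::real. norm (g (of_real t)) \<le> B" and s: "s \<ge> 0"
    and z: "0 \<le> Re z" "Im z \<le> 0"
  shows "norm (g z) \<le> max B C * exp (s * - Im z)"
proof -
  define F where "F = (\<lambda>v. g (- \<i> * v\<^sup>2) * exp (- of_real s * v\<^sup>2))"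
  have gi: "g (- \<i> * v\<^sup>2) = F v * exp (of_real s * v\<^sup>2)" for v
    by (simp add: F_def mult.assoc flip: exp_add)
  have C0: "C \<ge> 0" using order_trans[OF norm_ge_zero g(2)[of 0]] by simp
  have F: "norm (F v) \<le> max B C" if "0 \<le> Im v" "Im v \<le> Re v" for v
  proof (rule Phragmen_Lindelof_sector[OF _ _ _ _ that])
    show "F holomorphic_on UNIV"
      unfolding F_def by (intro holomorphic_intros holomorphic_on_compose_gen[OF _ g(1), unfolded o_def]) auto
    fix v
    have "norm (F v) = norm (g (- \<i> * v\<^sup>2)) * exp (- s * Re (v\<^sup>2))"
      by (simp add: F_def norm_mult)
    also have "\<dots> \<le> (C * exp (s * norm (- \<i> * v\<^sup>2))) * exp (s * norm (v\<^sup>2))"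
    proof (intro mult_mono g)
      have "- Re (v\<^sup>2) \<le> norm (v\<^sup>2)" using abs_Re_le_cmod[of "v\<^sup>2"] by linarith
      from mult_left_mono[OF this s] show "exp (- s * Re (v\<^sup>2)) \<le> exp (s * norm (v\<^sup>2))" by simp
    qed (use C0 in auto)
    also have "\<dots> = C * exp (2 * s * norm v ^ 2)"
      by (simp add: norm_mult norm_power mult.assoc flip: exp_add)
    finally show "norm (F v) \<le> C * exp ((2 * s) * norm v ^ 2)" by simp
  next
    fix t :: real assume "t \<ge> 0"
    have "norm (F (of_real t)) = norm (g (- \<i> * (of_real t)\<^sup>2)) * exp (- s * t\<^sup>2)"
      by (simp add: F_def norm_mult flip: of_real_power)
    also have "\<dots> \<le> C * exp (s * norm (- \<i> * (of_real t)\<^sup>2)) * exp (- s * t\<^sup>2)"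
      by (intro mult_right_mono g) auto
    also have "\<dots> = C" by (simp add: norm_mult norm_power flip: exp_add)
    finally show "norm (F (of_real t)) \<le> max B C" by simp
  next
    fix t :: real assume "t \<ge> 0"
    have sq: "(Complex t t)\<^sup>2 = \<i> * of_real (2 * t\<^sup>2)"
      by (simp add: complex_eq_iff power2_eq_square)
    have "- \<i> * (Complex t t)\<^sup>2 = of_real (2 * t\<^sup>2)" unfolding sq by simp
    then have "norm (F (Complex t t)) = norm (g (of_real (2 * t\<^sup>2)))"
      unfolding F_def sq by (simp add: norm_mult del: of_real_mult)
    then show "norm (F (Complex t t)) \<le> max B C" using b[of "2*t\<^sup>2"] by simp
  qed
  \<comment> \<open>The principal root has nonnegative real part; the signs of the real and
    imaginary parts of its square then place it between the real axis and the diagonal.\<close>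
  define v where "v = csqrt (\<i> * z)"
  have v2: "v\<^sup>2 = \<i> * z" by (simp add: v_def)
  have re: "Re v \<ge> 0" "Re (v\<^sup>2) = - Im z" "Im (v\<^sup>2) = Re z"
    using csqrt_principal[of "\<i> * z"] v2 by (auto simp: v_def)
  have "(Re v)\<^sup>2 - (Im v)\<^sup>2 \<ge> 0" "2 * Re v * Im v \<ge> 0"
    using re z by (auto simp: Re_power2 Im_power2)
  then have "Im v \<le> Re v" "0 \<le> Im v"
    using re(1) abs_le_square_iff[of "Im v" "Re v"]
    by (auto simp: zero_le_mult_iff)

  with F[of v] have Fv: "norm (F v) \<le> max B C" by blast
  have "- \<i> * v\<^sup>2 = z" by (simp add: v2)
  then have "norm (g z) = norm (F v) * exp (s * Re (v\<^sup>2))" using gi[of v] by (simp add: norm_mult)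
  also have "\<dots> \<le> max B C * exp (s * Re (v\<^sup>2))" using Fv by (intro mult_right_mono) auto
  finally show ?thesis by (simp add: re)
qed

lemma norm_increment_le_exp:
  fixes \<phi> :: "real \<Rightarrow> complex"
  assumes c: "c > 0" and Y: "Y > 0"
    and d: "\<And>y. (\<phi> has_vector_derivative \<phi>' y) (at y)"
    and b: "\<And>y. 0 \<le> y \<Longrightarrow> norm (\<phi>' y) \<le> K * exp (- c * y)"
  shows "norm (\<phi> Y - \<phi> 0) \<le> K / c"
proof -
  have K: "K \<ge> 0" using order_trans[OF norm_ge_zero b[of 0]] by simp
  have "norm (\<phi> Y - \<phi> 0) \<le> - K / c * exp (- c * Y) - (- K / c * exp (- c * 0))"
  proof (rule differentiable_bound_general[OF Y, where f' = \<phi>' and \<phi>' = "\<lambda>y. K * exp (- c * y)"])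
    show "continuous_on {0..Y} \<phi>"
      by (intro continuous_at_imp_continuous_on ballI has_vector_derivative_continuous[OF d])
    show "continuous_on {0..Y} (\<lambda>y. - K / c * exp (- c * y))" by (intro continuous_intros)
    show "((\<lambda>y. - K / c * exp (- c * y)) has_vector_derivative K * exp (- c * y)) (at y)" for y
      unfolding has_real_derivative_iff_has_vector_derivative[symmetric]
      using c by (auto intro!: derivative_eq_intros)
  qed (use d b in auto)
  also have "\<dots> \<le> K / c" using c K by (auto simp: field_simps)
  finally show ?thesis .
qed

text \<open>Cauchy's theorem on the rectangle with corners 0, L, L - i Y, - i Y, written with a
  primitive P. At depth y the integrand is at most M exp (- (l - s) y): each vertical side
  contributes at most M / (l - s) whatever L is, and the bottom side vanishes as Y grows.\<close>

lemma exp_type_integral_bounded: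
  fixes g :: "complex \<Rightarrow> complex"
  assumes g: "g holomorphic_on UNIV" "\<And>z. norm (g z) \<le> C * exp (s * norm z)"
    and b: "\<And>t::real. norm (g (of_real t)) \<le> B" and s: "s \<ge> 0" "s < l" and L: "L \<ge> 0"
  shows "norm (integral {0..L} (\<lambda>t. g (of_real t) * cis (- l * t))) \<le> 2 * max B C / (l - s)"
proof -
  define M where "M = max B C"
  define G where "G = (\<lambda>z. g z * exp (- (\<i> * of_real l) * z))"
  have hol: "G holomorphic_on UNIV"
    unfolding G_def by (intro holomorphic_intros g)
  obtain P where P: "\<And>z. (P has_field_derivative G z) (at z)"
    using holomorphic_convex_primitive'[OF convex_UNIV open_UNIV hol] by auto
  have Gb: "norm (G (Complex x (- y))) \<le> M * exp (- (l - s) * y)" if "0 \<le> x" "0 \<le> y" for x y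
  proof -
    have "norm (G (Complex x (- y))) = norm (g (Complex x (- y))) * exp (- l * y)"
      by (simp add: G_def norm_mult)
    also have "\<dots> \<le> (M * exp (s * y)) * exp (- l * y)"
      using exp_type_quadrant_bound[OF g b s(1), of "Complex x (- y)"] that
      by (intro mult_right_mono) (auto simp: M_def)
    also have "\<dots> = M * exp (- (l - s) * y)" by (simp add: algebra_simps flip: exp_add)
    finally show ?thesis .
  qed
  have C0: "C \<ge> 0" using order_trans[OF norm_ge_zero g(2)[of 0]] by simp
  have M0: "M \<ge> 0" using C0 by (simp add: M_def)
  have vert: "norm (P (Complex x (- Y)) - P (Complex x 0)) \<le> M / (l - s)" if x: "0 \<le> x" and Y: "Y > 0" for x Y
  proof -
    have "norm (P (Complex x (- Y)) - P (Complex x (- 0))) \<le> M / (l - s)"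
    proof (rule norm_increment_le_exp[OF _ Y, where \<phi>' = "\<lambda>y. G (Complex x (- y)) * (- \<i>)"])
      fix y
      have "((\<lambda>y. Complex x (- y)) has_vector_derivative - \<i>) (at y)"
        unfolding Complex_eq
        by (auto intro!: derivative_eq_intros has_vector_derivative_real_field simp: has_vector_derivative_def scaleR_conv_of_real mult.commute)
      from field_vector_diff_chain_at[OF this P]
      show "((\<lambda>y. P (Complex x (- y))) has_vector_derivative G (Complex x (- y)) * (- \<i>)) (at y)"
        by (simp add: o_def mult.commute)
    next
      fix y :: real assume "0 \<le> y"
      then show "norm (G (Complex x (- y)) * (- \<i>)) \<le> M * exp (- (l - s) * y)"
        using Gb[OF x, of y] by (simp add: norm_mult)
    qed (use s in auto)
    then show ?thesis by simp
  qed
  have horiz: "norm (P (Complex L (- Y)) - P (Complex 0 (- Y))) \<le> M * exp (- (l - s) * Y) * L" if Y: "Y > 0" for Y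
  proof -
    have "norm (P (Complex L (- Y)) - P (Complex 0 (- Y))) \<le> M * exp (- (l - s) * Y) * norm (Complex L (- Y) - Complex 0 (- Y))"
    proof (rule field_differentiable_bound[of "closed_segment (Complex 0 (- Y)) (Complex L (- Y))" P G])
      fix z assume "z \<in> closed_segment (Complex 0 (- Y)) (Complex L (- Y))"
      then obtain u where u: "0 \<le> u" "z = Complex (u * L) (- Y)"
        by (auto simp: in_segment complex_eq_iff algebra_simps)
      then show "norm (G z) \<le> M * exp (- (l - s) * Y)" using Gb[of "u * L" Y] L Y by simp
    qed (auto intro: has_field_derivative_at_within[OF P])
    also have "norm (Complex L (- Y) - Complex 0 (- Y)) = L" using L by (simp add: cmod_def)
    finally show ?thesis .
  qed
  have tot: "norm (P (of_real L) - P 0) \<le> 2 * M / (l - s) + M * exp (- (l - s) * Y) * L" if "Y > 0" for Y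
  proof -
    have "P (of_real L) - P 0 = (P (Complex L (- Y)) - P (Complex 0 (- Y)))
        - (P (Complex L (- Y)) - P (Complex L 0)) + (P (Complex 0 (- Y)) - P (Complex 0 0))"
      by (simp add: Complex_eq)
    also have "norm \<dots> \<le> M * exp (- (l - s) * Y) * L + M / (l - s) + M / (l - s)"
      by (intro norm_triangle_mono order_trans[OF norm_triangle_ineq4 add_mono] horiz vert that L order_refl)
    finally show ?thesis by simp
  qed
  have "((\<lambda>Y. 2 * M / (l - s) + M * exp (- (l - s) * Y) * L) \<longlongrightarrow> 2 * M / (l - s) + M * 0 * L) at_top"
    using s by (intro tendsto_intros) real_asymp
  then have lim: "((\<lambda>Y. 2 * M / (l - s) + M * exp (- (l - s) * Y) * L) \<longlongrightarrow> 2 * M / (l - s)) at_top" by simp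
  have bound: "norm (P (of_real L) - P 0) \<le> 2 * M / (l - s)"
    by (rule tendsto_lowerbound[OF lim eventually_mono[OF eventually_gt_at_top[of 0] tot]]) auto
  have "((\<lambda>t. G (of_real t)) has_integral P (of_real L) - P (of_real 0)) {0..L}"
  proof (rule fundamental_theorem_of_calculus[OF L])
    fix x :: real
    have "(of_real has_vector_derivative (1::complex)) (at x within {0..L})"
      by (auto intro!: derivative_eq_intros)
    from field_vector_diff_chain_within[OF this has_field_derivative_at_within[OF P]]
    show "((\<lambda>t. P (of_real t)) has_vector_derivative G (of_real x)) (at x within {0..L})"
      by (simp add: o_def)
  qed
  moreover have "G (of_real t) = g (of_real t) * cis (- l * t)" for t
    by (simp add: G_def cis_conv_exp mult_ac)
  ultimately show ?thesis using bound by (simp add: integral_unique M_def)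
qed

section \<open>The de la Vallee Poussin kernel\<close>

text \<open>On the positive half line Si t - (1 - cos t) / t is an antiderivative with limits 0 and
  pi / 2. Reflection and scaling give the rest, and the absolute value of c in the result is what
  later builds the trapezoid.\<close>

lemma has_bochner_integral_one_minus_cos:
  "has_bochner_integral lborel (\<lambda>t. (1 - cos (c * t)) / t\<^sup>2) (pi * \<bar>c\<bar>)"
proof (cases "c = 0")
  case False
  define f :: "real \<Rightarrow> real" where "f = (\<lambda>t. (1 - cos t) / t\<^sup>2)"
  have Si0: "Si 0 = 0" by (simp add: Si_def zero_ereal_def)
  define F where "F = (\<lambda>t. Si t - (1 - cos t) / t)"
  have d: "(F has_real_derivative f t) (at t)" if "0 < ereal t" for t
    using that unfolding F_def
    by (auto intro!: derivative_eq_intros DERIV_Si simp: f_def field_simps power2_eq_square zero_ereal_def)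
  have c: "isCont f t" if "0 < ereal t" for t
    using that unfolding f_def by (intro continuous_intros) (auto simp: zero_ereal_def)
  have l0: "((F \<circ> real_of_ereal) \<longlongrightarrow> 0) (at_right 0)"
  proof -
    have "isCont Si 0" by (rule isCont_Si)
    then have "(Si \<longlongrightarrow> 0) (at_right 0)" using Si0 by (simp add: isCont_def filterlim_at_split)
    moreover have "((\<lambda>t::real. (1 - cos t) / t) \<longlongrightarrow> 0) (at_right 0)" by real_asymp
    ultimately have "(F \<longlongrightarrow> 0 - 0) (at_right 0)" unfolding F_def by (intro tendsto_diff)
    then show ?thesis by (simp add: zero_ereal_def ereal_tendsto_simps)
  qed
  have l1: "((F \<circ> real_of_ereal) \<longlongrightarrow> pi / 2) (at_left \<infinity>)"
  proof -
    have "((\<lambda>t::real. (1 - cos t) / t) \<longlongrightarrow> 0) at_top" by real_asymp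
    then have "(F \<longlongrightarrow> pi / 2 - 0) at_top" unfolding F_def by (intro tendsto_diff Si_at_top)
    then show ?thesis by (simp add: ereal_tendsto_simps)
  qed
  have "AE x in lborel. 0 < ereal x \<longrightarrow> ereal x < \<infinity> \<longrightarrow> 0 \<le> f x" by (auto simp: f_def)
  from interval_integral_FTC_nonneg[OF _ d c this l0 l1]
  have "set_integrable lborel (einterval 0 \<infinity>) f \<and> (LBINT t=0..\<infinity>. f t) = pi / 2 - 0" by auto
  moreover have "einterval 0 \<infinity> = {0<..}" by (auto simp: einterval_def zero_ereal_def)
  ultimately have half: "has_bochner_integral lborel (\<lambda>t. indicator {0<..} t *\<^sub>R f t) (pi / 2)"
    by (simp add: has_bochner_integral_iff set_integrable_def interval_lebesgue_integral_0_infty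
        set_lebesgue_integral_def)
  have "has_bochner_integral lborel (\<lambda>t. indicator {0<..} t *\<^sub>R f t + indicator {0<..} (0 + (-1) * t) *\<^sub>R f (0 + (-1) * t))
          (pi / 2 + (pi / 2) /\<^sub>R \<bar>-1\<bar>)"
    by (intro has_bochner_integral_add half lborel_has_bochner_integral_real_affine_iff[THEN iffD1, OF _ half]) auto
  moreover have "(\<lambda>t. indicator {0<..} t *\<^sub>R f t + indicator {0<..} (0 + (-1) * t) *\<^sub>R f (0 + (-1) * t)) = f"
    by (auto simp: fun_eq_iff f_def indicator_def)
  ultimately have full: "has_bochner_integral lborel f pi" by simp
  have "has_bochner_integral lborel (\<lambda>t. c\<^sup>2 * f (0 + c * t)) (c\<^sup>2 * (pi /\<^sub>R \<bar>c\<bar>))"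
    by (intro has_bochner_integral_mult_right lborel_has_bochner_integral_real_affine_iff[THEN iffD1, OF _ full]) (use False in auto)
  moreover have "(\<lambda>t. c\<^sup>2 * f (0 + c * t)) = (\<lambda>t. (1 - cos (c * t)) / t\<^sup>2)"
    using False by (auto simp: f_def fun_eq_iff power_mult_distrib)
  moreover have "c\<^sup>2 * (pi /\<^sub>R \<bar>c\<bar>) = pi * \<bar>c\<bar>"
    using False by (simp add: field_simps power2_eq_square abs_if)
  ultimately show ?thesis by metis
qed (use has_bochner_integral_zero[of lborel] in auto)

text \<open>A difference of two Fejer kernels. At t = 0 the convention for division gives the value
  0, not the limit (a + b) / (2 pi).\<close>

definition vp_kernel :: "real \<Rightarrow> real \<Rightarrow> real \<Rightarrow> real" where
  "vp_kernel a b t = (cos (a * t) - cos (b * t)) / (pi * (b - a) * t\<^sup>2)"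

text \<open>Written with the absolute values that \<open>has_bochner_integral_one_minus_cos\<close>
  produces, so that \<open>vp_kernel_cos\<close> needs no case distinction.\<close>

definition trapezoid :: "real \<Rightarrow> real \<Rightarrow> real \<Rightarrow> real" where
  "trapezoid a b l = (\<bar>b + l\<bar> + \<bar>b - l\<bar> - \<bar>a + l\<bar> - \<bar>a - l\<bar>) / (2 * (b - a))"

lemma trapezoid_eq_1: "a < b \<Longrightarrow> \<bar>l\<bar> \<le> a \<Longrightarrow> trapezoid a b l = 1"
  by (auto simp: trapezoid_def field_simps)

lemma trapezoid_eq_0: "0 \<le> a \<Longrightarrow> a < b \<Longrightarrow> b \<le> \<bar>l\<bar> \<Longrightarrow> trapezoid a b l = 0"
  by (auto simp: trapezoid_def field_simps abs_if split: if_splits)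

lemma trapezoid_bounds: "0 \<le> a \<Longrightarrow> a < b \<Longrightarrow> 0 \<le> trapezoid a b l \<and> trapezoid a b l \<le> 1"
  by (auto simp: trapezoid_def field_simps abs_if split: if_splits)

lemma vp_kernel_measurable [measurable]: "vp_kernel a b \<in> borel_measurable borel"
  unfolding vp_kernel_def by measurable

lemma vp_kernel_minus [simp]: "vp_kernel a b (- t) = vp_kernel a b t"
  by (simp add: vp_kernel_def)

lemma vp_kernel_eq_sin:
  "vp_kernel a b t = 2 * sin ((a + b) / 2 * t) * sin ((b - a) / 2 * t) / (pi * (b - a) * t\<^sup>2)"
proof -
  have "cos (a * t) - cos (b * t) = 2 * sin ((a * t + b * t) / 2) * sin ((b * t - a * t) / 2)"
    by (rule cos_diff_cos)
  moreover have "(a * t + b * t) / 2 = (a + b) / 2 * t" "(b * t - a * t) / 2 = (b - a) / 2 * t"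
    by (auto simp: algebra_simps)
  ultimately show ?thesis by (simp add: vp_kernel_def)
qed

text \<open>The product formula 2 cos (c t) cos (l t) = cos ((c + l) t) + cos ((c - l) t), for c = a
  and c = b, reduces the transform to four integrals of (1 - cos) /
  \<open>t\<^sup>2\<close>.\<close>

lemma vp_kernel_cos:
  assumes "a < b"
  shows "has_bochner_integral lborel (\<lambda>t. vp_kernel a b t * cos (l * t)) (trapezoid a b l)"
proof -
  let ?I = "\<lambda>c t::real. (1 - cos (c * t)) / t\<^sup>2"
  have "has_bochner_integral lborel (\<lambda>t. (?I (b + l) t + ?I (b - l) t - ?I (a + l) t - ?I (a - l) t) * (1 / (2 * pi * (b - a))))
     ((pi * \<bar>b + l\<bar> + pi * \<bar>b - l\<bar> - pi * \<bar>a + l\<bar> - pi * \<bar>a - l\<bar>) * (1 / (2 * pi * (b - a))))"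
    by (intro has_bochner_integral_mult_left has_bochner_integral_add has_bochner_integral_diff
        has_bochner_integral_one_minus_cos)
  moreover have "(?I (b + l) t + ?I (b - l) t - ?I (a + l) t - ?I (a - l) t) * (1 / (2 * pi * (b - a)))
     = vp_kernel a b t * cos (l * t)" for t
  proof -
    have "cos ((c + l) * t) + cos ((c - l) * t) = 2 * cos (c * t) * cos (l * t)" for c
      by (simp add: distrib_right left_diff_distrib cos_add cos_diff)
    note * = this[of a] this[of b]
    have "?I (b + l) t + ?I (b - l) t - ?I (a + l) t - ?I (a - l) t
       = ((cos ((a + l) * t) + cos ((a - l) * t)) - (cos ((b + l) * t) + cos ((b - l) * t))) / t\<^sup>2"
      by (simp add: diff_divide_distrib add_divide_distrib)
    also have "\<dots> = 2 * (cos (a * t) - cos (b * t)) * cos (l * t) / t\<^sup>2"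
      unfolding * by (simp add: algebra_simps)
    finally have eq: "?I (b + l) t + ?I (b - l) t - ?I (a + l) t - ?I (a - l) t
       = 2 * (cos (a * t) - cos (b * t)) * cos (l * t) / t\<^sup>2" .
    have "2 * d * e / t\<^sup>2 * (1 / (2 * pi * (b - a))) = d / (pi * (b - a) * t\<^sup>2) * e" for d e :: real
      using assms by (cases "t = 0") (auto simp: field_simps)
    then show ?thesis unfolding eq vp_kernel_def .
  qed
  moreover have "(pi * \<bar>b + l\<bar> + pi * \<bar>b - l\<bar> - pi * \<bar>a + l\<bar> - pi * \<bar>a - l\<bar>) * (1 / (2 * pi * (b - a))) = trapezoid a b l"
    using assms by (simp add: trapezoid_def field_simps)
  ultimately show ?thesis by simp
qed

text \<open>Near 0 both sines of the product form are of order t and cancel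
  \<open>t\<^sup>2\<close>; beyond 1 they are at most 1. The integrable decay is the gain over the
  Dirichlet kernel.\<close>

lemma vp_kernel_bound:
  assumes "0 \<le> a" "a < b"
  shows "\<exists>C>0. \<forall>t. \<bar>vp_kernel a b t\<bar> \<le> C / (1 + t\<^sup>2)"
proof -
  define C where "C = 4 / (pi * (b - a)) + (a + b) / pi"
  have C0: "C > 0" using assms unfolding C_def by (intro add_pos_nonneg divide_pos_pos divide_nonneg_nonneg) auto
  have "\<bar>vp_kernel a b t\<bar> \<le> C / (1 + t\<^sup>2)" for t
  proof (cases "t = 0")
    case False
    then have t2: "t\<^sup>2 > 0" by simp
    have pb: "pi * (b - a) > 0" using assms by simp
    have nrm: "\<bar>vp_kernel a b t\<bar> = 2 * (\<bar>sin ((a + b) / 2 * t)\<bar> * \<bar>sin ((b - a) / 2 * t)\<bar>) / (pi * (b - a) * t\<^sup>2)"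
      using assms by (simp add: vp_kernel_eq_sin abs_mult)
    show ?thesis
    proof (cases "\<bar>t\<bar> \<le> 1")
      case True
      have "\<bar>sin ((a + b) / 2 * t)\<bar> * \<bar>sin ((b - a) / 2 * t)\<bar> \<le> ((a + b) / 2 * \<bar>t\<bar>) * ((b - a) / 2 * \<bar>t\<bar>)"
        using assms abs_sin_x_le_abs_x[of "(a + b) / 2 * t"] abs_sin_x_le_abs_x[of "(b - a) / 2 * t"]
        by (intro mult_mono) (auto simp: abs_mult)
      also have "\<dots> = (a + b) * (b - a) / 4 * t\<^sup>2" by (simp add: power2_eq_square)
      finally have "\<bar>vp_kernel a b t\<bar> \<le> 2 * ((a + b) * (b - a) / 4 * t\<^sup>2) / (pi * (b - a) * t\<^sup>2)"
        unfolding nrm using pb t2 by (intro divide_right_mono mult_left_mono) auto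
      also have "\<dots> = (a + b) / pi / 2" using assms False by (simp add: field_simps)
      also have "\<dots> \<le> C / 2" using assms by (intro divide_right_mono) (auto simp: C_def)
      also have "\<dots> \<le> C / (1 + t\<^sup>2)" using True C0
        by (intro divide_left_mono) (auto simp: abs_square_le_1 add_pos_nonneg)
      finally show ?thesis .
    next
      case gt: False
      have "\<bar>sin ((a + b) / 2 * t)\<bar> * \<bar>sin ((b - a) / 2 * t)\<bar> \<le> 1 * 1"
        by (intro mult_mono) auto
      then have "\<bar>vp_kernel a b t\<bar> \<le> 2 * (1 * 1) / (pi * (b - a) * t\<^sup>2)"
        unfolding nrm using pb t2 by (intro divide_right_mono mult_left_mono) auto
      also have "\<dots> = 4 / (pi * (b - a)) / (2 * t\<^sup>2)" by simp
      also have "\<dots> \<le> C / (2 * t\<^sup>2)" using assms by (intro divide_right_mono) (auto simp: C_def)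
      also have "\<dots> \<le> C / (1 + t\<^sup>2)"
      proof (intro divide_left_mono)
        have "1 \<le> t\<^sup>2" using gt by (metis abs_le_square_iff abs_one less_eq_real_def linorder_not_le one_power2)
        then show "1 + t\<^sup>2 \<le> 2 * t\<^sup>2" by simp
      qed (use C0 t2 in \<open>auto intro!: mult_pos_pos add_pos_pos\<close>)
      finally show ?thesis .
    qed
  qed (use C0 in \<open>auto simp: vp_kernel_def\<close>)
  then show ?thesis using C0 by blast
qed

lemma integrable_inverse_one_plus_square: "integrable lborel (\<lambda>t::real. 1 / (1 + t\<^sup>2))"
  using integrable_inverse_1_plus_square by (simp add: set_integrable_def divide_inverse)

lemma integrable_vp_kernel: "0 \<le> a \<Longrightarrow> a < b \<Longrightarrow> integrable lborel (vp_kernel a b)"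
proof -
  assume ab: "0 \<le> a" "a < b"
  obtain C where C: "C > 0" "\<And>t. \<bar>vp_kernel a b t\<bar> \<le> C / (1 + t\<^sup>2)" using vp_kernel_bound[OF ab] by blast
  show ?thesis
    by (rule Bochner_Integration.integrable_bound[OF integrable_mult_right[OF integrable_inverse_one_plus_square, of C]])
       (use C in auto)
qed

lemma vp_kernel_cis:
  assumes ab: "0 \<le> a" "a < b"
  shows "has_bochner_integral lborel (\<lambda>t. of_real (vp_kernel a b t) * cis (l * t)) (of_real (trapezoid a b l))"
proof -
  let ?s = "\<lambda>t. vp_kernel a b t * sin (l * t)"
  have int: "integrable lborel ?s"
    by (rule Bochner_Integration.integrable_bound[OF integrable_vp_kernel[OF ab]])
       (auto simp: abs_mult mult_left_le)
  \<comment> \<open>The sine part is odd, so its integral is its own negative.\<close>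
  have "integral\<^sup>L lborel ?s = \<bar>-1\<bar> *\<^sub>R integral\<^sup>L lborel (\<lambda>t. ?s (0 + (-1) * t))"
    by (rule lborel_integral_real_affine) simp
  also have "\<dots> = - integral\<^sup>L lborel ?s" by simp
  finally have "has_bochner_integral lborel ?s 0" using int by (simp add: has_bochner_integral_iff)
  then have "has_bochner_integral lborel (\<lambda>t. complex_of_real (vp_kernel a b t * cos (l * t)) + \<i> * complex_of_real (?s t))
     (of_real (trapezoid a b l) + \<i> * of_real 0)"
    by (intro has_bochner_integral_add has_bochner_integral_mult_right has_bochner_integral_of_real vp_kernel_cos ab)
  moreover have "complex_of_real (vp_kernel a b t * cos (l * t)) + \<i> * complex_of_real (?s t)
     = of_real (vp_kernel a b t) * cis (l * t)" for t
    by (simp add: complex_eq_iff)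
  ultimately show ?thesis by simp
qed

text \<open>Integration by parts in the form of Tonelli, with \<open>1 / (1 + t)\<^sup>2\<close> written as the integral of
  \<open>2 / (1 + u)\<^sup>3\<close> over \<open>u \<ge> t\<close>.\<close>

lemma weighted_integral_bound:
  fixes F :: "real \<Rightarrow> real"
  assumes [measurable]: "F \<in> borel_measurable borel" and F: "\<And>t. 0 \<le> F t"
    and int: "\<And>X. 0 \<le> X \<Longrightarrow> F integrable_on {0..X}" and M: "\<And>X. 0 \<le> X \<Longrightarrow> integral {0..X} F \<le> M * (X + 1)"
  shows "integrable lborel (\<lambda>t. indicator {0..} t * (F t / (1 + t)\<^sup>2))"
    and "(LBINT t. indicator {0..} t * (F t / (1 + t)\<^sup>2)) \<le> 2 * M"
proof -
  have M0: "M \<ge> 0" using M[of 0] by simp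
  have inner: "(\<integral>\<^sup>+u. ennreal (2 / (1 + u) ^ 3) * indicator {t..} u \<partial>lborel) = ennreal (1 / (1 + t)\<^sup>2)" if "0 \<le> t" for t :: real
  proof -
    have "(\<integral>\<^sup>+u. ennreal (2 / (1 + u) ^ 3) * indicator {t..} u \<partial>lborel) = ennreal (0 - (- 1 / (1 + t)\<^sup>2))"
    proof (rule nn_integral_FTC_atLeast[where F = "\<lambda>u. - 1 / (1 + u)\<^sup>2"])
      show "((\<lambda>u. - 1 / (1 + u)\<^sup>2) has_real_derivative 2 / (1 + u) ^ 3) (at u)" if "t \<le> u" for u
      proof -
        have "((\<lambda>u. - 1 / (1 + u)\<^sup>2) has_real_derivative (2 * (1 + u)) / ((1 + u)\<^sup>2 * (1 + u)\<^sup>2)) (at u)"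
          using that \<open>0 \<le> t\<close> by (auto intro!: derivative_eq_intros simp: minus_divide_left[of "- 2 - 2 * u" "(1 + u) ^ 4"])
        moreover have *: "(2 * v) / (v\<^sup>2 * v\<^sup>2) = 2 / v ^ 3" for v :: real
          by (simp add: power2_eq_square power3_eq_cube)
        from *[of "1 + u"] have "(2 * (1 + u)) / ((1 + u)\<^sup>2 * (1 + u)\<^sup>2) = 2 / (1 + u) ^ 3" .
        ultimately show ?thesis by metis
      qed
      show "((\<lambda>u::real. - 1 / (1 + u)\<^sup>2) \<longlongrightarrow> 0) at_top" by real_asymp
    qed (use that in auto)
    then show ?thesis by simp
  qed
  have outer: "(\<integral>\<^sup>+u. ennreal (1 / (1 + u)\<^sup>2) * indicator {0..} u \<partial>lborel) = 1"
  proof -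
    have "(\<integral>\<^sup>+u. ennreal (1 / (1 + u)\<^sup>2) * indicator {0..} u \<partial>lborel) = ennreal (0 - (- 1 / (1 + 0)))"
    proof (rule nn_integral_FTC_atLeast[where F = "\<lambda>u. - 1 / (1 + u)"])
      show "((\<lambda>u. - 1 / (1 + u)) has_real_derivative 1 / (1 + u)\<^sup>2) (at u)" if "0 \<le> u" for u :: real
        using that by (auto intro!: derivative_eq_intros simp: field_simps power2_eq_square)
      show "((\<lambda>u::real. - 1 / (1 + u)) \<longlongrightarrow> 0) at_top" by real_asymp
    qed auto
    then show ?thesis by simp
  qed
  have "(\<integral>\<^sup>+t. ennreal (indicator {0..} t * (F t / (1 + t)\<^sup>2)) \<partial>lborel)
      = (\<integral>\<^sup>+t. (\<integral>\<^sup>+u. (ennreal (F t) * indicator {0..u} t) * ennreal (2 / (1 + u) ^ 3) \<partial>lborel) \<partial>lborel)"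
  proof (rule nn_integral_cong)
    fix t :: real
    show "ennreal (indicator {0..} t * (F t / (1 + t)\<^sup>2))
        = (\<integral>\<^sup>+u. (ennreal (F t) * indicator {0..u} t) * ennreal (2 / (1 + u) ^ 3) \<partial>lborel)"
    proof (cases "0 \<le> t")
      case True
      have "ennreal (F t * (1 / (1 + t)\<^sup>2)) = ennreal (F t) * ennreal (1 / (1 + t)\<^sup>2)"
        by (intro ennreal_mult F) auto
      also have "\<dots> = (\<integral>\<^sup>+u. ennreal (F t) * (ennreal (2 / (1 + u) ^ 3) * indicator {t..} u) \<partial>lborel)"
        unfolding inner[OF True, symmetric] by (rule nn_integral_cmult[symmetric]) measurable
      also have "\<dots> = (\<integral>\<^sup>+u. (ennreal (F t) * indicator {0..u} t) * ennreal (2 / (1 + u) ^ 3) \<partial>lborel)"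
        using True by (intro nn_integral_cong) (auto split: split_indicator)
      finally show ?thesis using True by simp
    qed simp
  qed
  also have "\<dots> = (\<integral>\<^sup>+u. (\<integral>\<^sup>+t. (ennreal (F t) * indicator {0..u} t) * ennreal (2 / (1 + u) ^ 3) \<partial>lborel) \<partial>lborel)"
    by (rule lborel_pair.Fubini')
       (unfold indicator_def of_bool_def atLeastAtMost_iff case_prod_beta, measurable)
  also have "\<dots> \<le> (\<integral>\<^sup>+u. ennreal (2 * M) * (ennreal (1 / (1 + u)\<^sup>2) * indicator {0..} u) \<partial>lborel)"
  proof (rule nn_integral_mono)
    fix u :: real
    show "(\<integral>\<^sup>+t. (ennreal (F t) * indicator {0..u} t) * ennreal (2 / (1 + u) ^ 3) \<partial>lborel)
       \<le> ennreal (2 * M) * (ennreal (1 / (1 + u)\<^sup>2) * indicator {0..} u)"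
    proof (cases "0 \<le> u")
      case True
      have "(\<integral>\<^sup>+t. (ennreal (F t) * indicator {0..u} t) * ennreal (2 / (1 + u) ^ 3) \<partial>lborel)
         = (\<integral>\<^sup>+t. ennreal (F t) * indicator {0..u} t \<partial>lborel) * ennreal (2 / (1 + u) ^ 3)"
        by (rule nn_integral_multc) measurable
      also have "(\<integral>\<^sup>+t. ennreal (F t) * indicator {0..u} t \<partial>lborel) = ennreal (integral {0..u} F)"
        by (rule nn_integral_has_integral_lebesgue'[OF F integrable_integral[OF int[OF True]]])
      also have "ennreal (integral {0..u} F) * ennreal (2 / (1 + u) ^ 3) = ennreal (integral {0..u} F * (2 / (1 + u) ^ 3))"
        using True by (intro ennreal_mult[symmetric] integral_nonneg int F) auto
      also have "\<dots> \<le> ennreal (M * (u + 1) * (2 / (1 + u) ^ 3))"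
        using True M[OF True] by (intro ennreal_leI mult_right_mono) auto
      also have "M * (u + 1) * (2 / (1 + u) ^ 3) = 2 * M * (1 / (1 + u)\<^sup>2)"
      proof -
        have "M * v * (2 / v ^ 3) = 2 * M * (1 / v\<^sup>2)" for v :: real
          by (simp add: power2_eq_square power3_eq_cube)
        from this[of "1 + u"] show ?thesis by (simp add: add.commute)
      qed
      also have "ennreal \<dots> = ennreal (2 * M) * ennreal (1 / (1 + u)\<^sup>2)"
        using M0 by (intro ennreal_mult) auto
      finally show ?thesis using True by simp
    qed simp
  qed
  also have "\<dots> = ennreal (2 * M)" by (subst nn_integral_cmult) (auto simp: outer)
  finally have fin: "(\<integral>\<^sup>+t. ennreal (indicator {0..} t * (F t / (1 + t)\<^sup>2)) \<partial>lborel) \<le> ennreal (2 * M)" .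
  show I: "integrable lborel (\<lambda>t. indicator {0..} t * (F t / (1 + t)\<^sup>2))"
  proof (rule integrableI_nonneg)
    show "(\<integral>\<^sup>+t. ennreal (indicator {0..} t * (F t / (1 + t)\<^sup>2)) \<partial>lborel) < \<infinity>"
      using fin by (rule le_less_trans) simp
  qed (use F in auto)
  show "(LBINT t. indicator {0..} t * (F t / (1 + t)\<^sup>2)) \<le> 2 * M"
    using fin M0 F by (subst (asm) nn_integral_eq_integral[OF I]) (auto simp: ennreal_le_iff)
qed

section \<open>Almost periods and means\<close>

lemma bounded_borel_absolutely_integrable:
  fixes F :: "real \<Rightarrow> 'a::euclidean_space"
  assumes "F \<in> borel_measurable borel" "\<And>t. norm (F t) \<le> B"
  shows "F absolutely_integrable_on {a..b}"
proof (rule measurable_bounded_by_integrable_imp_absolutely_integrable)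
  have "F \<in> borel_measurable lebesgue" using assms(1) by (intro measurable_completion) simp
  then show "F \<in> borel_measurable (lebesgue_on {a..b})" by (rule measurable_restrict_space1)
  show "(\<lambda>_. B) integrable_on {a..b}" by (rule integrable_const_ivl)
qed (use assms in auto)

lemma bounded_borel_integrable_on:
  fixes F :: "real \<Rightarrow> 'a::euclidean_space"
  assumes "F \<in> borel_measurable borel" "\<And>t. norm (F t) \<le> B"
  shows "F integrable_on {a..b}"
  using bounded_borel_absolutely_integrable[OF assms] set_lebesgue_integral_eq_integral(1) by blast

lemma norm_integral_le_const:
  fixes F :: "real \<Rightarrow> 'a::euclidean_space"
  assumes "F integrable_on {a..b}" "\<And>t. norm (F t) \<le> B" "a \<le> b"
  shows "norm (integral {a..b} F) \<le> B * (b - a)"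
proof -
  have "norm (integral {a..b} F) \<le> integral {a..b} (\<lambda>_. B)"
    by (rule integral_norm_bound_integral) (use assms in auto)
  then show ?thesis using assms(3) by (simp add: mult.commute)
qed

lemma integral_translate:
  fixes F :: "real \<Rightarrow> 'a::real_normed_vector"
  shows "integral {a..b} (\<lambda>t. F (t + c)) = integral {a + c..b + c} F"
  using integral_shift_real_ivl[of "a + c" c "b + c" F] by simp

definition rel_dense :: "(real \<Rightarrow> bool) \<Rightarrow> bool" where
  "rel_dense P \<longleftrightarrow> (\<exists>l>0. \<forall>a. \<exists>\<tau>\<in>{a..a + l}. P \<tau>)"

text \<open>For bounded Borel functions the gauge and the Lebesgue integral over an interval agree
  and Fubini applies. A function of \<open>Omega1\<close> is only Lebesgue measurable and enters
  this class through \<open>borel_representative\<close>.\<close>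

definition stepanov_ap_borel :: "(real \<Rightarrow> complex) set" where
  "stepanov_ap_borel = {f \<in> borel_measurable borel. bounded (range f) \<and>
     (\<forall>\<epsilon>>0. rel_dense (stepanov_translation_number f \<epsilon>))}"

text \<open>Uniform in the starting point s, unlike the limit behind \<open>fourier_coeff\<close>: a
  convolution averages over windows with all starting points.\<close>

definition has_mean :: "(real \<Rightarrow> complex) \<Rightarrow> complex \<Rightarrow> bool" where
  "has_mean F A \<longleftrightarrow> (\<forall>e>0. \<exists>T0>0. \<forall>T\<ge>T0. \<forall>s. norm (integral {s..s + T} F - of_real T * A) \<le> e * T)"

lemma stepanov_ap_borelE:
  assumes "f \<in> stepanov_ap_borel"
  obtains B where "B > 0" "\<And>t. norm (f t) \<le> B" "f \<in> borel_measurable borel"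
    "\<And>\<epsilon>. \<epsilon> > 0 \<Longrightarrow> rel_dense (stepanov_translation_number f \<epsilon>)"
  using assms unfolding stepanov_ap_borel_def bounded_pos by auto

text \<open>Rounding the length up to whole windows of length pi costs at most one window, which is
  the summand pi.\<close>

lemma integral_windows_bound:
  fixes G :: "real \<Rightarrow> real"
  assumes int: "\<And>a b. G integrable_on {a..b}" and G: "\<And>t. 0 \<le> G t"
    and c: "\<And>u. integral {u..u + pi} G \<le> pi * c" and ab: "a \<le> b"
  shows "integral {a..b} G \<le> c * (b - a + pi)"
proof -
  define n where "n = nat \<lceil>(b - a) / pi\<rceil>"
  have c0: "c \<ge> 0"
    using order_trans[OF integral_nonneg[OF int] c[of 0]] G pi_gt_zero by (auto simp: zero_le_mult_iff)
  have n: "(b - a) / pi \<le> real n" "real n \<le> (b - a) / pi + 1"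
    using ab unfolding n_def by (auto simp: le_of_int_ceiling)
  have ind: "integral {a..a + real k * pi} G \<le> real k * (pi * c)" for k
  proof (induction k)
    case (Suc k)
    have "integral {a..a + real (Suc k) * pi} G
      = integral {a..a + real k * pi} G + integral {a + real k * pi..a + real k * pi + pi} G"
      using Henstock_Kurzweil_Integration.integral_combine[of a "a + real k * pi" "a + real (Suc k) * pi" G] int
      by (simp add: algebra_simps)
    with Suc c[of "a + real k * pi"] show ?case by (simp add: algebra_simps)
  qed simp
  have "integral {a..b} G \<le> integral {a..a + real n * pi} G"
    by (rule integral_subset_le) (use int G n in \<open>auto simp: field_simps\<close>)
  also have "\<dots> \<le> real n * (pi * c)" by (rule ind)
  also have "\<dots> \<le> ((b - a) / pi + 1) * (pi * c)" using n c0 by (intro mult_right_mono) auto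
  also have "\<dots> = c * (b - a + pi)" by (simp add: field_simps)
  finally show ?thesis .
qed

lemma borel_translate [measurable]:
  fixes f :: "real \<Rightarrow> complex"
  assumes [measurable]: "f \<in> borel_measurable borel"
  shows "(\<lambda>t. f (t + c)) \<in> borel_measurable borel"
  by measurable

lemma norm_diff_translate_integrable:
  fixes f :: "real \<Rightarrow> complex"
  assumes f [measurable]: "f \<in> borel_measurable borel" and B: "\<And>t. norm (f t) \<le> B"
  shows "(\<lambda>t. norm (f (t + c) - f (t + d))) integrable_on {a..b}"
  by (rule bounded_borel_integrable_on[where B = "B + B"])
     (use f in measurable, simp only: real_norm_def abs_norm_cancel, intro order_trans[OF norm_triangle_ineq4 add_mono] B)

lemma translation_number_integral_bound:
  assumes f: "f \<in> borel_measurable borel" and B: "\<And>t. norm (f t) \<le> B"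
    and st: "stepanov_translation_number f \<epsilon> \<tau>" and ab: "a \<le> b"
  shows "integral {a..b} (\<lambda>t. norm (f (t + \<tau>) - f t)) \<le> \<epsilon> * (b - a + pi)"
proof (rule integral_windows_bound[OF _ _ _ ab])
  show "(\<lambda>t. norm (f (t + \<tau>) - f t)) integrable_on {a..b}" for a b
    using norm_diff_translate_integrable[OF f B, of \<tau> 0] by simp
  show "integral {u..u + pi} (\<lambda>t. norm (f (t + \<tau>) - f t)) \<le> pi * \<epsilon>" for u
    using st by (auto simp: stepanov_translation_number_def field_simps)
qed auto

text \<open>Both functions are compared with the translate by - \<tau>2. This moves the windows,
  harmlessly, since the condition holds for every window.\<close>

lemma translation_number_diff:
  assumes f: "f \<in> borel_measurable borel" and B: "\<And>t. norm (f t) \<le> B"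
    and 1: "stepanov_translation_number f e1 \<tau>1" and 2: "stepanov_translation_number f e2 \<tau>2"
  shows "stepanov_translation_number f (e1 + e2) (\<tau>1 - \<tau>2)"
  unfolding stepanov_translation_number_def
proof
  fix u
  have int: "(\<lambda>t. norm (f (t + c) - f (t + d))) integrable_on {a..b}" for a b c d
    by (rule norm_diff_translate_integrable[OF f B])
  have "integral {u..u + pi} (\<lambda>t. norm (f (t + (\<tau>1 - \<tau>2)) - f t))
    \<le> integral {u..u + pi} (\<lambda>t. norm (f (t + (\<tau>1 - \<tau>2)) - f (t + - \<tau>2)) + norm (f (t + 0) - f (t + - \<tau>2)))"
  proof (rule integral_le)
    show "(\<lambda>t. norm (f (t + (\<tau>1 - \<tau>2)) - f t)) integrable_on {u..u + pi}"
      using int[of "\<tau>1 - \<tau>2" 0] by simp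
    show "norm (f (t + (\<tau>1 - \<tau>2)) - f t) \<le> norm (f (t + (\<tau>1 - \<tau>2)) - f (t + - \<tau>2)) + norm (f (t + 0) - f (t + - \<tau>2))" for t
      using norm_triangle_ineq4[of "f (t + (\<tau>1 - \<tau>2)) - f (t + - \<tau>2)" "f (t + 0) - f (t + - \<tau>2)"] by simp
  qed (intro integrable_add int)
  also have "\<dots> = integral {u..u + pi} (\<lambda>t. norm (f (t + (\<tau>1 - \<tau>2)) - f (t + - \<tau>2)))
       + integral {u..u + pi} (\<lambda>t. norm (f (t + 0) - f (t + - \<tau>2)))"
    by (intro integral_add int)
  also have "integral {u..u + pi} (\<lambda>t. norm (f (t + (\<tau>1 - \<tau>2)) - f (t + - \<tau>2)))
     = integral {u - \<tau>2..(u - \<tau>2) + pi} (\<lambda>t. norm (f (t + \<tau>1) - f t))"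
    using integral_translate[of u "u + pi" "\<lambda>t. norm (f (t + \<tau>1) - f t)" "- \<tau>2"] by (simp add: algebra_simps)
  also have "integral {u..u + pi} (\<lambda>t. norm (f (t + 0) - f (t + - \<tau>2)))
     = integral {u - \<tau>2..(u - \<tau>2) + pi} (\<lambda>t. norm (f (t + \<tau>2) - f t))"
    using integral_translate[of u "u + pi" "\<lambda>t. norm (f (t + \<tau>2) - f t)" "- \<tau>2"] by (simp add: algebra_simps)
  finally have "integral {u..u + pi} (\<lambda>t. norm (f (t + (\<tau>1 - \<tau>2)) - f t))
     \<le> integral {u - \<tau>2..(u - \<tau>2) + pi} (\<lambda>t. norm (f (t + \<tau>1) - f t))
       + integral {u - \<tau>2..(u - \<tau>2) + pi} (\<lambda>t. norm (f (t + \<tau>2) - f t))" .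
  from mult_left_mono[OF this, of "1 / pi"] 1[unfolded stepanov_translation_number_def, rule_format, of "u - \<tau>2"]
    2[unfolded stepanov_translation_number_def, rule_format, of "u - \<tau>2"]
  show "1 / pi * integral {u..u + pi} (\<lambda>t. norm (f (t + (\<tau>1 - \<tau>2)) - f t)) \<le> e1 + e2"
    by (simp add: distrib_left)
qed

lemma norm_cis_diff_minus_one: "norm (cis (\<mu> * (t - s)) - 1) = norm (cis (\<mu> * t) - cis (\<mu> * s))"
proof -
  have "cis (\<mu> * t) - cis (\<mu> * s) = cis (\<mu> * s) * (cis (\<mu> * (t - s)) - 1)"
    by (simp add: algebra_simps cis_mult)
  then show ?thesis by (simp add: norm_mult)
qed

text \<open>Two almost periods whose images on the circle fall into the same small arc differ by an
  almost period that almost fixes \<open>cis (\<mu> t)\<close>; finitely many arcs suffice.\<close>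

lemma rel_dense_joint:
  assumes rd: "rel_dense (P (e / 2))" and e: "e > 0"
    and diff: "\<And>\<tau>1 \<tau>2. P (e / 2) \<tau>1 \<Longrightarrow> P (e / 2) \<tau>2 \<Longrightarrow> P e (\<tau>1 - \<tau>2)"
  shows "rel_dense (\<lambda>\<tau>. P e \<tau> \<and> norm (cis (\<mu> * \<tau>) - 1) \<le> e)"
proof -
  obtain l where l: "l > 0" "\<And>a. \<exists>\<tau>\<in>{a..a + l}. P (e / 2) \<tau>" using rd by (auto simp: rel_dense_def)
  obtain K where K: "finite K" "sphere (0::complex) 1 \<subseteq> (\<Union>x\<in>K. ball x (e / 2))"
    by (rule compactE_image[of "sphere (0::complex) 1" "sphere 0 1" "\<lambda>x. ball x (e / 2)"]) (use e in auto)
  define good where "good = (\<lambda>k \<tau>. P (e / 2) \<tau> \<and> cis (\<mu> * \<tau>) \<in> ball k (e / 2))"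
  \<comment> \<open>One almost period is fixed for every arc that has one. For the other arcs
    \<open>SOME\<close> gives an arbitrary number, which only enlarges R.\<close>
  define r where "r = (\<lambda>k. SOME \<tau>. good k \<tau>)"
  define R where "R = (\<Sum>k\<in>K. \<bar>r k\<bar>)"
  have R0: "R \<ge> 0" by (auto simp: R_def intro: sum_nonneg)
  have "\<exists>\<tau>\<in>{a..a + (2 * R + l)}. P e \<tau> \<and> norm (cis (\<mu> * \<tau>) - 1) \<le> e" for a
  proof -
    \<comment> \<open>The search starts at a + R because subtracting \<open>r k\<close> may move
      \<tau> to the left by up to R.\<close>
    obtain \<tau> where \<tau>: "\<tau> \<in> {a + R..a + R + l}" "P (e / 2) \<tau>" using l(2)[of "a + R"] by blast
    have "cis (\<mu> * \<tau>) \<in> sphere 0 1" by simp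
    then obtain k where k: "k \<in> K" "cis (\<mu> * \<tau>) \<in> ball k (e / 2)" using K(2) by blast
    then have k: "k \<in> K" "good k \<tau>" using \<tau>(2) by (auto simp: good_def)
    have r: "good k (r k)" unfolding r_def by (rule someI[of "good k", OF k(2)])
    have rR: "\<bar>r k\<bar> \<le> R" unfolding R_def using K(1) k(1) by (intro member_le_sum) auto
    have "P e (\<tau> - r k)" using diff k r by (auto simp: good_def)
    moreover have "norm (cis (\<mu> * (\<tau> - r k)) - 1) \<le> e"
      unfolding norm_cis_diff_minus_one
      using k(2) r dist_triangle_half_r[of k "cis (\<mu> * \<tau>)" e "cis (\<mu> * r k)"]
      by (auto simp: good_def dist_norm norm_minus_commute)
    moreover have "\<tau> - r k \<in> {a..a + (2 * R + l)}" using \<tau>(1) rR by auto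
    ultimately show ?thesis by blast
  qed
  then show ?thesis unfolding rel_dense_def using l(1) R0 by (intro exI[of _ "2 * R + l"]) auto
qed

text \<open>Stands in for the theorem that sums and products of almost periodic functions are almost
  periodic: with a single exponential involved, the joint almost periods of
  \<open>rel_dense_joint\<close> suffice. The tolerance e is chosen with e + D e =
  \<epsilon>.\<close>

lemma stepanov_ap_borel_transfer:
  assumes f: "f \<in> stepanov_ap_borel" and F: "F \<in> borel_measurable borel" "bounded (range F)" and D: "D \<ge> 0"
    and le: "\<And>t \<tau>. norm (F (t + \<tau>) - F t) \<le> norm (f (t + \<tau>) - f t) + D * norm (cis (\<mu> * \<tau>) - 1)"
  shows "F \<in> stepanov_ap_borel"
proof -
  obtain B where B: "\<And>t. norm (f t) \<le> B" and fm: "f \<in> borel_measurable borel"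
    and rd: "\<And>\<epsilon>. \<epsilon> > 0 \<Longrightarrow> rel_dense (stepanov_translation_number f \<epsilon>)"
    using stepanov_ap_borelE[OF f] by metis
  obtain B' where B': "\<And>t. norm (F t) \<le> B'" using F(2) by (auto simp: bounded_iff)
  have "rel_dense (stepanov_translation_number F \<epsilon>)" if \<epsilon>: "\<epsilon> > 0" for \<epsilon>
  proof -
    define e where "e = \<epsilon> / (1 + D)"
    have e: "e > 0" "e * (1 + D) = \<epsilon>" using \<epsilon> D by (auto simp: e_def add_pos_nonneg)
    have "rel_dense (\<lambda>\<tau>. stepanov_translation_number f e \<tau> \<and> norm (cis (\<mu> * \<tau>) - 1) \<le> e)"
      using translation_number_diff[OF fm B, of "e / 2" _ "e / 2"] rd[of "e / 2"] e
      by (intro rel_dense_joint) auto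
    moreover have "stepanov_translation_number F \<epsilon> \<tau>"
      if \<tau>: "stepanov_translation_number f e \<tau>" "norm (cis (\<mu> * \<tau>) - 1) \<le> e" for \<tau>
      unfolding stepanov_translation_number_def
    proof
      fix u
      have int: "(\<lambda>t. norm (f (t + \<tau>) - f t)) integrable_on {u..u + pi}"
        using norm_diff_translate_integrable[OF fm B, of \<tau> 0] by simp
      have "integral {u..u + pi} (\<lambda>t. norm (F (t + \<tau>) - F t))
         \<le> integral {u..u + pi} (\<lambda>t. norm (f (t + \<tau>) - f t) + D * e)"
      proof (rule integral_le)
        show "(\<lambda>t. norm (F (t + \<tau>) - F t)) integrable_on {u..u + pi}"
          using norm_diff_translate_integrable[OF F(1) B', of \<tau> 0] by simp
        show "norm (F (t + \<tau>) - F t) \<le> norm (f (t + \<tau>) - f t) + D * e" for t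
          using le[of t \<tau>] mult_left_mono[OF \<tau>(2) D] by linarith
      qed (intro integrable_add int integrable_const_ivl)
      also have "\<dots> = integral {u..u + pi} (\<lambda>t. norm (f (t + \<tau>) - f t)) + pi * (D * e)"
        by (subst integral_add[OF int integrable_const_ivl]) simp
      also have "\<dots> \<le> pi * e + pi * (D * e)"
        using \<tau>(1) by (auto simp: stepanov_translation_number_def field_simps)
      also have "\<dots> = pi * \<epsilon>" unfolding e(2)[symmetric] by (simp add: algebra_simps)
      finally show "1 / pi * integral {u..u + pi} (\<lambda>t. norm (F (t + \<tau>) - F t)) \<le> \<epsilon>"
        by (simp add: field_simps)
    qed
    ultimately show ?thesis unfolding rel_dense_def by meson
  qed
  then show ?thesis using F by (simp add: stepanov_ap_borel_def)
qed

lemma cis_measurable [measurable]: "cis \<in> borel_measurable borel"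
  by (intro borel_measurable_continuous_onI continuous_intros)

lemma stepanov_ap_borel_mult_cis:
  assumes f: "f \<in> stepanov_ap_borel"
  shows "(\<lambda>t. f t * cis (\<mu> * t)) \<in> stepanov_ap_borel"
proof -
  obtain B where B: "B > 0" "\<And>t. norm (f t) \<le> B" and fm [measurable]: "f \<in> borel_measurable borel"
    using stepanov_ap_borelE[OF f] by metis
  show ?thesis
  proof (rule stepanov_ap_borel_transfer[OF f, where D = B and \<mu> = \<mu>])
    fix t \<tau>
    have "f (t + \<tau>) * cis (\<mu> * (t + \<tau>)) - f t * cis (\<mu> * t)
       = (f (t + \<tau>) - f t) * cis (\<mu> * (t + \<tau>)) + f t * cis (\<mu> * t) * (cis (\<mu> * \<tau>) - 1)"
      by (simp add: algebra_simps cis_mult)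
    also have "norm \<dots> \<le> norm (f (t + \<tau>) - f t) + norm (f t) * norm (cis (\<mu> * \<tau>) - 1)"
      by (rule norm_triangle_le) (simp add: norm_mult)
    also have "\<dots> \<le> norm (f (t + \<tau>) - f t) + B * norm (cis (\<mu> * \<tau>) - 1)"
      by (intro add_left_mono mult_right_mono B) auto
    finally show "norm (f (t + \<tau>) * cis (\<mu> * (t + \<tau>)) - f t * cis (\<mu> * t))
       \<le> norm (f (t + \<tau>) - f t) + B * norm (cis (\<mu> * \<tau>) - 1)" .
  qed (use B in \<open>auto simp: bounded_iff norm_mult intro!: exI[of _ B]\<close>)
qed

lemma stepanov_ap_borel_add_cis:
  assumes f: "f \<in> stepanov_ap_borel"
  shows "(\<lambda>t. f t + c * cis (\<mu> * t)) \<in> stepanov_ap_borel"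
proof -
  obtain B where B: "B > 0" "\<And>t. norm (f t) \<le> B" and fm [measurable]: "f \<in> borel_measurable borel"
    using stepanov_ap_borelE[OF f] by metis
  show ?thesis
  proof (rule stepanov_ap_borel_transfer[OF f, where D = "norm c" and \<mu> = \<mu>])
    show "bounded (range (\<lambda>t. f t + c * cis (\<mu> * t)))"
      by (rule boundedI[of _ "B + norm c"])
         (auto simp: norm_mult intro!: order_trans[OF norm_triangle_ineq add_mono] B)
    fix t \<tau>
    have "f (t + \<tau>) + c * cis (\<mu> * (t + \<tau>)) - (f t + c * cis (\<mu> * t))
       = (f (t + \<tau>) - f t) + c * cis (\<mu> * t) * (cis (\<mu> * \<tau>) - 1)"
      by (simp add: algebra_simps cis_mult)
    also have "norm \<dots> \<le> norm (f (t + \<tau>) - f t) + norm c * norm (cis (\<mu> * \<tau>) - 1)"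
      by (rule norm_triangle_le) (simp add: norm_mult)
    finally show "norm (f (t + \<tau>) + c * cis (\<mu> * (t + \<tau>)) - (f t + c * cis (\<mu> * t)))
       \<le> norm (f (t + \<tau>) - f t) + norm c * norm (cis (\<mu> * \<tau>) - 1)" .
  qed auto
qed

lemma stepanov_ap_borel_diff_trig_sum:
  assumes "finite I" "f \<in> stepanov_ap_borel"
  shows "(\<lambda>t. f t - (\<Sum>i\<in>I. c i * cis (\<mu> i * t))) \<in> stepanov_ap_borel"
  using assms
proof (induction I rule: finite_induct)
  case (insert i I)
  have "(\<lambda>t. (f t - (\<Sum>i\<in>I. c i * cis (\<mu> i * t))) + (- c i) * cis (\<mu> i * t)) \<in> stepanov_ap_borel"
    by (rule stepanov_ap_borel_add_cis) (use insert in auto)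
  moreover have "(\<lambda>t. (f t - (\<Sum>i\<in>I. c i * cis (\<mu> i * t))) + (- c i) * cis (\<mu> i * t))
     = (\<lambda>t. f t - (\<Sum>i\<in>insert i I. c i * cis (\<mu> i * t)))"
    using insert by (simp add: fun_eq_iff)
  ultimately show ?case by simp
qed simp

section \<open>Existence and uniformity of means\<close>

lemma integral_window_shift:
  fixes F :: "real \<Rightarrow> complex"
  assumes F: "F \<in> borel_measurable borel" and B: "\<And>t. norm (F t) \<le> B"
    and "s \<le> \<tau>" "\<tau> \<le> s + l" "T \<ge> 0"
  shows "norm (integral {s..s + T} F - integral {\<tau>..\<tau> + T} F) \<le> 2 * B * l"
proof -
  have B0: "B \<ge> 0" using order_trans[OF norm_ge_zero B[of 0]] .
  have int: "F integrable_on {a..b}" for a b by (rule bounded_borel_integrable_on[OF F B])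
  have 1: "integral {s..s + T} F + integral {s + T..\<tau> + T} F = integral {s..\<tau> + T} F"
    by (rule Henstock_Kurzweil_Integration.integral_combine) (use assms int in auto)
  have 2: "integral {s..\<tau>} F + integral {\<tau>..\<tau> + T} F = integral {s..\<tau> + T} F"
    by (rule Henstock_Kurzweil_Integration.integral_combine) (use assms int in auto)
  have "integral {s..s + T} F - integral {\<tau>..\<tau> + T} F = integral {s..\<tau>} F - integral {s + T..\<tau> + T} F"
    using 1 2 by (simp add: algebra_simps)
  also have "norm \<dots> \<le> B * (\<tau> - s) + B * (\<tau> + T - (s + T))"
    by (intro order_trans[OF norm_triangle_ineq4 add_mono] norm_integral_le_const int B) (use assms in auto)
  also have "\<dots> \<le> B * l + B * l" using assms B0 by (intro add_mono mult_left_mono) auto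
  finally show ?thesis by simp
qed

text \<open>The window at s is first moved to an almost period \<tau> in [s, s + l], which only
  exchanges end pieces and costs 2 B l, and then back to 0, which costs e / 4 (T + pi). Each cost is
  at most e T / 2 once T >= T0.\<close>

lemma stepanov_mean_uniform:
  assumes F: "F \<in> stepanov_ap_borel" and e: "e > 0"
  shows "\<exists>T0>0. \<forall>T\<ge>T0. \<forall>s. norm (integral {s..s + T} F - integral {0..T} F) \<le> e * T"
proof -
  obtain B where B: "B > 0" "\<And>t. norm (F t) \<le> B" and fm: "F \<in> borel_measurable borel"
    and rd: "\<And>\<epsilon>. \<epsilon> > 0 \<Longrightarrow> rel_dense (stepanov_translation_number F \<epsilon>)"
    using stepanov_ap_borelE[OF F] by metis
  obtain l where l: "l > 0" "\<And>a. \<exists>\<tau>\<in>{a..a + l}. stepanov_translation_number F (e / 4) \<tau>"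
    using rd[of "e / 4"] e unfolding rel_dense_def by auto
  define T0 where "T0 = max pi (4 * B * l / e)"
  have "norm (integral {s..s + T} F - integral {0..T} F) \<le> e * T" if T: "T \<ge> T0" for T s
  proof -
    have T': "T \<ge> pi" "4 * B * l \<le> e * T" using T e by (auto simp: T0_def field_simps)
    have T0: "T \<ge> 0" using T'(1) pi_ge_zero by linarith
    obtain \<tau> where \<tau>: "\<tau> \<in> {s..s + l}" "stepanov_translation_number F (e / 4) \<tau>" using l(2) by blast
    have 1: "norm (integral {s..s + T} F - integral {\<tau>..\<tau> + T} F) \<le> 2 * B * l"
      by (rule integral_window_shift[OF fm B(2)]) (use \<tau> T0 in auto)
    have int: "F integrable_on {a..b}" for a b by (rule bounded_borel_integrable_on[OF fm B(2)])
    have int': "(\<lambda>t. F (t + \<tau>)) integrable_on {0..T}"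
      by (rule bounded_borel_integrable_on[OF _ B(2)]) (use fm in measurable)
    have "integral {\<tau>..\<tau> + T} F - integral {0..T} F = integral {0..T} (\<lambda>t. F (t + \<tau>) - F t)"
      using integral_translate[of 0 T F \<tau>] integral_diff[OF int' int[of 0 T]] by (simp add: add.commute)
    also have "norm \<dots> \<le> integral {0..T} (\<lambda>t. norm (F (t + \<tau>) - F t))"
      using norm_diff_translate_integrable[OF fm B(2), of \<tau> 0]
      by (intro integral_norm_bound_integral integrable_diff int int') auto
    also have "\<dots> \<le> e / 4 * (T - 0 + pi)"
      by (rule translation_number_integral_bound[OF fm B(2) \<tau>(2) T0])
    also have "\<dots> \<le> e / 4 * (2 * T)" using T' e by (intro mult_left_mono) auto
    finally have 2: "norm (integral {\<tau>..\<tau> + T} F - integral {0..T} F) \<le> e * T / 2" by (simp add: mult.commute)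
    have "norm (integral {s..s + T} F - integral {0..T} F) \<le> 2 * B * l + e * T / 2"
      using norm_triangle_mono[OF 1 2] by simp
    then show ?thesis using T'(2) by simp
  qed
  moreover have "T0 > 0" by (simp add: T0_def less_max_iff_disj)
  ultimately show ?thesis by blast
qed

text \<open>Windows of equal length T have nearly the same integral, so the mean over a long
  interval, cut into such windows, is close to the mean over one of them. This makes the means a
  Cauchy family, and uniformity in the starting point is inherited from
  \<open>stepanov_mean_uniform\<close>.\<close>

lemma stepanov_has_mean:
  assumes F: "F \<in> stepanov_ap_borel"
  shows "\<exists>A. has_mean F A"
proof -
  obtain B where B: "B > 0" "\<And>t. norm (F t) \<le> B" and fm: "F \<in> borel_measurable borel"
    using stepanov_ap_borelE[OF F] by metis
  have int: "F integrable_on {a..b}" for a b by (rule bounded_borel_integrable_on[OF fm B(2)])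
  define I where "I = (\<lambda>T. integral {0..T} F)"
  define m where "m = (\<lambda>T. I T /\<^sub>R T)"
  have IB: "norm (I T) \<le> B * T" if "T \<ge> 0" for T
    using norm_integral_le_const[OF int B(2), of 0 T] that by (simp add: I_def)
  have near: "\<exists>T>0. \<exists>T1>0. \<forall>T'\<ge>T1. norm (m T' - m T) \<le> 2 * e" if e: "e > 0" for e
  proof -
    obtain T where T: "T > 0" "\<And>s. norm (integral {s..s + T} F - I T) \<le> e * T"
      using stepanov_mean_uniform[OF F e] unfolding I_def by blast
    have ind: "norm (I (real n * T) - of_nat n * I T) \<le> real n * (e * T)" for n
    proof (induction n)
      case (Suc n)
      have "I (real (Suc n) * T) = I (real n * T) + integral {real n * T..real n * T + T} F"
        using Henstock_Kurzweil_Integration.integral_combine[of 0 "real n * T" "real (Suc n) * T" F] int T(1)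
        by (simp add: algebra_simps I_def)
      then have "I (real (Suc n) * T) - of_nat (Suc n) * I T
          = (I (real n * T) - of_nat n * I T) + (integral {real n * T..real n * T + T} F - I T)"
        by (simp add: algebra_simps)
      also have "norm \<dots> \<le> real n * (e * T) + e * T" by (intro norm_triangle_mono Suc T)
      finally show ?case by (simp add: algebra_simps)
    qed (simp add: I_def)
    \<comment> \<open>The second summand pays for two errors of size at most B T: the incomplete
      last window, and the fractional part of T' / T.\<close>
    define T1 where "T1 = T + 2 * B * T / e"
    have "norm (m T' - m T) \<le> 2 * e" if T': "T' \<ge> T1" for T'
    proof -
      have p: "T' > 0" "2 * B * T \<le> e * T'"
      proof -
        have "2 * B * T / e \<le> T'" using T' T(1) unfolding T1_def by linarith
        then show "2 * B * T \<le> e * T'" using e by (simp add: field_simps)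
        show "T' > 0" using T' T(1) B(1) e unfolding T1_def
          by (smt (verit) divide_nonneg_pos mult_nonneg_nonneg)
      qed
      define n where "n = nat \<lfloor>T' / T\<rfloor>"
      have n: "real n * T \<le> T'" "T' \<le> real n * T + T"
      proof -
        have "real n \<le> T' / T" "T' / T \<le> real n + 1" using p T(1) by (auto simp: n_def)
        then show "real n * T \<le> T'" "T' \<le> real n * T + T" using T(1) by (auto simp: field_simps)
      qed
      have "I T' = I (real n * T) + integral {real n * T..T'} F"
        using Henstock_Kurzweil_Integration.integral_combine[of 0 "real n * T" T' F] int n T(1) by (simp add: I_def)
      then have split: "I T' - of_real (T' / T) * I T = (I (real n * T) - of_nat n * I T)
          + integral {real n * T..T'} F - of_real (T' / T - real n) * I T"
        by (simp add: algebra_simps)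
      have "norm (I T' - of_real (T' / T) * I T) \<le> real n * (e * T) + B * T + B * T"
        unfolding split
      proof (intro order_trans[OF norm_triangle_ineq4 add_mono] order_trans[OF norm_triangle_ineq add_mono] ind)
        have "norm (integral {real n * T..T'} F) \<le> B * (T' - real n * T)"
          by (rule norm_integral_le_const[OF int B(2) n(1)])
        also have "\<dots> \<le> B * T" using n B(1) by (intro mult_left_mono) auto
        finally show "norm (integral {real n * T..T'} F) \<le> B * T" .
        have "\<bar>T' / T - real n\<bar> \<le> 1" using n T(1) by (auto simp: abs_le_iff field_simps)
        then have "\<bar>T' / T - real n\<bar> * norm (I T) \<le> 1 * (B * T)" using IB[of T] T(1) B(1)
          by (intro mult_mono) auto
        then show "norm (of_real (T' / T - real n) * I T) \<le> B * T"
          by (simp only: norm_mult norm_of_real mult_1_left)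
      qed
      also have "\<dots> \<le> e * T' + e * T'"
      proof -
        have "real n * (e * T) \<le> e * T'" using mult_left_mono[OF n(1), of e] e by (simp add: mult_ac)
        then show ?thesis using p(2) by linarith
      qed
      finally have le: "norm (I T' - of_real (T' / T) * I T) \<le> 2 * e * T'" by (simp add: mult_ac)
      have "m T' - m T = (I T' - of_real (T' / T) * I T) /\<^sub>R T'"
        using p(1) T(1) by (simp add: m_def scaleR_conv_of_real field_simps)
      also have "norm \<dots> = norm (I T' - of_real (T' / T) * I T) / T'"
        using p(1) by (simp only: norm_scaleR) (simp add: divide_inverse)
      also have "\<dots> \<le> 2 * e" using le p(1) by (simp add: pos_divide_le_eq)
      finally show ?thesis .
    qed
    moreover have "T1 > 0" using T(1) B(1) e by (simp add: T1_def add_pos_nonneg)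
    ultimately show ?thesis using T(1) by blast
  qed
  have "Cauchy (\<lambda>n. m (real n))"
  proof (rule CauchyI)
    fix e :: real assume e: "e > 0"
    obtain T T1 where T: "\<And>T'. T' \<ge> T1 \<Longrightarrow> norm (m T' - m T) \<le> 2 * (e / 8)" using near[of "e / 8"] e by auto
    obtain N :: nat where N: "real N \<ge> T1" using real_arch_simple by blast
    show "\<exists>M. \<forall>k\<ge>M. \<forall>n\<ge>M. norm (m (real k) - m (real n)) < e"
    proof (intro exI allI impI)
      fix k n assume "N \<le> k" "N \<le> n"
      then have "norm (m (real k) - m T) \<le> e / 4" "norm (m (real n) - m T) \<le> e / 4"
        using T[of "real k"] T[of "real n"] N by auto
      then show "norm (m (real k) - m (real n)) < e"
        using norm_triangle_ineq4[of "m (real k) - m T" "m (real n) - m T"] e by simp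
    qed
  qed
  then obtain A where A: "(\<lambda>n. m (real n)) \<longlonglongrightarrow> A" using Cauchy_convergent convergent_def by blast
  have mA: "\<exists>T1>0. \<forall>T'\<ge>T1. norm (m T' - A) \<le> e" if e: "e > 0" for e
  proof -
    obtain T T1 where T1: "T1 > 0" and T: "\<And>T'. T' \<ge> T1 \<Longrightarrow> norm (m T' - m T) \<le> 2 * (e / 4)" using near[of "e / 4"] e by auto
    have "(\<lambda>n. norm (m (real n) - m T)) \<longlonglongrightarrow> norm (A - m T)" by (intro tendsto_intros A)
    moreover have "eventually (\<lambda>n. norm (m (real n) - m T) \<le> e / 2) sequentially"
      using eventually_ge_at_top[of "nat \<lceil>T1\<rceil>"] by eventually_elim (use T in force)
    ultimately have "norm (A - m T) \<le> e / 2" by (intro tendsto_upperbound) auto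
    then have "norm (m T' - A) \<le> e" if "T' \<ge> T1" for T'
      using T[OF that] norm_triangle_ineq4[of "m T' - m T" "A - m T"] by simp
    then show ?thesis using T1 by blast
  qed
  have "has_mean F A"
    unfolding has_mean_def
  proof (intro allI impI)
    fix e :: real assume e: "e > 0"
    obtain T1 where T1: "T1 > 0" "\<And>T s. T \<ge> T1 \<Longrightarrow> norm (integral {s..s + T} F - I T) \<le> e / 2 * T"
      using stepanov_mean_uniform[OF F, of "e / 2"] e unfolding I_def by auto
    obtain T2 where T2: "T2 > 0" "\<And>T. T \<ge> T2 \<Longrightarrow> norm (m T - A) \<le> e / 2" using mA[of "e / 2"] e by auto
    have "norm (integral {s..s + T} F - of_real T * A) \<le> e * T" if T: "T \<ge> max T1 T2" for T s
    proof -
      have Tp: "T > 0" using T T1(1) by linarith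
      have "I T - of_real T * A = of_real T * (m T - A)"
        using Tp by (simp add: m_def scaleR_conv_of_real field_simps)
      then have "norm (I T - of_real T * A) \<le> T * (e / 2)"
        using T2(2)[of T] T Tp by (simp add: norm_mult)
      then have "norm ((integral {s..s + T} F - I T) + (I T - of_real T * A)) \<le> e / 2 * T + T * (e / 2)"
        using T1(2)[of T s] T by (intro norm_triangle_mono) auto
      then show ?thesis by (simp add: field_simps)
    qed
    then show "\<exists>T0>0. \<forall>T\<ge>T0. \<forall>s. norm (integral {s..s + T} F - of_real T * A) \<le> e * T"
      using T1(1) by (intro exI[of _ "max T1 T2"]) auto
  qed
  then show ?thesis by blast
qed

lemma has_mean_tendsto:
  assumes "has_mean F A"
  shows "((\<lambda>L. of_real (1 / L) * integral {0..L} F) \<longlongrightarrow> A) at_top"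
proof (rule tendstoI)
  fix e :: real assume e: "e > 0"
  obtain T0 where T0: "T0 > 0" "\<And>T s. T \<ge> T0 \<Longrightarrow> norm (integral {s..s + T} F - of_real T * A) \<le> e / 2 * T"
    using assms e unfolding has_mean_def by (meson half_gt_zero)
  show "eventually (\<lambda>L. dist (of_real (1 / L) * integral {0..L} F) A < e) at_top"
    using eventually_ge_at_top[of T0]
  proof eventually_elim
    case (elim L)
    then have L: "L > 0" using T0(1) by linarith
    have "of_real (1 / L) * integral {0..L} F - A = of_real (1 / L) * (integral {0..0 + L} F - of_real L * A)"
      using L by (simp add: field_simps)
    then have "dist (of_real (1 / L) * integral {0..L} F) A = 1 / L * norm (integral {0..0 + L} F - of_real L * A)"
      using L by (simp add: dist_norm norm_mult norm_divide)
    also have "\<dots> \<le> 1 / L * (e / 2 * L)" using T0(2)[OF elim, of 0] L by (intro mult_left_mono) auto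
    finally show ?case using e L by simp
  qed
qed

lemma fourier_coeff_eq:
  assumes "has_mean (\<lambda>t. f t * cis (- \<mu> * t)) A"
  shows "fourier_coeff f \<mu> = A"
  unfolding fourier_coeff_def
  by (rule tendsto_Lim[OF trivial_limit_at_top_linorder has_mean_tendsto[OF assms]])

text \<open>The \<open>Lim\<close> in \<open>fourier_coeff\<close> carries information only once the
  limit exists; existence comes from \<open>stepanov_has_mean\<close> applied to f times an
  exponential.\<close>

lemma fourier_coeff_has_mean:
  assumes "f \<in> stepanov_ap_borel"
  shows "has_mean (\<lambda>t. f t * cis (- \<mu> * t)) (fourier_coeff f \<mu>)"
  using stepanov_has_mean[OF stepanov_ap_borel_mult_cis[OF assms, of "- \<mu>"]] fourier_coeff_eq by blast

lemma has_mean_add: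
  assumes F: "has_mean F A" "\<And>a b. F integrable_on {a..b}" and G: "has_mean G A'" "\<And>a b. G integrable_on {a..b}"
  shows "has_mean (\<lambda>t. F t + G t) (A + A')"
  unfolding has_mean_def
proof (intro allI impI)
  fix e :: real assume e: "e > 0"
  obtain T1 where T1: "T1 > 0" "\<And>T s. T \<ge> T1 \<Longrightarrow> norm (integral {s..s + T} F - of_real T * A) \<le> e / 2 * T"
    using F(1) e unfolding has_mean_def by (meson half_gt_zero)
  obtain T2 where T2: "T2 > 0" "\<And>T s. T \<ge> T2 \<Longrightarrow> norm (integral {s..s + T} G - of_real T * A') \<le> e / 2 * T"
    using G(1) e unfolding has_mean_def by (meson half_gt_zero)
  have "norm (integral {s..s + T} (\<lambda>t. F t + G t) - of_real T * (A + A')) \<le> e * T" if "T \<ge> max T1 T2" for T s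
  proof -
    have "integral {s..s + T} (\<lambda>t. F t + G t) - of_real T * (A + A')
       = (integral {s..s + T} F - of_real T * A) + (integral {s..s + T} G - of_real T * A')"
      by (simp add: integral_add F G algebra_simps)
    also have "norm \<dots> \<le> e / 2 * T + e / 2 * T" using that by (intro norm_triangle_mono T1 T2) auto
    finally show ?thesis by (simp add: mult.commute)
  qed
  then show "\<exists>T0>0. \<forall>T\<ge>T0. \<forall>s. norm (integral {s..s + T} (\<lambda>t. F t + G t) - of_real T * (A + A')) \<le> e * T"
    using T1(1) by (intro exI[of _ "max T1 T2"]) auto
qed

lemma has_mean_cmult:
  assumes F: "has_mean F A"
  shows "has_mean (\<lambda>t. c * F t) (c * A)"
  unfolding has_mean_def
proof (intro allI impI)
  fix e :: real assume e: "e > 0"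
  have e': "e / (norm c + 1) > 0" using e by (simp add: add_nonneg_pos)
  obtain T1 where T1: "T1 > 0" "\<And>T s. T \<ge> T1 \<Longrightarrow> norm (integral {s..s + T} F - of_real T * A) \<le> e / (norm c + 1) * T"
    using F e' unfolding has_mean_def by meson
  have "norm (integral {s..s + T} (\<lambda>t. c * F t) - of_real T * (c * A)) \<le> e * T" if "T \<ge> T1" for T s
  proof -
    have "norm (integral {s..s + T} (\<lambda>t. c * F t) - of_real T * (c * A)) = norm c * norm (integral {s..s + T} F - of_real T * A)"
      by (simp add: norm_mult[symmetric] algebra_simps)
    also have "\<dots> \<le> (norm c + 1) * (e / (norm c + 1) * T)"
      using T1(2)[OF that] by (intro mult_mono) auto
    also have "\<dots> = e * T"
    proof -
      have "norm c + 1 \<noteq> 0" using norm_ge_zero[of c] by linarith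
      then show ?thesis by simp
    qed
    finally show ?thesis .
  qed
  then show "\<exists>T0>0. \<forall>T\<ge>T0. \<forall>s. norm (integral {s..s + T} (\<lambda>t. c * F t) - of_real T * (c * A)) \<le> e * T"
    using T1(1) by blast
qed

lemma integrable_cis: "(\<lambda>t. cis (\<mu> * t)) integrable_on {a..b}"
  by (intro integrable_continuous_real continuous_intros)

lemma integral_cis_bound:
  assumes "\<mu> \<noteq> 0"
  shows "norm (integral {a..b} (\<lambda>t. cis (\<mu> * t))) \<le> 2 / \<bar>\<mu>\<bar>"
proof (cases "a \<le> b")
  case True
  have "((\<lambda>t. cis (\<mu> * t)) has_integral (cis (\<mu> * b) / (\<i> * \<mu>) - cis (\<mu> * a) / (\<i> * \<mu>))) {a..b}"
  proof (rule fundamental_theorem_of_calculus[OF True])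
    fix t :: real
    have "((\<lambda>z. exp (\<i> * (of_real \<mu> * z)) / (\<i> * of_real \<mu>)) has_field_derivative cis (\<mu> * t)) (at (of_real t))"
      using assms by (auto intro!: derivative_eq_intros simp: cis_conv_exp complex_eq_iff)
    from has_vector_derivative_real_field[OF this]
    show "((\<lambda>t. cis (\<mu> * t) / (\<i> * \<mu>)) has_vector_derivative cis (\<mu> * t)) (at t within {a..b})"
      by (simp add: cis_conv_exp)
  qed
  then have "integral {a..b} (\<lambda>t. cis (\<mu> * t)) = (cis (\<mu> * b) - cis (\<mu> * a)) / (\<i> * \<mu>)"
    by (simp add: integral_unique diff_divide_distrib)
  also have "norm \<dots> \<le> (norm (cis (\<mu> * b)) + norm (cis (\<mu> * a))) / \<bar>\<mu>\<bar>"
    by (simp only: norm_divide norm_mult) (simp add: divide_right_mono norm_triangle_le_diff del: norm_cis)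
  finally show ?thesis by simp
qed (use assms in auto)

lemma has_mean_cis: "has_mean (\<lambda>t. cis (\<mu> * t)) (if \<mu> = 0 then 1 else 0)"
proof (cases "\<mu> = 0")
  case False
  have "norm (integral {s..s + T} (\<lambda>t. cis (\<mu> * t))) \<le> e * T" if "e > 0" "T \<ge> 2 / \<bar>\<mu>\<bar> / e" for e T s
  proof -
    have "2 / \<bar>\<mu>\<bar> \<le> e * T" using iffD1[OF pos_divide_le_eq[OF that(1)] that(2)] by (simp only: mult.commute)
    then show ?thesis using integral_cis_bound[OF False, of s "s + T"] by linarith
  qed
  then show ?thesis using False unfolding has_mean_def
    by (auto intro!: exI[of _ "2 / \<bar>\<mu>\<bar> / _"] divide_pos_pos mult_pos_pos)
qed (auto simp: has_mean_def scaleR_conv_of_real intro!: exI[of _ 1])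

lemma has_mean_trig_sum:
  assumes "finite I"
  shows "has_mean (\<lambda>t. \<Sum>i\<in>I. c i * cis (\<mu> i * t)) (\<Sum>i\<in>I. c i * (if \<mu> i = 0 then 1 else 0))"
  using assms
proof (induction I rule: finite_induct)
  case empty
  show ?case by (auto simp: has_mean_def intro!: exI[of _ 1])
next
  case (insert i I)
  have "has_mean (\<lambda>t. c i * cis (\<mu> i * t) + (\<Sum>i\<in>I. c i * cis (\<mu> i * t)))
      (c i * (if \<mu> i = 0 then 1 else 0) + (\<Sum>i\<in>I. c i * (if \<mu> i = 0 then 1 else 0)))"
    by (intro has_mean_add has_mean_cmult has_mean_cis insert.IH integrable_continuous_real continuous_intros)
  then show ?case using insert by simp
qed

section \<open>Uniqueness of Fourier coefficients\<close>

lemma norm_cis_minus_one: "norm (cis x - 1) = 2 * \<bar>sin (x / 2)\<bar>"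
proof (rule power2_eq_imp_eq)
  have "(norm (cis x - 1))\<^sup>2 = (cos x - 1)\<^sup>2 + (sin x)\<^sup>2" by (simp add: cmod_power2)
  also have "\<dots> = 2 - 2 * cos x" using sin_cos_squared_add[of x] by (simp add: power2_diff)
  also have "cos x = 1 - 2 * (sin (x / 2))\<^sup>2" using cos_double_sin[of "x / 2"] by simp
  finally show "(norm (cis x - 1))\<^sup>2 = (2 * \<bar>sin (x / 2)\<bar>)\<^sup>2" by (simp add: power_mult_distrib)
qed auto

lemma norm_cis_minus_one_le: "norm (cis x - 1) \<le> \<bar>x\<bar>"
  using abs_sin_x_le_abs_x[of "x / 2"] by (simp add: norm_cis_minus_one)

text \<open>Jordan's inequality with 1 / 2 in place of 2 / pi, which allows a short proof: sin y - y
  / 2 increases up to pi / 3, and from there on sin y is at least sqrt 3 / 2, which exceeds pi /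
  4.\<close>

lemma abs_sin_ge_half:
  assumes "\<bar>y\<bar> \<le> pi / 2"
  shows "\<bar>y\<bar> / 2 \<le> \<bar>sin y\<bar>"
proof -
  have pos: "y / 2 \<le> sin y" if y: "0 \<le> y" "y \<le> pi / 2" for y :: real
  proof (cases "y \<le> pi / 3")
    case True
    have "sin 0 - 0 / 2 \<le> sin y - y / 2"
    proof (rule DERIV_nonneg_imp_nondecreasing[OF y(1)])
      fix u assume u: "0 \<le> u" "u \<le> y"
      then have "cos (pi / 3) \<le> cos u" using True pi_gt_zero by (intro cos_monotone_0_pi_le) auto
      then have "0 \<le> cos u - 1 / 2" by (simp add: cos_60)
      moreover have "((\<lambda>y. sin y - y / 2) has_real_derivative cos u - 1 / 2) (at u)"
        by (auto intro!: derivative_eq_intros)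
      ultimately show "\<exists>d. ((\<lambda>y. sin y - y / 2) has_real_derivative d) (at u) \<and> 0 \<le> d" by blast
    qed
    then show ?thesis by simp
  next
    case False
    then have "sin (pi / 3) \<le> sin y" using y pi_gt_zero by (intro sin_monotone_2pi_le) auto
    moreover have "sin (pi / 3) = sqrt 3 / 2" by (rule sin_60)
    moreover have "1.7 \<le> sqrt 3" by (rule real_le_rsqrt) (simp add: power2_eq_square)
    moreover have "y \<le> 1.6" using y pi_less_4 pi_approx by simp
    ultimately show ?thesis by linarith
  qed
  show ?thesis
  proof (cases "0 \<le> y")
    case True
    then show ?thesis using pos[of y] assms by auto
  next
    case False
    then show ?thesis using pos[of "- y"] assms by auto
  qed
qed

section \<open>Finite Fourier transforms\<close>

lemma sum_roots_of_unity:
  fixes j :: int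
  assumes "N > 0" "\<bar>j\<bar> < int N"
  shows "(\<Sum>k<N. cis (2 * pi * real k / real N * of_int j)) = (if j = 0 then of_nat N else 0)"
proof (cases "j = 0")
  case False
  define z where "z = cis (2 * pi / real N * of_int j)"
  have eq: "cis (2 * pi * real k / real N * of_int j) = z ^ k" for k
    by (simp add: z_def Complex.DeMoivre mult_ac)
  have "z ^ N = cis (2 * pi * of_int j)" using assms by (simp add: z_def Complex.DeMoivre)
  also have "\<dots> = 1" by (simp add: cis_multiple_2pi)
  finally have zN: "z ^ N = 1" .
  have "z \<noteq> 1"
  proof
    assume "z = 1"
    then have "exp (\<i> * of_real (2 * pi / real N * of_int j)) = 1" by (simp add: z_def cis_conv_exp)
    then obtain m :: int where "2 * pi / real N * of_int j = of_int (2 * m) * pi"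
      by (auto simp: exp_eq_1)
    then have "real_of_int j = of_int m * real N" using assms by (simp add: field_simps)
    then have "j = m * int N" by (metis of_int_eq_iff of_int_mult of_int_of_nat_eq)
    then have "int N dvd j" by simp
    then show False using False assms(2) zdvd_not_zless dvd_abs_iff by (metis abs_of_nat zdvd_not_zless zero_less_abs_iff)
  qed
  then have "(\<Sum>k<N. z ^ k) = 0" using zN by (simp add: geometric_sum)
  moreover have "(\<Sum>k<N. cis (2 * pi * real k / real N * of_int j)) = (\<Sum>k<N. z ^ k)"
    by (intro sum.cong refl eq)
  ultimately show ?thesis using False by metis
qed simp

text \<open>The support S is kept apart from the period N: sequences of length M are transformed
  with N = 2 M, so that correlations do not wrap around.\<close>

definition dft :: "nat \<Rightarrow> nat set \<Rightarrow> (nat \<Rightarrow> complex) \<Rightarrow> nat \<Rightarrow> complex" where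
  "dft N S c k = (\<Sum>n\<in>S. c n * cis (- (2 * pi * real k / real N) * real n))"

lemma dft_Parseval:
  assumes "N > 0" "S \<subseteq> {..<N}"
  shows "(\<Sum>k<N. (norm (dft N S c k))\<^sup>2) = real N * (\<Sum>n\<in>S. (norm (c n))\<^sup>2)"
proof -
  have fin: "finite S" using assms(2) finite_subset by blast
  have "(\<Sum>k<N. dft N S c k * cnj (dft N S c k))
    = (\<Sum>k<N. \<Sum>n\<in>S. \<Sum>n'\<in>S. c n * cnj (c n') * cis (2 * pi * real k / real N * of_int (int n' - int n)))"
    unfolding dft_def cnj_sum sum_product
    by (intro sum.cong refl) (simp add: cis_cnj cis_mult algebra_simps diff_divide_distrib)
  also have "\<dots> = (\<Sum>n\<in>S. \<Sum>n'\<in>S. c n * cnj (c n') * (\<Sum>k<N. cis (2 * pi * real k / real N * of_int (int n' - int n))))"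
    by (simp add: sum_distrib_left sum.swap[of _ S "{..<N}"])
  also have "\<dots> = (\<Sum>n\<in>S. \<Sum>n'\<in>S. if n = n' then c n * cnj (c n) * of_nat N else 0)"
  proof (intro sum.cong refl)
    fix n n' assume "n \<in> S" "n' \<in> S"
    then have "n < N" "n' < N" using assms(2) by auto
    then have "\<bar>int n' - int n\<bar> < int N" by linarith
    from sum_roots_of_unity[OF assms(1) this]
    show "c n * cnj (c n') * (\<Sum>k<N. cis (2 * pi * real k / real N * of_int (int n' - int n)))
      = (if n = n' then c n * cnj (c n) * of_nat N else 0)" by auto
  qed
  also have "\<dots> = of_nat N * (\<Sum>n\<in>S. c n * cnj (c n))"
    using fin by (simp add: sum_distrib_left mult_ac)
  finally have "of_real (\<Sum>k<N. (norm (dft N S c k))\<^sup>2) = complex_of_real (real N * (\<Sum>n\<in>S. (norm (c n))\<^sup>2))"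
    by (simp only: of_real_sum of_real_mult complex_norm_square of_real_of_nat_eq)
  then show ?thesis using of_real_eq_iff by blast
qed

text \<open>On the transform side the sum becomes the mean over k of
  \<open>\<bar>C k\<bar>\<^sup>2 * E k\<close>, where C belongs to c and E to the indicator of D.
  One factor C is estimated by \<epsilon> M; Cauchy-Schwarz and Parseval bound the sum over the
  remaining C and E by N M B.\<close>

lemma autocorrelation_bound:
  fixes c :: "nat \<Rightarrow> complex"
  assumes M: "M > 0" and D: "D \<subseteq> {..<M}" and B: "\<And>n. norm (c n) \<le> B"
    and e: "\<And>k. norm (dft (2 * M) {..<M} c k) \<le> \<epsilon> * real M"
  shows "norm (\<Sum>m\<in>D. \<Sum>n | n < M \<and> n + m < M. c n * cnj (c (n + m))) \<le> \<epsilon> * B * (real M)\<^sup>2"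
proof -
  define N where "N = 2 * M"
  define C where "C = dft N {..<M} c"
  define E where "E = dft N D (\<lambda>_. 1)"
  have N: "N > 0" "real N = 2 * real M" using M by (auto simp: N_def)
  have fin: "finite D" using D finite_subset by blast
  have B0: "B \<ge> 0" using order_trans[OF norm_ge_zero B[of 0]] .
  have eM: "\<epsilon> * real M \<ge> 0" using order_trans[OF norm_ge_zero e[of 0]] .
  let ?S = "\<Sum>m\<in>D. \<Sum>n | n < M \<and> n + m < M. c n * cnj (c (n + m))"
  have "(\<Sum>k<N. C k * E k * cnj (C k))
    = (\<Sum>k<N. \<Sum>m\<in>D. \<Sum>n<M. \<Sum>n'<M. c n * cnj (c n') * cis (2 * pi * real k / real N * of_int (int n' - int n - int m)))"
  proof (rule sum.cong[OF refl])
    fix k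
    have CC: "C k * cnj (C k) = (\<Sum>n<M. \<Sum>n'<M. c n * cis (- (2 * pi * real k / real N) * real n) *
        cnj (c n' * cis (- (2 * pi * real k / real N) * real n')))"
      unfolding C_def dft_def cnj_sum sum_product ..
    have "C k * E k * cnj (C k) = E k * (C k * cnj (C k))" by (simp add: mult_ac)
    also have "\<dots> = (\<Sum>m\<in>D. \<Sum>n<M. \<Sum>n'<M. cis (- (2 * pi * real k / real N) * real m) *
        (c n * cis (- (2 * pi * real k / real N) * real n) * cnj (c n' * cis (- (2 * pi * real k / real N) * real n'))))"
      unfolding CC E_def dft_def sum_product by (simp add: sum_distrib_left)
    also have "\<dots> = (\<Sum>m\<in>D. \<Sum>n<M. \<Sum>n'<M. c n * cnj (c n') * cis (2 * pi * real k / real N * of_int (int n' - int n - int m)))"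
    proof (intro sum.cong refl)
      fix m n n'
      have "cis (- (2 * pi * real k / real N) * real m) * cis (- (2 * pi * real k / real N) * real n)
            * cis (2 * pi * real k / real N * real n') = cis (2 * pi * real k / real N * of_int (int n' - int n - int m))"
        by (simp add: cis_mult algebra_simps diff_divide_distrib add_divide_distrib)
      then show "cis (- (2 * pi * real k / real N) * real m) *
        (c n * cis (- (2 * pi * real k / real N) * real n) * cnj (c n' * cis (- (2 * pi * real k / real N) * real n')))
        = c n * cnj (c n') * cis (2 * pi * real k / real N * of_int (int n' - int n - int m))"
        by (simp add: cis_cnj mult_ac)
    qed
    finally show "C k * E k * cnj (C k) = (\<Sum>m\<in>D. \<Sum>n<M. \<Sum>n'<M. c n * cnj (c n') * cis (2 * pi * real k / real N * of_int (int n' - int n - int m)))" .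
  qed
  also have "\<dots> = (\<Sum>m\<in>D. \<Sum>k<N. \<Sum>n<M. \<Sum>n'<M. c n * cnj (c n') * cis (2 * pi * real k / real N * of_int (int n' - int n - int m)))"
    by (rule sum.swap)
  also have "\<dots> = (\<Sum>m\<in>D. \<Sum>n<M. \<Sum>k<N. \<Sum>n'<M. c n * cnj (c n') * cis (2 * pi * real k / real N * of_int (int n' - int n - int m)))"
    by (intro sum.cong refl sum.swap)
  also have "\<dots> = (\<Sum>m\<in>D. \<Sum>n<M. \<Sum>n'<M. \<Sum>k<N. c n * cnj (c n') * cis (2 * pi * real k / real N * of_int (int n' - int n - int m)))"
    by (intro sum.cong refl sum.swap)
  also have "\<dots> = (\<Sum>m\<in>D. \<Sum>n<M. \<Sum>n'<M. if n' = n + m then c n * cnj (c n') * of_nat N else 0)"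
  proof (intro sum.cong refl)
    fix m n n' assume "m \<in> D" "n \<in> {..<M}" "n' \<in> {..<M}"
    then have *: "\<bar>int n' - int n - int m\<bar> < int N" "int n' - int n - int m = 0 \<longleftrightarrow> n' = n + m" using D by (auto simp: N_def)
    show "(\<Sum>k<N. c n * cnj (c n') * cis (2 * pi * real k / real N * of_int (int n' - int n - int m)))
       = (if n' = n + m then c n * cnj (c n') * of_nat N else 0)"
      unfolding sum_distrib_left[symmetric] sum_roots_of_unity[OF N(1) *(1)] *(2) by simp
  qed
  also have "\<dots> = (\<Sum>m\<in>D. \<Sum>n<M. if n + m < M then c n * cnj (c (n + m)) * of_nat N else 0)"
    by (intro sum.cong refl) (simp add: sum.delta)
  also have "\<dots> = of_nat N * ?S"
  proof -
    have "(\<Sum>n<M. if n + m < M then c n * cnj (c (n + m)) * of_nat N else 0)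
       = of_nat N * (\<Sum>n | n < M \<and> n + m < M. c n * cnj (c (n + m)))" for m
      unfolding sum_distrib_left by (rule sum.mono_neutral_cong_right) (auto simp: mult_ac)
    then show ?thesis by (simp add: sum_distrib_left)
  qed
  finally have "real N * norm ?S = norm (\<Sum>k<N. C k * E k * cnj (C k))"
    by (simp add: norm_mult)
  also have "\<dots> \<le> (\<Sum>k<N. norm (C k * E k * cnj (C k)))" by (rule norm_sum)
  also have "\<dots> \<le> (\<Sum>k<N. \<epsilon> * real M * (\<bar>norm (C k)\<bar> * \<bar>norm (E k)\<bar>))"
  proof (rule sum_mono)
    fix k
    have "norm (C k * E k * cnj (C k)) = norm (C k) * (norm (C k) * norm (E k))" by (simp add: norm_mult mult_ac)
    also have "\<dots> \<le> \<epsilon> * real M * (norm (C k) * norm (E k))"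
      using e[of k] by (intro mult_right_mono) (auto simp: C_def N_def)
    finally show "norm (C k * E k * cnj (C k)) \<le> \<epsilon> * real M * (\<bar>norm (C k)\<bar> * \<bar>norm (E k)\<bar>)" by simp
  qed
  also have "\<dots> = \<epsilon> * real M * (\<Sum>k<N. \<bar>norm (C k)\<bar> * \<bar>norm (E k)\<bar>)" by (simp add: sum_distrib_left)
  also have "\<dots> \<le> \<epsilon> * real M * (L2_set (\<lambda>k. norm (C k)) {..<N} * L2_set (\<lambda>k. norm (E k)) {..<N})"
    by (intro mult_left_mono L2_set_mult_ineq eM)
  also have "\<dots> \<le> \<epsilon> * real M * (sqrt (real N * real M * B\<^sup>2) * sqrt (real N * real M))"
  proof (intro mult_left_mono mult_mono eM)
    have "(\<Sum>k<N. (norm (C k))\<^sup>2) = real N * (\<Sum>n<M. (norm (c n))\<^sup>2)"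
      unfolding C_def using N by (intro dft_Parseval) (auto simp: N_def)
    also have "\<dots> \<le> real N * (\<Sum>n<M. B\<^sup>2)" by (intro mult_left_mono sum_mono power_mono B) auto
    finally show "L2_set (\<lambda>k. norm (C k)) {..<N} \<le> sqrt (real N * real M * B\<^sup>2)"
      unfolding L2_set_def by (simp add: mult_ac)
    have "(\<Sum>k<N. (norm (E k))\<^sup>2) = real N * (\<Sum>n\<in>D. (norm (1::complex))\<^sup>2)"
      unfolding E_def using N D by (intro dft_Parseval) (auto simp: N_def)
    also have "\<dots> = real N * real (card D)" by simp
    also have "\<dots> \<le> real N * real M" using card_mono[OF _ D] by (intro mult_left_mono) auto
    finally show "L2_set (\<lambda>k. norm (E k)) {..<N} \<le> sqrt (real N * real M)"
      unfolding L2_set_def by simp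
  qed (auto intro: L2_set_nonneg)
  also have "sqrt (real N * real M * B\<^sup>2) * sqrt (real N * real M) = real N * real M * B"
  proof -
    have "sqrt (x * B\<^sup>2) * sqrt x = x * B" if "x \<ge> 0" for x :: real
    proof -
      have "sqrt (x * B\<^sup>2) * sqrt x = B * (sqrt x * sqrt x)" using B0 by (simp add: real_sqrt_mult)
      then show ?thesis using that by simp
    qed
    then show ?thesis by simp
  qed
  finally have "real N * norm ?S \<le> real N * (\<epsilon> * B * (real M)\<^sup>2)" by (simp add: power2_eq_square mult_ac)
  then show ?thesis using N(1) by (simp add: mult_le_cancel_left)
qed

text \<open>Every window of length l + r contains a full interval [\<tau>, \<tau> + r] of points
  with P, hence at least r / (2 \<delta>) grid points. What matters is that \<rho> is fixed before
  \<delta>. In its denominator 3 r instead of r pays for rounding windows to whole grid steps, and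
  the factor 4 for rounding r / \<delta> down and for an incomplete last window.\<close>

lemma rel_dense_card:
  assumes rd: "rel_dense P0" and r: "r > 0" and P: "\<And>\<tau> u. P0 \<tau> \<Longrightarrow> \<tau> \<le> u \<Longrightarrow> u \<le> \<tau> + r \<Longrightarrow> P u"
  shows "\<exists>\<rho>>0. \<forall>\<delta>. 0 < \<delta> \<and> \<delta> \<le> r \<longrightarrow> (\<exists>n0. \<forall>n\<ge>n0. real (card {m. m < n \<and> P (\<delta> * real m)}) \<ge> \<rho> * real n)"
proof -
  obtain l where l: "l > 0" "\<And>a. \<exists>\<tau>\<in>{a..a + l}. P0 \<tau>" using rd by (auto simp: rel_dense_def)
  define \<rho> where "\<rho> = r / (4 * (l + 3 * r))"
  have "\<exists>n0. \<forall>n\<ge>n0. real (card {m. m < n \<and> P (\<delta> * real m)}) \<ge> \<rho> * real n" if \<delta>: "0 < \<delta>" "\<delta> \<le> r" for \<delta>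
  proof -
    define Q where "Q = nat \<lfloor>r / \<delta>\<rfloor>"
    define W where "W = nat \<lceil>(l + r) / \<delta>\<rceil> + 1"
    have rd: "r / \<delta> \<ge> 1" using \<delta> by simp
    have Q: "real Q \<le> r / \<delta>" "r / \<delta> / 2 \<le> real Q"
    proof -
      have 1: "\<lfloor>r / \<delta>\<rfloor> \<ge> 1" using rd by linarith
      then have "real Q = of_int \<lfloor>r / \<delta>\<rfloor>" by (simp add: Q_def)
      have "x / 2 \<le> real_of_int \<lfloor>x\<rfloor>" if "1 \<le> \<lfloor>x\<rfloor>" for x :: real
      proof -
        have "1 \<le> real_of_int \<lfloor>x\<rfloor>" using that by simp
        then show ?thesis using real_of_int_floor_add_one_gt[of x] by linarith
      qed
      from this[OF 1] \<open>real Q = of_int \<lfloor>r / \<delta>\<rfloor>\<close>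
      show "real Q \<le> r / \<delta>" "r / \<delta> / 2 \<le> real Q" using of_int_floor_le[of "r / \<delta>"] by metis+
    qed
    have W: "(l + r) / \<delta> + 1 \<le> real W" "real W \<le> (l + r) / \<delta> + 2"
    proof -
      have "(l + r) / \<delta> \<ge> 0" using \<delta> l r by auto
      then show "(l + r) / \<delta> + 1 \<le> real W" "real W \<le> (l + r) / \<delta> + 2" unfolding W_def by linarith+
    qed
    have Wp: "W > 0" by (simp add: W_def)
    define S where "S = (\<lambda>n. {m. m < n \<and> P (\<delta> * real m)})"
    have ind: "j * Q \<le> card (S (j * W))" for j
    proof (induction j)
      case (Suc j)
      obtain \<tau> where \<tau>: "\<tau> \<in> {\<delta> * real (j * W)..\<delta> * real (j * W) + l}" "P0 \<tau>" using l(2) by blast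
      have t0: "\<tau> / \<delta> \<ge> real (j * W)" using \<tau>(1) \<delta> by (simp add: field_simps)
      define m0 where "m0 = nat \<lceil>\<tau> / \<delta>\<rceil>"
      have m0: "\<tau> / \<delta> \<le> real m0" "real m0 < \<tau> / \<delta> + 1"
      proof -
        have "\<tau> / \<delta> \<ge> 0" using t0 by (meson of_nat_0_le_iff order_trans)
        then show "\<tau> / \<delta> \<le> real m0" "real m0 < \<tau> / \<delta> + 1" unfolding m0_def by linarith+
      qed
      have sub: "S (j * W) \<union> {m0..<m0 + Q} \<subseteq> S (Suc j * W)"
      proof
        fix m assume "m \<in> S (j * W) \<union> {m0..<m0 + Q}"
        then show "m \<in> S (Suc j * W)"
        proof
          assume "m \<in> {m0..<m0 + Q}"
          then have m: "real m0 \<le> real m" "real m + 1 \<le> real m0 + real Q" by auto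
          have "\<tau> / \<delta> \<le> real m" "real m \<le> \<tau> / \<delta> + r / \<delta>" using m m0 Q by linarith+
          then have "\<tau> \<le> \<delta> * real m" "\<delta> * real m \<le> \<tau> + r" using \<delta> by (auto simp: field_simps)
          then have "P (\<delta> * real m)" using P[OF \<tau>(2)] by blast
          moreover have "real m < real (Suc j * W)"
          proof -
            have "\<tau> / \<delta> \<le> real (j * W) + l / \<delta>" using \<tau>(1) \<delta> by (simp add: field_simps)
            then have "real m \<le> real (j * W) + l / \<delta> + r / \<delta>" using \<open>real m \<le> \<tau> / \<delta> + r / \<delta>\<close> by linarith
            also have "\<dots> < real (j * W) + real W" using W(1) by (simp add: add_divide_distrib)
            finally show ?thesis by (simp add: algebra_simps)
          qed
          ultimately show ?thesis unfolding S_def by (simp only: of_nat_less_iff mem_Collect_eq)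
        qed (auto simp: S_def)
      qed
      have "real (j * W) \<le> real m0" using t0 m0 by linarith
      then have "j * W \<le> m0" by (simp only: of_nat_le_iff)
      then have "S (j * W) \<inter> {m0..<m0 + Q} = {}" by (auto simp: S_def)
      then have "card (S (j * W)) + Q = card (S (j * W) \<union> {m0..<m0 + Q})"
        by (subst card_Un_disjoint) (auto simp: S_def)
      also have "\<dots> \<le> card (S (Suc j * W))" by (rule card_mono[OF _ sub]) (auto simp: S_def)
      finally show ?case using Suc by simp
    qed simp
    have "real (card (S n)) \<ge> \<rho> * real n" if n: "n \<ge> W" for n
    proof -
      define j where "j = n div W"
      have "j \<ge> 1" using n Wp by (simp add: j_def Suc_leI div_greater_zero_iff)
      have jW: "j * W \<le> n" by (simp add: j_def)
      have "n < j * W + W" using Wp unfolding j_def by (metis div_mult_mod_eq mod_less_divisor nat_add_left_cancel_less)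
      also have "\<dots> \<le> 2 * (j * W)" using \<open>j \<ge> 1\<close> by simp
      finally have n2: "real n \<le> 2 * (real j * real W)" by (metis less_imp_le_nat of_nat_le_iff of_nat_mult of_nat_numeral)
      have "real W \<le> (l + 3 * r) / \<delta>" using W(2) rd by (simp add: add_divide_distrib)
      then have "real n \<le> 2 * (real j * ((l + 3 * r) / \<delta>))" using n2
        by (meson mult_left_mono of_nat_0_le_iff order_trans zero_le_numeral)
      then have "\<rho> * real n \<le> \<rho> * (2 * (real j * ((l + 3 * r) / \<delta>)))"
        using l r by (intro mult_left_mono) (auto simp: \<rho>_def)
      also have "\<dots> = real j * (r / \<delta> / 2)"
      proof -
        have "r / (4 * L) * (2 * (k * (L / \<delta>))) = k * (r / \<delta> / 2)" if "L \<noteq> 0" for L k :: real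
          using that by simp
        moreover have "l + 3 * r \<noteq> 0" using l r by linarith
        ultimately show ?thesis unfolding \<rho>_def by blast
      qed
      also have "\<dots> \<le> real j * real Q" by (intro mult_left_mono Q) auto
      also have "\<dots> \<le> real (card (S (j * W)))" using ind[of j] by (metis of_nat_le_iff of_nat_mult)
      also have "\<dots> \<le> real (card (S n))" using jW by (intro of_nat_mono card_mono) (auto simp: S_def)
      finally show ?thesis .
    qed
    then show ?thesis unfolding S_def by blast
  qed
  moreover have "\<rho> > 0" using l r by (simp add: \<rho>_def)
  ultimately show ?thesis by blast
qed

text \<open>On a block of length T0 starting at s, changing \<mu>0 to \<mu> is a constant phase,
  harmless for the norm, up to an error of at most B r T0 = e / 3. The length T0 is chosen for
  \<mu>0 alone and serves all blocks because \<open>has_mean\<close> is uniform in s; only then is r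
  chosen. The last third of e pays for the incomplete block.\<close>

lemma mean_zero_locally_uniform:
  fixes h :: "real \<Rightarrow> complex"
  assumes cont: "continuous_on UNIV h" and B: "B > 0" "\<And>t. norm (h t) \<le> B"
    and mean: "has_mean (\<lambda>t. h t * cis (- \<mu>0 * t)) 0" and e: "e > 0"
  shows "\<exists>r>0. \<exists>T1>0. \<forall>\<mu> T. \<bar>\<mu> - \<mu>0\<bar> < r \<longrightarrow> T1 \<le> T \<longrightarrow>
      norm (integral {0..T} (\<lambda>t. h t * cis (- \<mu> * t))) \<le> e * T"
proof -
  have int: "(\<lambda>t. h t * cis (- \<mu> * t)) integrable_on {a..b}" for \<mu> a b
    by (intro integrable_continuous_real continuous_intros continuous_on_subset[OF cont]) auto
  obtain T0 where T0: "T0 > 0" "\<And>s. norm (integral {s..s + T0} (\<lambda>t. h t * cis (- \<mu>0 * t))) \<le> e / 3 * T0"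
  proof -
    have "e / 3 > 0" using e by simp
    from mean[unfolded has_mean_def, rule_format, OF this] that show ?thesis by auto
  qed
  define r where "r = e / (3 * B * T0)"
  have r: "r > 0" "B * r * T0 = e / 3" using e B T0 by (auto simp: r_def)
  define T1 where "T1 = 3 * B * T0 / e"
  have T1: "T1 > 0" using e B T0 by (simp add: T1_def)
  have "norm (integral {0..T} (\<lambda>t. h t * cis (- \<mu> * t))) \<le> e * T" if l: "\<bar>\<mu> - \<mu>0\<bar> < r" and T: "T1 \<le> T" for \<mu> T
  proof -
    have block: "norm (integral {s..s + T0} (\<lambda>t. h t * cis (- \<mu> * t))) \<le> 2 * e / 3 * T0" for s
    proof -
      let ?d = "\<lambda>t. h t * cis (- \<mu> * t) - cis (- (\<mu> - \<mu>0) * s) * (h t * cis (- \<mu>0 * t))"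
      have dint: "?d integrable_on {s..s + T0}"
        by (intro integrable_continuous_real continuous_intros continuous_on_subset[OF cont]) auto
      have db: "norm (?d t) \<le> e / 3" if t: "t \<in> {s..s + T0}" for t
      proof -
        have "?d t = h t * cis (- \<mu>0 * t) * cis (- (\<mu> - \<mu>0) * s) * (cis (- (\<mu> - \<mu>0) * (t - s)) - 1)"
        proof -
          have "cis (- \<mu> * t) = cis (- \<mu>0 * t) * cis (- (\<mu> - \<mu>0) * s) * cis (- (\<mu> - \<mu>0) * (t - s))"
            unfolding cis_mult by (rule arg_cong[of _ _ cis]) (simp add: algebra_simps)
          then show ?thesis by (simp only: right_diff_distrib mult_1_right mult_1_left mult.assoc mult.left_commute mult.commute)
        qed
        then have "norm (?d t) = norm (h t) * norm (cis (- (\<mu> - \<mu>0) * (t - s)) - 1)"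
          by (simp add: norm_mult)
        also have "\<dots> \<le> B * (r * T0)"
        proof (intro mult_mono B)
          have "\<bar>- (\<mu> - \<mu>0) * (t - s)\<bar> \<le> r * T0" unfolding abs_mult using l t by (intro mult_mono) auto
          then show "norm (cis (- (\<mu> - \<mu>0) * (t - s)) - 1) \<le> r * T0"
            using norm_cis_minus_one_le order_trans by blast
        qed (use B in auto)
        finally show ?thesis using r(2) by (simp add: mult.assoc)
      qed
      have "integral {s..s + T0} ?d = integral {s..s + T0} (\<lambda>t. h t * cis (- \<mu> * t))
          - cis (- (\<mu> - \<mu>0) * s) * integral {s..s + T0} (\<lambda>t. h t * cis (- \<mu>0 * t))"
        by (subst integral_diff[OF int]) (use int in \<open>auto intro!: integrable_on_mult_right\<close>)
      then have "integral {s..s + T0} (\<lambda>t. h t * cis (- \<mu> * t)) = integral {s..s + T0} ?d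
          + cis (- (\<mu> - \<mu>0) * s) * integral {s..s + T0} (\<lambda>t. h t * cis (- \<mu>0 * t))" by simp
      also have "norm \<dots> \<le> e / 3 * T0 + e / 3 * T0"
      proof (rule norm_triangle_mono)
        have "norm (integral {s..s + T0} ?d) \<le> integral {s..s + T0} (\<lambda>_. e / 3)"
          by (rule integral_norm_bound_integral[OF dint]) (use db in auto)
        then show "norm (integral {s..s + T0} ?d) \<le> e / 3 * T0" using T0(1) by (simp add: mult.commute)
        show "norm (cis (- (\<mu> - \<mu>0) * s) * integral {s..s + T0} (\<lambda>t. h t * cis (- \<mu>0 * t))) \<le> e / 3 * T0"
          using T0(2)[of s] by (simp add: norm_mult)
      qed
      finally show ?thesis by (simp add: mult_ac)
    qed
    define I where "I = (\<lambda>a b. integral {a..b} (\<lambda>t. h t * cis (- \<mu> * t)))"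
    have ind: "norm (I 0 (real n * T0)) \<le> real n * (2 * e / 3 * T0)" for n
    proof (induction n)
      case (Suc n)
      have "I 0 (real (Suc n) * T0) = I 0 (real n * T0) + I (real n * T0) (real n * T0 + T0)"
        using Henstock_Kurzweil_Integration.integral_combine[of 0 "real n * T0" "real (Suc n) * T0", OF _ _ int[of \<mu>]] T0(1)
        by (simp add: algebra_simps I_def)
      also have "norm \<dots> \<le> real n * (2 * e / 3 * T0) + 2 * e / 3 * T0"
        using block[of "real n * T0"] by (intro norm_triangle_mono Suc) (simp add: I_def)
      finally show ?case by (simp add: algebra_simps)
    qed (simp add: I_def)
    define n where "n = nat \<lfloor>T / T0\<rfloor>"
    have "T > 0" using T T1 by linarith
    moreover have "B * T0 \<le> e / 3 * T" using T e unfolding T1_def by (simp add: field_simps)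
    ultimately have Tp: "T > 0" "B * T0 \<le> e / 3 * T" .
    have n: "real n * T0 \<le> T" "T \<le> real n * T0 + T0"
    proof -
      have "real n \<le> T / T0" "T / T0 \<le> real n + 1" using Tp T0(1) by (auto simp: n_def)
      then show "real n * T0 \<le> T" "T \<le> real n * T0 + T0" using T0(1) by (auto simp: field_simps)
    qed
    have "I 0 T = I 0 (real n * T0) + I (real n * T0) T"
      using Henstock_Kurzweil_Integration.integral_combine[of 0 "real n * T0" T, OF _ _ int[of \<mu>]] n T0(1) by (simp add: I_def)
    also have "norm \<dots> \<le> real n * (2 * e / 3 * T0) + B * T0"
    proof (rule norm_triangle_mono[OF ind])
      have "norm (I (real n * T0) T) \<le> B * (T - real n * T0)"
        unfolding I_def by (rule norm_integral_le_const[OF int _ n(1)]) (use B in \<open>simp add: norm_mult\<close>)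
      also have "\<dots> \<le> B * T0" using n B by (intro mult_left_mono) auto
      finally show "norm (I (real n * T0) T) \<le> B * T0" .
    qed
    also have "\<dots> \<le> 2 * e / 3 * T + e / 3 * T"
      using mult_left_mono[OF n(1), of "2 * e / 3"] e Tp(2) by (intro add_mono) (auto simp: mult_ac)
    finally show ?thesis by (simp add: I_def mult_ac)
  qed
  then show ?thesis using r(1) T1 by blast
qed

text \<open>A finite cover of a bounded frequency range gives one T1. A bounded range is enough
  later, since samples with step \<delta> see frequencies only modulo 2 pi / \<delta>.\<close>

lemma mean_zero_uniform:
  fixes h :: "real \<Rightarrow> complex"
  assumes cont: "continuous_on UNIV h" and B: "B > 0" "\<And>t. norm (h t) \<le> B"
    and mean: "\<And>\<mu>. has_mean (\<lambda>t. h t * cis (- \<mu> * t)) 0" and e: "e > 0"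
  shows "\<exists>T1. \<forall>\<mu> T. \<bar>\<mu>\<bar> \<le> \<Omega> \<longrightarrow> T1 \<le> T \<longrightarrow> norm (integral {0..T} (\<lambda>t. h t * cis (- \<mu> * t))) \<le> e * T"
proof -
  obtain r T1 where rT: "\<And>\<mu>0. r \<mu>0 > 0" "\<And>\<mu>0 \<mu> T. \<bar>\<mu> - \<mu>0\<bar> < r \<mu>0 \<Longrightarrow> T1 \<mu>0 \<le> T \<Longrightarrow>
      norm (integral {0..T} (\<lambda>t. h t * cis (- \<mu> * t))) \<le> e * T"
    using mean_zero_locally_uniform[OF cont B mean e] by metis
  obtain K where K: "finite K" "{-\<Omega>..\<Omega>} \<subseteq> (\<Union>x\<in>K. ball x (r x))"
    by (rule compactE_image[of "{-\<Omega>..\<Omega>}" "{-\<Omega>..\<Omega>}" "\<lambda>x. ball x (r x)"])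
       (use rT(1) in \<open>auto intro: centre_in_ball[THEN iffD2]\<close>)
  define T2 where "T2 = Max (insert 0 (T1 ` K))"
  have "norm (integral {0..T} (\<lambda>t. h t * cis (- \<mu> * t))) \<le> e * T" if l: "\<bar>\<mu>\<bar> \<le> \<Omega>" and T: "T2 \<le> T" for \<mu> T
  proof -
    have "\<mu> \<in> {-\<Omega>..\<Omega>}" using l by auto
    then obtain k where k: "k \<in> K" "\<mu> \<in> ball k (r k)" using K(2) by blast
    have "T1 k \<le> T2" unfolding T2_def using K(1) k(1) by (intro Max_ge) auto
    then show ?thesis using rT(2)[of \<mu> k T] k T by (auto simp: dist_real_def abs_minus_commute)
  qed
  then show ?thesis by blast
qed

text \<open>Over one grid cell the integral of h against the exponential equals the term of the sum
  times Z, up to \<eta> \<delta>, where Z is the integral of the exponential over [0, \<delta>]. For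
  \<theta> in [- pi, pi] the modulus of Z is at least \<delta> / 2, so dividing by it costs only the
  factor 2.\<close>

lemma dft_sample_bound:
  fixes h :: "real \<Rightarrow> complex"
  assumes cont: "continuous_on UNIV h" and \<delta>: "\<delta> > 0"
    and uc: "\<And>t s. \<bar>t - s\<bar> \<le> \<delta> \<Longrightarrow> norm (h t - h s) \<le> \<eta>"
    and \<theta>: "\<bar>\<theta>\<bar> \<le> pi"
    and I: "norm (integral {0..real M * \<delta>} (\<lambda>t. h t * cis (- (\<theta> / \<delta>) * t))) \<le> \<epsilon> * (real M * \<delta>)"
  shows "norm (\<Sum>n<M. h (\<delta> * real n) * cis (- \<theta> * real n)) \<le> 2 * (\<epsilon> + \<eta>) * real M"
proof -
  define \<mu> where "\<mu> = \<theta> / \<delta>"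
  define Z where "Z = integral {0..\<delta>} (\<lambda>t. cis (- \<mu> * t))"
  have Z: "norm Z \<ge> \<delta> / 2"
  proof (cases "\<mu> = 0")
    case True
    then show ?thesis using \<delta> by (simp add: Z_def)
  next
    case False
    have "((\<lambda>t. cis (- \<mu> * t)) has_integral (cis (- \<mu> * \<delta>) / (\<i> * of_real (- \<mu>)) - cis (- \<mu> * 0) / (\<i> * of_real (- \<mu>)))) {0..\<delta>}"
    proof (rule fundamental_theorem_of_calculus)
      fix t :: real
      have "((\<lambda>z. exp (\<i> * (of_real (- \<mu>) * z)) / (\<i> * of_real (- \<mu>))) has_field_derivative cis (- \<mu> * t)) (at (of_real t))"
        using False by (auto intro!: derivative_eq_intros simp: cis_conv_exp complex_eq_iff)
      from has_vector_derivative_real_field[OF this]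
      show "((\<lambda>t. cis (- \<mu> * t) / (\<i> * of_real (- \<mu>))) has_vector_derivative cis (- \<mu> * t)) (at t within {0..\<delta>})"
        by (simp add: cis_conv_exp)
    qed (use \<delta> in simp)
    then have "Z = (cis (- \<mu> * \<delta>) - 1) / (\<i> * of_real (- \<mu>))"
      unfolding Z_def by (simp add: integral_unique diff_divide_distrib)
    then have nz: "norm Z = 2 * \<bar>sin (- \<mu> * \<delta> / 2)\<bar> / \<bar>\<mu>\<bar>"
      by (simp only: norm_divide norm_mult norm_cis_minus_one) simp
    have "\<bar>- \<mu> * \<delta> / 2\<bar> \<le> pi / 2" using \<theta> \<delta> by (simp add: \<mu>_def)
    from abs_sin_ge_half[OF this] have "\<bar>\<mu>\<bar> * \<delta> / 4 \<le> \<bar>sin (- \<mu> * \<delta> / 2)\<bar>" using \<delta> by (simp add: abs_mult)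
    then show ?thesis unfolding nz using False by (simp add: field_simps)
  qed
  define S where "S = (\<lambda>m. \<Sum>n<m. h (\<delta> * real n) * cis (- \<theta> * real n))"
  have int: "(\<lambda>t. h t * cis (- \<mu> * t)) integrable_on {a..b}" for a b
    by (intro integrable_continuous_real continuous_intros continuous_on_subset[OF cont]) auto
  have block: "norm (integral {\<delta> * real n..\<delta> * real n + \<delta>} (\<lambda>t. h t * cis (- \<mu> * t)) - h (\<delta> * real n) * cis (- \<theta> * real n) * Z) \<le> \<eta> * \<delta>" for n
  proof -
    let ?a = "\<delta> * real n"
    let ?d = "\<lambda>t. h t * cis (- \<mu> * t) - h ?a * cis (- \<mu> * t)"
    have "integral {0 + ?a..\<delta> + ?a} (\<lambda>t. cis (- \<mu> * t)) = integral {0..\<delta>} (\<lambda>t. cis (- \<mu> * (t + ?a)))"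
      by (rule integral_translate[symmetric])
    also have "\<dots> = integral {0..\<delta>} (\<lambda>t. cis (- \<theta> * real n) * cis (- \<mu> * t))"
      using \<delta> by (intro integral_cong) (simp add: cis_mult \<mu>_def algebra_simps)
    also have "\<dots> = cis (- \<theta> * real n) * Z" by (simp add: Z_def)
    finally have shift: "integral {?a..?a + \<delta>} (\<lambda>t. cis (- \<mu> * t)) = cis (- \<theta> * real n) * Z" by (simp add: add.commute)
    have "integral {?a..?a + \<delta>} ?d = integral {?a..?a + \<delta>} (\<lambda>t. h t * cis (- \<mu> * t)) - h ?a * integral {?a..?a + \<delta>} (\<lambda>t. cis (- \<mu> * t))"
      by (subst integral_diff[OF int integrable_on_mult_right[OF integrable_cis]]) simp
    then have "integral {?a..?a + \<delta>} (\<lambda>t. h t * cis (- \<mu> * t)) - h ?a * cis (- \<theta> * real n) * Z = integral {?a..?a + \<delta>} ?d"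
      using shift by (simp add: mult.assoc)
    also have "norm \<dots> \<le> integral {?a..?a + \<delta>} (\<lambda>_. \<eta>)"
    proof (rule integral_norm_bound_integral)
      show "?d integrable_on {?a..?a + \<delta>}"
        by (intro integrable_continuous_real continuous_intros continuous_on_subset[OF cont]) auto
      show "norm (?d t) \<le> \<eta>" if "t \<in> {?a..?a + \<delta>}" for t
        using uc[of t ?a] that by (simp add: norm_mult flip: left_diff_distrib)
    qed auto
    also have "\<dots> = \<eta> * \<delta>" using \<delta> by simp
    finally show ?thesis .
  qed
  have ind: "norm (integral {0..\<delta> * real m} (\<lambda>t. h t * cis (- \<mu> * t)) - S m * Z) \<le> real m * (\<eta> * \<delta>)" for m
  proof (induction m)
    case (Suc m)
    have "integral {0..\<delta> * real (Suc m)} (\<lambda>t. h t * cis (- \<mu> * t))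
       = integral {0..\<delta> * real m} (\<lambda>t. h t * cis (- \<mu> * t)) + integral {\<delta> * real m..\<delta> * real m + \<delta>} (\<lambda>t. h t * cis (- \<mu> * t))"
      using Henstock_Kurzweil_Integration.integral_combine[of 0 "\<delta> * real m" "\<delta> * real (Suc m)", OF _ _ int] \<delta>
      by (simp add: algebra_simps)
    then have "integral {0..\<delta> * real (Suc m)} (\<lambda>t. h t * cis (- \<mu> * t)) - S (Suc m) * Z
      = (integral {0..\<delta> * real m} (\<lambda>t. h t * cis (- \<mu> * t)) - S m * Z)
       + (integral {\<delta> * real m..\<delta> * real m + \<delta>} (\<lambda>t. h t * cis (- \<mu> * t)) - h (\<delta> * real m) * cis (- \<theta> * real m) * Z)"
      by (simp add: S_def algebra_simps)
    also have "norm \<dots> \<le> real m * (\<eta> * \<delta>) + \<eta> * \<delta>" by (rule norm_triangle_mono[OF Suc block])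
    finally show ?case by (simp add: algebra_simps)
  qed (simp add: S_def)
  have "norm (S M) * (\<delta> / 2) \<le> norm (S M) * norm Z" by (intro mult_left_mono Z) auto
  also have "\<dots> = norm (S M * Z)" by (simp add: norm_mult)
  also have "\<dots> \<le> \<epsilon> * (real M * \<delta>) + real M * (\<eta> * \<delta>)"
    using norm_triangle_sub[of "S M * Z" "integral {0..\<delta> * real M} (\<lambda>t. h t * cis (- \<mu> * t))"]
      ind[of M] I by (simp add: norm_minus_commute \<mu>_def mult.commute)
  also have "\<dots> = (2 * (\<epsilon> + \<eta>) * real M) * (\<delta> / 2)" by (simp add: algebra_simps)
  finally show ?thesis using \<delta> by (simp add: S_def)
qed

text \<open>De la Vallee Poussin's argument, with sums in place of integrals: sampling \<open>h\<close> on a fine grid, the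
  discrete Fourier coefficients of a long block are all small, hence so is the correlation of the block
  with its translates, summed over a set of almost periods. But a translate by an almost period is close
  to the block itself, and the mean square of the block is bounded below.\<close>

theorem almost_periodic_mean_zero_imp_zero:
  fixes h :: "real \<Rightarrow> complex"
  assumes uc: "uniformly_continuous_on UNIV h" and B: "B > 0" "\<And>t. norm (h t) \<le> B"
    and ap: "\<And>\<epsilon>. \<epsilon> > 0 \<Longrightarrow> rel_dense (\<lambda>\<tau>. \<forall>t. norm (h (t + \<tau>) - h t) \<le> \<epsilon>)"
    and mean: "\<And>\<mu>. has_mean (\<lambda>t. h t * cis (- \<mu> * t)) 0"
  shows "h t0 = 0"
proof (rule ccontr)
  assume nz: "h t0 \<noteq> 0"
  define c where "c = norm (h t0)"
  have c: "c > 0" using nz by (simp add: c_def)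
  have cont: "continuous_on UNIV h" by (rule uniformly_continuous_imp_continuous[OF uc])
  have ucE: "\<exists>d>0. \<forall>t s. \<bar>t - s\<bar> \<le> d \<longrightarrow> norm (h t - h s) \<le> e" if e: "e > 0" for e
  proof -
    obtain d where d: "d > 0" "\<forall>t\<in>UNIV. \<forall>s\<in>UNIV. dist s t < d \<longrightarrow> dist (h s) (h t) < e"
      using uc[unfolded uniformly_continuous_on_def] e by meson
    have "norm (h t - h s) \<le> e" if "\<bar>t - s\<bar> \<le> d / 2" for t s
    proof -
      have "dist t s < d" using that d(1) by (simp add: dist_real_def)
      then show ?thesis using d(2) by (simp add: dist_norm less_imp_le)
    qed
    then show ?thesis using d(1) by (intro exI[of _ "d / 2"]) auto
  qed
  define big where "big = (\<lambda>t. norm (h t) \<ge> c / 2)"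
  obtain r1 where r1: "r1 > 0" "\<And>t s. \<bar>t - s\<bar> \<le> r1 \<Longrightarrow> norm (h t - h s) \<le> c / 4"
    using ucE[of "c / 4"] c by auto
  have "\<exists>\<rho>>0. \<forall>\<delta>. 0 < \<delta> \<and> \<delta> \<le> r1 \<longrightarrow> (\<exists>n0. \<forall>n\<ge>n0. real (card {m. m < n \<and> big (\<delta> * real m)}) \<ge> \<rho> * real n)"
  proof (rule rel_dense_card[OF _ r1(1)])
    obtain l where l: "l > 0" "\<And>a. \<exists>\<tau>\<in>{a..a + l}. \<forall>t. norm (h (t + \<tau>) - h t) \<le> c / 4"
      using ap[of "c / 4"] c unfolding rel_dense_def by auto
    show "rel_dense (\<lambda>u. norm (h u - h t0) \<le> c / 4)"
      unfolding rel_dense_def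
    proof (intro exI[of _ l] conjI l(1) allI)
      fix a
      obtain \<tau> where "\<tau> \<in> {a - t0..a - t0 + l}" "\<And>t. norm (h (t + \<tau>) - h t) \<le> c / 4" using l(2) by blast
      then show "\<exists>u\<in>{a..a + l}. norm (h u - h t0) \<le> c / 4" by (intro bexI[of _ "t0 + \<tau>"]) auto
    qed
    fix \<tau> u assume "norm (h \<tau> - h t0) \<le> c / 4" "\<tau> \<le> u" "u \<le> \<tau> + r1"
    then show "big u" using r1(2)[of u \<tau>] norm_triangle_ineq2[of "h t0" "h t0 - h u"]
        norm_triangle_ineq[of "h t0 - h \<tau>" "h \<tau> - h u"]
      by (simp add: big_def c_def norm_minus_commute)
  qed
  then obtain \<rho>1 where \<rho>1: "\<rho>1 > 0"
    "\<And>\<delta>. 0 < \<delta> \<Longrightarrow> \<delta> \<le> r1 \<Longrightarrow> \<exists>n0. \<forall>n\<ge>n0. real (card {m. m < n \<and> big (\<delta> * real m)}) \<ge> \<rho>1 * real n" by blast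
  \<comment> \<open>Replacing a translate by the block itself costs at most M \<eta> B with M = 2 n,
    which is half of the lower bound \<rho>1 n (c / 2) ^ 2 for the sum of squares.\<close>
  define \<eta> where "\<eta> = \<rho>1 * c\<^sup>2 / (16 * B)"
  have \<eta>: "\<eta> > 0" "\<eta> * B = \<rho>1 * c\<^sup>2 / 16" using \<rho>1 c B by (auto simp: \<eta>_def)
  define per where "per = (\<lambda>\<tau>. \<forall>t. norm (h (t + \<tau>) - h t) \<le> \<eta>)"
  obtain r2 where r2: "r2 > 0" "\<And>t s. \<bar>t - s\<bar> \<le> r2 \<Longrightarrow> norm (h t - h s) \<le> \<eta> / 2"
    using ucE[of "\<eta> / 2"] \<eta> by auto
  have "\<exists>\<rho>>0. \<forall>\<delta>. 0 < \<delta> \<and> \<delta> \<le> r2 \<longrightarrow> (\<exists>n0. \<forall>n\<ge>n0. real (card {m. m < n \<and> per (\<delta> * real m)}) \<ge> \<rho> * real n)"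
  proof (rule rel_dense_card[OF _ r2(1)])
    show "rel_dense (\<lambda>\<tau>. \<forall>t. norm (h (t + \<tau>) - h t) \<le> \<eta> / 2)" using ap[of "\<eta> / 2"] \<eta> by simp
    fix \<tau> u assume *: "\<forall>t. norm (h (t + \<tau>) - h t) \<le> \<eta> / 2" "\<tau> \<le> u" "u \<le> \<tau> + r2"
    have "norm (h (t + u) - h t) \<le> \<eta>" for t
    proof -
      have "norm (h (t + u) - h (t + \<tau>)) \<le> \<eta> / 2" using * by (intro r2(2)) auto
      moreover have "norm (h (t + u) - h t) \<le> norm (h (t + u) - h (t + \<tau>)) + norm (h (t + \<tau>) - h t)"
        using norm_triangle_ineq[of "h (t + u) - h (t + \<tau>)" "h (t + \<tau>) - h t"] by simp
      ultimately show ?thesis using *(1)[rule_format, of t] by linarith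
    qed
    then show "per u" by (simp add: per_def)
  qed
  then obtain \<rho>2 where \<rho>2: "\<rho>2 > 0"
    "\<And>\<delta>. 0 < \<delta> \<Longrightarrow> \<delta> \<le> r2 \<Longrightarrow> \<exists>n0. \<forall>n\<ge>n0. real (card {m. m < n \<and> per (\<delta> * real m)}) \<ge> \<rho>2 * real n" by blast
  \<comment> \<open>Chosen so that the upper bound \<epsilon> B (2 n) ^ 2 for the correlation sum is
    half of its lower bound. It depends on \<rho>1 and \<rho>2 but not on the grid step, which is
    fixed only afterwards.\<close>
  define \<epsilon> where "\<epsilon> = \<rho>1 * \<rho>2 * c\<^sup>2 / (64 * B)"
  have \<epsilon>: "\<epsilon> > 0" "\<epsilon> * B = \<rho>1 * \<rho>2 * c\<^sup>2 / 64" using \<rho>1 \<rho>2 c B by (auto simp: \<epsilon>_def)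
  obtain r3 where r3: "r3 > 0" "\<And>t s. \<bar>t - s\<bar> \<le> r3 \<Longrightarrow> norm (h t - h s) \<le> \<epsilon> / 4"
    using ucE[of "\<epsilon> / 4"] \<epsilon> by auto
  define \<delta> where "\<delta> = min r1 (min r2 r3)"
  have \<delta>: "0 < \<delta>" "\<delta> \<le> r1" "\<delta> \<le> r2" "\<delta> \<le> r3" using r1 r2 r3 by (auto simp: \<delta>_def)
  obtain n1 where n1: "\<And>n. n \<ge> n1 \<Longrightarrow> real (card {m. m < n \<and> big (\<delta> * real m)}) \<ge> \<rho>1 * real n" using \<rho>1(2) \<delta> by blast
  obtain n2 where n2: "\<And>n. n \<ge> n2 \<Longrightarrow> real (card {m. m < n \<and> per (\<delta> * real m)}) \<ge> \<rho>2 * real n" using \<rho>2(2) \<delta> by blast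
  obtain T1 where T1: "\<And>\<mu> T. \<bar>\<mu>\<bar> \<le> pi / \<delta> \<Longrightarrow> T1 \<le> T \<Longrightarrow> norm (integral {0..T} (\<lambda>t. h t * cis (- \<mu> * t))) \<le> \<epsilon> / 4 * T"
    using mean_zero_uniform[OF cont B mean, of "\<epsilon> / 4" "pi / \<delta>"] \<epsilon> by auto
  define n where "n = max 1 (max n1 (max n2 (nat \<lceil>T1 / \<delta>\<rceil>)))"
  have "nat \<lceil>T1 / \<delta>\<rceil> \<le> n" unfolding n_def by (intro max.coboundedI2 order_refl)
  then have nT: "T1 / \<delta> \<le> real n" by linarith
  have n: "n \<ge> 1" "n \<ge> n1" "n \<ge> n2" by (auto simp: n_def)
  \<comment> \<open>With positions i < n and shifts m < n all translated positions i + m stay inside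
    the block of length 2 n.\<close>
  define M where "M = 2 * n"
  define x where "x = (\<lambda>i. h (\<delta> * real i))"
  define D where "D = {m. m < n \<and> per (\<delta> * real m)}"
  have "T1 \<le> real n * \<delta>" using nT \<delta>(1) by (simp add: field_simps)
  also have "\<dots> \<le> real M * \<delta>" using \<delta>(1) by (simp add: M_def)
  finally have TM: "T1 \<le> real M * \<delta>" .
  have sample: "norm (\<Sum>i<M. x i * cis (- \<theta> * real i)) \<le> \<epsilon> * real M" if "\<bar>\<theta>\<bar> \<le> pi" for \<theta>
  proof -
    have "norm (\<Sum>i<M. h (\<delta> * real i) * cis (- \<theta> * real i)) \<le> 2 * (\<epsilon> / 4 + \<epsilon> / 4) * real M"
    proof (rule dft_sample_bound[OF cont \<delta>(1) _ that])
      show "norm (h t - h s) \<le> \<epsilon> / 4" if "\<bar>t - s\<bar> \<le> \<delta>" for t s using r3(2) that \<delta>(4) by auto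
      show "norm (integral {0..real M * \<delta>} (\<lambda>t. h t * cis (- (\<theta> / \<delta>) * t))) \<le> \<epsilon> / 4 * (real M * \<delta>)"
        using that \<delta>(1) TM by (intro T1) (auto simp: divide_right_mono)
    qed
    then show ?thesis by (simp add: x_def)
  qed
  have dftb: "norm (dft (2 * M) {..<M} x k) \<le> \<epsilon> * real M" for k
  proof -
    \<comment> \<open>Subtracting the nearest integer multiple of 2 pi brings the frequency into
      [- pi, pi], as \<open>dft_sample_bound\<close> requires, and leaves its values at integers
      unchanged.\<close>
    define j where "j = \<lfloor>real k / real (2 * M) + 1 / 2\<rfloor>"
    define \<theta> where "\<theta> = 2 * pi * (real k / real (2 * M)) - 2 * pi * of_int j"
    have "\<bar>real k / real (2 * M) - of_int j\<bar> \<le> 1 / 2" unfolding j_def by linarith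
    then have "\<bar>2 * pi * (real k / real (2 * M) - of_int j)\<bar> \<le> 2 * pi * (1 / 2)"
      unfolding abs_mult by (intro mult_mono) auto
    then have \<theta>: "\<bar>\<theta>\<bar> \<le> pi" by (simp add: \<theta>_def right_diff_distrib)
    have "cis (- (2 * pi * real k / real (2 * M)) * real i) = cis (- \<theta> * real i)" for i
    proof -
      have "cis (- \<theta> * real i) = cis (- (2 * pi * real k / real (2 * M)) * real i) * cis (2 * pi * of_int (j * int i))"
        unfolding cis_mult by (rule arg_cong[of _ _ cis]) (simp add: \<theta>_def algebra_simps)
      then show ?thesis by (simp add: cis_multiple_2pi del: of_int_mult)
    qed
    then have "dft (2 * M) {..<M} x k = (\<Sum>i<M. x i * cis (- \<theta> * real i))"
      unfolding dft_def by (intro sum.cong refl arg_cong2[where f = times]) auto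
    then show ?thesis using sample[OF \<theta>] by simp
  qed
  let ?S = "\<Sum>m\<in>D. \<Sum>i | i < M \<and> i + m < M. x i * cnj (x (i + m))"
  have "norm ?S \<le> \<epsilon> * B * (real M)\<^sup>2"
    by (rule autocorrelation_bound[OF _ _ _ dftb]) (use n B in \<open>auto simp: M_def D_def x_def\<close>)
  then have up: "Re ?S \<le> \<rho>1 * \<rho>2 * c\<^sup>2 * (real n)\<^sup>2 / 16"
    using complex_Re_le_cmod[of ?S] \<epsilon>(2) by (simp add: M_def power_mult_distrib)
  have low: "\<rho>1 * c\<^sup>2 * real n / 8 \<le> Re (\<Sum>i | i < M \<and> i + m < M. x i * cnj (x (i + m)))" if m: "m \<in> D" for m
  proof -
    have per: "norm (x (i + m) - x i) \<le> \<eta>" for i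
    proof -
      have "per (\<delta> * real m)" "m < n" using m by (auto simp: D_def)
      then show ?thesis unfolding per_def x_def by (metis distrib_left of_nat_add)
    qed
    have tm: "(norm (x i))\<^sup>2 - \<eta> * B \<le> Re (x i * cnj (x (i + m)))" for i
    proof -
      have "x i * cnj (x (i + m)) = x i * cnj (x i) + x i * cnj (x (i + m) - x i)" by (simp add: algebra_simps)
      then have "Re (x i * cnj (x (i + m))) = (norm (x i))\<^sup>2 + Re (x i * cnj (x (i + m) - x i))"
        by (simp add: complex_norm_square[symmetric] del: complex_cnj_diff of_real_power)
      moreover have "norm (x i * cnj (x (i + m) - x i)) \<le> B * \<eta>"
        unfolding norm_mult complex_mod_cnj using per[of i] B by (intro mult_mono) (auto simp: x_def)
      ultimately show ?thesis
        using abs_Re_le_cmod[of "x i * cnj (x (i + m) - x i)"] by (simp add: abs_le_iff mult.commute)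
    qed
    have "real (card {i. i < n \<and> big (\<delta> * real i)}) * (c / 2)\<^sup>2 = (\<Sum>i | i < n \<and> big (\<delta> * real i). (c / 2)\<^sup>2)" by simp
    also have "\<dots> \<le> (\<Sum>i | i < n \<and> big (\<delta> * real i). (norm (x i))\<^sup>2)"
      using c by (intro sum_mono power_mono) (auto simp: big_def x_def)
    also have "\<dots> \<le> (\<Sum>i | i < M \<and> i + m < M. (norm (x i))\<^sup>2)"
      using m by (intro sum_mono2) (auto simp: M_def D_def)
    finally have 1: "real (card {i. i < n \<and> big (\<delta> * real i)}) * (c / 2)\<^sup>2 \<le> (\<Sum>i | i < M \<and> i + m < M. (norm (x i))\<^sup>2)" .
    have "\<rho>1 * real n * (c / 2)\<^sup>2 \<le> real (card {i. i < n \<and> big (\<delta> * real i)}) * (c / 2)\<^sup>2"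
      by (intro mult_right_mono n1 n) auto
    with 1 have 2: "\<rho>1 * real n * c\<^sup>2 / 4 \<le> (\<Sum>i | i < M \<and> i + m < M. (norm (x i))\<^sup>2)"
      by (simp add: power_divide)
    have "real (card {i. i < M \<and> i + m < M}) \<le> real (card {..<M})"
      by (intro of_nat_mono card_mono) auto
    then have "real (card {i. i < M \<and> i + m < M}) * (\<eta> * B) \<le> real M * (\<eta> * B)"
      using \<eta>(1) B(1) by (intro mult_right_mono) auto
    then have 3: "real (card {i. i < M \<and> i + m < M}) * (\<eta> * B) \<le> \<rho>1 * c\<^sup>2 * real n / 8"
      unfolding \<eta>(2) by (simp add: M_def mult_ac)
    have "(\<Sum>i | i < M \<and> i + m < M. (norm (x i))\<^sup>2) - real (card {i. i < M \<and> i + m < M}) * (\<eta> * B)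
       = (\<Sum>i | i < M \<and> i + m < M. (norm (x i))\<^sup>2 - \<eta> * B)" by (simp add: sum_subtractf)
    also have "\<dots> \<le> (\<Sum>i | i < M \<and> i + m < M. Re (x i * cnj (x (i + m))))" by (intro sum_mono tm)
    also have "\<dots> = Re (\<Sum>i | i < M \<and> i + m < M. x i * cnj (x (i + m)))" by (simp only: Re_sum)
    finally show ?thesis using 2 3 by (simp add: mult_ac)
  qed
  have "(\<rho>2 * real n) * (\<rho>1 * c\<^sup>2 * real n / 8) \<le> real (card D) * (\<rho>1 * c\<^sup>2 * real n / 8)"
    unfolding D_def using \<rho>1 by (intro mult_right_mono n2 n) auto
  also have "\<dots> = (\<Sum>m\<in>D. \<rho>1 * c\<^sup>2 * real n / 8)" by simp
  also have "\<dots> \<le> (\<Sum>m\<in>D. Re (\<Sum>i | i < M \<and> i + m < M. x i * cnj (x (i + m))))" by (intro sum_mono low)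
  also have "\<dots> = Re ?S" by (simp only: Re_sum)
  finally have "\<rho>1 * \<rho>2 * c\<^sup>2 * (real n)\<^sup>2 / 8 \<le> \<rho>1 * \<rho>2 * c\<^sup>2 * (real n)\<^sup>2 / 16"
    using up by (simp add: power2_eq_square mult_ac)
  moreover have "\<rho>1 * \<rho>2 * c\<^sup>2 * (real n)\<^sup>2 > 0" using \<rho>1(1) \<rho>2(1) c n(1) by simp
  ultimately show False by linarith
qed

section \<open>Convolution with the kernel\<close>

text \<open>Each half line is treated with \<open>weighted_integral_bound\<close> for M = pi
  \<epsilon> and contributes at most 2 pi \<epsilon>. A further factor 2 comes from comparing the
  weight 1 / \<open>(1 + t\<^sup>2)\<close> with 1 /
  \<open>(1 + \<bar>t\<bar>)\<^sup>2\<close>.\<close>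

lemma windows_weighted_bound:
  fixes G :: "real \<Rightarrow> real"
  assumes Gm [measurable]: "G \<in> borel_measurable borel" and G: "\<And>t. 0 \<le> G t" "\<And>t. G t \<le> B" and e: "\<epsilon> \<ge> 0"
    and int: "\<And>a b. a \<le> b \<Longrightarrow> integral {a..b} G \<le> \<epsilon> * (b - a + pi)"
  shows "integrable lborel (\<lambda>t. G t / (1 + t\<^sup>2))" "(LBINT t. G t / (1 + t\<^sup>2)) \<le> 8 * pi * \<epsilon>"
proof -
  have half: "integrable lborel (\<lambda>t. indicator {0..} t * (F t / (1 + t)\<^sup>2)) \<and>
      (LBINT t. indicator {0..} t * (F t / (1 + t)\<^sup>2)) \<le> 2 * (pi * \<epsilon>)"
    if [measurable]: "F \<in> borel_measurable borel" and F: "\<And>t. 0 \<le> F t" "\<And>t. F t \<le> B"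
      and Fi: "\<And>X. 0 \<le> X \<Longrightarrow> integral {0..X} F \<le> \<epsilon> * (X + pi)" for F :: "real \<Rightarrow> real"
  proof -
    have 1: "F integrable_on {0..X}" for X by (rule bounded_borel_integrable_on[where B = B]) (use F in auto)
    have 2: "integral {0..X} F \<le> pi * \<epsilon> * (X + 1)" if "0 \<le> X" for X
    proof -
      have "X \<le> pi * X" using that pi_ge_two by (simp add: mult_le_cancel_right1)
      then have "\<epsilon> * (X + pi) \<le> \<epsilon> * (pi * (X + 1))" using e by (intro mult_left_mono) (auto simp: algebra_simps)
      then show ?thesis using Fi[OF that] by (simp add: mult_ac)
    qed
    show ?thesis using weighted_integral_bound[OF _ F(1) 1 2] by auto
  qed
  define P where "P = (\<lambda>t. indicator {0..} t * (G t / (1 + t)\<^sup>2))"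
  define Q where "Q = (\<lambda>t. indicator {0..} t * (G (- t) / (1 + t)\<^sup>2))"
  have P: "integrable lborel P" "integral\<^sup>L lborel P \<le> 2 * (pi * \<epsilon>)"
    using half[of G] G int[of 0] unfolding P_def by auto
  have "integral {0..X} (\<lambda>t. G (- t)) \<le> \<epsilon> * (X + pi)" if "0 \<le> X" for X
  proof -
    have "integral {0..X} (\<lambda>t. G (- t)) = integral {- X..0} G"
      using Henstock_Kurzweil_Integration.integral_reflect_real[of 0 "- X" G] by simp
    then show ?thesis using int[of "- X" 0] that by simp
  qed
  then have Q: "integrable lborel Q" "integral\<^sup>L lborel Q \<le> 2 * (pi * \<epsilon>)"
    using half[of "\<lambda>t. G (- t)"] G unfolding Q_def by auto
  have Q': "integrable lborel (\<lambda>t. Q (0 + (-1) * t))" "integral\<^sup>L lborel (\<lambda>t. Q (0 + (-1) * t)) = integral\<^sup>L lborel Q"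
    using lborel_integrable_real_affine[OF Q(1), of "-1" 0] lborel_integral_real_affine[of "-1" Q 0] by auto
  have le: "G t / (1 + t\<^sup>2) \<le> 2 * (P t + Q (0 + (-1) * t))" for t
  proof -
    have *: "G t / (1 + t\<^sup>2) \<le> 2 * (G t / (1 + \<bar>t\<bar>)\<^sup>2)"
    proof -
      have "(1 + \<bar>t\<bar>)\<^sup>2 \<le> 2 * (1 + t\<^sup>2)"
        using sum_squares_ge_zero[of "1 - \<bar>t\<bar>" 0] by (simp add: power2_eq_square algebra_simps)
      moreover have "1 + t\<^sup>2 > 0" "(1 + \<bar>t\<bar>)\<^sup>2 > 0" by (auto simp: add_pos_nonneg)
      moreover have "1 / x \<le> 2 / y" if "y \<le> 2 * x" "x > 0" "y > 0" for x y :: real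
        using that by (simp add: divide_simps)
      ultimately have "1 / (1 + t\<^sup>2) \<le> 2 / (1 + \<bar>t\<bar>)\<^sup>2" by blast
      from mult_left_mono[OF this G(1)[of t]] show ?thesis by (simp add: mult.commute)
    qed
    have nn: "P t \<ge> 0" "Q (- t) \<ge> 0" unfolding P_def Q_def using G by auto
    show ?thesis
    proof (cases "0 \<le> t")
      case True
      then have "P t = G t / (1 + \<bar>t\<bar>)\<^sup>2" by (simp add: P_def)
      then show ?thesis using * nn by simp
    next
      case False
      then have "Q (- t) = G t / (1 + \<bar>t\<bar>)\<^sup>2" by (simp add: Q_def)
      then show ?thesis using * nn by simp
    qed
  qed
  have sumint: "integrable lborel (\<lambda>t. 2 * (P t + Q (0 + (-1) * t)))" using P Q' by (intro integrable_mult_right Bochner_Integration.integrable_add)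
  show int1: "integrable lborel (\<lambda>t. G t / (1 + t\<^sup>2))"
  proof (rule Bochner_Integration.integrable_bound[OF sumint])
    show "AE t in lborel. norm (G t / (1 + t\<^sup>2)) \<le> norm (2 * (P t + Q (0 + (-1) * t)))"
    proof (intro AE_I2)
      fix t
      have "norm (G t / (1 + t\<^sup>2)) = G t / (1 + t\<^sup>2)" using G(1)[of t] by simp
      also have "\<dots> \<le> norm (2 * (P t + Q (0 + (-1) * t)))" using le[of t] by (rule order_trans) simp
      finally show "norm (G t / (1 + t\<^sup>2)) \<le> norm (2 * (P t + Q (0 + (-1) * t)))" .
    qed
  qed simp
  have "(LBINT t. G t / (1 + t\<^sup>2)) \<le> (LBINT t. 2 * (P t + Q (0 + (-1) * t)))"
    by (rule integral_mono[OF int1 sumint le])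
  also have "\<dots> = 2 * (integral\<^sup>L lborel P + integral\<^sup>L lborel Q)"
    by (subst integral_mult_right_zero, subst Bochner_Integration.integral_add[OF P(1) Q'(1)], simp only: Q'(2))
  also have "\<dots> \<le> 8 * pi * \<epsilon>" using P(2) Q(2) by simp
  finally show "(LBINT t. G t / (1 + t\<^sup>2)) \<le> 8 * pi * \<epsilon>" .
qed

text \<open>Since the kernel is even, this correlation is the convolution of g with it.\<close>

definition vp_mean :: "real \<Rightarrow> real \<Rightarrow> (real \<Rightarrow> complex) \<Rightarrow> real \<Rightarrow> complex" where
  "vp_mean a b g s = (LBINT t. of_real (vp_kernel a b t) * g (s + t))"

lemma vp_mean_integrable:
  fixes g :: "real \<Rightarrow> complex"
  assumes ab: "0 \<le> a" "a < b" and g [measurable]: "g \<in> borel_measurable borel" and B: "\<And>t. norm (g t) \<le> B"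
  shows "integrable lborel (\<lambda>t. of_real (vp_kernel a b t) * g (s + t))"
proof (rule Bochner_Integration.integrable_bound[OF integrable_mult_right[OF integrable_vp_kernel[OF ab], of B]])
  have B0: "B \<ge> 0" using order_trans[OF norm_ge_zero B[of 0]] .
  show "AE t in lborel. norm (complex_of_real (vp_kernel a b t) * g (s + t)) \<le> norm (B * vp_kernel a b t)"
    using B0 by (auto simp: norm_mult abs_mult mult.commute[of B] intro!: mult_left_mono B)
qed simp

lemma vp_mean_bound:
  fixes g :: "real \<Rightarrow> complex"
  assumes ab: "0 \<le> a" "a < b" and g [measurable]: "g \<in> borel_measurable borel" and B: "\<And>t. norm (g t) \<le> B"
  shows "norm (vp_mean a b g s) \<le> B * (LBINT t. \<bar>vp_kernel a b t\<bar>)"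
proof -
  have "norm (vp_mean a b g s) \<le> (LBINT t. norm (of_real (vp_kernel a b t) * g (s + t)))"
    unfolding vp_mean_def by (rule integral_norm_bound)
  also have "\<dots> \<le> (LBINT t. B * \<bar>vp_kernel a b t\<bar>)"
  proof (rule integral_mono)
    show "integrable lborel (\<lambda>t. norm (of_real (vp_kernel a b t) * g (s + t)))"
      by (intro integrable_norm vp_mean_integrable[OF ab g B])
    show "integrable lborel (\<lambda>t. B * \<bar>vp_kernel a b t\<bar>)"
      by (intro integrable_mult_right integrable_abs integrable_vp_kernel ab)
    show "norm (of_real (vp_kernel a b t) * g (s + t)) \<le> B * \<bar>vp_kernel a b t\<bar>" for t
      by (simp add: norm_mult mult.commute[of B] mult_left_mono B)
  qed
  finally show ?thesis by simp
qed

lemma vp_kernel_isCont: "t \<noteq> 0 \<Longrightarrow> a < b \<Longrightarrow> isCont (vp_kernel a b) t"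
  unfolding vp_kernel_def[abs_def] by (intro continuous_intros) auto

text \<open>Dominated convergence along sequences. The point v = 0 is left out because there the
  kernel has the value 0 instead of its limit.\<close>

lemma vp_kernel_translation_L1:
  assumes ab: "0 \<le> a" "a < b"
  shows "((\<lambda>u. LBINT v. \<bar>vp_kernel a b (v + u) - vp_kernel a b v\<bar>) \<longlongrightarrow> 0) (at 0)"
  unfolding tendsto_at_iff_sequentially
proof (intro allI impI)
  fix X :: "nat \<Rightarrow> real" assume X: "X \<longlonglongrightarrow> 0"
  obtain C where C: "C > 0" "\<And>t. \<bar>vp_kernel a b t\<bar> \<le> C / (1 + t\<^sup>2)" using vp_kernel_bound[OF ab] by blast
  obtain R where R: "R > 0" "\<And>n. \<bar>X n\<bar> \<le> R"
    using convergent_imp_Bseq[OF convergentI[OF X]] by (auto simp: Bseq_def)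
  have "(\<lambda>n. LBINT v. \<bar>vp_kernel a b (v + X n) - vp_kernel a b v\<bar>) \<longlonglongrightarrow> (LBINT v::real. 0)"
  proof (rule integral_dominated_convergence[where w = "\<lambda>v. C * (2 * (1 + R\<^sup>2) + 1) * (1 / (1 + v\<^sup>2))"])
    show "integrable lborel (\<lambda>v. C * (2 * (1 + R\<^sup>2) + 1) * (1 / (1 + v\<^sup>2)))"
      by (intro integrable_mult_right integrable_inverse_one_plus_square)
    show "AE v in lborel. (\<lambda>n. \<bar>vp_kernel a b (v + X n) - vp_kernel a b v\<bar>) \<longlonglongrightarrow> 0"
      using AE_lborel_singleton[of 0]
    proof eventually_elim
      case (elim v)
      have "(\<lambda>n. v + X n) \<longlonglongrightarrow> v + 0" by (intro tendsto_intros X)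
      then have "(\<lambda>n. vp_kernel a b (v + X n)) \<longlonglongrightarrow> vp_kernel a b v"
        using isCont_tendsto_compose[OF vp_kernel_isCont[OF elim ab(2)]] by simp
      then have "(\<lambda>n. \<bar>vp_kernel a b (v + X n) - vp_kernel a b v\<bar>) \<longlonglongrightarrow> \<bar>vp_kernel a b v - vp_kernel a b v\<bar>"
        by (intro tendsto_intros)
      then show ?case by simp
    qed
    fix n
    show "AE v in lborel. norm \<bar>vp_kernel a b (v + X n) - vp_kernel a b v\<bar> \<le> C * (2 * (1 + R\<^sup>2) + 1) * (1 / (1 + v\<^sup>2))"
    proof (intro AE_I2)
      fix v
      define u where "u = X n"
      have u2: "u\<^sup>2 \<le> R\<^sup>2" using R(2)[of n] R(1) by (simp add: u_def abs_le_square_iff[symmetric])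
      \<comment> \<open>A translation by at most R changes the weight 1 /
        \<open>(1 + v\<^sup>2)\<close> by a bounded factor, which gives one dominating function for
        the whole sequence.\<close>
      have "v\<^sup>2 \<le> 2 * (v + u)\<^sup>2 + 2 * u\<^sup>2"
        using sum_squares_ge_zero[of "v + 2 * u" 0] by (simp add: power2_eq_square algebra_simps)
      then have "1 + v\<^sup>2 \<le> 2 * (1 + R\<^sup>2) + 2 * (v + u)\<^sup>2" using u2 by simp
      also have "\<dots> \<le> 2 * (1 + R\<^sup>2) * (1 + (v + u)\<^sup>2)" by (simp add: algebra_simps)
      finally have le: "1 + v\<^sup>2 \<le> 2 * (1 + R\<^sup>2) * (1 + (v + u)\<^sup>2)" .
      have "1 / y \<le> k * (1 / x)" if "x \<le> k * y" "0 < x" "0 < y" for x y k :: real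
        using that by (simp add: field_simps)
      from this[OF le] have "1 / (1 + (v + u)\<^sup>2) \<le> 2 * (1 + R\<^sup>2) * (1 / (1 + v\<^sup>2))"
        by (simp only: add_pos_nonneg zero_less_one zero_le_power2)
      then have "C * (1 / (1 + (v + u)\<^sup>2)) \<le> C * (2 * (1 + R\<^sup>2) * (1 / (1 + v\<^sup>2)))"
        using C(1) by (intro mult_left_mono) auto
      then have "C / (1 + (v + u)\<^sup>2) \<le> C * (2 * (1 + R\<^sup>2) * (1 / (1 + v\<^sup>2)))" by simp
      moreover have "\<bar>vp_kernel a b (v + u) - vp_kernel a b v\<bar> \<le> C / (1 + (v + u)\<^sup>2) + C / (1 + v\<^sup>2)"
        using C(2)[of "v + u"] C(2)[of v] by linarith
      moreover have "C * (2 * (1 + R\<^sup>2) + 1) * (1 / (1 + v\<^sup>2)) = C * (2 * (1 + R\<^sup>2) * (1 / (1 + v\<^sup>2))) + C / (1 + v\<^sup>2)"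
      proof -
        have "C * (2 * (1 + R\<^sup>2) + 1) * k = C * (2 * (1 + R\<^sup>2) * k) + C * k" for k by (simp add: algebra_simps)
        from this[of "1 / (1 + v\<^sup>2)"] show ?thesis by simp
      qed
      ultimately show "norm \<bar>vp_kernel a b (v + X n) - vp_kernel a b v\<bar> \<le> C * (2 * (1 + R\<^sup>2) + 1) * (1 / (1 + v\<^sup>2))"
        unfolding u_def real_norm_def abs_abs by linarith
    qed
  qed auto
  then show "((\<lambda>u. LBINT v. \<bar>vp_kernel a b (v + u) - vp_kernel a b v\<bar>) \<circ> X) \<longlonglongrightarrow> 0" by (simp add: o_def)
qed

text \<open>The function g has no continuity to offer, so the translation is moved to the kernel,
  where it is small in L1.\<close>

lemma vp_mean_uniformly_continuous:
  fixes g :: "real \<Rightarrow> complex"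
  assumes ab: "0 \<le> a" "a < b" and g [measurable]: "g \<in> borel_measurable borel" and B: "B > 0" "\<And>t. norm (g t) \<le> B"
  shows "uniformly_continuous_on UNIV (vp_mean a b g)"
proof -
  define D where "D = (\<lambda>u. LBINT v. \<bar>vp_kernel a b (v + u) - vp_kernel a b v\<bar>)"
  have sh: "vp_mean a b g s = (LBINT v. of_real (vp_kernel a b (v - s)) * g v)" for s
    unfolding vp_mean_def
    using lborel_integral_real_affine[of 1 "\<lambda>v. of_real (vp_kernel a b (v - s)) * g v" s] by simp
  have int: "integrable lborel (\<lambda>v. of_real (vp_kernel a b (v - s)) * g v)" for s
    using lborel_integrable_real_affine[OF vp_mean_integrable[OF ab g B(2), of s], of 1 "- s"] by simp
  have kint: "integrable lborel (\<lambda>v. vp_kernel a b (v + c))" for c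
    using lborel_integrable_real_affine[OF integrable_vp_kernel[OF ab], of 1 c] by (simp add: add.commute)
  have diff: "norm (vp_mean a b g s' - vp_mean a b g s) \<le> B * D (s - s')" for s s'
  proof -
    have eq: "vp_mean a b g s' - vp_mean a b g s
       = (LBINT v. of_real (vp_kernel a b (v - s')) * g v - of_real (vp_kernel a b (v - s)) * g v)"
      unfolding sh by (rule Bochner_Integration.integral_diff[symmetric, OF int int])
    have "norm (vp_mean a b g s' - vp_mean a b g s)
        \<le> (LBINT v. norm (of_real (vp_kernel a b (v - s')) * g v - of_real (vp_kernel a b (v - s)) * g v))"
      unfolding eq by (rule integral_norm_bound)
    also have "\<dots> \<le> (LBINT v. B * \<bar>vp_kernel a b (v + - s') - vp_kernel a b (v + - s)\<bar>)"
    proof (rule integral_mono)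
      show "integrable lborel (\<lambda>v. norm (of_real (vp_kernel a b (v - s')) * g v - of_real (vp_kernel a b (v - s)) * g v))"
        by (rule integrable_norm[OF Bochner_Integration.integrable_diff[OF int int]])
      show "integrable lborel (\<lambda>v. B * \<bar>vp_kernel a b (v + - s') - vp_kernel a b (v + - s)\<bar>)"
        by (rule integrable_mult_right[OF integrable_abs[OF Bochner_Integration.integrable_diff[OF kint kint]]])
      fix v
      have "norm (of_real (vp_kernel a b (v - s')) * g v - of_real (vp_kernel a b (v - s)) * g v)
         = \<bar>vp_kernel a b (v - s') - vp_kernel a b (v - s)\<bar> * norm (g v)"
        by (simp only: left_diff_distrib[symmetric] norm_mult of_real_diff[symmetric] norm_of_real)
      also have "\<dots> \<le> \<bar>vp_kernel a b (v - s') - vp_kernel a b (v - s)\<bar> * B" by (intro mult_left_mono B) auto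
      finally show "norm (of_real (vp_kernel a b (v - s')) * g v - of_real (vp_kernel a b (v - s)) * g v)
         \<le> B * \<bar>vp_kernel a b (v + - s') - vp_kernel a b (v + - s)\<bar>" by (simp add: mult.commute)
    qed
    also have "\<dots> = B * (LBINT v. \<bar>vp_kernel a b (v + - s') - vp_kernel a b (v + - s)\<bar>)" by simp
    also have "(LBINT v. \<bar>vp_kernel a b (v + - s') - vp_kernel a b (v + - s)\<bar>) = D (s - s')"
    proof -
      have "(LBINT v. \<bar>vp_kernel a b (v + - s') - vp_kernel a b (v + - s)\<bar>)
          = \<bar>1\<bar> *\<^sub>R (LBINT v. \<bar>vp_kernel a b ((s + 1 * v) + - s') - vp_kernel a b ((s + 1 * v) + - s)\<bar>)"
        by (rule lborel_integral_real_affine) simp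
      also have "\<dots> = D (s - s')" unfolding D_def by (simp add: algebra_simps)
      finally show ?thesis .
    qed
    finally show ?thesis .
  qed
  show ?thesis unfolding uniformly_continuous_on_def
  proof (intro allI impI)
    fix e :: real assume e: "e > 0"
    have "eventually (\<lambda>u. D u < e / B) (at 0)"
      using order_tendstoD(2)[OF vp_kernel_translation_L1[OF ab], of "e / B"] e B(1) unfolding D_def by simp
    then obtain d where d: "d > 0" "\<And>u. u \<noteq> 0 \<Longrightarrow> dist u 0 < d \<Longrightarrow> D u < e / B"
      unfolding eventually_at by auto
    have "dist (vp_mean a b g s') (vp_mean a b g s) < e" if "dist s' s < d" for s s'
    proof (cases "s = s'")
      case False
      then have "D (s - s') < e / B" using that by (intro d(2)) (auto simp: dist_real_def)
      then have "B * D (s - s') < e" using B(1) by (simp add: field_simps)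
      then show ?thesis using diff[of s' s] by (simp add: dist_norm)
    qed (use e in simp)
    then show "\<exists>d>0. \<forall>x\<in>UNIV. \<forall>x'\<in>UNIV. dist x' x < d \<longrightarrow> dist (vp_mean a b g x') (vp_mean a b g x) < e"
      using d(1) by blast
  qed
qed

text \<open>Convolution turns almost periods in the Stepanov sense into uniform ones: the kernel is
  below C / \<open>(1 + t\<^sup>2)\<close>, and \<open>windows_weighted_bound\<close> converts
  window means at most e into a bound 8 pi C e at every point.\<close>

lemma vp_mean_almost_periodic:
  assumes ab: "0 \<le> a" "a < b" and g: "g \<in> stepanov_ap_borel" and \<epsilon>: "\<epsilon> > 0"
  shows "rel_dense (\<lambda>\<tau>. \<forall>s. norm (vp_mean a b g (s + \<tau>) - vp_mean a b g s) \<le> \<epsilon>)"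
proof -
  obtain B where B: "B > 0" "\<And>t. norm (g t) \<le> B" and gm [measurable]: "g \<in> borel_measurable borel"
    and rd: "\<And>\<epsilon>. \<epsilon> > 0 \<Longrightarrow> rel_dense (stepanov_translation_number g \<epsilon>)"
    using stepanov_ap_borelE[OF g] by metis
  obtain C where C: "C > 0" "\<And>t. \<bar>vp_kernel a b t\<bar> \<le> C / (1 + t\<^sup>2)" using vp_kernel_bound[OF ab] by blast
  define e where "e = \<epsilon> / (8 * pi * C)"
  have e: "e > 0" "C * (8 * pi * e) = \<epsilon>" using \<epsilon> C(1) by (auto simp: e_def)
  have "norm (vp_mean a b g (s + \<tau>) - vp_mean a b g s) \<le> \<epsilon>" if \<tau>: "stepanov_translation_number g e \<tau>" for \<tau> s
  proof -
    define G where "G = (\<lambda>t. norm (g (t + (s + \<tau>)) - g (t + s)))"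
    have Gm [measurable]: "G \<in> borel_measurable borel" unfolding G_def by measurable
    have Gb: "0 \<le> G t" for t by (simp add: G_def)
    have Gb': "G t \<le> B + B" for t
      unfolding G_def by (intro order_trans[OF norm_triangle_ineq4 add_mono] B)
    have Gi: "integral {p..q} G \<le> e * (q - p + pi)" if "p \<le> q" for p q
    proof -
      have "integral {p..q} G = integral {p + s..q + s} (\<lambda>t. norm (g (t + \<tau>) - g t))"
        using integral_translate[of p q "\<lambda>t. norm (g (t + \<tau>) - g t)" s] by (simp add: G_def algebra_simps)
      also have "\<dots> \<le> e * (q + s - (p + s) + pi)"
        by (rule translation_number_integral_bound[OF gm B(2) \<tau>]) (use that in simp)
      finally show ?thesis by simp
    qed
    note W = windows_weighted_bound[OF Gm Gb Gb' less_imp_le[OF e(1)] Gi]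
    have eq: "vp_mean a b g (s + \<tau>) - vp_mean a b g s
      = (LBINT t. of_real (vp_kernel a b t) * g (s + \<tau> + t) - of_real (vp_kernel a b t) * g (s + t))"
      unfolding vp_mean_def
      by (rule Bochner_Integration.integral_diff[symmetric, OF vp_mean_integrable vp_mean_integrable]) (use ab B in auto)
    have "norm (vp_mean a b g (s + \<tau>) - vp_mean a b g s)
        \<le> (LBINT t. norm (of_real (vp_kernel a b t) * g (s + \<tau> + t) - of_real (vp_kernel a b t) * g (s + t)))"
      unfolding eq by (rule integral_norm_bound)
    also have "\<dots> \<le> (LBINT t. C * (G t / (1 + t\<^sup>2)))"
    proof (rule integral_mono)
      show "integrable lborel (\<lambda>t. norm (of_real (vp_kernel a b t) * g (s + \<tau> + t) - of_real (vp_kernel a b t) * g (s + t)))"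
        by (rule integrable_norm[OF Bochner_Integration.integrable_diff[OF vp_mean_integrable[OF ab gm B(2)] vp_mean_integrable[OF ab gm B(2)]]])
      show "integrable lborel (\<lambda>t. C * (G t / (1 + t\<^sup>2)))" by (intro integrable_mult_right W)
      fix t
      have "norm (of_real (vp_kernel a b t) * g (s + \<tau> + t) - of_real (vp_kernel a b t) * g (s + t)) = \<bar>vp_kernel a b t\<bar> * G t"
        by (simp only: right_diff_distrib[symmetric] norm_mult norm_of_real G_def add_ac)
      also have "\<dots> \<le> C / (1 + t\<^sup>2) * G t" by (intro mult_right_mono C Gb)
      finally show "norm (of_real (vp_kernel a b t) * g (s + \<tau> + t) - of_real (vp_kernel a b t) * g (s + t)) \<le> C * (G t / (1 + t\<^sup>2))"
        by simp
    qed
    also have "\<dots> = C * (LBINT t. G t / (1 + t\<^sup>2))" by (rule integral_mult_right_zero)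
    also have "\<dots> \<le> C * (8 * pi * e)" using W(2) C(1) by (intro mult_left_mono) auto
    finally show ?thesis using e(2) by simp
  qed
  then show ?thesis using rd[OF e(1)] unfolding rel_dense_def by meson
qed

lemma integral_eq_lborel:
  fixes F :: "real \<Rightarrow> complex"
  assumes F [measurable]: "F \<in> borel_measurable borel" and B: "\<And>t. norm (F t) \<le> B"
  shows "integral {a..b} F = (LBINT t. indicator {a..b} t *\<^sub>R F t)"
proof -
  have "integrable lborel (\<lambda>t. indicator {a..b} t *\<^sub>R F t)"
    by (rule integrableI_bounded_set_indicator[where B = B]) (use B in \<open>auto simp: emeasure_lborel_Icc_eq\<close>)
  then have "set_integrable lborel {a..b} F" by (simp add: set_integrable_def)
  from set_borel_integral_eq_integral(2)[OF this] show ?thesis by (simp add: set_lebesgue_integral_def)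
qed

text \<open>By Fubini a window integral of the convolution is the integral, with weight
  \<open>vp_kernel a b t * cis (\<mu> * t)\<close>, of the window integrals of G shifted by t. All
  of these are close to T A simultaneously because \<open>has_mean\<close> is uniform in the
  starting point, and the weight itself has integral \<open>trapezoid a b \<mu>\<close>.\<close>

lemma vp_mean_has_mean:
  assumes ab: "0 \<le> a" "a < b" and g: "g \<in> borel_measurable borel" and B: "B > 0" "\<And>t. norm (g t) \<le> B"
    and mean: "has_mean (\<lambda>t. g t * cis (- \<mu> * t)) A"
  shows "has_mean (\<lambda>s. vp_mean a b g s * cis (- \<mu> * s)) (of_real (trapezoid a b \<mu>) * A)"
proof -
  define k where "k = vp_kernel a b"
  have km [measurable]: "k \<in> borel_measurable borel" by (simp add: k_def)
  note [measurable] = g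
  have kint: "integrable lborel k" using integrable_vp_kernel[OF ab] by (simp add: k_def)
  define N where "N = (LBINT t. \<bar>k t\<bar>)"
  have N0: "N \<ge> 0" by (simp add: N_def)
  define G where "G = (\<lambda>v. g v * cis (- \<mu> * v))"
  have Gm [measurable]: "G \<in> borel_measurable borel" unfolding G_def by measurable
  have GB: "norm (G v) \<le> B" for v using B by (simp add: G_def norm_mult)
  have hm: "vp_mean a b g \<in> borel_measurable borel"
    by (intro borel_measurable_continuous_onI uniformly_continuous_imp_continuous
        vp_mean_uniformly_continuous[OF ab g B])
  have hcm [measurable]: "(\<lambda>s. vp_mean a b g s * cis (- \<mu> * s)) \<in> borel_measurable borel"
    using hm by measurable
  have key: "integral {s0..s0 + T} (\<lambda>s. vp_mean a b g s * cis (- \<mu> * s)) - of_real T * (of_real (trapezoid a b \<mu>) * A)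
      = (LBINT t. of_real (k t) * cis (\<mu> * t) * (integral {s0 + t..s0 + t + T} G - of_real T * A))"
    and kb: "integrable lborel (\<lambda>t. of_real (k t) * cis (\<mu> * t) * (integral {s0 + t..s0 + t + T} G - of_real T * A))"
    if T: "T \<ge> 0" for s0 T
  proof -
    define I where "I = (indicator {s0..s0 + T} :: real \<Rightarrow> real)"
    have Im [measurable]: "I \<in> borel_measurable borel" by (simp add: I_def)
    define f where "f = (\<lambda>s t. I s *\<^sub>R (of_real (k t) * g (s + t) * cis (- \<mu> * s)))"
    have fm [measurable]: "case_prod f \<in> borel_measurable (lborel \<Otimes>\<^sub>M lborel)"
      unfolding f_def by measurable
    have fb: "norm (f s t) \<le> I s * (B * \<bar>k t\<bar>)" for s t
      unfolding f_def using B(2)[of "s + t"]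
      by (simp add: norm_mult I_def indicator_def mult.commute[of B] mult_left_mono)
    have Ii: "integrable lborel I" unfolding I_def by (rule integrable_real_indicator) (auto simp: emeasure_lborel_Icc_eq)
    have kai: "integrable lborel (\<lambda>t. B * \<bar>k t\<bar>)" by (intro integrable_mult_right integrable_abs kint)
    have fi: "integrable lborel (f s)" for s
    proof (rule Bochner_Integration.integrable_bound[OF integrable_mult_right[OF kai, of "I s"]])
      show "AE t in lborel. norm (f s t) \<le> norm (I s * (B * \<bar>k t\<bar>))"
        by (intro AE_I2 order_trans[OF fb]) simp
      show "f s \<in> borel_measurable lborel" unfolding f_def by measurable
    qed
    have pint: "integrable (lborel \<Otimes>\<^sub>M lborel) (case_prod f)"
    proof (rule lborel_pair.Fubini_integrable[OF fm])
      show "integrable lborel (\<lambda>s. LBINT t. norm (case (s, t) of (s, t) \<Rightarrow> f s t))"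
      proof (rule Bochner_Integration.integrable_bound[OF integrable_mult_left[OF Ii, of "B * N"]])
        show "AE s in lborel. norm (LBINT t. norm (case (s, t) of (s, t) \<Rightarrow> f s t)) \<le> norm (I s * (B * N))"
        proof (intro AE_I2)
          fix s
          have "(LBINT t. norm (f s t)) \<le> (LBINT t. I s * (B * \<bar>k t\<bar>))"
            by (rule integral_mono[OF integrable_norm[OF fi] integrable_mult_right[OF kai] fb])
          also have "\<dots> = I s * (B * N)" by (simp add: N_def)
          finally show "norm (LBINT t. norm (case (s, t) of (s, t) \<Rightarrow> f s t)) \<le> norm (I s * (B * N))" by simp
        qed
      qed measurable
      show "AE s in lborel. integrable lborel (\<lambda>t. case (s, t) of (s, t) \<Rightarrow> f s t)" using fi by simp
    qed
    have "integral {s0..s0 + T} (\<lambda>s. vp_mean a b g s * cis (- \<mu> * s))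
       = (LBINT s. I s *\<^sub>R (vp_mean a b g s * cis (- \<mu> * s)))"
      unfolding I_def
      by (rule integral_eq_lborel[OF hcm, where B = "B * N"])
         (use vp_mean_bound[OF ab g B(2)] in \<open>simp add: norm_mult N_def k_def\<close>)
    also have "\<dots> = (LBINT s. LBINT t. f s t)"
    proof (rule Bochner_Integration.integral_cong[OF refl])
      fix s
      have "I s *\<^sub>R (vp_mean a b g s * cis (- \<mu> * s)) = (LBINT t. I s *\<^sub>R (of_real (k t) * g (s + t) * cis (- \<mu> * s)))"
        unfolding vp_mean_def k_def by simp
      then show "I s *\<^sub>R (vp_mean a b g s * cis (- \<mu> * s)) = (LBINT t. f s t)" by (simp add: f_def)
    qed
    also have "\<dots> = (LBINT t. LBINT s. f s t)"
      by (rule lborel_pair.Fubini_integral[symmetric]) (rule pint)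
    also have "\<dots> = (LBINT t. of_real (k t) * cis (\<mu> * t) * integral {s0 + t..s0 + t + T} G)"
    proof (rule Bochner_Integration.integral_cong[OF refl])
      fix t
      have "(LBINT s. f s t) = (LBINT s. (of_real (k t) * cis (\<mu> * t)) * (I s *\<^sub>R G (s + t)))"
      proof (rule Bochner_Integration.integral_cong[OF refl])
        fix s
        have "cis (- \<mu> * s) = cis (\<mu> * t) * cis (- \<mu> * (s + t))"
          unfolding cis_mult by (rule arg_cong[of _ _ cis]) (simp add: algebra_simps)
        then show "f s t = (of_real (k t) * cis (\<mu> * t)) * (I s *\<^sub>R G (s + t))"
          by (simp only: f_def G_def mult_ac mult_scaleR_right mult_scaleR_left)
      qed
      also have "\<dots> = of_real (k t) * cis (\<mu> * t) * (LBINT s. I s *\<^sub>R G (s + t))" by (rule integral_mult_right_zero)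
      also have "(LBINT s. I s *\<^sub>R G (s + t)) = integral {s0..s0 + T} (\<lambda>s. G (s + t))"
        unfolding I_def by (rule integral_eq_lborel[symmetric, OF borel_translate[OF Gm] GB])
      also have "\<dots> = integral {s0 + t..s0 + t + T} G" by (simp add: integral_translate add_ac)
      finally show "(LBINT s. f s t) = of_real (k t) * cis (\<mu> * t) * integral {s0 + t..s0 + t + T} G" .
    qed
    finally have 1: "integral {s0..s0 + T} (\<lambda>s. vp_mean a b g s * cis (- \<mu> * s))
      = (LBINT t. of_real (k t) * cis (\<mu> * t) * integral {s0 + t..s0 + t + T} G)" .
    have 2: "has_bochner_integral lborel (\<lambda>t. of_real (k t) * cis (\<mu> * t) * (of_real T * A)) (of_real (trapezoid a b \<mu>) * (of_real T * A))"
      unfolding k_def by (intro has_bochner_integral_mult_left vp_kernel_cis ab)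
    have 3: "integrable lborel (\<lambda>t. of_real (k t) * cis (\<mu> * t) * integral {s0 + t..s0 + t + T} G)"
    proof -
      \<comment> \<open>A window integral is Lipschitz in its starting point with constant 2 B; this
        supplies the measurability in t.\<close>
      have cont: "continuous_on UNIV (\<lambda>t. integral {s0 + t..s0 + t + T} G)"
      proof -
        have Gi: "G integrable_on {p..q}" for p q by (rule bounded_borel_integrable_on[OF Gm GB])
        have "\<forall>x y. dist (integral {s0 + x..s0 + x + T} G) (integral {s0 + y..s0 + y + T} G) \<le> (2 * B) * dist x y"
        proof (intro allI)
          fix x y :: real
          have *: "norm (integral {s..s + T} G - integral {\<tau>..\<tau> + T} G) \<le> 2 * B * (\<tau> - s)" if "s \<le> \<tau>" for s \<tau>
            by (rule integral_window_shift[OF Gm GB]) (use that T in auto)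
          show "dist (integral {s0 + x..s0 + x + T} G) (integral {s0 + y..s0 + y + T} G) \<le> (2 * B) * dist x y"
          proof (cases "x \<le> y")
            case True
            then show ?thesis using *[of "s0 + x" "s0 + y"] by (simp add: dist_norm)
          next
            case False
            then show ?thesis using *[of "s0 + y" "s0 + x"] by (simp add: dist_norm norm_minus_commute)
          qed
        qed
        then have "(2 * B)-lipschitz_on UNIV (\<lambda>t. integral {s0 + t..s0 + t + T} G)"
          using B(1) by (intro lipschitz_onI) auto
        then show ?thesis by (rule lipschitz_on_continuous_on)
      qed
      then have [measurable]: "(\<lambda>t. integral {s0 + t..s0 + t + T} G) \<in> borel_measurable borel"
        by (rule borel_measurable_continuous_onI)
      show ?thesis
      proof (rule Bochner_Integration.integrable_bound[OF integrable_mult_right[OF kint, of "B * T"]])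
        show "AE t in lborel. norm (of_real (k t) * cis (\<mu> * t) * integral {s0 + t..s0 + t + T} G) \<le> norm (B * T * k t)"
        proof (intro AE_I2)
          fix t
          have "norm (integral {s0 + t..s0 + t + T} G) \<le> B * (s0 + t + T - (s0 + t))"
            by (rule norm_integral_le_const[OF bounded_borel_integrable_on[OF Gm GB] GB]) (use T in auto)
          then have "\<bar>k t\<bar> * norm (integral {s0 + t..s0 + t + T} G) \<le> \<bar>k t\<bar> * (B * T)"
            by (intro mult_left_mono) auto
          then show "norm (of_real (k t) * cis (\<mu> * t) * integral {s0 + t..s0 + t + T} G) \<le> norm (B * T * k t)"
            using B(1) T by (simp add: norm_mult abs_mult mult.commute)
        qed
      qed measurable
    qed
    have split: "of_real (k t) * cis (\<mu> * t) * (integral {s0 + t..s0 + t + T} G - of_real T * A)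
      = of_real (k t) * cis (\<mu> * t) * integral {s0 + t..s0 + t + T} G - of_real (k t) * cis (\<mu> * t) * (of_real T * A)" for t
      by (rule right_diff_distrib)
    have i2: "integrable lborel (\<lambda>t. of_real (k t) * cis (\<mu> * t) * (of_real T * A))"
      "(LBINT t. of_real (k t) * cis (\<mu> * t) * (of_real T * A)) = of_real (trapezoid a b \<mu>) * (of_real T * A)"
      using 2 by (auto simp: has_bochner_integral_iff)
    show "integral {s0..s0 + T} (\<lambda>s. vp_mean a b g s * cis (- \<mu> * s)) - of_real T * (of_real (trapezoid a b \<mu>) * A)
      = (LBINT t. of_real (k t) * cis (\<mu> * t) * (integral {s0 + t..s0 + t + T} G - of_real T * A))"
      unfolding split Bochner_Integration.integral_diff[OF 3 i2(1)] 1 i2(2) by (simp add: mult.left_commute)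
    show "integrable lborel (\<lambda>t. of_real (k t) * cis (\<mu> * t) * (integral {s0 + t..s0 + t + T} G - of_real T * A))"
      unfolding split by (rule Bochner_Integration.integrable_diff[OF 3 i2(1)])
  qed
  show ?thesis unfolding has_mean_def
  proof (intro allI impI)
    fix e :: real assume e: "e > 0"
    have e': "e / (N + 1) > 0" using e N0 by simp
    obtain T0 where T0: "T0 > 0" "\<And>T s. T \<ge> T0 \<Longrightarrow> norm (integral {s..s + T} G - of_real T * A) \<le> e / (N + 1) * T"
      using mean[unfolded has_mean_def, rule_format, OF e'] unfolding G_def by auto
    have "norm (integral {s0..s0 + T} (\<lambda>s. vp_mean a b g s * cis (- \<mu> * s)) - of_real T * (of_real (trapezoid a b \<mu>) * A)) \<le> e * T"
      if T: "T \<ge> T0" for T s0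
    proof -
      have Tp: "T \<ge> 0" using T T0(1) by linarith
      have "norm (integral {s0..s0 + T} (\<lambda>s. vp_mean a b g s * cis (- \<mu> * s)) - of_real T * (of_real (trapezoid a b \<mu>) * A))
        \<le> (LBINT t. norm (of_real (k t) * cis (\<mu> * t) * (integral {s0 + t..s0 + t + T} G - of_real T * A)))"
        unfolding key[OF Tp] by (rule integral_norm_bound)
      also have "\<dots> \<le> (LBINT t. e / (N + 1) * T * \<bar>k t\<bar>)"
      proof (rule integral_mono[OF integrable_norm[OF kb[OF Tp]] integrable_mult_right[OF integrable_abs[OF kint]]])
        fix t
        show "norm (of_real (k t) * cis (\<mu> * t) * (integral {s0 + t..s0 + t + T} G - of_real T * A)) \<le> e / (N + 1) * T * \<bar>k t\<bar>"
          using mult_left_mono[OF T0(2)[OF T, of "s0 + t"], of "\<bar>k t\<bar>"] by (simp add: norm_mult mult_ac)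
      qed
      also have "\<dots> = e / (N + 1) * T * N" unfolding N_def by (rule integral_mult_right_zero)
      also have "\<dots> = e * T * (N / (N + 1))" by simp
      also have "\<dots> \<le> e * T * 1" using N0 e Tp by (intro mult_left_mono) auto
      finally show ?thesis by simp
    qed
    then show "\<exists>T0>0. \<forall>T\<ge>T0. \<forall>s. norm (integral {s..s + T} (\<lambda>s. vp_mean a b g s * cis (- \<mu> * s)) - of_real T * (of_real (trapezoid a b \<mu>) * A)) \<le> e * T"
      using T0(1) by blast
  qed
qed

lemma vp_mean_cis:
  assumes ab: "0 \<le> a" "a < b"
  shows "vp_mean a b (\<lambda>t. cis (\<mu> * t)) x = of_real (trapezoid a b \<mu>) * cis (\<mu> * x)"
proof -
  have "vp_mean a b (\<lambda>t. cis (\<mu> * t)) x = (LBINT t. of_real (vp_kernel a b t) * cis (\<mu> * t) * cis (\<mu> * x))"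
    unfolding vp_mean_def
    by (rule Bochner_Integration.integral_cong[OF refl]) (simp add: distrib_left cis_mult[symmetric] mult_ac)
  also have "\<dots> = (LBINT t. of_real (vp_kernel a b t) * cis (\<mu> * t)) * cis (\<mu> * x)" by (rule integral_mult_left_zero)
  also have "(LBINT t. of_real (vp_kernel a b t) * cis (\<mu> * t)) = of_real (trapezoid a b \<mu>)"
    using vp_kernel_cis[OF ab, of \<mu>] by (simp add: has_bochner_integral_iff)
  finally show ?thesis .
qed

text \<open>After subtracting the trigonometric polynomial P, every mean of the convolution of g0
  vanishes: below b the coefficient of g0 is 0, beyond b the trapezoid is 0. The uniqueness theorem
  then gives the value 0 at each point, so no convergence of the Fourier series is involved.\<close>

theorem vp_mean_eq_sum:
  assumes ab: "0 \<le> a" "a < b" and g: "g \<in> stepanov_ap_borel" and F: "finite F"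
    and spec: "\<And>\<mu>. \<bar>\<mu>\<bar> < b \<Longrightarrow> fourier_coeff g \<mu> \<noteq> 0 \<Longrightarrow> \<mu> \<in> F"
  shows "vp_mean a b g x = (\<Sum>\<mu>\<in>F. of_real (trapezoid a b \<mu>) * fourier_coeff g \<mu> * cis (\<mu> * x))"
proof -
  define P where "P = (\<lambda>t. \<Sum>\<mu>\<in>F. fourier_coeff g \<mu> * cis (\<mu> * t))"
  define g0 where "g0 = (\<lambda>t. g t - P t)"
  have g0: "g0 \<in> stepanov_ap_borel" unfolding g0_def P_def by (rule stepanov_ap_borel_diff_trig_sum[OF F g])
  obtain B0 where B0: "B0 > 0" "\<And>t. norm (g0 t) \<le> B0" and g0m: "g0 \<in> borel_measurable borel"
    using stepanov_ap_borelE[OF g0] by metis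
  obtain B where B: "B > 0" "\<And>t. norm (g t) \<le> B" and gm [measurable]: "g \<in> borel_measurable borel"
    using stepanov_ap_borelE[OF g] by metis
  have mean0: "has_mean (\<lambda>t. g0 t * cis (- \<kappa> * t)) (fourier_coeff g \<kappa> - (if \<kappa> \<in> F then fourier_coeff g \<kappa> else 0))" for \<kappa>
  proof -
    have "has_mean (\<lambda>t. g t * cis (- \<kappa> * t) + (\<Sum>\<mu>\<in>F. (- fourier_coeff g \<mu>) * cis ((\<mu> - \<kappa>) * t)))
       (fourier_coeff g \<kappa> + (\<Sum>\<mu>\<in>F. (- fourier_coeff g \<mu>) * (if \<mu> - \<kappa> = 0 then 1 else 0)))"
    proof (intro has_mean_add fourier_coeff_has_mean[OF g] has_mean_trig_sum[OF F])
      show "(\<lambda>t. g t * cis (- \<kappa> * t)) integrable_on {p..q}" for p q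
        by (rule bounded_borel_integrable_on[where B = B]) (use B in \<open>auto simp: norm_mult\<close>)
      show "(\<lambda>t. \<Sum>\<mu>\<in>F. (- fourier_coeff g \<mu>) * cis ((\<mu> - \<kappa>) * t)) integrable_on {p..q}" for p q
        by (intro integrable_continuous_real continuous_intros)
    qed
    moreover have "g t * cis (- \<kappa> * t) + (\<Sum>\<mu>\<in>F. (- fourier_coeff g \<mu>) * cis ((\<mu> - \<kappa>) * t)) = g0 t * cis (- \<kappa> * t)" for t
    proof -
      have "cis ((\<mu> - \<kappa>) * t) = cis (\<mu> * t) * cis (- \<kappa> * t)" for \<mu>
        unfolding cis_mult by (rule arg_cong[of _ _ cis]) (simp add: algebra_simps)
      then show ?thesis by (simp add: g0_def P_def left_diff_distrib sum_distrib_right sum_negf mult.assoc)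
    qed
    moreover have "(\<Sum>\<mu>\<in>F. (- fourier_coeff g \<mu>) * (if \<mu> - \<kappa> = 0 then 1 else 0)) = - (if \<kappa> \<in> F then fourier_coeff g \<kappa> else 0)"
    proof -
      have "(\<Sum>\<mu>\<in>F. (- fourier_coeff g \<mu>) * (if \<mu> - \<kappa> = 0 then 1 else 0)) = (\<Sum>\<mu>\<in>F. if \<mu> = \<kappa> then - fourier_coeff g \<mu> else 0)"
        by (intro sum.cong refl) auto
      then show ?thesis using F by simp
    qed
    ultimately show ?thesis by simp
  qed
  have zero: "vp_mean a b g0 x = 0"
  proof (rule almost_periodic_mean_zero_imp_zero[where h = "vp_mean a b g0" and B = "B0 * (LBINT t. \<bar>vp_kernel a b t\<bar>) + 1"])
    show "uniformly_continuous_on UNIV (vp_mean a b g0)" by (rule vp_mean_uniformly_continuous[OF ab g0m B0])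
    show "B0 * (LBINT t. \<bar>vp_kernel a b t\<bar>) + 1 > 0" using B0(1) by (simp add: add_nonneg_pos)
    show "norm (vp_mean a b g0 t) \<le> B0 * (LBINT t. \<bar>vp_kernel a b t\<bar>) + 1" for t
      using vp_mean_bound[OF ab g0m B0(2), of t] by linarith
    show "rel_dense (\<lambda>\<tau>. \<forall>t. norm (vp_mean a b g0 (t + \<tau>) - vp_mean a b g0 t) \<le> \<epsilon>)" if "\<epsilon> > 0" for \<epsilon>
      by (rule vp_mean_almost_periodic[OF ab g0 that])
    show "has_mean (\<lambda>t. vp_mean a b g0 t * cis (- \<kappa> * t)) 0" for \<kappa>
    proof -
      have "of_real (trapezoid a b \<kappa>) * (fourier_coeff g \<kappa> - (if \<kappa> \<in> F then fourier_coeff g \<kappa> else 0)) = 0"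
        using spec[of \<kappa>] trapezoid_eq_0[OF ab, of \<kappa>] by (cases "\<bar>\<kappa>\<bar> < b") auto
      then show ?thesis using vp_mean_has_mean[OF ab g0m B0 mean0[of \<kappa>]] by metis
    qed
  qed
  have Pi: "integrable lborel (\<lambda>t. of_real (vp_kernel a b t) * P (x + t))"
    and Pv: "(LBINT t. of_real (vp_kernel a b t) * P (x + t)) = (\<Sum>\<mu>\<in>F. of_real (trapezoid a b \<mu>) * fourier_coeff g \<mu> * cis (\<mu> * x))"
  proof -
    have eq: "of_real (vp_kernel a b t) * P (x + t) = (\<Sum>\<mu>\<in>F. fourier_coeff g \<mu> * (of_real (vp_kernel a b t) * cis (\<mu> * (x + t))))" for t
      by (simp add: P_def sum_distrib_left mult_ac)
    have i: "integrable lborel (\<lambda>t. fourier_coeff g \<mu> * (of_real (vp_kernel a b t) * cis (\<mu> * (x + t))))" for \<mu>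
      by (intro integrable_mult_right vp_mean_integrable[OF ab, where g = "\<lambda>t. cis (\<mu> * t)" and B = 1]) auto
    show "integrable lborel (\<lambda>t. of_real (vp_kernel a b t) * P (x + t))"
      unfolding eq by (intro Bochner_Integration.integrable_sum i)
    have "(LBINT t. of_real (vp_kernel a b t) * P (x + t)) = (\<Sum>\<mu>\<in>F. fourier_coeff g \<mu> * vp_mean a b (\<lambda>t. cis (\<mu> * t)) x)"
      unfolding eq by (subst Bochner_Integration.integral_sum[OF i]) (simp add: vp_mean_def)
    then show "(LBINT t. of_real (vp_kernel a b t) * P (x + t)) = (\<Sum>\<mu>\<in>F. of_real (trapezoid a b \<mu>) * fourier_coeff g \<mu> * cis (\<mu> * x))"
      by (simp add: vp_mean_cis[OF ab] mult_ac)
  qed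
  have "vp_mean a b g0 x = (LBINT t. of_real (vp_kernel a b t) * g (x + t) - of_real (vp_kernel a b t) * P (x + t))"
    unfolding vp_mean_def g0_def by (simp only: right_diff_distrib)
  also have "\<dots> = vp_mean a b g x - (LBINT t. of_real (vp_kernel a b t) * P (x + t))"
    unfolding vp_mean_def by (rule Bochner_Integration.integral_diff[OF vp_mean_integrable[OF ab gm B(2)] Pi])
  finally show ?thesis using zero Pv by simp
qed

section \<open>Fourier coefficients and best approximation\<close>

text \<open>The definition allows growth of any type above \<sigma>, and s is the midpoint between
  \<sigma> and \<open>\<bar>\<mu>\<bar>\<close>. For negative \<mu> the function is replaced by its
  reflection z to cnj (h (cnj z)), which conjugates the integral.\<close>

lemma exp_type_bounded_integral:
  assumes h: "h \<in> exp_type_bounded \<sigma>" and \<mu>: "0 \<le> \<sigma>" "\<sigma> < \<bar>\<mu>\<bar>"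
  shows "\<exists>K. \<forall>L\<ge>0. norm (integral {0..L} (\<lambda>t. h (of_real t) * cis (- \<mu> * t))) \<le> K"
proof -
  define s where "s = (\<sigma> + \<bar>\<mu>\<bar>) / 2"
  have s: "s = \<sigma> + (\<bar>\<mu>\<bar> - \<sigma>) / 2" "0 \<le> s" "s < \<bar>\<mu>\<bar>" using \<mu> by (auto simp: s_def field_simps)
  obtain C where C: "\<And>z. norm (h z) \<le> C * exp (s * norm z)"
  proof -
    have "\<forall>\<epsilon>>0. \<exists>C. \<forall>z. norm (h z) \<le> C * exp ((\<sigma> + \<epsilon>) * norm z)" using h by (simp add: exp_type_bounded_def)
    moreover have "(\<bar>\<mu>\<bar> - \<sigma>) / 2 > 0" using \<mu> by simp
    ultimately have "\<exists>C. \<forall>z. norm (h z) \<le> C * exp (s * norm z)" unfolding s(1) by blast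
    then show ?thesis using that by blast
  qed
  obtain B where B: "\<And>t::real. norm (h (of_real t)) \<le> B"
    using h unfolding exp_type_bounded_def bounded_iff by auto
  have hol: "h holomorphic_on UNIV" using h by (simp add: exp_type_bounded_def)
  show ?thesis
  proof (cases "\<mu> \<ge> 0")
    case True
    then show ?thesis using exp_type_integral_bounded[OF hol C B s(2), of \<mu>] s(3) by auto
  next
    case False
    define h' where "h' = cnj \<circ> h \<circ> cnj"
    have hol': "h' holomorphic_on UNIV"
      unfolding h'_def by (rule holomorphic_on_compose_cnj_cnj) (auto intro: holomorphic_on_subset[OF hol])
    have C': "norm (h' z) \<le> C * exp (s * norm z)" for z using C[of "cnj z"] by (simp add: h'_def)
    have B': "norm (h' (of_real t)) \<le> B" for t :: real using B[of t] by (simp add: h'_def)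
    have "norm (integral {0..L} (\<lambda>t. h (of_real t) * cis (- \<mu> * t))) \<le> 2 * max B C / (- \<mu> - s)" if L: "L \<ge> 0" for L
    proof -
      have "integral {0..L} (\<lambda>t. h' (of_real t) * cis (- (- \<mu>) * t)) = integral {0..L} (\<lambda>t. cnj (h (of_real t) * cis (- \<mu> * t)))"
        by (simp add: h'_def cis_cnj)
      also have "\<dots> = cnj (integral {0..L} (\<lambda>t. h (of_real t) * cis (- \<mu> * t)))"
        by (rule integral_cnj[symmetric])
      finally have "norm (integral {0..L} (\<lambda>t. h (of_real t) * cis (- \<mu> * t))) = norm (integral {0..L} (\<lambda>t. h' (of_real t) * cis (- (- \<mu>) * t)))"
        by simp
      also have "\<dots> \<le> 2 * max B C / (- \<mu> - s)"
        by (rule exp_type_integral_bounded[OF hol' C' B' s(2) _ L]) (use False s(3) in auto)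
      finally show ?thesis .
    qed
    then show ?thesis by blast
  qed
qed

text \<open>Boundedness of F guarantees that the supremum in \<open>stepanov_norm\<close> is taken
  over a set that is bounded above.\<close>

lemma stepanov_norm_window:
  assumes F: "F \<in> borel_measurable borel" and B: "\<And>t. norm (F t) \<le> B"
  shows "integral {u..u + pi} (\<lambda>t. norm (F t)) \<le> pi * stepanov_norm F"
proof -
  have B0: "B \<ge> 0" using order_trans[OF norm_ge_zero B[of 0]] .
  have int: "(\<lambda>t. norm (F t)) integrable_on {p..q}" for p q
    by (rule bounded_borel_integrable_on[where B = B]) (use F B in auto)
  have le: "1 / pi * integral {u..u + pi} (\<lambda>t. norm (F t)) \<le> B" for u
  proof -
    have "norm (integral {u..u + pi} (\<lambda>t. norm (F t))) \<le> B * (u + pi - u)"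
      by (rule norm_integral_le_const[OF int]) (use B in auto)
    then show ?thesis by (simp add: field_simps)
  qed
  have "1 / pi * integral {u..u + pi} (\<lambda>t. norm (F t)) \<le> stepanov_norm F"
    unfolding stepanov_norm_def by (rule cSUP_upper) (use le in \<open>auto intro!: bdd_aboveI[of _ B]\<close>)
  then show ?thesis by (simp add: field_simps)
qed

lemma stepanov_norm_nonneg:
  assumes F: "F \<in> borel_measurable borel" and B: "\<And>t. norm (F t) \<le> B"
  shows "0 \<le> stepanov_norm F"
proof -
  have "0 \<le> integral {0..0 + pi} (\<lambda>t. norm (F t))"
    by (rule integral_nonneg[OF bounded_borel_integrable_on[where B = B]]) (use F B in auto)
  also have "\<dots> \<le> pi * stepanov_norm F" by (rule stepanov_norm_window[OF F B])
  finally show ?thesis using pi_gt_zero by (simp add: zero_le_mult_iff)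
qed

lemma exp_type_bounded_borel:
  assumes h: "h \<in> exp_type_bounded \<sigma>"
  shows "(\<lambda>t::real. h (of_real t)) \<in> borel_measurable borel" "\<exists>B. \<forall>t::real. norm (h (of_real t)) \<le> B"
proof -
  have "continuous_on UNIV h" using h by (auto simp: exp_type_bounded_def intro: holomorphic_on_imp_continuous_on)
  then have "continuous_on UNIV (\<lambda>t::real. h (of_real t))"
    by (rule continuous_on_compose2[where g = h and t = UNIV]) (auto intro: continuous_intros)
  then show "(\<lambda>t::real. h (of_real t)) \<in> borel_measurable borel" by (rule borel_measurable_continuous_onI)
  show "\<exists>B. \<forall>t::real. norm (h (of_real t)) \<le> B"
    using h unfolding exp_type_bounded_def bounded_iff by auto
qed

lemma approximant_diff:
  assumes g: "g \<in> borel_measurable borel" "\<And>t. norm (g t) \<le> B" and h: "h \<in> exp_type_bounded \<sigma>"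
  shows "(\<lambda>t. g t - h (of_real t)) \<in> borel_measurable borel" "\<exists>B. \<forall>t. norm (g t - h (of_real t)) \<le> B"
proof -
  note [measurable] = g(1) exp_type_bounded_borel(1)[OF h]
  show "(\<lambda>t. g t - h (of_real t)) \<in> borel_measurable borel" by measurable
  obtain B' where "\<And>t::real. norm (h (of_real t)) \<le> B'" using exp_type_bounded_borel(2)[OF h] by blast
  then have "norm (g t - h (of_real t)) \<le> B + B'" for t by (intro order_trans[OF norm_triangle_ineq4 add_mono] g)
  then show "\<exists>B. \<forall>t. norm (g t - h (of_real t)) \<le> B" by blast
qed

text \<open>Split g into F and h. After division by L the bounded integral of the part with h
  disappears, and the part with F is at most N (L + pi) / L, which tends to N.\<close>

lemma fourier_coeff_le_stepanov_norm:
  assumes g: "g \<in> stepanov_ap_borel" and h: "h \<in> exp_type_bounded \<sigma>" and \<mu>: "0 \<le> \<sigma>" "\<sigma> < \<bar>\<mu>\<bar>"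
  shows "norm (fourier_coeff g \<mu>) \<le> stepanov_norm (\<lambda>t. g t - h (of_real t))"
proof -
  obtain B where B: "B > 0" "\<And>t. norm (g t) \<le> B" and gm [measurable]: "g \<in> borel_measurable borel"
    using stepanov_ap_borelE[OF g] by metis
  define F where "F = (\<lambda>t. g t - h (of_real t))"
  have Fm [measurable]: "F \<in> borel_measurable borel" unfolding F_def by (rule approximant_diff[OF gm B(2) h])
  obtain B' where FB: "\<And>t. norm (F t) \<le> B'" using approximant_diff(2)[OF gm B(2) h] unfolding F_def by blast
  have hm [measurable]: "(\<lambda>t::real. h (of_real t)) \<in> borel_measurable borel" by (rule exp_type_bounded_borel[OF h])
  obtain Bh where Bh: "\<And>t::real. norm (h (of_real t)) \<le> Bh" using exp_type_bounded_borel(2)[OF h] by blast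
  obtain K where K: "\<And>L. L \<ge> 0 \<Longrightarrow> norm (integral {0..L} (\<lambda>t. h (of_real t) * cis (- \<mu> * t))) \<le> K"
    using exp_type_bounded_integral[OF h \<mu>] by blast
  define N where "N = stepanov_norm F"
  have i1: "(\<lambda>t. F t * cis (- \<mu> * t)) integrable_on {0..L}" for L
    by (rule bounded_borel_integrable_on[where B = B']) (use FB in \<open>auto simp: norm_mult\<close>)
  have i2: "(\<lambda>t. h (of_real t) * cis (- \<mu> * t)) integrable_on {0..L}" for L
    by (rule bounded_borel_integrable_on[where B = Bh]) (use Bh in \<open>auto simp: norm_mult\<close>)
  have i3: "(\<lambda>t. norm (F t)) integrable_on {p..q}" for p q
    by (rule bounded_borel_integrable_on[where B = B']) (use FB in auto)
  have bound: "norm (of_real (1 / L) * integral {0..L} (\<lambda>t. g t * cis (- \<mu> * t))) \<le> N + (N * pi + K) / L" if L: "L > 0" for L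
  proof -
    have "integral {0..L} (\<lambda>t. g t * cis (- \<mu> * t)) = integral {0..L} (\<lambda>t. F t * cis (- \<mu> * t) + h (of_real t) * cis (- \<mu> * t))"
      by (simp add: F_def left_diff_distrib)
    also have "\<dots> = integral {0..L} (\<lambda>t. F t * cis (- \<mu> * t)) + integral {0..L} (\<lambda>t. h (of_real t) * cis (- \<mu> * t))"
      by (rule integral_add[OF i1 i2])
    finally have eq: "integral {0..L} (\<lambda>t. g t * cis (- \<mu> * t)) = integral {0..L} (\<lambda>t. F t * cis (- \<mu> * t)) + integral {0..L} (\<lambda>t. h (of_real t) * cis (- \<mu> * t))" .
    have "norm (integral {0..L} (\<lambda>t. F t * cis (- \<mu> * t))) \<le> integral {0..L} (\<lambda>t. norm (F t))"
      by (rule integral_norm_bound_integral[OF i1 i3]) (simp add: norm_mult)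
    also have "\<dots> \<le> N * (L - 0 + pi)"
      by (rule integral_windows_bound[OF i3]) (use stepanov_norm_window[OF Fm FB] L in \<open>auto simp: N_def\<close>)
    finally have "norm (integral {0..L} (\<lambda>t. g t * cis (- \<mu> * t))) \<le> N * (L - 0 + pi) + K"
      unfolding eq using K[of L] L by (intro norm_triangle_mono) auto
    then have "norm (integral {0..L} (\<lambda>t. g t * cis (- \<mu> * t))) / L \<le> (N * (L - 0 + pi) + K) / L"
      using L by (intro divide_right_mono) auto
    also have "\<dots> = N + (N * pi + K) / L" using L by (simp add: field_simps)
    finally show ?thesis using L by (simp add: norm_mult norm_divide)
  qed
  have "((\<lambda>L. norm (of_real (1 / L) * integral {0..L} (\<lambda>t. g t * cis (- \<mu> * t)))) \<longlongrightarrow> norm (fourier_coeff g \<mu>)) at_top"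
    by (intro tendsto_norm has_mean_tendsto fourier_coeff_has_mean g)
  moreover have "((\<lambda>L. N + (N * pi + K) / L) \<longlongrightarrow> N + 0) at_top"
    by (intro tendsto_add tendsto_const tendsto_divide_0[OF tendsto_const] filterlim_at_top_imp_at_infinity filterlim_ident)
  moreover have "eventually (\<lambda>L. norm (of_real (1 / L) * integral {0..L} (\<lambda>t. g t * cis (- \<mu> * t))) \<le> N + (N * pi + K) / L) at_top"
    using eventually_gt_at_top[of 0] by eventually_elim (rule bound)
  ultimately have "norm (fourier_coeff g \<mu>) \<le> N + 0" using tendsto_le[OF trivial_limit_at_top_linorder] by blast
  then show ?thesis by (simp add: N_def F_def)
qed

lemma zero_exp_type_bounded: "0 \<le> \<sigma> \<Longrightarrow> (\<lambda>_. 0) \<in> exp_type_bounded \<sigma>"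
  by (auto simp: exp_type_bounded_def intro!: exI[of _ 0])

lemma fourier_coeff_le_best_approx:
  assumes g: "g \<in> stepanov_ap_borel" and \<mu>: "0 \<le> \<sigma>" "\<sigma> < \<bar>\<mu>\<bar>"
  shows "norm (fourier_coeff g \<mu>) \<le> best_approx \<sigma> g"
  unfolding best_approx_def
  by (rule cINF_greatest) (use zero_exp_type_bounded[OF \<mu>(1)] fourier_coeff_le_stepanov_norm[OF g _ \<mu>] in auto)

lemma best_approx_nonneg:
  assumes g: "g \<in> stepanov_ap_borel" and \<sigma>: "0 \<le> \<sigma>"
  shows "0 \<le> best_approx \<sigma> g"
proof -
  obtain B where B: "B > 0" "\<And>t. norm (g t) \<le> B" and gm: "g \<in> borel_measurable borel"
    using stepanov_ap_borelE[OF g] by metis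
  show ?thesis unfolding best_approx_def
  proof (rule cINF_greatest)
    show "exp_type_bounded \<sigma> \<noteq> {}" using zero_exp_type_bounded[OF \<sigma>] by blast
    fix h assume h: "h \<in> exp_type_bounded \<sigma>"
    show "0 \<le> stepanov_norm (\<lambda>t. g t - h (of_real t))"
      using approximant_diff[OF gm B(2) h] stepanov_norm_nonneg by blast
  qed
qed

text \<open>The infimum runs over a larger class; the lower bound 0 is what makes the real infimum
  monotone.\<close>

lemma best_approx_antimono:
  assumes g: "g \<in> stepanov_ap_borel" and \<sigma>: "0 \<le> \<sigma>" "\<sigma> \<le> \<sigma>'"
  shows "best_approx \<sigma>' g \<le> best_approx \<sigma> g"
  unfolding best_approx_def
proof (rule cINF_superset_mono)
  obtain B where B: "B > 0" "\<And>t. norm (g t) \<le> B" and gm: "g \<in> borel_measurable borel"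
    using stepanov_ap_borelE[OF g] by metis
  show "exp_type_bounded \<sigma> \<noteq> {}" using zero_exp_type_bounded[OF \<sigma>(1)] by blast
  show "bdd_below ((\<lambda>h. stepanov_norm (\<lambda>t. g t - h (of_real t))) ` exp_type_bounded \<sigma>')"
  proof (rule bdd_belowI2)
    fix h assume h: "h \<in> exp_type_bounded \<sigma>'"
    show "0 \<le> stepanov_norm (\<lambda>t. g t - h (of_real t))"
      using approximant_diff[OF gm B(2) h] stepanov_norm_nonneg by blast
  qed
  show "exp_type_bounded \<sigma> \<subseteq> exp_type_bounded \<sigma>'"
  proof
    fix h assume h: "h \<in> exp_type_bounded \<sigma>"
    have "\<exists>C. \<forall>z. norm (h z) \<le> C * exp ((\<sigma>' + \<epsilon>) * norm z)" if "\<epsilon> > 0" for \<epsilon>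
    proof -
      obtain C where C: "\<And>z. norm (h z) \<le> C * exp ((\<sigma> + \<epsilon>) * norm z)" using h \<open>\<epsilon> > 0\<close> by (auto simp: exp_type_bounded_def)
      have C0: "C \<ge> 0" using order_trans[OF norm_ge_zero C[of 0]] by simp
      have "norm (h z) \<le> C * exp ((\<sigma>' + \<epsilon>) * norm z)" for z
      proof -
        have "(\<sigma> + \<epsilon>) * norm z \<le> (\<sigma>' + \<epsilon>) * norm z" using \<sigma> by (intro mult_right_mono) auto
        then have "C * exp ((\<sigma> + \<epsilon>) * norm z) \<le> C * exp ((\<sigma>' + \<epsilon>) * norm z)" using C0 by (intro mult_left_mono) auto
        then show ?thesis using C[of z] by linarith
      qed
      then show ?thesis by blast
    qed
    then show "h \<in> exp_type_bounded \<sigma>'" using h by (auto simp: exp_type_bounded_def)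
  qed
qed auto

section \<open>Large sieve\<close>

text \<open>The finite sum is pulled inside both integrals, so that cancellation between the r is
  used before taking norms. The kernel is to be bounded only where u and v are nonzero, which is how
  the support of \<psi> enters \<open>large_sieve\<close>.\<close>

lemma kernel_bilinear_bound:
  fixes u v :: "real \<Rightarrow> complex"
  assumes R: "finite R" and M: "M \<ge> 0"
    and xc: "\<And>r. r \<in> R \<Longrightarrow> continuous_on UNIV (x r)" and yc: "\<And>r. r \<in> R \<Longrightarrow> continuous_on UNIV (y r)"
    and ux: "\<And>r. r \<in> R \<Longrightarrow> (\<lambda>t. u t * x r t) integrable_on I" and vy: "\<And>r. r \<in> R \<Longrightarrow> (\<lambda>s. v s * y r s) integrable_on J"
    and u: "(\<lambda>t. norm (u t)) integrable_on I" and v: "(\<lambda>s. norm (v s)) integrable_on J"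
    and le: "\<And>t s. t \<in> I \<Longrightarrow> s \<in> J \<Longrightarrow> u t \<noteq> 0 \<Longrightarrow> v s \<noteq> 0 \<Longrightarrow> norm (\<Sum>r\<in>R. x r t * y r s) \<le> M"
  shows "norm (\<Sum>r\<in>R. integral I (\<lambda>t. u t * x r t) * integral J (\<lambda>s. v s * y r s))
     \<le> M * integral I (\<lambda>t. norm (u t)) * integral J (\<lambda>s. norm (v s))"
proof -
  define Y where "Y = (\<lambda>r. integral J (\<lambda>s. v s * y r s))"
  have inner: "norm (u t * (\<Sum>r\<in>R. x r t * Y r)) \<le> norm (u t) * (M * integral J (\<lambda>s. norm (v s)))" if t: "t \<in> I" for t
  proof (cases "u t = 0")
    case False
    have "(\<Sum>r\<in>R. x r t * Y r) = integral J (\<lambda>s. \<Sum>r\<in>R. x r t * (v s * y r s))"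
      unfolding Y_def using R vy by (subst integral_sum) (auto intro: integrable_on_mult_right)
    also have "norm \<dots> \<le> integral J (\<lambda>s. M * norm (v s))"
    proof (rule integral_norm_bound_integral)
      show "(\<lambda>s. \<Sum>r\<in>R. x r t * (v s * y r s)) integrable_on J"
        using R vy by (intro integrable_sum integrable_on_mult_right) auto
      show "(\<lambda>s. M * norm (v s)) integrable_on J" by (rule integrable_on_mult_right[OF v])
      fix s assume s: "s \<in> J"
      have "(\<Sum>r\<in>R. x r t * (v s * y r s)) = v s * (\<Sum>r\<in>R. x r t * y r s)"
        by (simp add: sum_distrib_left mult_ac)
      then show "norm (\<Sum>r\<in>R. x r t * (v s * y r s)) \<le> M * norm (v s)"
        using le[OF t s False] by (cases "v s = 0") (auto simp: norm_mult mult.commute[of M] intro!: mult_left_mono)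
    qed
    also have "\<dots> = M * integral J (\<lambda>s. norm (v s))" by simp
    finally show ?thesis by (simp add: norm_mult mult_left_mono)
  qed simp
  have "(\<Sum>r\<in>R. integral I (\<lambda>t. u t * x r t) * Y r) = (\<Sum>r\<in>R. integral I (\<lambda>t. u t * x r t * Y r))"
    by simp
  also have "\<dots> = integral I (\<lambda>t. \<Sum>r\<in>R. u t * x r t * Y r)"
    by (rule integral_sum[symmetric, OF R]) (intro integrable_on_mult_left ux)
  also have "\<dots> = integral I (\<lambda>t. u t * (\<Sum>r\<in>R. x r t * Y r))" by (simp add: sum_distrib_left mult.assoc)
  finally have eq: "(\<Sum>r\<in>R. integral I (\<lambda>t. u t * x r t) * Y r) = integral I (\<lambda>t. u t * (\<Sum>r\<in>R. x r t * Y r))" .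
  have "norm (integral I (\<lambda>t. u t * (\<Sum>r\<in>R. x r t * Y r))) \<le> integral I (\<lambda>t. norm (u t) * (M * integral J (\<lambda>s. norm (v s))))"
  proof (rule integral_norm_bound_integral[OF _ _ inner])
    have "(\<lambda>t. \<Sum>r\<in>R. u t * x r t * Y r) integrable_on I" using R by (intro integrable_sum integrable_on_mult_left ux)
    then show "(\<lambda>t. u t * (\<Sum>r\<in>R. x r t * Y r)) integrable_on I" by (simp add: sum_distrib_left mult.assoc)
    show "(\<lambda>t. norm (u t) * (M * integral J (\<lambda>s. norm (v s)))) integrable_on I" by (rule integrable_on_mult_left[OF u])
  qed
  also have "\<dots> = integral I (\<lambda>t. norm (u t)) * (M * integral J (\<lambda>s. norm (v s)))" by simp
  finally have le: "norm (integral I (\<lambda>t. u t * (\<Sum>r\<in>R. x r t * Y r)))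
      \<le> integral I (\<lambda>t. norm (u t)) * (M * integral J (\<lambda>s. norm (v s)))" .
  show ?thesis using le[folded eq] unfolding Y_def by (simp only: mult_ac)
qed

lemma sum_abs_diff_le:
  fixes g :: "nat \<Rightarrow> real"
  assumes g: "\<And>i. g i \<ge> 0" and j: "j < J"
  shows "(\<Sum>l<J. g (nat \<bar>int j - int l\<bar>)) \<le> 2 * (\<Sum>i<J. g i)"
proof -
  have "(\<Sum>l<J. g (nat \<bar>int j - int l\<bar>)) = (\<Sum>l\<in>{..j}. g (nat \<bar>int j - int l\<bar>)) + (\<Sum>l\<in>{j<..<J}. g (nat \<bar>int j - int l\<bar>))"
    using j by (subst sum.union_disjoint[symmetric]) (auto intro!: sum.cong)
  also have "(\<Sum>l\<in>{..j}. g (nat \<bar>int j - int l\<bar>)) = (\<Sum>i\<in>{..j}. g i)"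
    by (rule sum.reindex_bij_witness[where i = "\<lambda>i. j - i" and j = "\<lambda>l. j - l"]) (auto intro!: arg_cong[of _ _ g])
  also have "(\<Sum>l\<in>{j<..<J}. g (nat \<bar>int j - int l\<bar>)) = (\<Sum>i\<in>{0<..<J - j}. g i)"
    by (rule sum.reindex_bij_witness[where i = "\<lambda>i. j + i" and j = "\<lambda>l. l - j"]) (auto intro!: arg_cong[of _ _ g])
  also have "(\<Sum>i\<in>{..j}. g i) \<le> (\<Sum>i<J. g i)" using g j by (intro sum_mono2) auto
  also have "(\<Sum>i\<in>{0<..<J - j}. g i) \<le> (\<Sum>i<J. g i)" using g by (intro sum_mono2) auto
  finally show ?thesis by simp
qed

lemma sum_inverse_squares_le: "(\<Sum>i<n. 1 / (1 + real i)\<^sup>2) \<le> 2"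
proof (cases n)
  case (Suc n')
  have "(\<Sum>i<Suc k. 1 / (1 + real i)\<^sup>2) \<le> 2 - 1 / (real k + 1)" for k
  proof (induction k)
    case (Suc k)
    have "1 / (x + 1)\<^sup>2 \<le> 1 / x - 1 / (x + 1)" if "x > 0" for x :: real
    proof -
      have "1 / x - 1 / (x + 1) = 1 / (x * (x + 1))" using that by (simp add: field_simps)
      moreover have "1 / (x + 1)\<^sup>2 \<le> 1 / (x * (x + 1))"
        using that by (intro divide_left_mono) (auto simp: power2_eq_square intro!: mult_right_mono)
      ultimately show ?thesis by simp
    qed
    from this[of "real k + 1"] have "1 / (1 + real (Suc k))\<^sup>2 \<le> 1 / (real k + 1) - 1 / (real (Suc k) + 1)"
      by (simp add: add_ac)
    then show ?case using Suc by (simp only: sum.lessThan_Suc[of _ "Suc k"])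
  qed simp
  from this[of n'] show ?thesis unfolding Suc by (rule order_trans) simp
qed simp

text \<open>The denominator of the geometric sum is 2 |sin (\<theta> / 2)|, and |\<theta>| <= pi
  keeps it at least |\<theta>| / 2; the numerator is at most 2.\<close>

lemma norm_geometric_cis_le:
  assumes \<theta>: "\<theta> \<noteq> 0" "\<bar>\<theta>\<bar> \<le> pi"
  shows "norm (\<Sum>p<R. cis (\<theta> * real p)) \<le> 4 / \<bar>\<theta>\<bar>"
proof -
  have half: "\<bar>\<theta>\<bar> / 4 \<le> \<bar>sin (\<theta> / 2)\<bar>" using abs_sin_ge_half[of "\<theta> / 2"] \<theta> by simp
  then have "sin (\<theta> / 2) \<noteq> 0" using \<theta> by auto
  then have ne: "cis \<theta> - 1 \<noteq> 0" using norm_cis_minus_one[of \<theta>] by auto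
  have "(\<Sum>p<R. cis (\<theta> * real p)) = (\<Sum>p<R. cis \<theta> ^ p)"
    by (simp add: Complex.DeMoivre mult.commute)
  also have "\<dots> = (cis \<theta> ^ R - 1) / (cis \<theta> - 1)" using ne by (intro geometric_sum) auto
  finally have "norm (\<Sum>p<R. cis (\<theta> * real p)) = norm (cis \<theta> ^ R - 1) / (2 * \<bar>sin (\<theta> / 2)\<bar>)"
    by (simp add: norm_divide norm_cis_minus_one)
  also have "\<dots> \<le> 2 / (2 * (\<bar>\<theta>\<bar> / 4))"
  proof (rule frac_le)
    show "norm (cis \<theta> ^ R - 1) \<le> 2"
      using norm_triangle_ineq4[of "cis \<theta> ^ R" 1] by (simp add: norm_power)
  qed (use half \<theta> in auto)
  finally show ?thesis by simp
qed

text \<open>The frequencies \<open>m + p - q\<close> with \<open>p, q < 2 (m + 1)\<close> contain each of \<open>m, \<dots>, 2 m\<close> at least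
  \<open>m + 1\<close> times, and summing over them produces the square of a Dirichlet kernel, which decays like the
  inverse square of the distance. The integral of \<open>\<bar>\<psi>\<bar>\<close> over a cell may therefore be squared cell by cell.\<close>

lemma large_sieve:
  fixes \<psi> :: "real \<Rightarrow> complex"
  assumes \<psi>m: "\<psi> \<in> borel_measurable borel" and B: "\<And>t. norm (\<psi> t) \<le> B"
    and supp: "\<And>t. \<psi> t \<noteq> 0 \<Longrightarrow> 0 \<le> t \<and> t \<le> L" and \<beta>: "\<beta> > 0" "\<beta> * L \<le> pi" and \<delta>: "\<delta> > 0"
    and D: "(real m + 1) * \<beta> * \<delta> \<ge> D" "D > 0"
  shows "(\<Sum>k=m..2 * m. (norm (integral {0..real J * \<delta>} (\<lambda>t. \<psi> t * cis (\<beta> * real k * t))))\<^sup>2)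
    \<le> (64 + 576 / D\<^sup>2) * (real m + 1) * (\<Sum>j<J. (integral {real j * \<delta>..(real j + 1) * \<delta>} (\<lambda>t. norm (\<psi> t)))\<^sup>2)"
proof -
  define I where "I = (\<lambda>j::nat. {real j * \<delta>..(real j + 1) * \<delta>})"
  define v where "v = (\<lambda>j. integral (I j) (\<lambda>t. norm (\<psi> t)))"
  define c where "c = (\<lambda>\<omega>. integral {0..real J * \<delta>} (\<lambda>t. \<psi> t * cis (\<beta> * \<omega> * t)))"
  define cj where "cj = (\<lambda>\<omega> j. integral (I j) (\<lambda>t. \<psi> t * cis (\<beta> * \<omega> * t)))"
  have int: "(\<lambda>t. \<psi> t * cis (\<omega> * t)) integrable_on {p..q}" for \<omega> p q
    by (rule bounded_borel_integrable_on[where B = B]) (use \<psi>m B in \<open>auto simp: norm_mult\<close>)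
  have inti: "(\<lambda>t. norm (\<psi> t)) integrable_on {p..q}" for p q
    by (rule bounded_borel_integrable_on[where B = B]) (use \<psi>m B in auto)
  have v0: "v j \<ge> 0" for j unfolding v_def I_def by (rule integral_nonneg[OF inti]) simp
  have split: "integral {0..real n * \<delta>} (\<lambda>t. \<psi> t * cis (\<beta> * \<omega> * t)) = (\<Sum>j<n. cj \<omega> j)" for n \<omega>
  proof (induction n)
    case (Suc n)
    have "integral {0..real (Suc n) * \<delta>} (\<lambda>t. \<psi> t * cis (\<beta> * \<omega> * t))
      = integral {0..real n * \<delta>} (\<lambda>t. \<psi> t * cis (\<beta> * \<omega> * t)) + cj \<omega> n"
      using Henstock_Kurzweil_Integration.integral_combine[of 0 "real n * \<delta>" "real (Suc n) * \<delta>" "\<lambda>t. \<psi> t * cis (\<beta> * \<omega> * t)", OF _ _ int] \<delta>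
      by (simp add: cj_def I_def algebra_simps)
    then show ?case using Suc by simp
  qed simp
  have csum: "c \<omega> = (\<Sum>j<J. cj \<omega> j)" for \<omega> unfolding c_def by (rule split)
  define R where "R = 2 * (m + 1)"
  define P where "P = {..<R} \<times> {..<R}"
  define \<omega> where "\<omega> = (\<lambda>r :: nat \<times> nat. real m + real (fst r) - real (snd r))"
  \<comment> \<open>For cell distance d <= 1 the trivial bound 4 (m + 1) ^ 2 and (1 + d) ^ 2 <= 4
    lead to 16. For d >= 2 the bound 4 / |\<theta>| together with d - 1 >= (1 + d) / 3 leads to 12 /
    D, whose square is the second summand.\<close>
  define A where "A = 16 + 144 / D\<^sup>2"
  define \<kappa> where "\<kappa> = (\<lambda>i::nat. A * (1 / (1 + real i)\<^sup>2))"
  have A0: "A \<ge> 16" by (simp add: A_def)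
  have m1: "real m + 1 > 0" by simp
  \<comment> \<open>The pair (q + (k - m), q) has frequency k for each of the m + 1 values of q, and
    all these pairs are distinct.\<close>
  have lower: "(real m + 1) * (\<Sum>k=m..2 * m. (norm (c (real k)))\<^sup>2) \<le> (\<Sum>r\<in>P. (norm (c (\<omega> r)))\<^sup>2)"
  proof -
    have "(real m + 1) * (\<Sum>k=m..2 * m. (norm (c (real k)))\<^sup>2) = (\<Sum>q<m + 1. \<Sum>k=m..2 * m. (norm (c (real k)))\<^sup>2)"
      by simp
    also have "\<dots> = (\<Sum>r\<in>{..<m + 1} \<times> {m..2 * m}. (norm (c (real (snd r))))\<^sup>2)"
      by (subst sum.cartesian_product) (auto intro!: sum.cong)
    also have "\<dots> = (\<Sum>r\<in>(\<lambda>(q, k). (q + (k - m), q)) ` ({..<m + 1} \<times> {m..2 * m}). (norm (c (\<omega> r)))\<^sup>2)"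
      by (subst sum.reindex) (auto simp: inj_on_def \<omega>_def of_nat_diff intro!: sum.cong)
    also have "\<dots> \<le> (\<Sum>r\<in>P. (norm (c (\<omega> r)))\<^sup>2)"
      by (rule sum_mono2) (auto simp: P_def R_def)
    finally show ?thesis .
  qed
  have kern: "norm (\<Sum>r\<in>P. cis (\<beta> * \<omega> r * t) * cis (- (\<beta> * \<omega> r) * s)) \<le> (real m + 1)\<^sup>2 * \<kappa> (nat \<bar>int j - int l\<bar>)"
    if t: "t \<in> I j" and s: "s \<in> I l" and nz: "\<psi> t \<noteq> 0" "\<psi> s \<noteq> 0" for j l t s
  proof -
    define \<theta> where "\<theta> = \<beta> * (t - s)"
    define E where "E = (\<Sum>p<R. cis (\<theta> * real p))"
    have "(\<Sum>r\<in>P. cis (\<beta> * \<omega> r * t) * cis (- (\<beta> * \<omega> r) * s))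
       = (\<Sum>p<R. \<Sum>q<R. cis (\<theta> * real m) * (cis (\<theta> * real p) * cnj (cis (\<theta> * real q))))"
      unfolding P_def sum.cartesian_product
      by (intro sum.cong refl) (auto simp: \<omega>_def \<theta>_def cis_cnj cis_mult algebra_simps)
    also have "\<dots> = cis (\<theta> * real m) * (E * cnj E)"
    proof -
      have "E * cnj E = (\<Sum>p<R. \<Sum>q<R. cis (\<theta> * real p) * cnj (cis (\<theta> * real q)))"
        unfolding E_def cnj_sum sum_product ..
      then show ?thesis by (simp only: sum_distrib_left)
    qed
    finally have "norm (\<Sum>r\<in>P. cis (\<beta> * \<omega> r * t) * cis (- (\<beta> * \<omega> r) * s)) = (norm E)\<^sup>2"
      by (simp add: norm_mult power2_eq_square)
    moreover have "(norm E)\<^sup>2 \<le> (real m + 1)\<^sup>2 * \<kappa> (nat \<bar>int j - int l\<bar>)"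
    proof -
      define d where "d = nat \<bar>int j - int l\<bar>"
      show ?thesis
      proof (cases "d \<le> 1")
        case True
        have "norm E \<le> (\<Sum>p<R. norm (cis (\<theta> * real p)))" unfolding E_def by (rule norm_sum)
        then have "norm E \<le> 2 * (real m + 1)" by (simp add: R_def)
        then have "(norm E)\<^sup>2 \<le> (2 * (real m + 1))\<^sup>2" by (intro power_mono) auto
        also have "\<dots> = (real m + 1)\<^sup>2 * 4" unfolding power_mult_distrib by simp
        finally have E4: "(norm E)\<^sup>2 \<le> (real m + 1)\<^sup>2 * 4" .
        have "4 \<le> \<kappa> d"
        proof -
          have "(1 + real d)\<^sup>2 \<le> 2\<^sup>2" using True by (intro power_mono) auto
          then have "1 / 4 \<le> 1 / (1 + real d)\<^sup>2" by (intro divide_left_mono) auto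
          then have "16 * (1 / 4) \<le> A * (1 / (1 + real d)\<^sup>2)" using A0 by (intro mult_mono) auto
          then show ?thesis by (simp add: \<kappa>_def)
        qed
        then have "(real m + 1)\<^sup>2 * 4 \<le> (real m + 1)\<^sup>2 * \<kappa> d" by (intro mult_left_mono) auto
        then show ?thesis using E4 unfolding d_def by linarith
      next
        case False
        \<comment> \<open>Points in cells whose indices differ by d may be as close as (d - 1)
          \<delta>.\<close>
        have ts: "(real d - 1) * \<delta> \<le> \<bar>t - s\<bar>"
        proof (cases "j \<le> l")
          case True
          then have "real d = real l - real j" by (simp add: d_def)
          then have "(real d - 1) * \<delta> = real l * \<delta> - (real j + 1) * \<delta>" by (simp add: left_diff_distrib distrib_right)
          moreover have "real l * \<delta> \<le> s" "t \<le> (real j + 1) * \<delta>" using t s by (auto simp: I_def)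
          ultimately show ?thesis by linarith
        next
          case False
          then have "real d = real j - real l" by (simp add: d_def)
          then have "(real d - 1) * \<delta> = real j * \<delta> - (real l + 1) * \<delta>" by (simp add: left_diff_distrib distrib_right)
          moreover have "real j * \<delta> \<le> t" "s \<le> (real l + 1) * \<delta>" using t s by (auto simp: I_def)
          ultimately show ?thesis by linarith
        qed
        have d1: "real d - 1 \<ge> (1 + real d) / 3" using False by auto
        have dp: "(1 + real d) / 3 * (D / (real m + 1)) > 0" using D m1 by auto
        have "(1 + real d) / 3 * (D / (real m + 1)) \<le> (real d - 1) * (\<beta> * \<delta>)"
          using d1 D m1 \<beta> \<delta> by (intro mult_mono) (auto simp: field_simps)
        also have "\<dots> \<le> \<bar>\<theta>\<bar>" using ts \<beta> by (simp add: \<theta>_def abs_mult mult.left_commute mult_left_mono)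
        finally have th: "(1 + real d) / 3 * (D / (real m + 1)) \<le> \<bar>\<theta>\<bar>" .
        \<comment> \<open>Both points lie in the support [0, L], so \<beta> L <= pi keeps \<theta>
          in the range where the geometric sum has no second peak.\<close>
        have "\<bar>t - s\<bar> \<le> L" using supp[OF nz(1)] supp[OF nz(2)] by auto
        then have "\<bar>\<theta>\<bar> \<le> \<beta> * L" using \<beta>(1) by (simp add: \<theta>_def abs_mult)
        then have "norm E \<le> 4 / \<bar>\<theta>\<bar>"
          unfolding E_def using th dp \<beta>(2) by (intro norm_geometric_cis_le) auto
        also have "\<dots> \<le> 4 / ((1 + real d) / 3 * (D / (real m + 1)))"
          by (rule frac_le[OF _ _ dp th]) auto
        also have "\<dots> = 12 * (real m + 1) / (D * (1 + real d))"
        proof -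
          have "4 / (x / 3 * (D / y)) = 12 * y / (D * x)" for x y :: real by (simp add: mult_ac)
          then show ?thesis .
        qed
        finally have "(norm E)\<^sup>2 \<le> (12 * (real m + 1) / (D * (1 + real d)))\<^sup>2" by (intro power_mono) auto
        also have "\<dots> = (real m + 1)\<^sup>2 * (144 / D\<^sup>2 * (1 / (1 + real d)\<^sup>2))"
        proof -
          have "(12 * x / (D * y))\<^sup>2 = x\<^sup>2 * (144 / D\<^sup>2 * (1 / y\<^sup>2))" for x y :: real
            by (simp add: power_divide power_mult_distrib)
          then show ?thesis .
        qed
        also have "\<dots> \<le> (real m + 1)\<^sup>2 * (A * (1 / (1 + real d)\<^sup>2))"
          by (intro mult_left_mono mult_right_mono) (auto simp: A_def)
        finally show ?thesis by (simp add: \<kappa>_def d_def)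
      qed
    qed
    ultimately show ?thesis by simp
  qed
  have pair: "norm (\<Sum>r\<in>P. cj (\<omega> r) j * cnj (cj (\<omega> r) l)) \<le> (real m + 1)\<^sup>2 * \<kappa> (nat \<bar>int j - int l\<bar>) * v j * v l" for j l
  proof -
    have cn: "cnj (cj (\<omega> r) l) = integral (I l) (\<lambda>s. cnj (\<psi> s) * cis (- (\<beta> * \<omega> r) * s))" for r
      unfolding cj_def by (subst integral_cnj) (simp add: cis_cnj)
    have int': "(\<lambda>s. cnj (\<psi> s) * cis (\<omega> * s)) integrable_on {p..q}" for \<omega> p q
      by (rule bounded_borel_integrable_on[where B = B]) (use \<psi>m B in \<open>auto simp: norm_mult intro!: borel_measurable_times borel_measurable_continuous_on[where g = "\<psi>" and f = cnj]  continuous_intros\<close>)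
    have "norm (\<Sum>r\<in>P. integral (I j) (\<lambda>t. \<psi> t * cis (\<beta> * \<omega> r * t)) * integral (I l) (\<lambda>s. cnj (\<psi> s) * cis (- (\<beta> * \<omega> r) * s)))
      \<le> (real m + 1)\<^sup>2 * \<kappa> (nat \<bar>int j - int l\<bar>) * integral (I j) (\<lambda>t. norm (\<psi> t)) * integral (I l) (\<lambda>s. norm (cnj (\<psi> s)))"
    proof (rule kernel_bilinear_bound)
      show "finite P" by (simp add: P_def)
      show "(real m + 1)\<^sup>2 * \<kappa> (nat \<bar>int j - int l\<bar>) \<ge> 0" using A0 by (auto simp: \<kappa>_def)
      show "(\<lambda>t. \<psi> t * cis (\<beta> * \<omega> r * t)) integrable_on I j" for r unfolding I_def by (rule int)
      show "(\<lambda>s. cnj (\<psi> s) * cis (- (\<beta> * \<omega> r) * s)) integrable_on I l" for r unfolding I_def by (rule int')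
      show "(\<lambda>t. norm (\<psi> t)) integrable_on I j" unfolding I_def by (rule inti)
      show "(\<lambda>s. norm (cnj (\<psi> s))) integrable_on I l" unfolding I_def complex_mod_cnj by (rule inti)
      show "norm (\<Sum>r\<in>P. cis (\<beta> * \<omega> r * t) * cis (- (\<beta> * \<omega> r) * s)) \<le> (real m + 1)\<^sup>2 * \<kappa> (nat \<bar>int j - int l\<bar>)"
        if "t \<in> I j" "s \<in> I l" "\<psi> t \<noteq> 0" "cnj (\<psi> s) \<noteq> 0" for t s
        using kern[OF that(1,2,3)] that(4) by simp
    qed (intro continuous_intros)+
    then show ?thesis unfolding cn by (simp add: cj_def v_def)
  qed
  have "complex_of_real (\<Sum>r\<in>P. (norm (c (\<omega> r)))\<^sup>2) = (\<Sum>r\<in>P. c (\<omega> r) * cnj (c (\<omega> r)))"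
    by (simp only: of_real_sum complex_norm_square)
  also have "\<dots> = (\<Sum>r\<in>P. \<Sum>j<J. \<Sum>l<J. cj (\<omega> r) j * cnj (cj (\<omega> r) l))"
    by (simp only: csum cnj_sum sum_product)
  also have "\<dots> = (\<Sum>j<J. \<Sum>r\<in>P. \<Sum>l<J. cj (\<omega> r) j * cnj (cj (\<omega> r) l))" by (rule sum.swap)
  also have "\<dots> = (\<Sum>j<J. \<Sum>l<J. \<Sum>r\<in>P. cj (\<omega> r) j * cnj (cj (\<omega> r) l))" by (intro sum.cong refl sum.swap)
  finally have "norm (complex_of_real (\<Sum>r\<in>P. (norm (c (\<omega> r)))\<^sup>2)) = norm (\<Sum>j<J. \<Sum>l<J. \<Sum>r\<in>P. cj (\<omega> r) j * cnj (cj (\<omega> r) l))"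
    by (rule arg_cong)
  then have "(\<Sum>r\<in>P. (norm (c (\<omega> r)))\<^sup>2) \<le> norm (\<Sum>j<J. \<Sum>l<J. \<Sum>r\<in>P. cj (\<omega> r) j * cnj (cj (\<omega> r) l))"
    by (simp only: norm_of_real)
  also have "\<dots> \<le> (\<Sum>j<J. \<Sum>l<J. norm (\<Sum>r\<in>P. cj (\<omega> r) j * cnj (cj (\<omega> r) l)))"
    by (intro order_trans[OF norm_sum] sum_mono norm_sum)
  \<comment> \<open>Schur's test: the product of the two cell integrals is split into their squares,
    and the row sums of the symmetric weights are bounded.\<close>
  also have "\<dots> \<le> (\<Sum>j<J. \<Sum>l<J. (real m + 1)\<^sup>2 / 2 * (\<kappa> (nat \<bar>int j - int l\<bar>) * (v j)\<^sup>2 + \<kappa> (nat \<bar>int l - int j\<bar>) * (v l)\<^sup>2))"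
  proof (intro sum_mono order_trans[OF pair])
    fix j l
    define k where "k = \<kappa> (nat \<bar>int j - int l\<bar>)"
    have k: "k \<ge> 0" "\<kappa> (nat \<bar>int l - int j\<bar>) = k" using A0 by (auto simp: k_def \<kappa>_def abs_minus_commute)
    have "v j * v l \<le> ((v j)\<^sup>2 + (v l)\<^sup>2) / 2" using sum_squares_ge_zero[of "v j - v l" 0] by (simp add: power2_eq_square algebra_simps)
    then have "(real m + 1)\<^sup>2 * k * (v j * v l) \<le> (real m + 1)\<^sup>2 * k * (((v j)\<^sup>2 + (v l)\<^sup>2) / 2)"
      using k by (intro mult_left_mono) auto
    then show "(real m + 1)\<^sup>2 * \<kappa> (nat \<bar>int j - int l\<bar>) * v j * v l
       \<le> (real m + 1)\<^sup>2 / 2 * (\<kappa> (nat \<bar>int j - int l\<bar>) * (v j)\<^sup>2 + \<kappa> (nat \<bar>int l - int j\<bar>) * (v l)\<^sup>2)"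
      unfolding k(2) k_def[symmetric] by (simp add: algebra_simps)
  qed
  also have "\<dots> = (real m + 1)\<^sup>2 / 2 * ((\<Sum>j<J. \<Sum>l<J. \<kappa> (nat \<bar>int j - int l\<bar>) * (v j)\<^sup>2) + (\<Sum>j<J. \<Sum>l<J. \<kappa> (nat \<bar>int l - int j\<bar>) * (v l)\<^sup>2))"
    by (simp only: sum_distrib_left[symmetric] sum.distrib)
  also have "(\<Sum>j<J. \<Sum>l<J. \<kappa> (nat \<bar>int l - int j\<bar>) * (v l)\<^sup>2) = (\<Sum>j<J. \<Sum>l<J. \<kappa> (nat \<bar>int j - int l\<bar>) * (v j)\<^sup>2)"
    by (rule sum.swap)
  also have "(real m + 1)\<^sup>2 / 2 * ((\<Sum>j<J. \<Sum>l<J. \<kappa> (nat \<bar>int j - int l\<bar>) * (v j)\<^sup>2) + (\<Sum>j<J. \<Sum>l<J. \<kappa> (nat \<bar>int j - int l\<bar>) * (v j)\<^sup>2))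
     = (real m + 1)\<^sup>2 * (\<Sum>j<J. (v j)\<^sup>2 * (\<Sum>l<J. \<kappa> (nat \<bar>int j - int l\<bar>)))"
  proof -
    have "(\<Sum>j<J. \<Sum>l<J. \<kappa> (nat \<bar>int j - int l\<bar>) * (v j)\<^sup>2) = (\<Sum>j<J. (v j)\<^sup>2 * (\<Sum>l<J. \<kappa> (nat \<bar>int j - int l\<bar>)))"
      by (simp only: sum_distrib_left mult.commute)
    then show ?thesis by simp
  qed
  also have "\<dots> \<le> (real m + 1)\<^sup>2 * (\<Sum>j<J. (v j)\<^sup>2 * (4 * A))"
  proof (intro mult_left_mono sum_mono)
    fix j assume j: "j \<in> {..<J}"
    have "(\<Sum>l<J. \<kappa> (nat \<bar>int j - int l\<bar>)) \<le> 2 * (\<Sum>i<J. \<kappa> i)"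
      using j A0 by (intro sum_abs_diff_le) (auto simp: \<kappa>_def)
    also have "(\<Sum>i<J. \<kappa> i) = A * (\<Sum>i<J. 1 / (1 + real i)\<^sup>2)" by (simp only: \<kappa>_def sum_distrib_left)
    also have "2 * (A * (\<Sum>i<J. 1 / (1 + real i)\<^sup>2)) \<le> 2 * (A * 2)"
      using A0 by (intro mult_left_mono sum_inverse_squares_le) auto
    finally show "(\<Sum>l<J. \<kappa> (nat \<bar>int j - int l\<bar>)) \<le> 4 * A" by simp
  qed auto
  also have "\<dots> = (real m + 1) * (4 * A * (real m + 1) * (\<Sum>j<J. (v j)\<^sup>2))"
    by (simp add: sum_distrib_right[symmetric] power2_eq_square)
  finally have "(real m + 1) * (\<Sum>k=m..2 * m. (norm (c (real k)))\<^sup>2) \<le> (real m + 1) * (4 * A * (real m + 1) * (\<Sum>j<J. (v j)\<^sup>2))"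
    using lower by linarith
  then have "(\<Sum>k=m..2 * m. (norm (c (real k)))\<^sup>2) \<le> 4 * A * (real m + 1) * (\<Sum>j<J. (v j)\<^sup>2)"
    using m1 by (simp only: mult_le_cancel_left_pos)
  moreover have "4 * A = 64 + 576 / D\<^sup>2" by (simp add: A_def)
  ultimately show ?thesis by (simp only: c_def v_def I_def)
qed

section \<open>Oscillating integrals over the tail and the head\<close>

text \<open>Shifting by half a period changes the sign of \<open>sin (\<omega> t)\<close>, so the oscillating integral is
  half the integral of a difference of translates.\<close>

lemma half_period_shift:
  fixes u :: "real \<Rightarrow> complex"
  assumes \<omega>: "\<omega> > 0" and u: "integrable lborel u"
  shows "norm (LBINT t. u t * of_real (sin (\<omega> * t))) \<le> 1 / 2 * (LBINT t. norm (u t - u (t + pi / \<omega>)))"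
proof -
  define \<gamma> where "\<gamma> = pi / \<omega>"
  have us: "integrable lborel (\<lambda>t. u (t + \<gamma>))"
    using lborel_integrable_real_affine[OF u, of 1 \<gamma>] by (simp add: add.commute)
  have i: "integrable lborel (\<lambda>t. v t * of_real (sin (\<omega> * t)))" if v: "integrable lborel v" for v :: "real \<Rightarrow> complex"
  proof (rule Bochner_Integration.integrable_bound[OF v])
    have "v \<in> borel_measurable borel" using borel_measurable_integrable[OF v] by simp
    then show "(\<lambda>t. v t * of_real (sin (\<omega> * t))) \<in> borel_measurable lborel" by simp
    show "AE t in lborel. norm (v t * of_real (sin (\<omega> * t))) \<le> norm (v t)"
      by (auto simp: norm_mult mult_left_le)
  qed
  have sg: "sin (\<omega> * (\<gamma> + 1 * t)) = - sin (\<omega> * t)" for t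
  proof -
    have "\<omega> * (\<gamma> + 1 * t) = \<omega> * t + pi" using \<omega> by (simp add: \<gamma>_def field_simps)
    then show ?thesis by simp
  qed
  define I where "I = (LBINT t. u t * of_real (sin (\<omega> * t)))"
  have "I = \<bar>1\<bar> *\<^sub>R (LBINT t. u (\<gamma> + 1 * t) * of_real (sin (\<omega> * (\<gamma> + 1 * t))))"
    unfolding I_def by (rule lborel_integral_real_affine) simp
  also have "\<dots> = - (LBINT t. u (t + \<gamma>) * of_real (sin (\<omega> * t)))"
    unfolding sg by (simp add: add.commute)
  finally have "2 * I = (LBINT t. u t * of_real (sin (\<omega> * t))) - (LBINT t. u (t + \<gamma>) * of_real (sin (\<omega> * t)))"
    by (simp add: I_def)
  also have "\<dots> = (LBINT t. u t * of_real (sin (\<omega> * t)) - u (t + \<gamma>) * of_real (sin (\<omega> * t)))"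
    by (rule Bochner_Integration.integral_diff[symmetric, OF i[OF u] i[OF us]])
  finally have eq: "2 * I = (LBINT t. u t * of_real (sin (\<omega> * t)) - u (t + \<gamma>) * of_real (sin (\<omega> * t)))" .
  have "norm (2 * I) \<le> (LBINT t. norm (u t * of_real (sin (\<omega> * t)) - u (t + \<gamma>) * of_real (sin (\<omega> * t))))"
    unfolding eq by (rule integral_norm_bound)
  also have "\<dots> \<le> (LBINT t. norm (u t - u (t + \<gamma>)))"
  proof (rule integral_mono[OF integrable_norm[OF Bochner_Integration.integrable_diff[OF i[OF u] i[OF us]]]
        integrable_norm[OF Bochner_Integration.integrable_diff[OF u us]]])
    fix t
    have "norm (u t * of_real (sin (\<omega> * t)) - u (t + \<gamma>) * of_real (sin (\<omega> * t))) = norm (u t - u (t + \<gamma>)) * \<bar>sin (\<omega> * t)\<bar>"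
      by (simp only: left_diff_distrib[symmetric] norm_mult norm_of_real)
    then show "norm (u t * of_real (sin (\<omega> * t)) - u (t + \<gamma>) * of_real (sin (\<omega> * t))) \<le> norm (u t - u (t + \<gamma>))"
      by (simp add: mult_left_le)
  qed
  finally show ?thesis by (simp add: I_def \<gamma>_def norm_mult)
qed

text \<open>The slow factor of the kernel changes by order \<gamma> / \<open>t\<^sup>2\<close> under
  a shift by \<gamma>: the sine contributes the Lipschitz constant c, and the relative change of the
  inverse square is at most 2 \<gamma> / T0.\<close>

lemma sin_over_square_diff:
  fixes c t \<gamma> T0 :: real
  assumes "c \<ge> 0" "T0 > 0" "t \<ge> T0" "\<gamma> \<ge> 0"
  shows "\<bar>sin (c * t) / t\<^sup>2 - sin (c * (t + \<gamma>)) / (t + \<gamma>)\<^sup>2\<bar> \<le> (c + 2 / T0) * \<gamma> / t\<^sup>2"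
proof -
  define s where "s = t + \<gamma>"
  have p: "t > 0" "s > 0" "t \<le> s" "T0 \<le> s" using assms by (auto simp: s_def)
  have 1: "\<bar>sin (c * t) - sin (c * s)\<bar> \<le> c * \<gamma>"
  proof -
    have "sin (c * t) - sin (c * s) = 2 * sin ((c * t - c * s) / 2) * cos ((c * t + c * s) / 2)"
      by (rule sin_diff_sin)
    then have "\<bar>sin (c * t) - sin (c * s)\<bar> = 2 * (\<bar>sin ((c * t - c * s) / 2)\<bar> * \<bar>cos ((c * t + c * s) / 2)\<bar>)"
      by (simp add: abs_mult)
    also have "\<dots> \<le> 2 * (\<bar>(c * t - c * s) / 2\<bar> * 1)"
      by (intro mult_left_mono mult_mono abs_sin_x_le_abs_x) auto
    also have "\<dots> = \<bar>c * (t - s)\<bar>" by (simp add: right_diff_distrib)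
    also have "\<dots> = c * \<gamma>" using assms by (simp add: s_def abs_mult)
    finally show ?thesis .
  qed
  have 2: "0 \<le> 1 / t\<^sup>2 - 1 / s\<^sup>2" "1 / t\<^sup>2 - 1 / s\<^sup>2 \<le> 2 / T0 * \<gamma> / t\<^sup>2"
  proof -
    have "t\<^sup>2 \<le> s\<^sup>2" using p by (intro power_mono) auto
    then show "0 \<le> 1 / t\<^sup>2 - 1 / s\<^sup>2" using p by (simp add: frac_le)
    have "1 / t\<^sup>2 - 1 / s\<^sup>2 = (s\<^sup>2 - t\<^sup>2) / s\<^sup>2 / t\<^sup>2" using p by (simp add: field_simps)
    also have "(s\<^sup>2 - t\<^sup>2) / s\<^sup>2 \<le> 2 / T0 * \<gamma>"
    proof -
      have "(s\<^sup>2 - t\<^sup>2) / s\<^sup>2 = (s + t) * \<gamma> / s\<^sup>2" by (simp add: s_def power2_eq_square algebra_simps)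
      also have "\<dots> \<le> (2 * s) * \<gamma> / s\<^sup>2" using p assms by (intro divide_right_mono mult_right_mono) auto
      also have "\<dots> = 2 / s * \<gamma>" using p by (simp add: power2_eq_square)
      also have "\<dots> \<le> 2 / T0 * \<gamma>" using p assms by (intro mult_right_mono divide_left_mono) auto
      finally show ?thesis .
    qed
    finally show "1 / t\<^sup>2 - 1 / s\<^sup>2 \<le> 2 / T0 * \<gamma> / t\<^sup>2" by (simp add: divide_right_mono)
  qed
  have "sin (c * t) / t\<^sup>2 - sin (c * s) / s\<^sup>2 = (sin (c * t) - sin (c * s)) / t\<^sup>2 + sin (c * s) * (1 / t\<^sup>2 - 1 / s\<^sup>2)"
    by (simp add: algebra_simps diff_divide_distrib)
  also have "\<bar>\<dots>\<bar> \<le> \<bar>sin (c * t) - sin (c * s)\<bar> / t\<^sup>2 + \<bar>sin (c * s)\<bar> * (1 / t\<^sup>2 - 1 / s\<^sup>2)"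
    using abs_triangle_ineq[of "(sin (c * t) - sin (c * s)) / t\<^sup>2" "sin (c * s) * (1 / t\<^sup>2 - 1 / s\<^sup>2)"] 2(1)
    by (simp add: abs_mult)
  also have "\<dots> \<le> c * \<gamma> / t\<^sup>2 + 1 * (2 / T0 * \<gamma> / t\<^sup>2)"
    using 1 2 by (intro add_mono divide_right_mono mult_mono) auto
  also have "\<dots> = (c + 2 / T0) * \<gamma> / t\<^sup>2" by (simp add: add_divide_distrib distrib_right)
  finally show ?thesis by (simp add: s_def)
qed

text \<open>The difference of translates of the cut-off product splits into the change of \<phi>,
  controlled by W, the change of the slow factor, of order \<gamma>, and an edge interval of length
  \<gamma> where only one of the two translates is cut off. The number C0 converts 1 /
  \<open>t\<^sup>2\<close> into 1 / \<open>(1 + t)\<^sup>2\<close> for t >= T0, the weight for which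
  mean bounds on [0, X] give an integral bound.\<close>

lemma tail_bound:
  fixes \<phi> :: "real \<Rightarrow> complex"
  assumes \<phi>m [measurable]: "\<phi> \<in> borel_measurable borel" and B: "\<And>t. norm (\<phi> t) \<le> B"
    and T0: "T0 > 0" and c: "c \<ge> 0" and \<omega>: "\<omega> > 0"
    and W: "\<And>X. X \<ge> 0 \<Longrightarrow> integral {0..X} (\<lambda>t. norm (\<phi> t - \<phi> (t + pi / \<omega>))) \<le> W * X" and W0: "W \<ge> 0"
  shows "norm (LBINT t. indicator {T0..} t *\<^sub>R (\<phi> t * of_real (sin (c * t) / t\<^sup>2)) * of_real (sin (\<omega> * t)))
     \<le> (1 + 1 / T0)\<^sup>2 * W + ((1 + 1 / T0)\<^sup>2 * B * (c + 2 / T0) + B / T0\<^sup>2) * (pi / \<omega>)"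
proof -
  define \<gamma> where "\<gamma> = pi / \<omega>"
  have \<gamma>: "\<gamma> > 0" using \<omega> by (simp add: \<gamma>_def)
  define C0 where "C0 = (1 + 1 / T0)\<^sup>2"
  have C0: "C0 \<ge> 0" by (simp add: C0_def)
  have B0: "B \<ge> 0" using order_trans[OF norm_ge_zero B[of 0]] .
  define k where "k = (\<lambda>t. sin (c * t) / t\<^sup>2)"
  have km [measurable]: "k \<in> borel_measurable borel" unfolding k_def by measurable
  have kb: "\<bar>k t\<bar> \<le> 1 / t\<^sup>2" for t by (simp add: k_def divide_right_mono)
  define u where "u = (\<lambda>t. indicator {T0..} t *\<^sub>R (\<phi> t * of_real (k t)))"
  have um [measurable]: "u \<in> borel_measurable borel" unfolding u_def by measurable
  have inv: "1 / t\<^sup>2 \<le> C0 * (1 / (1 + t)\<^sup>2)" if "t \<ge> T0" for t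
  proof -
    have t: "t > 0" using that T0 by simp
    have "(1 + t) / t \<le> 1 + 1 / T0" using t T0 that by (simp add: add_divide_distrib frac_le)
    then have "((1 + t) / t)\<^sup>2 \<le> C0" unfolding C0_def using t by (intro power_mono) auto
    then have "((1 + t) / t)\<^sup>2 * (1 / (1 + t)\<^sup>2) \<le> C0 * (1 / (1 + t)\<^sup>2)" by (intro mult_right_mono) auto
    moreover have "((1 + t) / t)\<^sup>2 * (1 / (1 + t)\<^sup>2) = 1 / t\<^sup>2" using t by (simp add: power_divide)
    ultimately show ?thesis by simp
  qed
  define q where "q = (\<lambda>t::real. indicator {0..} t * (1 / (1 + t)\<^sup>2))"
  have q: "integrable lborel q" "integral\<^sup>L lborel q \<le> 2 * 1"
  proof -
    have "(\<lambda>_. 1 :: real) integrable_on {0..X}" "integral {0..X} (\<lambda>_. 1 :: real) \<le> 1 * (X + 1)" if "0 \<le> X" for X :: real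
      using that by auto
    note weighted_integral_bound[OF borel_measurable_const _ this, simplified]
    then show "integrable lborel q" "integral\<^sup>L lborel q \<le> 2 * 1" unfolding q_def by auto
  qed
  define F where "F = (\<lambda>t. norm (\<phi> t - \<phi> (t + \<gamma>)))"
  have Fm [measurable]: "F \<in> borel_measurable borel" unfolding F_def by measurable
  have Fb: "norm (F t) \<le> B + B" for t
    unfolding F_def real_norm_def abs_norm_cancel by (intro order_trans[OF norm_triangle_ineq4 add_mono] B)
  define p where "p = (\<lambda>t::real. indicator {0..} t * (F t / (1 + t)\<^sup>2))"
  have p: "integrable lborel p" "integral\<^sup>L lborel p \<le> 2 * W"
  proof -
    have "integral {0..X} F \<le> W * (X + 1)" if "0 \<le> X" for X
      using W[OF that] W0 by (simp add: F_def \<gamma>_def distrib_left)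
    from weighted_integral_bound[OF Fm _ bounded_borel_integrable_on[OF Fm Fb] this]
    show "integrable lborel p" "integral\<^sup>L lborel p \<le> 2 * W" unfolding p_def by (auto simp: F_def)
  qed
  \<comment> \<open>The edge interval: here t is below the cut-off while t + \<gamma> may be beyond
    it.\<close>
  define r where "r = (indicator {T0 - \<gamma>..T0} :: real \<Rightarrow> real)"
  have r: "integrable lborel r" "integral\<^sup>L lborel r = \<gamma>"
    unfolding r_def using \<gamma> by (auto simp: emeasure_lborel_Icc_eq intro!: integrable_real_indicator)
  have ui: "integrable lborel u"
  proof (rule Bochner_Integration.integrable_bound[OF integrable_mult_right[OF q(1), of "B * C0"]])
    show "AE t in lborel. norm (u t) \<le> norm (B * C0 * q t)"
    proof (intro AE_I2)
      fix t
      show "norm (u t) \<le> norm (B * C0 * q t)"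
      proof (cases "t \<ge> T0")
        case True
        have "norm (u t) = norm (\<phi> t) * \<bar>k t\<bar>" using True by (simp add: u_def norm_mult)
        also have "\<dots> \<le> B * (C0 * (1 / (1 + t)\<^sup>2))"
          by (intro mult_mono B order_trans[OF kb inv] True B0) auto
        finally show ?thesis using True T0 B0 C0 by (simp add: q_def)
      qed (simp add: u_def)
    qed
  qed simp
  have diff: "norm (u t - u (t + \<gamma>)) \<le> C0 * p t + B * (c + 2 / T0) * \<gamma> * C0 * q t + B / T0\<^sup>2 * r t" for t
  proof -
    have nn: "C0 * p t \<ge> 0" "B * (c + 2 / T0) * \<gamma> * C0 * q t \<ge> 0" "B / T0\<^sup>2 * r t \<ge> 0"
      using C0 B0 c T0 \<gamma> by (auto simp: p_def q_def r_def F_def)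
    consider "t \<ge> T0" | "t < T0" "t + \<gamma> \<ge> T0" | "t + \<gamma> < T0" by linarith
    then show ?thesis
    proof cases
      case 1
      have "u t - u (t + \<gamma>) = (\<phi> t - \<phi> (t + \<gamma>)) * of_real (k t) + \<phi> (t + \<gamma>) * of_real (k t - k (t + \<gamma>))"
        using 1 \<gamma> by (simp add: u_def algebra_simps)
      also have "norm \<dots> \<le> F t * \<bar>k t\<bar> + norm (\<phi> (t + \<gamma>)) * \<bar>k t - k (t + \<gamma>)\<bar>"
        by (rule norm_triangle_le) (simp only: norm_mult norm_of_real F_def)
      also have "\<dots> \<le> F t * (C0 * (1 / (1 + t)\<^sup>2)) + B * ((c + 2 / T0) * \<gamma> * (C0 * (1 / (1 + t)\<^sup>2)))"
      proof (intro add_mono mult_mono B B0)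
        show "\<bar>k t\<bar> \<le> C0 * (1 / (1 + t)\<^sup>2)" by (rule order_trans[OF kb inv[OF 1]])
        have "\<bar>k t - k (t + \<gamma>)\<bar> \<le> (c + 2 / T0) * \<gamma> * (1 / t\<^sup>2)"
          using sin_over_square_diff[OF c T0 1 less_imp_le[OF \<gamma>]] by (simp add: k_def)
        also have "\<dots> \<le> (c + 2 / T0) * \<gamma> * (C0 * (1 / (1 + t)\<^sup>2))"
          using c T0 \<gamma> by (intro mult_left_mono inv 1) auto
        finally show "\<bar>k t - k (t + \<gamma>)\<bar> \<le> (c + 2 / T0) * \<gamma> * (C0 * (1 / (1 + t)\<^sup>2))" .
      qed (auto simp: F_def)
      also have "\<dots> = C0 * p t + B * (c + 2 / T0) * \<gamma> * C0 * q t"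
      proof -
        have "p t = F t * (1 / (1 + t)\<^sup>2)" "q t = 1 / (1 + t)\<^sup>2" using 1 T0 by (simp_all add: p_def q_def)
        then show ?thesis by (simp only: mult_ac)
      qed
      finally show ?thesis using nn(3) by linarith
    next
      case 2
      have "u t - u (t + \<gamma>) = - (\<phi> (t + \<gamma>) * of_real (k (t + \<gamma>)))" using 2 by (simp add: u_def)
      then have "norm (u t - u (t + \<gamma>)) = norm (\<phi> (t + \<gamma>)) * \<bar>k (t + \<gamma>)\<bar>" by (simp add: norm_mult)
      also have "\<dots> \<le> B * (1 / T0\<^sup>2)"
      proof (intro mult_mono B B0)
        have "T0\<^sup>2 \<le> (t + \<gamma>)\<^sup>2" using 2 T0 by (intro power_mono) auto
        then have "1 / (t + \<gamma>)\<^sup>2 \<le> 1 / T0\<^sup>2" using T0 by (intro frac_le) auto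
        then show "\<bar>k (t + \<gamma>)\<bar> \<le> 1 / T0\<^sup>2" using kb[of "t + \<gamma>"] by linarith
      qed auto
      also have "\<dots> = B / T0\<^sup>2 * r t" using 2 by (simp add: r_def)
      finally show ?thesis using nn by linarith
    next
      case 3
      then have "u t - u (t + \<gamma>) = 0" using \<gamma> by (simp add: u_def)
      then show ?thesis using nn by simp
    qed
  qed
  have us: "integrable lborel (\<lambda>t. u (t + \<gamma>))"
    using lborel_integrable_real_affine[OF ui, of 1 \<gamma>] by (simp add: add.commute)
  have bi: "integrable lborel (\<lambda>t. C0 * p t + B * (c + 2 / T0) * \<gamma> * C0 * q t + B / T0\<^sup>2 * r t)"
    by (intro Bochner_Integration.integrable_add integrable_mult_right p q r)
  have "(LBINT t. norm (u t - u (t + \<gamma>))) \<le> (LBINT t. C0 * p t + B * (c + 2 / T0) * \<gamma> * C0 * q t + B / T0\<^sup>2 * r t)"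
    by (rule integral_mono[OF integrable_norm[OF Bochner_Integration.integrable_diff[OF ui us]] bi diff])
  also have "\<dots> = C0 * integral\<^sup>L lborel p + B * (c + 2 / T0) * \<gamma> * C0 * integral\<^sup>L lborel q + B / T0\<^sup>2 * \<gamma>"
    using p q r by simp
  also have "\<dots> \<le> C0 * (2 * W) + B * (c + 2 / T0) * \<gamma> * C0 * (2 * 1) + B / T0\<^sup>2 * \<gamma>"
    using p q C0 B0 c T0 \<gamma> by (intro add_mono mult_left_mono order_refl) auto
  finally have fin: "(LBINT t. norm (u t - u (t + pi / \<omega>))) \<le> C0 * (2 * W) + B * (c + 2 / T0) * \<gamma> * C0 * (2 * 1) + B / T0\<^sup>2 * \<gamma>"
    by (simp only: \<gamma>_def)
  have "norm (LBINT t. u t * of_real (sin (\<omega> * t))) \<le> 1 / 2 * (C0 * (2 * W) + B * (c + 2 / T0) * \<gamma> * C0 * (2 * 1) + B / T0\<^sup>2 * \<gamma>)"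
    by (rule order_trans[OF half_period_shift[OF \<omega> ui] mult_left_mono[OF fin]]) simp
  also have "\<dots> \<le> C0 * W + (C0 * B * (c + 2 / T0) + B / T0\<^sup>2) * \<gamma>"
  proof -
    have "B / T0\<^sup>2 * \<gamma> \<ge> 0" using B0 \<gamma> by simp
    moreover have "(C0 * B * (c + 2 / T0) + B / T0\<^sup>2) * \<gamma> = B * (c + 2 / T0) * \<gamma> * C0 + B / T0\<^sup>2 * \<gamma>" by (simp add: algebra_simps)
    moreover have "1 / 2 * (C0 * (2 * W) + z * (2 * 1) + y) \<le> C0 * W + (z + y)" if "0 \<le> y" for y z
      using that by (simp add: field_simps)
    ultimately show ?thesis by metis
  qed
  finally show ?thesis by (simp only: u_def k_def C0_def \<gamma>_def)
qed

text \<open>At \<open>t = 0\<close> the kernel has the junk value \<open>0\<close>, so the two half lines may share this point.\<close>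

lemma vp_mean_minus_const:
  assumes ab: "0 \<le> a" "a < b" and g [measurable]: "g \<in> borel_measurable borel" and B: "\<And>t. norm (g t) \<le> B"
  shows "vp_mean a b g x - y = (LBINT t. indicator {0..} t *\<^sub>R (of_real (vp_kernel a b t) * (g (x + t) + g (x - t) - 2 * y)))"
    and "integrable lborel (\<lambda>t. indicator {0..} t *\<^sub>R (of_real (vp_kernel a b t) * (g (x + t) + g (x - t) - 2 * y)))"
proof -
  define H where "H = (\<lambda>t. of_real (vp_kernel a b t) * g (x + t) - of_real (vp_kernel a b t) * y)"
  have Ig: "integrable lborel (\<lambda>t. of_real (vp_kernel a b t) * g (x + t))" by (rule vp_mean_integrable[OF ab g B])
  have hy: "has_bochner_integral lborel (\<lambda>t. of_real (vp_kernel a b t) * y) y"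
    using has_bochner_integral_mult_left[OF vp_kernel_cis[OF ab, of 0], of y] trapezoid_eq_1[OF ab(2), of 0] ab(1)
    by simp
  then have Iy: "integrable lborel (\<lambda>t. of_real (vp_kernel a b t) * y)" "(LBINT t. of_real (vp_kernel a b t) * y) = y"
    by (auto simp: has_bochner_integral_iff)
  have HI: "integrable lborel H" unfolding H_def by (rule Bochner_Integration.integrable_diff[OF Ig Iy(1)])
  have Hv: "integral\<^sup>L lborel H = vp_mean a b g x - y"
    unfolding H_def Bochner_Integration.integral_diff[OF Ig Iy(1)] Iy(2) vp_mean_def ..
  have H0: "H 0 = 0" by (simp add: H_def vp_kernel_def)
  define P where "P = (\<lambda>t. indicator {0..} t *\<^sub>R H t)"
  define Q where "Q = (\<lambda>t. indicator {0..} t *\<^sub>R H (- t))"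
  have P: "integrable lborel P" unfolding P_def
    by (rule integrable_mult_indicator[OF _ HI]) simp
  have Hm: "integrable lborel (\<lambda>t. H (- t))" using lborel_integrable_real_affine[OF HI, of "-1" 0] by simp
  have Q: "integrable lborel Q" unfolding Q_def by (rule integrable_mult_indicator[OF _ Hm]) simp
  have Q': "integrable lborel (\<lambda>t. Q (0 + (-1) * t))" "(LBINT t. Q (0 + (-1) * t)) = integral\<^sup>L lborel Q"
    using lborel_integrable_real_affine[OF Q, of "-1" 0] lborel_integral_real_affine[of "-1" Q 0] by auto
  have "H t = P t + Q (0 + (-1) * t)" for t
    using H0 by (cases "t = 0") (auto simp: P_def Q_def indicator_def)
  then have "integral\<^sup>L lborel H = (LBINT t. P t + Q (0 + (-1) * t))" by presburger
  also have "\<dots> = integral\<^sup>L lborel P + integral\<^sup>L lborel Q"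
    by (simp only: Bochner_Integration.integral_add[OF P Q'(1)] Q'(2))
  also have "\<dots> = (LBINT t. P t + Q t)" by (rule Bochner_Integration.integral_add[symmetric, OF P Q])
  finally have 1: "vp_mean a b g x - y = (LBINT t. P t + Q t)" using Hv by simp
  have PQ: "P t + Q t = indicator {0..} t *\<^sub>R (of_real (vp_kernel a b t) * (g (x + t) + g (x - t) - 2 * y))" for t
    by (simp add: P_def Q_def H_def algebra_simps)
  show "vp_mean a b g x - y = (LBINT t. indicator {0..} t *\<^sub>R (of_real (vp_kernel a b t) * (g (x + t) + g (x - t) - 2 * y)))"
    using 1 unfolding PQ .
  show "integrable lborel (\<lambda>t. indicator {0..} t *\<^sub>R (of_real (vp_kernel a b t) * (g (x + t) + g (x - t) - 2 * y)))"
    using Bochner_Integration.integrable_add[OF P Q] unfolding PQ .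
qed

text \<open>The factors in front of the exponentials do not depend on k. After multiplication by
  \<phi> the integrals become values of one fixed transform at the points \<alpha> k / 2, to which
  \<open>large_sieve\<close> applies.\<close>

lemma vp_kernel_sum_cis:
  assumes "\<alpha> > 0"
  shows "complex_of_real (vp_kernel (\<alpha> * real k / 2) (\<alpha> * (real k + 1) / 2) t)
    = (1 - cis (\<alpha> / 2 * t)) / of_real (pi * \<alpha> * t\<^sup>2) * cis (\<alpha> / 2 * real k * t)
     + (1 - cis (- (\<alpha> / 2 * t))) / of_real (pi * \<alpha> * t\<^sup>2) * cis (- (\<alpha> / 2 * real k * t))"
proof -
  have "(1 - cis \<theta>) * cis x + (1 - cis (- \<theta>)) * cis (- x) = of_real (2 * (cos x - cos (x + \<theta>)))" for x \<theta> :: real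
    by (simp add: complex_eq_iff cos_add sin_add algebra_simps)
  note eq = this[of "\<alpha> / 2 * t" "\<alpha> / 2 * real k * t"]
  have "(1 - cis (\<alpha> / 2 * t)) / of_real (pi * \<alpha> * t\<^sup>2) * cis (\<alpha> / 2 * real k * t)
     + (1 - cis (- (\<alpha> / 2 * t))) / of_real (pi * \<alpha> * t\<^sup>2) * cis (- (\<alpha> / 2 * real k * t))
     = ((1 - cis (\<alpha> / 2 * t)) * cis (\<alpha> / 2 * real k * t) + (1 - cis (- (\<alpha> / 2 * t))) * cis (- (\<alpha> / 2 * real k * t))) / of_real (pi * \<alpha> * t\<^sup>2)"
    by (simp only: add_divide_distrib times_divide_eq_left)
  also have "\<dots> = of_real (2 * (cos (\<alpha> / 2 * real k * t) - cos (\<alpha> / 2 * real k * t + \<alpha> / 2 * t)) / (pi * \<alpha> * t\<^sup>2))"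
    unfolding eq by (simp only: of_real_divide)
  also have "2 * (cos (\<alpha> / 2 * real k * t) - cos (\<alpha> / 2 * real k * t + \<alpha> / 2 * t)) / (pi * \<alpha> * t\<^sup>2)
     = vp_kernel (\<alpha> * real k / 2) (\<alpha> * (real k + 1) / 2) t"
  proof -
    have "\<alpha> * (real k + 1) / 2 - \<alpha> * real k / 2 = \<alpha> / 2" by (simp add: algebra_simps diff_divide_distrib[symmetric])
    moreover have "\<alpha> * (real k + 1) / 2 * t = \<alpha> / 2 * real k * t + \<alpha> / 2 * t" "\<alpha> * real k / 2 * t = \<alpha> / 2 * real k * t"
      by (simp_all add: algebra_simps add_divide_distrib)
    moreover have "2 * z / (pi * \<alpha> * t\<^sup>2) = z / (pi * (\<alpha> / 2) * t\<^sup>2)" for z by (simp add: mult_ac)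
    ultimately show ?thesis unfolding vp_kernel_def by metis
  qed
  finally show ?thesis by (rule sym)
qed

text \<open>The slow factor sin (\<alpha> t / 4) / \<open>t\<^sup>2\<close> is the same for all k,
  and the fast sine has frequency (2 k + 1) \<alpha> / 4. This is the form in which
  \<open>tail_bound\<close> uses the kernel.\<close>

lemma vp_kernel_sin_form:
  assumes "\<alpha> > 0"
  shows "vp_kernel (\<alpha> * real k / 2) (\<alpha> * (real k + 1) / 2) t
    = 4 / (pi * \<alpha>) * (sin (\<alpha> / 4 * t) / t\<^sup>2) * sin ((2 * real k + 1) * \<alpha> / 4 * t)"
proof -
  have ba: "\<alpha> * (real k + 1) / 2 - \<alpha> * real k / 2 = \<alpha> / 2" by (simp add: algebra_simps diff_divide_distrib[symmetric])
  have st: "(\<alpha> * real k / 2 + \<alpha> * (real k + 1) / 2) / 2 * t = (2 * real k + 1) * \<alpha> / 4 * t"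
    by (simp add: algebra_simps add_divide_distrib)
  have q: "\<alpha> / 2 / 2 = \<alpha> / 4" by simp
  have "2 * u * v / (pi * (\<alpha> / 2) * z) = 4 / (pi * \<alpha>) * (v / z) * u" for u v z :: real by (simp add: mult_ac)
  then show ?thesis unfolding vp_kernel_eq_sin st ba q .
qed

text \<open>The height of the kernel near 0 is of order k, from |sin u| <= |u| in both factors; this
  is the bound for the interval closest to 0.\<close>

lemma abs_vp_kernel_le:
  assumes "\<alpha> > 0"
  shows "\<bar>vp_kernel (\<alpha> * real k / 2) (\<alpha> * (real k + 1) / 2) t\<bar> \<le> (2 * real k + 1) * \<alpha> / (4 * pi)"
proof (cases "t = 0")
  case False
  then have t2: "t\<^sup>2 > 0" by simp
  have "\<bar>vp_kernel (\<alpha> * real k / 2) (\<alpha> * (real k + 1) / 2) t\<bar>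
     = 4 / (pi * \<alpha>) * (\<bar>sin (\<alpha> / 4 * t)\<bar> * \<bar>sin ((2 * real k + 1) * \<alpha> / 4 * t)\<bar> / t\<^sup>2)"
    using assms by (simp add: vp_kernel_sin_form[OF assms] abs_mult)
  also have "\<dots> \<le> 4 / (pi * \<alpha>) * (\<bar>\<alpha> / 4 * t\<bar> * \<bar>(2 * real k + 1) * \<alpha> / 4 * t\<bar> / t\<^sup>2)"
    using assms by (intro mult_left_mono divide_right_mono mult_mono abs_sin_x_le_abs_x) auto
  also have "\<bar>\<alpha> / 4 * t\<bar> * \<bar>(2 * real k + 1) * \<alpha> / 4 * t\<bar> / t\<^sup>2 = \<alpha> / 4 * ((2 * real k + 1) * \<alpha> / 4)"
  proof -
    have "\<bar>\<alpha> / 4 * t\<bar> * \<bar>(2 * real k + 1) * \<alpha> / 4 * t\<bar> = \<alpha> / 4 * ((2 * real k + 1) * \<alpha> / 4) * (\<bar>t\<bar> * \<bar>t\<bar>)"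
      using assms by (simp add: abs_mult)
    then show ?thesis using False by (simp add: power2_eq_square)
  qed
  also have "4 / (pi * \<alpha>) * (\<alpha> / 4 * ((2 * real k + 1) * \<alpha> / 4)) = (2 * real k + 1) * \<alpha> / (4 * pi)"
    using assms by simp
  finally show ?thesis .
qed (use assms in \<open>simp add: vp_kernel_def\<close>)

text \<open>The interval is cut at \<delta> = pi / (m + 1). Below \<delta> the kernel is of order 1
  / \<delta>, so every single integral is bounded by the first term of the sum in G. Above \<delta>
  the factors free of k are at most 1 / (2 pi t), which on cell j >= 1 is at most 1 / ((j + 1)
  \<delta>): these are the weights of \<open>G21\<close>. The large sieve applies with \<beta> =
  \<alpha> / 2 and D = \<alpha> pi / 2, since (m + 1) \<delta> = pi.\<close>

lemma head_bound:
  fixes \<phi> :: "real \<Rightarrow> complex"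
  assumes \<phi>m [measurable]: "\<phi> \<in> borel_measurable borel" and B: "\<And>t. norm (\<phi> t) \<le> B" and \<alpha>: "\<alpha> > 0"
    and \<delta>: "\<delta> = pi / (real m + 1)" and J: "J = nat \<lfloor>pi / (\<alpha> * \<delta>)\<rfloor> + 1"
    and G: "(\<Sum>j<J. (1 / ((real j + 1) * \<delta>) * integral {real j * \<delta>..(real j + 1) * \<delta>} (\<lambda>t. norm (\<phi> t)))\<^sup>2) \<le> \<Gamma>\<^sup>2"
    and \<Gamma>: "\<Gamma> \<ge> 0"
  shows "(\<Sum>k=m..2 * m. (norm (LBINT t. indicator {0..<pi / \<alpha>} t *\<^sub>R
        (of_real (vp_kernel (\<alpha> * real k / 2) (\<alpha> * (real k + 1) / 2) t) * \<phi> t)))\<^sup>2)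
     \<le> (2 * \<alpha>\<^sup>2 + 8 * (64 + 576 / (\<alpha> * pi / 2)\<^sup>2)) * (real m + 1) * \<Gamma>\<^sup>2"
proof -
  have B0: "B \<ge> 0" using order_trans[OF norm_ge_zero B[of 0]] .
  have \<delta>0: "\<delta> > 0" by (simp add: \<delta>)
  define \<Psi> where "\<Psi> = (\<lambda>k::nat. vp_kernel (\<alpha> * real k / 2) (\<alpha> * (real k + 1) / 2))"
  have \<Psi>m [measurable]: "\<Psi> k \<in> borel_measurable borel" for k by (simp add: \<Psi>_def)
  define V where "V = (\<lambda>j::nat. integral {real j * \<delta>..(real j + 1) * \<delta>} (\<lambda>t. norm (\<phi> t)))"
  have \<phi>i: "(\<lambda>t. norm (\<phi> t)) integrable_on {p..q}" for p q
    by (rule bounded_borel_integrable_on[where B = B]) (use B in auto)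
  have V0: "V j \<ge> 0" for j unfolding V_def by (rule integral_nonneg[OF \<phi>i]) simp
  define c where "c = (\<lambda>s t. (1 - cis (s * (\<alpha> / 2 * t))) / of_real (pi * \<alpha> * t\<^sup>2))"
  have cm [measurable]: "c s \<in> borel_measurable borel" for s unfolding c_def by measurable
  have cb: "norm (c s t) \<le> 1 / (2 * pi * t)" if "t > 0" "\<bar>s\<bar> = 1" for s t
  proof -
    have "norm (1 - cis (s * (\<alpha> / 2 * t))) \<le> \<alpha> / 2 * t"
      using norm_cis_minus_one_le[of "s * (\<alpha> / 2 * t)"] that \<alpha> by (simp add: norm_minus_commute abs_mult)
    then have "norm (c s t) \<le> (\<alpha> / 2 * t) / (pi * \<alpha> * t\<^sup>2)"
    proof -
      have "norm (complex_of_real (pi * \<alpha> * t\<^sup>2)) = pi * \<alpha> * t\<^sup>2" unfolding norm_of_real using \<alpha> by simp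
      then show ?thesis unfolding c_def norm_divide
        using \<open>norm (1 - cis (s * (\<alpha> / 2 * t))) \<le> \<alpha> / 2 * t\<close> \<alpha> by (simp only:) (intro divide_right_mono, auto)
    qed
    also have "\<dots> = 1 / (2 * pi * t)" using that \<alpha> by (simp add: power2_eq_square)
    finally show ?thesis .
  qed
  define far where "far = (indicator {\<delta><..<pi / \<alpha>} :: real \<Rightarrow> real)"
  \<comment> \<open>Defined as a difference so that the two parts add up even when \<delta> exceeds
    pi / \<alpha> and the far part is empty.\<close>
  define near where "near = (\<lambda>t::real. indicator {0..<pi / \<alpha>} t - far t)"
  have fm [measurable]: "far \<in> borel_measurable borel" by (simp add: far_def)
  have nm [measurable]: "near \<in> borel_measurable borel" unfolding near_def by measurable
  have nn: "0 \<le> near t" "near t \<le> indicator {0..\<delta>} t" for t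
    using \<delta>0 by (auto simp: near_def far_def indicator_def)
  define \<psi> where "\<psi> = (\<lambda>s t. far t *\<^sub>R (\<phi> t * c s t))"
  have \<psi>m [measurable]: "\<psi> s \<in> borel_measurable borel" for s unfolding \<psi>_def by measurable
  have \<psi>b: "norm (\<psi> s t) \<le> far t * (norm (\<phi> t) * (1 / (2 * pi * t)))" if "\<bar>s\<bar> = 1" for s t
  proof (cases "far t = 0")
    case False
    then have ft: "0 < t" "far t = 1" using \<delta>0 by (auto simp: far_def indicator_def split: if_splits)
    have "norm (\<phi> t) * norm (c s t) \<le> norm (\<phi> t) * (1 / (2 * pi * t))" by (intro mult_left_mono cb ft that) auto
    then show ?thesis by (simp add: \<psi>_def ft norm_mult)
  qed (simp add: \<psi>_def)
  have \<psi>B: "norm (\<psi> s t) \<le> B * (1 / (2 * pi * \<delta>))" if "\<bar>s\<bar> = 1" for s t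
  proof (cases "far t = 0")
    case False
    then have t: "\<delta> < t" by (auto simp: far_def indicator_def split: if_splits)
    have "norm (\<psi> s t) \<le> norm (\<phi> t) * (1 / (2 * pi * t))" using \<psi>b[OF that, of t] False by (auto simp: far_def indicator_def split: if_splits)
    also have "\<dots> \<le> B * (1 / (2 * pi * \<delta>))" using t \<delta>0 B0 by (intro mult_mono B frac_le) auto
    finally show ?thesis .
  qed (use B0 \<delta>0 in \<open>simp add: \<psi>_def\<close>)
  \<comment> \<open>The summation in \<open>G21\<close> includes its last index, so J is the floor
    plus one and the cells cover the whole head.\<close>
  have Jd: "pi / \<alpha> \<le> real J * \<delta>"
  proof -
    have "pi / (\<alpha> * \<delta>) \<le> real J" unfolding J by linarith
    then show ?thesis using \<alpha> \<delta>0 by (simp add: field_simps)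
  qed
  have vj: "integral {real j * \<delta>..(real j + 1) * \<delta>} (\<lambda>t. norm (\<psi> s t)) \<le> 1 / ((real j + 1) * \<delta>) * V j"
    and vj0: "0 \<le> integral {real j * \<delta>..(real j + 1) * \<delta>} (\<lambda>t. norm (\<psi> s t))" if s: "\<bar>s\<bar> = 1" for s j
  proof -
    have \<psi>i: "(\<lambda>t. norm (\<psi> s t)) integrable_on {p..q}" for p q
      by (rule bounded_borel_integrable_on[where B = "B * (1 / (2 * pi * \<delta>))"]) (use \<psi>B[OF s] in auto)
    show "0 \<le> integral {real j * \<delta>..(real j + 1) * \<delta>} (\<lambda>t. norm (\<psi> s t))" by (rule integral_nonneg[OF \<psi>i]) simp
    have "norm (\<psi> s t) \<le> 1 / ((real j + 1) * \<delta>) * norm (\<phi> t)" if t: "t \<in> {real j * \<delta>..(real j + 1) * \<delta>}" for t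
    proof (cases "far t = 0")
      case False
      then have ft: "\<delta> < t" "far t = 1" by (auto simp: far_def indicator_def split: if_splits)
      \<comment> \<open>The far part starts strictly above \<delta>, so cell 0 does not meet it. For
        j >= 1 one has j + 1 <= 2 j, which compares t with the right end of its cell.\<close>
      have "j \<ge> 1" using ft(1) t by (cases j) auto
      then have "(real j + 1) * \<delta> \<le> (2 * real j) * \<delta>" using \<delta>0 by (intro mult_right_mono) auto
      also have "\<dots> \<le> 2 * t" using t by simp
      also have "\<dots> \<le> 2 * pi * t" using ft(1) \<delta>0 pi_ge_two by simp
      finally have "1 / (2 * pi * t) \<le> 1 / ((real j + 1) * \<delta>)" using \<delta>0 by (intro frac_le) auto
      then have "norm (\<phi> t) * (1 / (2 * pi * t)) \<le> norm (\<phi> t) * (1 / ((real j + 1) * \<delta>))" by (rule mult_left_mono) simp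
      then show ?thesis using \<psi>b[OF s, of t] ft(2) by (simp add: mult.commute)
    qed (use \<delta>0 in \<open>simp add: \<psi>_def\<close>)
    then have "integral {real j * \<delta>..(real j + 1) * \<delta>} (\<lambda>t. norm (\<psi> s t))
       \<le> integral {real j * \<delta>..(real j + 1) * \<delta>} (\<lambda>t. 1 / ((real j + 1) * \<delta>) * norm (\<phi> t))"
      by (intro integral_le \<psi>i integrable_on_mult_right \<phi>i)
    also have "\<dots> = 1 / ((real j + 1) * \<delta>) * V j" by (simp only: integral_mult_right V_def)
    finally show "integral {real j * \<delta>..(real j + 1) * \<delta>} (\<lambda>t. norm (\<psi> s t)) \<le> 1 / ((real j + 1) * \<delta>) * V j" .
  qed
  define CL where "CL = 64 + 576 / (\<alpha> * pi / 2)\<^sup>2"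
  have CL: "CL \<ge> 0" by (simp add: CL_def)
  define I1 where "I1 = (\<lambda>k::nat. integral {0..real J * \<delta>} (\<lambda>t. \<psi> 1 t * cis (\<alpha> / 2 * real k * t)))"
  define I2 where "I2 = (\<lambda>k::nat. integral {0..real J * \<delta>} (\<lambda>t. \<psi> (-1) t * cis (- (\<alpha> / 2 * real k * t))))"
  have ls: "(\<Sum>k=m..2 * m. (norm (integral {0..real J * \<delta>} (\<lambda>t. h t * cis (\<alpha> / 2 * real k * t))))\<^sup>2) \<le> CL * (real m + 1) * \<Gamma>\<^sup>2"
    if h: "h \<in> borel_measurable borel" "\<And>t. norm (h t) = norm (\<psi> s t)" and s: "\<bar>s\<bar> = 1" for h s
  proof -
    have supp: "0 \<le> t \<and> t \<le> pi / \<alpha>" if "h t \<noteq> 0" for t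
    proof -
      have "\<psi> s t \<noteq> 0" using that h(2)[of t] by auto
      then have "far t \<noteq> 0" by (auto simp: \<psi>_def)
      then show ?thesis using \<delta>0 by (auto simp: far_def indicator_def split: if_splits)
    qed
    have hB: "norm (h t) \<le> B * (1 / (2 * pi * \<delta>))" for t using \<psi>B[OF s, of t] h(2)[of t] by simp
    have D1: "(real m + 1) * (\<alpha> / 2) * \<delta> \<ge> \<alpha> * pi / 2"
    proof -
      have "(real m + 1) * \<delta> = pi"
      proof -
        have "z * (pi / z) = pi" if "z \<noteq> 0" for z :: real using that by simp
        moreover have "real m + 1 \<noteq> 0" by linarith
        ultimately show ?thesis unfolding \<delta> by blast
      qed
      moreover have "(real m + 1) * (\<alpha> / 2) * \<delta> = \<alpha> / 2 * ((real m + 1) * \<delta>)" by (simp only: mult_ac)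
      ultimately have "(real m + 1) * (\<alpha> / 2) * \<delta> = \<alpha> / 2 * pi" by metis
      then show ?thesis by linarith
    qed
    have "(\<Sum>k=m..2 * m. (norm (integral {0..real J * \<delta>} (\<lambda>t. h t * cis (\<alpha> / 2 * real k * t))))\<^sup>2)
       \<le> (64 + 576 / (\<alpha> * pi / 2)\<^sup>2) * (real m + 1) * (\<Sum>j<J. (integral {real j * \<delta>..(real j + 1) * \<delta>} (\<lambda>t. norm (h t)))\<^sup>2)"
      by (rule large_sieve[OF h(1) hB supp _ _ \<delta>0 D1]) (use \<alpha> in auto)
    also have "\<dots> \<le> CL * (real m + 1) * \<Gamma>\<^sup>2"
      unfolding CL_def[symmetric]
    proof (intro mult_left_mono)
      have "(\<Sum>j<J. (integral {real j * \<delta>..(real j + 1) * \<delta>} (\<lambda>t. norm (h t)))\<^sup>2)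
        \<le> (\<Sum>j<J. (1 / ((real j + 1) * \<delta>) * V j)\<^sup>2)"
        unfolding h(2) by (intro sum_mono power_mono vj vj0 s)
      also have "\<dots> \<le> \<Gamma>\<^sup>2" using G by (simp only: V_def)
      finally show "(\<Sum>j<J. (integral {real j * \<delta>..(real j + 1) * \<delta>} (\<lambda>t. norm (h t)))\<^sup>2) \<le> \<Gamma>\<^sup>2" .
    qed (use CL in auto)
    finally show ?thesis .
  qed
  have S1: "(\<Sum>k=m..2 * m. (norm (I1 k))\<^sup>2) \<le> CL * (real m + 1) * \<Gamma>\<^sup>2"
    unfolding I1_def by (rule ls[of _ 1]) auto
  have S2: "(\<Sum>k=m..2 * m. (norm (I2 k))\<^sup>2) \<le> CL * (real m + 1) * \<Gamma>\<^sup>2"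
  proof -
    \<comment> \<open>Conjugation turns the negative frequencies into the positive ones that
      \<open>large_sieve\<close> treats.\<close>
    have "norm (I2 k) = norm (integral {0..real J * \<delta>} (\<lambda>t. cnj (\<psi> (-1) t) * cis (\<alpha> / 2 * real k * t)))" for k
    proof -
      have "cnj (I2 k) = integral {0..real J * \<delta>} (\<lambda>t. cnj (\<psi> (-1) t) * cis (\<alpha> / 2 * real k * t))"
        unfolding I2_def by (subst integral_cnj) (simp add: cis_cnj)
      then show ?thesis by (metis complex_mod_cnj)
    qed
    moreover have "(\<lambda>t. cnj (\<psi> (-1) t)) \<in> borel_measurable borel"
      by (rule borel_measurable_continuous_on[where f = cnj, OF _ \<psi>m]) (intro continuous_intros)
    ultimately show ?thesis using ls[of "\<lambda>t. cnj (\<psi> (-1) t)" "-1"] by simp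
  qed
  define X where "X = (\<lambda>k. LBINT t. indicator {0..<pi / \<alpha>} t *\<^sub>R (of_real (\<Psi> k t) * \<phi> t))"
  have Xk: "norm (X k) \<le> \<alpha> * \<Gamma> + norm (I1 k + I2 k)" if k: "k \<le> 2 * m" for k
  proof -
    define A where "A = (\<lambda>t. near t *\<^sub>R (of_real (\<Psi> k t) * \<phi> t))"
    define E where "E = (\<lambda>t. \<psi> 1 t * cis (\<alpha> / 2 * real k * t) + \<psi> (-1) t * cis (- (\<alpha> / 2 * real k * t)))"
    have Am [measurable]: "A \<in> borel_measurable borel" unfolding A_def by measurable
    have Em [measurable]: "E \<in> borel_measurable borel" unfolding E_def by measurable
    have kb: "\<bar>\<Psi> k t\<bar> \<le> (real m + 1) * \<alpha> / pi" for t
    proof -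
      have "\<bar>\<Psi> k t\<bar> \<le> (2 * real k + 1) * \<alpha> / (4 * pi)" unfolding \<Psi>_def by (rule abs_vp_kernel_le[OF \<alpha>])
      also have "\<dots> \<le> (4 * (real m + 1)) * \<alpha> / (4 * pi)" using k \<alpha> by (intro divide_right_mono mult_right_mono) auto
      also have "\<dots> = (real m + 1) * \<alpha> / pi"
      proof -
        have "(4 * z) * \<alpha> / (4 * pi) = z * \<alpha> / pi" for z by simp
        then show ?thesis .
      qed
      finally show ?thesis .
    qed
    have Ab: "norm (A t) \<le> indicator {0..\<delta>} t * ((real m + 1) * \<alpha> / pi * norm (\<phi> t))" for t
    proof -
      have "norm (A t) = near t * (\<bar>\<Psi> k t\<bar> * norm (\<phi> t))" using nn(1)[of t] by (simp add: A_def norm_mult)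
      also have "\<dots> \<le> indicator {0..\<delta>} t * ((real m + 1) * \<alpha> / pi * norm (\<phi> t))"
        using nn[of t] kb[of t] by (intro mult_mono) auto
      finally show ?thesis .
    qed
    have ni: "integrable lborel (\<lambda>t. indicator {0..\<delta>} t *\<^sub>R norm (\<phi> t))"
      by (rule integrableI_bounded_set_indicator[where B = B]) (use B in \<open>auto simp: emeasure_lborel_Icc_eq\<close>)
    then have nv: "(LBINT t. indicator {0..\<delta>} t *\<^sub>R norm (\<phi> t)) = V 0"
      using set_borel_integral_eq_integral(2)[of "{0..\<delta>}" "\<lambda>t. norm (\<phi> t)"]
      by (simp add: set_integrable_def set_lebesgue_integral_def V_def)
    have ni': "integrable lborel (\<lambda>t. (real m + 1) * \<alpha> / pi * (indicator {0..\<delta>} t *\<^sub>R norm (\<phi> t)))"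
      by (rule integrable_mult_right[OF ni])
    have Ai: "integrable lborel A"
    proof (rule Bochner_Integration.integrable_bound[OF ni'])
      show "AE t in lborel. norm (A t) \<le> norm ((real m + 1) * \<alpha> / pi * (indicator {0..\<delta>} t *\<^sub>R norm (\<phi> t)))"
      proof (intro AE_I2)
        fix t
        have "norm (A t) \<le> (real m + 1) * \<alpha> / pi * (indicator {0..\<delta>} t *\<^sub>R norm (\<phi> t))" using Ab[of t] by (simp add: mult_ac)
        then show "norm (A t) \<le> norm ((real m + 1) * \<alpha> / pi * (indicator {0..\<delta>} t *\<^sub>R norm (\<phi> t)))"
          by (rule order_trans) (simp only: real_norm_def abs_ge_self)
      qed
    qed simp
    have "norm (LBINT t. A t) \<le> (LBINT t. norm (A t))" by (rule integral_norm_bound)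
    also have "\<dots> \<le> (LBINT t. (real m + 1) * \<alpha> / pi * (indicator {0..\<delta>} t *\<^sub>R norm (\<phi> t)))"
      by (rule integral_mono[OF integrable_norm[OF Ai] ni']) (use Ab in \<open>simp add: mult_ac\<close>)
    also have "\<dots> = (real m + 1) * \<alpha> / pi * V 0" by (simp only: integral_mult_right_zero nv)
    also have "\<dots> = \<alpha> * (1 / ((real 0 + 1) * \<delta>) * V 0)"
    proof -
      have "z * \<alpha> / pi * v = \<alpha> * (1 / ((real 0 + 1) * (pi / z)) * v)" for z v :: real by simp
      then show ?thesis unfolding \<delta> .
    qed
    also have "\<dots> \<le> \<alpha> * \<Gamma>"
    proof (rule mult_left_mono)
      have "(1 / ((real 0 + 1) * \<delta>) * V 0)\<^sup>2 \<le> (\<Sum>j<J. (1 / ((real j + 1) * \<delta>) * V j)\<^sup>2)"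
        by (rule member_le_sum[of 0 "{..<J}" "\<lambda>j. (1 / ((real j + 1) * \<delta>) * V j)\<^sup>2"]) (auto simp: J)
      also have "\<dots> \<le> \<Gamma>\<^sup>2" using G by (simp only: V_def)
      finally show "1 / ((real 0 + 1) * \<delta>) * V 0 \<le> \<Gamma>" using \<Gamma> by (rule power2_le_imp_le)
    qed (use \<alpha> in simp)
    finally have An: "norm (LBINT t. A t) \<le> \<alpha> * \<Gamma>" .
    have p1: "\<bar>1::real\<bar> = 1" "\<bar>- 1::real\<bar> = 1" by auto
    have EB: "norm (E t) \<le> 2 * (B * (1 / (2 * pi * \<delta>)))" for t
      unfolding E_def using \<psi>B[OF p1(1), of t] \<psi>B[OF p1(2), of t]
      by (intro norm_triangle_le) (simp add: norm_mult)
    have Esupp: "E t = indicator {0..real J * \<delta>} t *\<^sub>R E t" for t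
    proof (cases "far t = 0")
      case True
      then show ?thesis by (simp add: E_def \<psi>_def)
    next
      case False
      then have "t \<in> {0..real J * \<delta>}" using \<delta>0 Jd by (auto simp: far_def indicator_def split: if_splits)
      then show ?thesis by simp
    qed
    have Efun: "(\<lambda>t. indicator {0..real J * \<delta>} t *\<^sub>R E t) = E" by (rule ext) (rule Esupp[symmetric])
    have Ei: "integrable lborel E"
    proof -
      have "integrable lborel (\<lambda>t. indicator {0..real J * \<delta>} t *\<^sub>R E t)"
        by (rule integrableI_bounded_set_indicator[where B = "2 * (B * (1 / (2 * pi * \<delta>)))"])
           (use EB in \<open>auto simp: emeasure_lborel_Icc_eq\<close>)
      then show ?thesis unfolding Efun .
    qed
    have "(LBINT t. E t) = (LBINT t. indicator {0..real J * \<delta>} t *\<^sub>R E t)" unfolding Efun ..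
    also have "\<dots> = integral {0..real J * \<delta>} E" by (rule integral_eq_lborel[symmetric, OF Em EB])
    also have "\<dots> = I1 k + I2 k"
      unfolding E_def I1_def I2_def
    proof (rule integral_add)
      show "(\<lambda>t. \<psi> 1 t * cis (\<alpha> / 2 * real k * t)) integrable_on {0..real J * \<delta>}"
      proof (rule bounded_borel_integrable_on)
        show "norm (\<psi> 1 t * cis (\<alpha> / 2 * real k * t)) \<le> B * (1 / (2 * pi * \<delta>))" for t
          using \<psi>B[OF p1(1), of t] by (simp add: norm_mult)
      qed measurable
      show "(\<lambda>t. \<psi> (-1) t * cis (- (\<alpha> / 2 * real k * t))) integrable_on {0..real J * \<delta>}"
      proof (rule bounded_borel_integrable_on)
        show "norm (\<psi> (-1) t * cis (- (\<alpha> / 2 * real k * t))) \<le> B * (1 / (2 * pi * \<delta>))" for t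
          using \<psi>B[OF p1(2), of t] by (simp add: norm_mult)
      qed measurable
    qed
    finally have Ev: "(LBINT t. E t) = I1 k + I2 k" .
    have AE: "indicator {0..<pi / \<alpha>} t *\<^sub>R (of_real (\<Psi> k t) * \<phi> t) = A t + E t" for t
    proof -
      have "E t = far t *\<^sub>R (\<phi> t * (c 1 t * cis (\<alpha> / 2 * real k * t) + c (-1) t * cis (- (\<alpha> / 2 * real k * t))))"
        by (simp add: E_def \<psi>_def scaleR_add_right algebra_simps)
      also have "c 1 t * cis (\<alpha> / 2 * real k * t) + c (-1) t * cis (- (\<alpha> / 2 * real k * t)) = of_real (\<Psi> k t)"
        unfolding \<Psi>_def vp_kernel_sum_cis[OF \<alpha>] c_def by simp
      finally have "E t = far t *\<^sub>R (of_real (\<Psi> k t) * \<phi> t)" by (simp add: mult.commute)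
      then show ?thesis by (simp add: A_def near_def scaleR_left_diff_distrib)
    qed
    have "X k = (LBINT t. A t) + (I1 k + I2 k)"
      unfolding X_def AE Bochner_Integration.integral_add[OF Ai Ei] Ev ..
    then show ?thesis using norm_triangle_ineq[of "LBINT t. A t" "I1 k + I2 k"] An by simp
  qed
  have sq: "(norm (X k))\<^sup>2 \<le> 2 * (\<alpha> * \<Gamma>)\<^sup>2 + 4 * (norm (I1 k))\<^sup>2 + 4 * (norm (I2 k))\<^sup>2" if "k \<in> {m..2 * m}" for k
  proof -
    have two: "(p + q)\<^sup>2 \<le> 2 * p\<^sup>2 + 2 * q\<^sup>2" for p q :: real
      using sum_squares_ge_zero[of "p - q" 0] by (simp add: power2_eq_square algebra_simps)
    have "(norm (X k))\<^sup>2 \<le> (\<alpha> * \<Gamma> + (norm (I1 k) + norm (I2 k)))\<^sup>2"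
      using Xk[of k] that norm_triangle_ineq[of "I1 k" "I2 k"] by (intro power_mono) auto
    also have "\<dots> \<le> 2 * (\<alpha> * \<Gamma>)\<^sup>2 + 2 * (norm (I1 k) + norm (I2 k))\<^sup>2" by (rule two)
    finally show ?thesis using two[of "norm (I1 k)" "norm (I2 k)"] by linarith
  qed
  have "(\<Sum>k=m..2 * m. (norm (X k))\<^sup>2) \<le> (\<Sum>k=m..2 * m. 2 * (\<alpha> * \<Gamma>)\<^sup>2 + 4 * (norm (I1 k))\<^sup>2 + 4 * (norm (I2 k))\<^sup>2)"
    by (intro sum_mono sq)
  also have "\<dots> = (real m + 1) * (2 * (\<alpha> * \<Gamma>)\<^sup>2) + 4 * (\<Sum>k=m..2 * m. (norm (I1 k))\<^sup>2) + 4 * (\<Sum>k=m..2 * m. (norm (I2 k))\<^sup>2)"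
    by (simp only: sum.distrib sum_distrib_left[symmetric]) simp
  also have "\<dots> \<le> (real m + 1) * (2 * (\<alpha> * \<Gamma>)\<^sup>2) + 4 * (CL * (real m + 1) * \<Gamma>\<^sup>2) + 4 * (CL * (real m + 1) * \<Gamma>\<^sup>2)"
    using S1 S2 by linarith
  also have "\<dots> = (2 * \<alpha>\<^sup>2 + 8 * CL) * (real m + 1) * \<Gamma>\<^sup>2" by (simp add: power_mult_distrib algebra_simps)
  finally show ?thesis by (simp only: X_def \<Psi>_def CL_def)
qed

section \<open>Moduli of continuity and partial sums\<close>

text \<open>Local integrability makes f Lebesgue measurable, as a pointwise limit of its truncations
  to intervals. Real and imaginary part then have Borel versions.\<close>

lemma borel_representative:
  assumes f: "f \<in> stepanov_ap" "bounded (range f)"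
  obtains g B where "g \<in> borel_measurable borel" "B > 0" "\<And>t. norm (g t) \<le> B" "negligible {t. f t \<noteq> g t}"
proof -
  obtain B where B: "B > 0" "\<And>t. norm (f t) \<le> B" using f(2) by (auto simp: bounded_pos)
  have fi: "f absolutely_integrable_on {a..b}" for a b using f(1) by (auto simp: stepanov_ap_def)
  have fm: "f \<in> borel_measurable lebesgue"
  proof (rule borel_measurable_LIMSEQ_metric)
    fix n :: nat
    have "integrable lebesgue (\<lambda>t. indicator {- real n..real n} t *\<^sub>R f t)"
      using fi[of "- real n" "real n"] by (simp add: set_integrable_def)
    then show "(\<lambda>t. indicator {- real n..real n} t *\<^sub>R f t) \<in> borel_measurable lebesgue"
      by (rule borel_measurable_integrable)
  next
    fix t :: real
    show "(\<lambda>n. indicator {- real n..real n} t *\<^sub>R f t) \<longlonglongrightarrow> f t"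
    proof (rule tendsto_eventually)
      obtain N :: nat where N: "real N \<ge> \<bar>t\<bar>" using real_arch_simple by blast
      show "eventually (\<lambda>n. indicator {- real n..real n} t *\<^sub>R f t = f t) sequentially"
        using eventually_ge_at_top[of N]
      proof eventually_elim
        case (elim n)
        then have "\<bar>t\<bar> \<le> real n" using N by linarith
        then show ?case by (auto simp: indicator_def)
      qed
    qed
  qed
  have m: "(\<lambda>t. Re (f t)) \<in> borel_measurable lebesgue" "(\<lambda>t. Im (f t)) \<in> borel_measurable lebesgue"
    using fm by measurable
  obtain u where u: "u \<in> borel_measurable lborel" "AE t in lborel. Re (f t) = u t"
    using completion_ex_borel_measurable_real[OF m(1)] by auto
  obtain v where v: "v \<in> borel_measurable lborel" "AE t in lborel. Im (f t) = v t"
    using completion_ex_borel_measurable_real[OF m(2)] by auto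
  have um: "u \<in> borel_measurable borel" "v \<in> borel_measurable borel" using u v by simp_all
  define h where "h = (\<lambda>t. of_real (u t) + \<i> * of_real (v t))"
  \<comment> \<open>The Borel version may be unbounded on a null set; setting it to 0 there restores
    the bound B at every point.\<close>
  define g where "g = (\<lambda>t. if norm (h t) \<le> B then h t else 0)"
  have hm [measurable]: "h \<in> borel_measurable borel" unfolding h_def using um by measurable
  have gm: "g \<in> borel_measurable borel" unfolding g_def by measurable
  have "AE t in lborel. f t = g t"
    using u(2) v(2)
  proof eventually_elim
    case (elim t)
    then have "f t = h t" by (simp add: h_def complex_eq_iff)
    then show ?case using B(2)[of t] by (simp add: g_def)
  qed
  then obtain N where N: "{t \<in> space lborel. \<not> f t = g t} \<subseteq> N" "N \<in> null_sets lborel"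
    by (auto simp: eventually_ae_filter)
  then have "negligible N" by (simp add: negligible_iff_null_sets null_sets_completionI)
  moreover have "{t. f t \<noteq> g t} \<subseteq> N" using N(1) by auto
  ultimately have "negligible {t. f t \<noteq> g t}" by (rule negligible_subset)
  moreover have "norm (g t) \<le> B" for t using B(1) by (simp add: g_def)
  ultimately show thesis using that[OF gm B(1)] by blast
qed

lemma negligible_diff_translate:
  fixes f g :: "real \<Rightarrow> complex"
  assumes "negligible {t. f t \<noteq> g t}"
  shows "negligible {t. f (t + c) \<noteq> g (t + c)}" "negligible {t. f (c - t) \<noteq> g (c - t)}"
proof -
  have "{t. f (t + c) \<noteq> g (t + c)} = (+) (- c) ` {t. f t \<noteq> g t}"
    by (auto simp: image_iff intro!: exI[of _ "_ + c"])
  then show "negligible {t. f (t + c) \<noteq> g (t + c)}" using negligible_translation[OF assms, of "- c"] by simp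
  have "{t. f (c - t) \<noteq> g (c - t)} = (+) c ` (uminus ` {t. f t \<noteq> g t})"
    by (auto simp: image_iff intro!: exI[of _ "c - _"])
  moreover have "negligible (uminus ` {t. f t \<noteq> g t})"
    by (rule negligible_differentiable_image_negligible[OF _ assms]) (auto intro: derivative_intros)
  ultimately show "negligible {t. f (c - t) \<noteq> g (c - t)}" using negligible_translation[of _ c] by simp
qed

lemma integral_eq_of_ae_eq:
  fixes F G :: "real \<Rightarrow> 'a::real_normed_vector"
  assumes "negligible {t. F t \<noteq> G t}"
  shows "integral S F = integral S G"
  by (rule integral_spike[OF assms]) auto

lemma stepanov_ap_ae_eq:
  assumes f: "f \<in> stepanov_ap" and g: "g \<in> borel_measurable borel" "\<And>t. norm (g t) \<le> B"
    and neg: "negligible {t. f t \<noteq> g t}"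
  shows "g \<in> stepanov_ap_borel"
proof -
  have "stepanov_translation_number f \<epsilon> \<tau> = stepanov_translation_number g \<epsilon> \<tau>" for \<epsilon> \<tau>
  proof -
    have "negligible ({t. f (t + \<tau>) \<noteq> g (t + \<tau>)} \<union> {t. f t \<noteq> g t})"
      by (intro negligible_Un negligible_diff_translate neg)
    then have "negligible {t. norm (f (t + \<tau>) - f t) \<noteq> norm (g (t + \<tau>) - g t)}" by (rule negligible_subset) auto
    then show ?thesis unfolding stepanov_translation_number_def by (simp add: integral_eq_of_ae_eq)
  qed
  then have "stepanov_translation_number f = stepanov_translation_number g" by (intro ext)
  then show ?thesis
    using f g by (auto simp: stepanov_ap_borel_def stepanov_ap_def rel_dense_def bounded_iff)
qed

lemma fourier_coeff_ae_eq:
  assumes neg: "negligible {t. f t \<noteq> g t}"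
  shows "fourier_coeff f \<mu> = fourier_coeff g \<mu>"
proof -
  have "negligible {t. f t * cis (- \<mu> * t) \<noteq> g t * cis (- \<mu> * t)}" by (rule negligible_subset[OF neg]) auto
  from integral_eq_of_ae_eq[OF this] show ?thesis unfolding fourier_coeff_def by simp
qed

lemma best_approx_ae_eq:
  assumes neg: "negligible {t. f t \<noteq> g t}"
  shows "best_approx \<sigma> f = best_approx \<sigma> g"
proof -
  have "stepanov_norm (\<lambda>t. f t - h (of_real t)) = stepanov_norm (\<lambda>t. g t - h (of_real t))" for h :: "complex \<Rightarrow> complex"
  proof -
    have "negligible {t. norm (f t - h (of_real t)) \<noteq> norm (g t - h (of_real t))}" by (rule negligible_subset[OF neg]) auto
    from integral_eq_of_ae_eq[OF this] show ?thesis unfolding stepanov_norm_def by simp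
  qed
  then show ?thesis unfolding best_approx_def by simp
qed

text \<open>Subadditivity iterated over the next integer above c, which is at most c + 1.\<close>

lemma modulus_type_mult:
  assumes w: "modulus_type w" and c: "c \<ge> 0" and d: "\<delta> \<ge> 0"
  shows "w (c * \<delta>) \<le> (c + 1) * w \<delta>"
proof -
  have nn: "\<And>\<delta>. \<delta> \<ge> 0 \<Longrightarrow> w \<delta> \<ge> 0" and mono: "mono_on {0..} w" and w0: "w 0 = 0"
    and sub: "\<And>x y. x \<ge> 0 \<Longrightarrow> y \<ge> 0 \<Longrightarrow> w (x + y) \<le> w x + w y"
    using w by (auto simp: modulus_type_def)
  have ind: "w (real n * \<delta>) \<le> real n * w \<delta>" for n
  proof (induction n)
    case (Suc n)
    have "w (real (Suc n) * \<delta>) \<le> w (real n * \<delta>) + w \<delta>"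
      using sub[of "real n * \<delta>" \<delta>] d by (simp add: algebra_simps)
    then show ?case using Suc by (simp add: algebra_simps)
  qed (simp add: w0)
  define n where "n = nat \<lceil>c\<rceil>"
  have n: "c \<le> real n" "real n \<le> c + 1" using c unfolding n_def by linarith+
  have "w (c * \<delta>) \<le> w (real n * \<delta>)" using n c d by (intro mono_onD[OF mono] mult_right_mono) auto
  also have "\<dots> \<le> real n * w \<delta>" by (rule ind)
  also have "\<dots> \<le> (c + 1) * w \<delta>" using n nn[OF d] by (intro mult_right_mono) auto
  finally show ?thesis .
qed

text \<open>A modulus that does not vanish at \<Gamma> is at least linear near 0. This absorbs the
  error terms of order \<gamma> that \<open>tail_bound\<close> leaves.\<close>

lemma modulus_type_ge_linear:
  assumes w: "modulus_type w" and \<Gamma>: "w \<Gamma> > 0" and d: "0 < \<delta>" "\<delta> \<le> \<Gamma>"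
  shows "\<delta> \<le> 2 * \<Gamma> / w \<Gamma> * w \<delta>"
proof -
  have nn: "w \<delta> \<ge> 0" using w d by (auto simp: modulus_type_def)
  have "w \<Gamma> = w (\<Gamma> / \<delta> * \<delta>)" using d by simp
  also have "\<dots> \<le> (\<Gamma> / \<delta> + 1) * w \<delta>" by (rule modulus_type_mult[OF w]) (use d in auto)
  also have "\<dots> \<le> (2 * \<Gamma> / \<delta>) * w \<delta>" using d nn by (intro mult_right_mono) (auto simp: field_simps)
  finally have "w \<Gamma> * \<delta> \<le> 2 * \<Gamma> * w \<delta>" using d by (simp add: field_simps)
  then show ?thesis using \<Gamma> by (simp add: field_simps)
qed

text \<open>If \<open>w pi\<close> is positive, the linear error of \<open>tail_bound\<close> is
  below a multiple of w. If it is 0, then w vanishes identically, and the mean condition forces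
  \<phi> to vanish almost everywhere on the half line, so the tail is 0.\<close>

lemma tail_modulus_bound:
  fixes \<phi> :: "real \<Rightarrow> complex"
  assumes \<phi>m [measurable]: "\<phi> \<in> borel_measurable borel" and B: "\<And>t. norm (\<phi> t) \<le> B" and \<alpha>: "\<alpha> > 0"
    and w: "modulus_type w" and C: "C > 0"
    and tr: "\<And>\<gamma> \<delta>. \<gamma> > 0 \<Longrightarrow> \<delta> > 0 \<Longrightarrow> 1 / \<delta> * integral {0..\<delta>} (\<lambda>t. norm (\<phi> t - \<phi> (t + \<gamma>))) \<le> C * w \<gamma>"
    and mn: "\<And>\<delta>. \<delta> > 0 \<Longrightarrow> 1 / \<delta> * integral {0..\<delta>} (\<lambda>t. norm (\<phi> t)) \<le> C * w \<delta>"
  shows "\<exists>K\<ge>0. \<forall>k. norm (LBINT t. indicator {pi / \<alpha>..} t *\<^sub>R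
      (of_real (vp_kernel (\<alpha> * real k / 2) (\<alpha> * (real k + 1) / 2) t) * \<phi> t)) \<le> K * w (pi / (real k + 1))"
proof -
  have nn: "\<And>\<delta>. \<delta> \<ge> 0 \<Longrightarrow> w \<delta> \<ge> 0" and mono: "mono_on {0..} w" using w by (auto simp: modulus_type_def)
  define T0 where "T0 = pi / \<alpha>"
  have T0: "T0 > 0" using \<alpha> by (simp add: T0_def)
  have B0: "B \<ge> 0" using order_trans[OF norm_ge_zero B[of 0]] .
  show ?thesis
  proof (cases "w pi > 0")
    case True
    define A1 where "A1 = (1 + 1 / T0)\<^sup>2"
    define A2 where "A2 = (1 + 1 / T0)\<^sup>2 * B * (\<alpha> / 4 + 2 / T0) + B / T0\<^sup>2"
    have A: "A1 \<ge> 0" "A2 \<ge> 0" using B0 \<alpha> T0 by (auto simp: A1_def A2_def)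
    define K where "K = 4 / (pi * \<alpha>) * (A1 * (C * (4 / \<alpha> + 1)) + A2 * (4 / \<alpha> * (2 * pi / w pi)))"
    have K0: "K \<ge> 0" using A \<alpha> C True by (simp add: K_def)
    have "norm (LBINT t. indicator {pi / \<alpha>..} t *\<^sub>R
      (of_real (vp_kernel (\<alpha> * real k / 2) (\<alpha> * (real k + 1) / 2) t) * \<phi> t)) \<le> K * w (pi / (real k + 1))" for k
    proof -
      define \<omega> where "\<omega> = (2 * real k + 1) * \<alpha> / 4"
      have \<omega>: "\<omega> > 0" using \<alpha> by (simp add: \<omega>_def add_nonneg_pos)
      define \<gamma> where "\<gamma> = pi / \<omega>"
      have \<gamma>: "\<gamma> > 0" using \<omega> by (simp add: \<gamma>_def)
      define \<delta> where "\<delta> = pi / (real k + 1)"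
      have \<delta>: "0 < \<delta>" "\<delta> \<le> pi" by (auto simp: \<delta>_def field_simps)
      \<comment> \<open>The half period at frequency (2 k + 1) \<alpha> / 4 is comparable with pi /
        (k + 1), the argument at which w has to appear.\<close>
      have g1: "\<gamma> \<le> 4 / \<alpha> * \<delta>"
      proof -
        have "\<gamma> = 4 / \<alpha> * (pi / (2 * real k + 1))" using \<alpha> by (simp add: \<gamma>_def \<omega>_def field_simps)
        also have "\<dots> \<le> 4 / \<alpha> * \<delta>" unfolding \<delta>_def using \<alpha> by (intro mult_left_mono divide_left_mono) (auto intro!: mult_pos_pos add_nonneg_pos)
        finally show ?thesis .
      qed
      have "w \<gamma> \<le> w (4 / \<alpha> * \<delta>)" using g1 \<gamma> by (intro mono_onD[OF mono]) auto
      also have "\<dots> \<le> (4 / \<alpha> + 1) * w \<delta>" by (rule modulus_type_mult[OF w]) (use \<alpha> \<delta> in auto)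
      finally have wg: "w \<gamma> \<le> (4 / \<alpha> + 1) * w \<delta>" .
      have "4 / \<alpha> * \<delta> \<le> 4 / \<alpha> * (2 * pi / w pi * w \<delta>)"
        using \<alpha> by (intro mult_left_mono modulus_type_ge_linear[OF w True \<delta>]) auto
      then have g2: "\<gamma> \<le> 4 / \<alpha> * (2 * pi / w pi) * w \<delta>" using g1 by (simp add: mult.assoc)
      have tr': "integral {0..X} (\<lambda>t. norm (\<phi> t - \<phi> (t + pi / \<omega>))) \<le> C * w \<gamma> * X" if "X \<ge> 0" for X
      proof (cases "X = 0")
        case False
        then show ?thesis using tr[OF \<gamma>, of X] that by (simp add: \<gamma>_def field_simps)
      qed simp
      define S where "S = (LBINT t. indicator {T0..} t *\<^sub>R (\<phi> t * of_real (sin (\<alpha> / 4 * t) / t\<^sup>2)) * of_real (sin (\<omega> * t)))"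
      have Sb: "norm S \<le> A1 * (C * w \<gamma>) + A2 * (pi / \<omega>)"
        unfolding S_def A1_def A2_def
        by (rule tail_bound[OF \<phi>m B T0 _ \<omega> tr']) (use \<alpha> C nn[of \<gamma>] \<gamma> in auto)
      have "(LBINT t. indicator {pi / \<alpha>..} t *\<^sub>R (of_real (vp_kernel (\<alpha> * real k / 2) (\<alpha> * (real k + 1) / 2) t) * \<phi> t))
         = (LBINT t. of_real (4 / (pi * \<alpha>)) * (indicator {T0..} t *\<^sub>R (\<phi> t * of_real (sin (\<alpha> / 4 * t) / t\<^sup>2)) * of_real (sin (\<omega> * t))))"
      proof (rule Bochner_Integration.integral_cong[OF refl])
        fix t
        have "r *\<^sub>R (complex_of_real (p * q * u) * z) = of_real p * (r *\<^sub>R (z * of_real q) * of_real u)" for p q u r z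
          by (simp add: scaleR_conv_of_real)
        then show "indicator {pi / \<alpha>..} t *\<^sub>R (of_real (vp_kernel (\<alpha> * real k / 2) (\<alpha> * (real k + 1) / 2) t) * \<phi> t)
          = of_real (4 / (pi * \<alpha>)) * (indicator {T0..} t *\<^sub>R (\<phi> t * of_real (sin (\<alpha> / 4 * t) / t\<^sup>2)) * of_real (sin (\<omega> * t)))"
          unfolding vp_kernel_sin_form[OF \<alpha>] T0_def \<omega>_def .
      qed
      also have "\<dots> = of_real (4 / (pi * \<alpha>)) * S" unfolding S_def by (rule integral_mult_right_zero)
      finally have "norm (LBINT t. indicator {pi / \<alpha>..} t *\<^sub>R (of_real (vp_kernel (\<alpha> * real k / 2) (\<alpha> * (real k + 1) / 2) t) * \<phi> t))
        = 4 / (pi * \<alpha>) * norm S" using \<alpha> by (simp only: norm_mult norm_of_real) simp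
      also have "\<dots> \<le> 4 / (pi * \<alpha>) * (A1 * (C * w \<gamma>) + A2 * \<gamma>)" using Sb \<alpha> by (intro mult_left_mono) (auto simp: \<gamma>_def)
      also have "\<dots> \<le> 4 / (pi * \<alpha>) * (A1 * (C * ((4 / \<alpha> + 1) * w \<delta>)) + A2 * (4 / \<alpha> * (2 * pi / w pi) * w \<delta>))"
        using wg g2 A C \<alpha> by (intro mult_left_mono add_mono) auto
      also have "\<dots> = K * w \<delta>"
      proof -
        have "p * (a1 * (C * (x * v)) + a2 * (y * v)) = (p * (a1 * (C * x) + a2 * y)) * v" for p a1 x v a2 y :: real
          by (simp add: algebra_simps)
        then show ?thesis unfolding K_def .
      qed
      finally show ?thesis unfolding \<delta>_def .
    qed
    then show ?thesis using K0 by blast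
  next
    case False
    then have wpi: "w pi = 0" using nn[of pi] pi_ge_zero by linarith
    \<comment> \<open>Every X is a multiple of pi, so \<open>modulus_type_mult\<close> carries the
      zero at pi to the whole half line.\<close>
    have wX: "w X \<le> 0" if "X \<ge> 0" for X
      using modulus_type_mult[OF w, of "X / pi" pi] that wpi by simp
    have \<phi>i: "(\<lambda>t. norm (\<phi> t)) integrable_on {p..q}" for p q
      by (rule bounded_borel_integrable_on[where B = B]) (use B in auto)
    have z: "integral {0..X} (\<lambda>t. norm (\<phi> t)) \<le> 0 * (X + 1)" if "0 \<le> X" for X
    proof (cases "X = 0")
      case False
      have "C * w X \<le> 0" using C wX[OF that] by (simp add: mult_le_0_iff)
      then have "1 / X * integral {0..X} (\<lambda>t. norm (\<phi> t)) \<le> 0" using mn[of X] False that by linarith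
      then show ?thesis using False that by (simp add: divide_le_0_iff)
    qed simp
    have nm: "(\<lambda>t. norm (\<phi> t)) \<in> borel_measurable borel" by measurable
    have W: "integrable lborel (\<lambda>t. indicator {0..} t * (norm (\<phi> t) / (1 + t)\<^sup>2))"
      "(LBINT t. indicator {0..} t * (norm (\<phi> t) / (1 + t)\<^sup>2)) \<le> 0"
      using weighted_integral_bound[OF nm norm_ge_zero \<phi>i z] by auto
    have "norm (LBINT t. indicator {pi / \<alpha>..} t *\<^sub>R
      (of_real (vp_kernel (\<alpha> * real k / 2) (\<alpha> * (real k + 1) / 2) t) * \<phi> t)) \<le> 0 * w (pi / (real k + 1))" for k
    proof -
      obtain C1 where C1: "C1 > 0" "\<And>t. \<bar>vp_kernel (\<alpha> * real k / 2) (\<alpha> * (real k + 1) / 2) t\<bar> \<le> C1 / (1 + t\<^sup>2)"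
        using vp_kernel_bound[of "\<alpha> * real k / 2" "\<alpha> * (real k + 1) / 2"] \<alpha> by auto
      define F where "F = (\<lambda>t. indicator {pi / \<alpha>..} t *\<^sub>R (of_real (vp_kernel (\<alpha> * real k / 2) (\<alpha> * (real k + 1) / 2) t) * \<phi> t))"
      have Fm [measurable]: "F \<in> borel_measurable borel" unfolding F_def by measurable
      have Fb: "norm (F t) \<le> 2 * C1 * (indicator {0..} t * (norm (\<phi> t) / (1 + t)\<^sup>2))" for t
      proof (cases "t \<ge> pi / \<alpha>")
        case True
        then have t: "t > 0" using T0 by (simp add: T0_def)
        have "(1 + t)\<^sup>2 \<le> 2 * (1 + t\<^sup>2)" using sum_squares_ge_zero[of "1 - t" 0] by (simp add: power2_eq_square algebra_simps)
        moreover have "1 / x \<le> 2 / y" if "y \<le> 2 * x" "x > 0" "y > 0" for x y :: real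
          using that by (simp add: divide_simps)
        ultimately have "1 / (1 + t\<^sup>2) \<le> 2 / (1 + t)\<^sup>2" using t by (simp add: add_pos_pos)
        then have "C1 * (1 / (1 + t\<^sup>2)) \<le> C1 * (2 / (1 + t)\<^sup>2)" using C1 by (intro mult_left_mono) auto
        then have "\<bar>vp_kernel (\<alpha> * real k / 2) (\<alpha> * (real k + 1) / 2) t\<bar> \<le> 2 * C1 * (1 / (1 + t)\<^sup>2)" using C1(2)[of t] by (simp add: mult.commute)
        from mult_right_mono[OF this norm_ge_zero[of "\<phi> t"]] show ?thesis using True t by (simp add: F_def norm_mult mult_ac)
      qed (use C1 in \<open>simp add: F_def\<close>)
      have Fi: "integrable lborel F"
      proof (rule Bochner_Integration.integrable_bound[OF integrable_mult_right[OF W(1)]])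
        show "AE t in lborel. norm (F t) \<le> norm (2 * C1 * (indicator {0..} t * (norm (\<phi> t) / (1 + t)\<^sup>2)))"
          by (intro AE_I2 order_trans[OF Fb]) (simp only: real_norm_def abs_ge_self)
      qed simp
      have "norm (integral\<^sup>L lborel F) \<le> (LBINT t. norm (F t))" by (rule integral_norm_bound)
      also have "\<dots> \<le> (LBINT t. 2 * C1 * (indicator {0..} t * (norm (\<phi> t) / (1 + t)\<^sup>2)))"
        by (rule integral_mono[OF integrable_norm[OF Fi] integrable_mult_right[OF W(1)] Fb])
      also have "\<dots> = 2 * C1 * (LBINT t. indicator {0..} t * (norm (\<phi> t) / (1 + t)\<^sup>2))" by (rule integral_mult_right_zero)
      also have "\<dots> \<le> 2 * C1 * 0" using W(2) C1 by (intro mult_left_mono) auto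
      finally show ?thesis by (simp add: F_def)
    qed
    then show ?thesis by blast
  qed
qed

section \<open>Exponents with gaps and the partial sums\<close>

lemma fourier_exponents_strict_mono:
  assumes "fourier_exponents f \<Lambda>"
  shows "strict_mono \<Lambda>"
proof -
  have z: "\<Lambda> 0 = 0" and pos: "\<And>\<nu>. \<nu> \<ge> 1 \<Longrightarrow> 0 < \<Lambda> \<nu> \<and> \<Lambda> \<nu> < \<Lambda> (\<nu> + 1)" and odd: "\<And>\<nu>. \<Lambda> (- \<nu>) = - \<Lambda> \<nu>"
    using assms by (auto simp: fourier_exponents_def)
  have step: "\<Lambda> \<nu> < \<Lambda> (\<nu> + 1)" for \<nu>
  proof -
    consider "\<nu> \<ge> 1" | "\<nu> = 0" | "\<nu> = -1" | "\<nu> \<le> -2" by linarith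
    then show ?thesis
    proof cases
      case 3
      then show ?thesis using pos[of 1] z odd[of 1] by simp
    next
      case 4
      then show ?thesis using pos[of "- \<nu> - 1"] odd[of "\<nu> + 1"] odd[of \<nu>] by simp
    qed (use pos[of 1] pos[of \<nu>] z in auto)
  qed
  show ?thesis
  proof (rule strict_monoI)
    fix \<nu> \<nu>' :: int assume "\<nu> < \<nu>'"
    then show "\<Lambda> \<nu> < \<Lambda> \<nu>'"
    proof (induction \<nu>' rule: int_gr_induct)
      case base
      show ?case by (rule step)
    next
      case (step i)
      then show ?case using \<open>\<And>\<nu>. \<Lambda> \<nu> < \<Lambda> (\<nu> + 1)\<close>[of i] by linarith
    qed
  qed
qed

text \<open>The class \<open>Omega1\<close> provides the gap for some sequence \<Lambda>', while the
  partial sums use the given \<Lambda>. Every positive exponent of \<Lambda> carries a nonzero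
  coefficient at itself or at its negative, so it also occurs in \<Lambda>'.\<close>

lemma fourier_exponents_gap:
  assumes f: "f \<in> Omega1 \<alpha>" and \<Lambda>: "fourier_exponents f \<Lambda>"
    and \<mu>: "\<mu> \<in> range \<Lambda>" "\<mu>' \<in> range \<Lambda>" "0 < \<mu>" "\<mu> < \<mu>'"
  shows "\<mu>' - \<mu> \<ge> \<alpha>"
proof -
  obtain \<Lambda>' where \<Lambda>': "fourier_exponents f \<Lambda>'" and gap: "\<And>\<nu>. \<nu> \<ge> 1 \<Longrightarrow> \<Lambda>' (\<nu> + 1) - \<Lambda>' \<nu> \<ge> \<alpha>"
    using f by (auto simp: Omega1_def)
  have odd': "\<And>\<nu>. \<Lambda>' (- \<nu>) = - \<Lambda>' \<nu>" and z': "\<Lambda>' 0 = 0" using \<Lambda>' by (auto simp: fourier_exponents_def)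
  have odd: "\<And>\<nu>. \<Lambda> (- \<nu>) = - \<Lambda> \<nu>" and z: "\<Lambda> 0 = 0" using \<Lambda> by (auto simp: fourier_exponents_def)
  have sm: "strict_mono \<Lambda>" "strict_mono \<Lambda>'" using fourier_exponents_strict_mono \<Lambda> \<Lambda>' by blast+
  have sub: "\<exists>\<nu>\<ge>1. x = \<Lambda>' \<nu>" if x: "x \<in> range \<Lambda>" "0 < x" for x
  proof -
    obtain \<nu> where \<nu>: "x = \<Lambda> \<nu>" using x by auto
    have "\<nu> > 0" using x(2) \<nu> z strict_mono_less[OF sm(1), of 0 \<nu>] by simp
    then have "norm (fourier_coeff f (\<Lambda> \<nu>)) + norm (fourier_coeff f (\<Lambda> (- \<nu>))) > 0"
      using \<Lambda> by (auto simp: fourier_exponents_def)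
    then have "fourier_coeff f x \<noteq> 0 \<or> fourier_coeff f (- x) \<noteq> 0" using \<nu> odd by auto
    then have "x \<in> range \<Lambda>' \<or> - x \<in> range \<Lambda>'" using \<Lambda>' by (auto simp: fourier_exponents_def)
    then obtain \<kappa> where "x = \<Lambda>' \<kappa>" by (metis imageE minus_minus odd')
    moreover from this have "\<kappa> > 0" using x(2) z' strict_mono_less[OF sm(2), of 0 \<kappa>] by simp
    ultimately show ?thesis by (intro exI[of _ \<kappa>]) auto
  qed
  obtain \<nu> where \<nu>: "\<nu> \<ge> 1" "\<mu> = \<Lambda>' \<nu>" using sub[OF \<mu>(1,3)] by blast
  obtain \<nu>' where \<nu>': "\<mu>' = \<Lambda>' \<nu>'" using sub[OF \<mu>(2)] \<mu> by auto
  have "\<nu> < \<nu>'" using \<mu>(4) \<nu>(2) \<nu>' strict_mono_less[OF sm(2)] by simp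
  then have "\<Lambda>' (\<nu> + 1) \<le> \<Lambda>' \<nu>'" using strict_mono_less_eq[OF sm(2)] by simp
  then show ?thesis using gap[OF \<nu>(1)] \<nu>(2) \<nu>' by linarith
qed

text \<open>The interval from \<open>\<alpha> k / 2\<close> to \<open>\<alpha> (k + 1) / 2\<close> is shorter than the gap, so at most one pair of
  exponents \<open>\<plusminus>\<mu>\<close> falls into the sloping part of the trapezoid.\<close>

lemma partial_sum_vp_mean_diff:
  assumes f: "f \<in> Omega1 \<alpha>" and \<Lambda>: "fourier_exponents f \<Lambda>" and \<alpha>: "\<alpha> > 0"
    and g: "g \<in> stepanov_ap_borel" and coeff: "\<And>\<mu>. fourier_coeff f \<mu> = fourier_coeff g \<mu>"
  shows "norm (fourier_partial_sum f \<Lambda> (\<alpha> * real k / 2) x - vp_mean (\<alpha> * real k / 2) (\<alpha> * (real k + 1) / 2) g x)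
    \<le> 2 * best_approx (\<alpha> * real k / 2) g"
proof -
  define a b where "a = \<alpha> * real k / 2" and "b = \<alpha> * (real k + 1) / 2"
  have ab: "0 \<le> a" "a < b" "b - a < \<alpha>" using \<alpha> by (auto simp: a_def b_def field_simps)
  have inj: "inj \<Lambda>" by (rule strict_mono_imp_inj_on[OF fourier_exponents_strict_mono[OF \<Lambda>]])
  have odd: "\<And>\<nu>. \<Lambda> (- \<nu>) = - \<Lambda> \<nu>" using \<Lambda> by (auto simp: fourier_exponents_def)
  have sym: "- \<mu> \<in> range \<Lambda>" if "\<mu> \<in> range \<Lambda>" for \<mu> using that odd by (metis imageE rangeI)
  define T where "T = (\<lambda>\<mu>. fourier_coeff g \<mu> * cis (\<mu> * x))"
  define Fa where "Fa = \<Lambda> ` {\<nu>. \<bar>\<Lambda> \<nu>\<bar> \<le> a}"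
  define F where "F = Fa \<union> \<Lambda> ` {\<nu>. a < \<bar>\<Lambda> \<nu>\<bar> \<and> \<bar>\<Lambda> \<nu>\<bar> < b}"
  define D where "D = \<Lambda> ` {\<nu>. a < \<bar>\<Lambda> \<nu>\<bar> \<and> \<bar>\<Lambda> \<nu>\<bar> < b}"
  have fin: "finite Fa" "finite D"
  proof -
    show "finite Fa" unfolding Fa_def by (intro finite_imageI finite_fourier_partial_sum_index[OF \<Lambda>])
    have "finite {\<nu>. a < \<bar>\<Lambda> \<nu>\<bar> \<and> \<bar>\<Lambda> \<nu>\<bar> < b}"
      by (rule finite_subset[OF _ finite_fourier_partial_sum_index[OF \<Lambda>, of b]]) auto
    then show "finite D" unfolding D_def by (rule finite_imageI)
  qed
  have S: "fourier_partial_sum f \<Lambda> a x = (\<Sum>\<mu>\<in>Fa. T \<mu>)"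
    unfolding fourier_partial_sum_def Fa_def T_def coeff
    by (subst sum.reindex[OF inj_on_subset[OF inj subset_UNIV]]) (simp add: o_def)
  have spec: "\<mu> \<in> Fa \<union> D" if "\<bar>\<mu>\<bar> < b" "fourier_coeff g \<mu> \<noteq> 0" for \<mu>
  proof -
    have "\<mu> \<in> range \<Lambda>" using \<Lambda> that(2) coeff by (auto simp: fourier_exponents_def)
    then show ?thesis using that(1) unfolding Fa_def D_def by (cases "\<bar>\<mu>\<bar> \<le> a") auto
  qed
  have "vp_mean a b g x = (\<Sum>\<mu>\<in>Fa \<union> D. of_real (trapezoid a b \<mu>) * fourier_coeff g \<mu> * cis (\<mu> * x))"
    by (rule vp_mean_eq_sum[OF ab(1,2) g _ spec]) (use fin in auto)
  also have "\<dots> = (\<Sum>\<mu>\<in>Fa. of_real (trapezoid a b \<mu>) * T \<mu>) + (\<Sum>\<mu>\<in>D. of_real (trapezoid a b \<mu>) * T \<mu>)"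
    unfolding T_def mult.assoc by (rule sum.union_disjoint[OF fin]) (auto simp: Fa_def D_def)
  also have "(\<Sum>\<mu>\<in>Fa. of_real (trapezoid a b \<mu>) * T \<mu>) = (\<Sum>\<mu>\<in>Fa. T \<mu>)"
    using trapezoid_eq_1[OF ab(2)] by (intro sum.cong) (auto simp: Fa_def)
  finally have V: "vp_mean a b g x = fourier_partial_sum f \<Lambda> a x + (\<Sum>\<mu>\<in>D. of_real (trapezoid a b \<mu>) * T \<mu>)" unfolding S .
  have D: "\<mu> \<in> range \<Lambda>" "a < \<bar>\<mu>\<bar>" "\<bar>\<mu>\<bar> < b" if "\<mu> \<in> D" for \<mu> using that by (auto simp: D_def)
  \<comment> \<open>The gap separates exponents of equal sign only, so the two signs are counted
    apart; 0 does not occur because \<mu> exceeds a in absolute value.\<close>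
  have one: "card (D \<inter> {0<..}) \<le> 1" "card (D \<inter> {..<0}) \<le> 1"
  proof -
    have "\<not> \<mu> < \<mu>'" if "\<mu> \<in> range \<Lambda>" "\<mu>' \<in> range \<Lambda>" "a < \<mu>" "\<mu>' < b" for \<mu> \<mu>'
      using fourier_exponents_gap[OF f \<Lambda> that(1,2)] that ab by auto
    note * = this
    have "\<mu> = \<mu>'" if "\<mu> \<in> D \<inter> {0<..}" "\<mu>' \<in> D \<inter> {0<..}" for \<mu> \<mu>'
      using *[of \<mu> \<mu>'] *[of \<mu>' \<mu>] D[of \<mu>] D[of \<mu>'] that by auto
    then show "card (D \<inter> {0<..}) \<le> 1" using card_le_Suc0_iff_eq[of "D \<inter> {0<..}"] fin by auto
    have "\<mu> = \<mu>'" if "\<mu> \<in> D \<inter> {..<0}" "\<mu>' \<in> D \<inter> {..<0}" for \<mu> \<mu>'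
      using *[of "- \<mu>" "- \<mu>'"] *[of "- \<mu>'" "- \<mu>"] D[of \<mu>] D[of \<mu>'] sym that by auto
    then show "card (D \<inter> {..<0}) \<le> 1" using card_le_Suc0_iff_eq[of "D \<inter> {..<0}"] fin by auto
  qed
  have "D = (D \<inter> {0<..}) \<union> (D \<inter> {..<0})" using D ab(1) by force
  then have "card D \<le> card (D \<inter> {0<..}) + card (D \<inter> {..<0})" by (metis card_Un_le)
  then have cD: "card D \<le> 2" using one by linarith
  have E0: "best_approx a g \<ge> 0" by (rule best_approx_nonneg[OF g ab(1)])
  have "norm (fourier_partial_sum f \<Lambda> a x - vp_mean a b g x) = norm (\<Sum>\<mu>\<in>D. of_real (trapezoid a b \<mu>) * T \<mu>)"
    unfolding V by (simp add: norm_minus_commute)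
  also have "\<dots> \<le> (\<Sum>\<mu>\<in>D. best_approx a g)"
  proof (rule sum_norm_le)
    fix \<mu> assume \<mu>: "\<mu> \<in> D"
    have "norm (of_real (trapezoid a b \<mu>) * T \<mu>) = trapezoid a b \<mu> * norm (fourier_coeff g \<mu>)"
      using trapezoid_bounds[OF ab(1,2), of \<mu>] by (simp add: T_def norm_mult)
    also have "\<dots> \<le> 1 * best_approx a g"
      using trapezoid_bounds[OF ab(1,2), of \<mu>] D[OF \<mu>] by (intro mult_mono fourier_coeff_le_best_approx[OF g ab(1)]) auto
    finally show "norm (of_real (trapezoid a b \<mu>) * T \<mu>) \<le> best_approx a g" by simp
  qed
  also have "\<dots> = real (card D) * best_approx a g" by simp
  also have "\<dots> \<le> 2 * best_approx a g" using cD E0 by (intro mult_right_mono) auto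
  finally show ?thesis unfolding a_def b_def .
qed

section \<open>Strong means with monotone weights\<close>

text \<open>The block from M to 2 M with M = 2 * 2 ^ n is charged to the preceding one, from 2 ^ n
  to M: by monotonicity all its 2 ^ n terms are at least \<open>a M * X M\<close>. The factor 4
  comes from M + 1 <= 4 * 2 ^ n.\<close>

lemma dyadic_block_le:
  fixes a X Y :: "nat \<Rightarrow> real"
  assumes a: "\<And>k. a k \<ge> 0" "decseq a" and X: "decseq X" "\<And>k. X k \<ge> 0" and Y: "\<And>k. Y k \<ge> 0" and K: "K \<ge> 0"
    and block: "\<And>m. (\<Sum>k=m..2 * m. Y k) \<le> K * (real m + 1) * X m"
  shows "(\<Sum>k<2 ^ Suc n. a k * Y k) \<le> 4 * K * (\<Sum>k<2 ^ n. a k * X k)"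
proof (induction n)
  case 0
  \<comment> \<open>At the bottom the indices 0 and 1 are both charged to index 0, with factors 1
    and 2.\<close>
  have "Y 0 \<le> K * X 0" using block[of 0] by simp
  moreover have "Y 1 \<le> K * 2 * X 1"
  proof -
    have "(\<Sum>k\<in>{1}. Y k) \<le> (\<Sum>k=1..2 * 1. Y k)" by (rule sum_mono2) (use Y in auto)
    then show ?thesis using block[of 1] by simp
  qed
  moreover have "a 1 * (K * 2 * X 1) \<le> a 0 * (K * 2 * X 0)"
    using decseqD[OF a(2), of 0 1] decseqD[OF X(1), of 0 1] a(1) X(2) K by (intro mult_mono mult_nonneg_nonneg) auto
  ultimately have "a 0 * Y 0 + a 1 * Y 1 \<le> a 0 * (K * X 0) + a 0 * (K * 2 * X 0)"
    using mult_left_mono[of "Y 0" "K * X 0" "a 0"] mult_left_mono[of "Y 1" "K * 2 * X 1" "a 1"] a(1)[of 0] a(1)[of 1] by linarith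
  also have "\<dots> \<le> 4 * K * (a 0 * X 0)" using K a(1)[of 0] X(2)[of 0] by (simp add: mult_ac)
  finally show ?case by (simp add: lessThan_Suc numeral_2_eq_2)
next
  case (Suc n)
  define M :: nat where "M = 2 ^ Suc n"
  have M: "2 * 2 ^ n = M" by (simp add: M_def)
  have "(\<Sum>k<2 * M. a k * Y k) = (\<Sum>k<M. a k * Y k) + (\<Sum>k=M..<2 * M. a k * Y k)"
    by (metis (no_types, lifting) atLeast0LessThan le_add2 mult_2 sum.atLeastLessThan_concat zero_le)
  also have "(\<Sum>k=M..<2 * M. a k * Y k) \<le> (\<Sum>k=M..<2 * M. a M * Y k)"
    using decseqD[OF a(2)] Y by (intro sum_mono mult_right_mono) auto
  also have "\<dots> \<le> a M * (\<Sum>k=M..2 * M. Y k)"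
    unfolding sum_distrib_left using a(1) Y by (intro sum_mono2) auto
  also have "\<dots> \<le> a M * (K * (real M + 1) * X M)" by (intro mult_left_mono block a)
  also have "\<dots> \<le> a M * (K * (4 * 2 ^ n) * X M)"
  proof -
    have "real M = 2 * 2 ^ n" by (simp add: M_def)
    moreover have "1 \<le> (2::real) ^ n" by simp
    ultimately have "real M + 1 \<le> 4 * 2 ^ n" by linarith
    then show ?thesis using a(1) K X(2) by (intro mult_left_mono mult_right_mono) auto
  qed
  also have "\<dots> = 4 * K * (\<Sum>k=2 ^ n..<M. a M * X M)"
    by (simp add: M[symmetric] mult_ac)
  also have "\<dots> \<le> 4 * K * (\<Sum>k=2 ^ n..<M. a k * X k)"
    using decseqD[OF a(2)] decseqD[OF X(1)] a(1) X(2) K by (intro mult_left_mono sum_mono mult_mono) auto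
  finally have "(\<Sum>k<2 * M. a k * Y k) \<le> 4 * K * (\<Sum>k<2 ^ n. a k * X k) + 4 * K * (\<Sum>k=2 ^ n..<M. a k * X k)"
    using Suc by (simp add: M_def)
  also have "\<dots> = 4 * K * (\<Sum>k<M. a k * X k)"
  proof -
    have "(\<Sum>k<M. a k * X k) = (\<Sum>k<2 ^ n. a k * X k) + (\<Sum>k=2 ^ n..<M. a k * X k)"
      unfolding atLeast0LessThan[symmetric] M[symmetric]
      by (rule sum.atLeastLessThan_concat[symmetric]) auto
    then show ?thesis by (simp add: distrib_left)
  qed
  finally show ?case by (simp add: M_def)
qed

text \<open>The dyadic bound holds for every partial sum, so summability of the left side comes out
  together with the estimate; on the right X is bounded by \<open>X 0\<close> and a is
  summable.\<close>

lemma monotone_weights_sum_le: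
  fixes a X Y :: "nat \<Rightarrow> real"
  assumes a: "\<And>k. a k \<ge> 0" "decseq a" "summable a"
    and X: "decseq X" "\<And>k. X k \<ge> 0" and Y: "\<And>k. Y k \<ge> 0" and K: "K \<ge> 0"
    and block: "\<And>m. (\<Sum>k=m..2 * m. Y k) \<le> K * (real m + 1) * X m"
  shows "summable (\<lambda>k. a k * Y k) \<and> summable (\<lambda>k. a k * X k) \<and> (\<Sum>k. a k * Y k) \<le> 4 * K * (\<Sum>k. a k * X k)"
proof -
  have sX: "summable (\<lambda>k. a k * X k)"
  proof (rule summable_comparison_test'[where N = 0])
    show "summable (\<lambda>k. a k * X 0)" by (intro summable_mult2 a)
    show "norm (a k * X k) \<le> a k * X 0" for k
      using a(1)[of k] X(2)[of k] decseqD[OF X(1), of 0 k] by (simp add: mult_left_mono)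
  qed
  have part: "(\<Sum>k<n. a k * Y k) \<le> 4 * K * (\<Sum>k. a k * X k)" for n
  proof -
    have "n \<le> 2 ^ Suc n" unfolding power_Suc using less_imp_le[OF less_exp[of n]] by linarith
    then have "(\<Sum>k<n. a k * Y k) \<le> (\<Sum>k<2 ^ Suc n. a k * Y k)"
      using a(1) Y by (intro sum_mono2) auto
    also have "\<dots> \<le> 4 * K * (\<Sum>k<2 ^ n. a k * X k)" by (rule dyadic_block_le[OF a(1,2) X Y K block])
    also have "\<dots> \<le> 4 * K * (\<Sum>k. a k * X k)"
      using a(1) X(2) K by (intro mult_left_mono sum_le_suminf sX) auto
    finally show ?thesis .
  qed
  have sY: "summable (\<lambda>k. a k * Y k)" by (rule summableI_nonneg_bounded[OF _ part]) (use a(1) Y in auto)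
  moreover have "(\<Sum>k. a k * Y k) \<le> 4 * K * (\<Sum>k. a k * X k)"
    by (rule suminf_le_const[OF sY part])
  ultimately show ?thesis using sX by blast
qed

text \<open>Uses \<open>u powr q \<le> 1 + u\<^sup>2\<close> for \<open>u = y k / \<beta>\<close>.\<close>

lemma powr_sum_from_square_sum:
  fixes y :: "nat \<Rightarrow> real"
  assumes q: "0 < q" "q \<le> 2" and y: "\<And>k. y k \<ge> 0" and b: "\<beta> \<ge> 0" and C: "C \<ge> 0"
    and sq: "(\<Sum>k=m..2 * m. (y k)\<^sup>2) \<le> C * (real m + 1) * \<beta>\<^sup>2"
  shows "(\<Sum>k=m..2 * m. y k powr q) \<le> (C + 1) * (real m + 1) * \<beta> powr q"
proof (cases "\<beta> = 0")
  case True
  \<comment> \<open>Without a positive \<beta> to divide by, the square sum is 0 and every term of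
    the block vanishes.\<close>
  then have s0: "(\<Sum>k=m..2 * m. (y k)\<^sup>2) \<le> 0" using sq by simp
  have "y k = 0" if "k \<in> {m..2 * m}" for k
  proof -
    have "(y k)\<^sup>2 \<le> (\<Sum>k=m..2 * m. (y k)\<^sup>2)" using that by (intro member_le_sum) auto
    then show ?thesis using s0 by (smt (verit) zero_le_power2 power_eq_0_iff)
  qed
  then show ?thesis using True by simp
next
  case False
  then have bp: "\<beta> > 0" using b by simp
  have "y k powr q \<le> \<beta> powr q * (1 + (y k)\<^sup>2 / \<beta>\<^sup>2)" for k
  proof -
    define u where "u = y k / \<beta>"
    have u: "u \<ge> 0" "y k = \<beta> * u" using y bp by (auto simp: u_def)
    have "u powr q \<le> 1 + u\<^sup>2"
    proof (cases "u \<le> 1")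
      case True
      then have "u powr q \<le> 1" using u q by (simp add: powr_le1)
      then show ?thesis by (simp add: add_increasing2)
    next
      case False
      then have "u powr q \<le> u powr 2" using q by (intro powr_mono) auto
      also have "\<dots> = u\<^sup>2" using False by (simp add: powr_numeral)
      finally show ?thesis by simp
    qed
    then have "\<beta> powr q * u powr q \<le> \<beta> powr q * (1 + u\<^sup>2)" by (intro mult_left_mono) auto
    then show ?thesis using u bp by (simp add: powr_mult power_mult_distrib)
  qed
  then have "(\<Sum>k=m..2 * m. y k powr q) \<le> (\<Sum>k=m..2 * m. \<beta> powr q * (1 + (y k)\<^sup>2 / \<beta>\<^sup>2))"
    by (intro sum_mono) auto
  also have "\<dots> = \<beta> powr q * (real m + 1 + (\<Sum>k=m..2 * m. (y k)\<^sup>2) / \<beta>\<^sup>2)"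
    by (simp add: sum_distrib_left[symmetric] sum.distrib sum_divide_distrib[symmetric])
  also have "\<dots> \<le> \<beta> powr q * (real m + 1 + C * (real m + 1))"
    using sq bp by (intro mult_left_mono add_left_mono) (auto simp: pos_divide_le_eq)
  also have "\<dots> = (C + 1) * (real m + 1) * \<beta> powr q" by (simp add: algebra_simps)
  finally show ?thesis .
qed

text \<open>The deviation is split into partial sum minus \<open>vp_mean\<close>, the head
  \<open>X k\<close> and the tail. Only the head needs the average over k; the other two have bounds
  for each k that decrease in k.\<close>

lemma strong_square_mean_bound:
  assumes \<alpha>: "\<alpha> > 0" and w: "modulus_type w" and f: "f \<in> Omega12 \<alpha> x w" and \<Lambda>: "fourier_exponents f \<Lambda>"
    and g: "g \<in> stepanov_ap_borel" and neg: "negligible {t. f t \<noteq> g t}"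
  shows "\<exists>K\<ge>0. \<forall>m. (\<Sum>k=m..2 * m. (norm (fourier_partial_sum f \<Lambda> (\<alpha> * real k / 2) x - f x))\<^sup>2)
     \<le> K * (real m + 1) * (w (pi / (real m + 1)) + best_approx (\<alpha> * real m / 2) g)\<^sup>2"
proof -
  have f1: "f \<in> Omega1 \<alpha>" using f by (simp add: Omega12_def)
  obtain C where C: "C > 0" and H: "\<forall>\<gamma>>0. \<forall>\<delta>>0.
     1 / \<delta> * integral {0..\<delta>} (\<lambda>t. norm (second_diff f x t - second_diff f x (t + \<gamma>))) \<le> C * w \<gamma> \<and>
     1 / \<delta> * integral {0..\<delta>} (\<lambda>t. norm (second_diff f x t - second_diff f x (t - \<gamma>))) \<le> C * w \<gamma> \<and>
     G21 \<alpha> f x \<delta> \<le> C * w \<delta>"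
    using f unfolding Omega12_def by blast
  have trf: "1 / \<delta> * integral {0..\<delta>} (\<lambda>t. norm (second_diff f x t - second_diff f x (t + \<gamma>))) \<le> C * w \<gamma>"
    if "\<gamma> > 0" "\<delta> > 0" for \<gamma> \<delta> using H that by blast
  have Gf: "G21 \<alpha> f x \<delta> \<le> C * w \<delta>" if "\<delta> > 0" for \<delta> using H that zero_less_one by blast
  have nn: "\<And>\<delta>. \<delta> \<ge> 0 \<Longrightarrow> w \<delta> \<ge> 0" and mono: "mono_on {0..} w" using w by (auto simp: modulus_type_def)
  obtain B where B: "B > 0" "\<And>t. norm (g t) \<le> B" and gm [measurable]: "g \<in> borel_measurable borel"
    using stepanov_ap_borelE[OF g] by metis
  \<comment> \<open>The translates come from the representative g, but the subtracted value is that
    of f: g may differ from f at x, and the claim is about \<open>f x\<close>.\<close>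
  define \<phi> where "\<phi> = (\<lambda>t. g (x + t) + g (x - t) - 2 * f x)"
  have \<phi>m [measurable]: "\<phi> \<in> borel_measurable borel" unfolding \<phi>_def by measurable
  define B' where "B' = B + B + norm (2 * f x)"
  have \<phi>B: "norm (\<phi> t) \<le> B'" for t
    unfolding \<phi>_def B'_def
    by (intro order_trans[OF norm_triangle_ineq4 add_mono] order_trans[OF norm_triangle_ineq add_mono] B order_refl)
  have neg1: "negligible {t. second_diff f x t \<noteq> \<phi> t}"
  proof (rule negligible_subset)
    show "negligible ({t. f (t + x) \<noteq> g (t + x)} \<union> {t. f (x - t) \<noteq> g (x - t)})"
      by (intro negligible_Un negligible_diff_translate neg)
  qed (auto simp: second_diff_def \<phi>_def add.commute)
  have int1: "integral S (\<lambda>t. norm (second_diff f x t)) = integral S (\<lambda>t. norm (\<phi> t))" for S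
    by (rule integral_eq_of_ae_eq[OF negligible_subset[OF neg1]]) auto
  have int2: "integral S (\<lambda>t. norm (second_diff f x t - second_diff f x (t + \<gamma>))) = integral S (\<lambda>t. norm (\<phi> t - \<phi> (t + \<gamma>)))" for S \<gamma>
  proof (rule integral_eq_of_ae_eq)
    have "negligible ({t. second_diff f x t \<noteq> \<phi> t} \<union> {t. second_diff f x (t + \<gamma>) \<noteq> \<phi> (t + \<gamma>)})"
      by (intro negligible_Un negligible_diff_translate neg1)
    then show "negligible {t. norm (second_diff f x t - second_diff f x (t + \<gamma>)) \<noteq> norm (\<phi> t - \<phi> (t + \<gamma>))}"
      by (rule negligible_subset) auto
  qed
  have tr: "1 / \<delta> * integral {0..\<delta>} (\<lambda>t. norm (\<phi> t - \<phi> (t + \<gamma>))) \<le> C * w \<gamma>" if "\<gamma> > 0" "\<delta> > 0" for \<gamma> \<delta>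
    using trf[OF that] by (simp only: int2)
  have G: "(\<Sum>j<nat \<lfloor>pi / (\<alpha> * \<delta>)\<rfloor> + 1. (1 / ((real j + 1) * \<delta>) * integral {real j * \<delta>..(real j + 1) * \<delta>} (\<lambda>t. norm (\<phi> t)))\<^sup>2) \<le> (C * w \<delta>)\<^sup>2"
    if d: "\<delta> > 0" for \<delta>
  proof -
    have "sqrt (\<Sum>j<nat \<lfloor>pi / (\<alpha> * \<delta>)\<rfloor> + 1. (1 / ((real j + 1) * \<delta>) * integral {real j * \<delta>..(real j + 1) * \<delta>} (\<lambda>t. norm (\<phi> t)))\<^sup>2) \<le> C * w \<delta>"
      using Gf[OF d] unfolding G21_def int1 atLeast0AtMost Suc_eq_plus1[symmetric] lessThan_Suc_atMost .
    then show ?thesis by (rule sqrt_le_D)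
  qed
  \<comment> \<open>The term with index 0 of the sum in \<open>G21\<close> alone is a mean of
    |\<phi>| over [0, \<delta>].\<close>
  have mn: "1 / \<delta> * integral {0..\<delta>} (\<lambda>t. norm (\<phi> t)) \<le> C * w \<delta>" if d: "\<delta> > 0" for \<delta>
  proof -
    have "(1 / ((real 0 + 1) * \<delta>) * integral {real 0 * \<delta>..(real 0 + 1) * \<delta>} (\<lambda>t. norm (\<phi> t)))\<^sup>2
      \<le> (\<Sum>j<nat \<lfloor>pi / (\<alpha> * \<delta>)\<rfloor> + 1. (1 / ((real j + 1) * \<delta>) * integral {real j * \<delta>..(real j + 1) * \<delta>} (\<lambda>t. norm (\<phi> t)))\<^sup>2)"
      by (rule member_le_sum[of 0 _ "\<lambda>j. (1 / ((real j + 1) * \<delta>) * integral {real j * \<delta>..(real j + 1) * \<delta>} (\<lambda>t. norm (\<phi> t)))\<^sup>2"]) auto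
    also have "\<dots> \<le> (C * w \<delta>)\<^sup>2" by (rule G[OF d])
    finally have "1 / ((real 0 + 1) * \<delta>) * integral {real 0 * \<delta>..(real 0 + 1) * \<delta>} (\<lambda>t. norm (\<phi> t)) \<le> C * w \<delta>"
      by (rule power2_le_imp_le) (use C nn[of \<delta>] d in auto)
    then show ?thesis by simp
  qed
  obtain Kt where Kt: "Kt \<ge> 0" "\<And>k. norm (LBINT t. indicator {pi / \<alpha>..} t *\<^sub>R
      (of_real (vp_kernel (\<alpha> * real k / 2) (\<alpha> * (real k + 1) / 2) t) * \<phi> t)) \<le> Kt * w (pi / (real k + 1))"
    using tail_modulus_bound[OF \<phi>m \<phi>B \<alpha> w C tr mn] by blast
  define Kh where "Kh = (2 * \<alpha>\<^sup>2 + 8 * (64 + 576 / (\<alpha> * pi / 2)\<^sup>2)) * C\<^sup>2"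
  have Kh: "Kh \<ge> 0" by (simp add: Kh_def)
  define X where "X = (\<lambda>k::nat. LBINT t. indicator {0..<pi / \<alpha>} t *\<^sub>R
      (of_real (vp_kernel (\<alpha> * real k / 2) (\<alpha> * (real k + 1) / 2) t) * \<phi> t))"
  have head: "(\<Sum>k=m..2 * m. (norm (X k))\<^sup>2) \<le> Kh * (real m + 1) * (w (pi / (real m + 1)))\<^sup>2" for m
  proof -
    have d: "pi / (real m + 1) > 0" by simp
    have "(\<Sum>k=m..2 * m. (norm (X k))\<^sup>2) \<le> (2 * \<alpha>\<^sup>2 + 8 * (64 + 576 / (\<alpha> * pi / 2)\<^sup>2)) * (real m + 1) * (C * w (pi / (real m + 1)))\<^sup>2"
      unfolding X_def
      by (rule head_bound[OF \<phi>m \<phi>B \<alpha> refl refl G[OF d]]) (use C nn[of "pi / (real m + 1)"] in auto)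
    then show ?thesis by (simp add: Kh_def power_mult_distrib mult_ac)
  qed
  \<comment> \<open>Everything except the head is replaced by its value at the left end m of the
    block, by monotonicity of w and of the best approximation.\<close>
  have dec: "norm (fourier_partial_sum f \<Lambda> (\<alpha> * real k / 2) x - f x)
      \<le> norm (X k) + (Kt * w (pi / (real m + 1)) + 2 * best_approx (\<alpha> * real m / 2) g)" if k: "m \<le> k" for k m
  proof -
    define a b where "a = \<alpha> * real k / 2" and "b = \<alpha> * (real k + 1) / 2"
    have ab: "0 \<le> a" "a < b" using \<alpha> by (auto simp: a_def b_def field_simps)
    define F where "F = (\<lambda>t. of_real (vp_kernel a b t) * \<phi> t)"
    have Fi: "integrable lborel (\<lambda>t. indicator {0..} t *\<^sub>R F t)"
      and Fv: "vp_mean a b g x - f x = (LBINT t. indicator {0..} t *\<^sub>R F t)"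
      using vp_mean_minus_const[OF ab gm B(2), of x "f x"] by (simp_all add: F_def \<phi>_def)
    have T0: "0 \<le> t" if "pi / \<alpha> \<le> t" for t
      using divide_pos_pos[OF pi_gt_zero \<alpha>] that by linarith
    have split: "indicator {0..} t *\<^sub>R F t = indicator {0..<pi / \<alpha>} t *\<^sub>R F t + indicator {pi / \<alpha>..} t *\<^sub>R F t" for t
      using T0[of t] by (auto simp: indicator_def)
    have 1: "integrable lborel (\<lambda>t. indicator {0..<pi / \<alpha>} t *\<^sub>R F t)"
    proof -
      have "integrable lborel (\<lambda>t. indicator {0..<pi / \<alpha>} t *\<^sub>R (indicator {0..} t *\<^sub>R F t))"
        by (rule integrable_mult_indicator[OF _ Fi]) simp
      moreover have "indicator {0..<pi / \<alpha>} t *\<^sub>R (indicator {0..} t *\<^sub>R F t) = indicator {0..<pi / \<alpha>} t *\<^sub>R F t" for t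
        by (auto simp: indicator_def)
      ultimately show ?thesis by (simp only:)
    qed
    have 2: "integrable lborel (\<lambda>t. indicator {pi / \<alpha>..} t *\<^sub>R F t)"
    proof -
      have "integrable lborel (\<lambda>t. indicator {pi / \<alpha>..} t *\<^sub>R (indicator {0..} t *\<^sub>R F t))"
        by (rule integrable_mult_indicator[OF _ Fi]) simp
      moreover have "indicator {pi / \<alpha>..} t *\<^sub>R (indicator {0..} t *\<^sub>R F t) = indicator {pi / \<alpha>..} t *\<^sub>R F t" for t
        using T0[of t] by (auto simp: indicator_def)
      ultimately show ?thesis by (simp only:)
    qed
    have "vp_mean a b g x - f x = X k + (LBINT t. indicator {pi / \<alpha>..} t *\<^sub>R F t)"
      unfolding Fv split Bochner_Integration.integral_add[OF 1 2] by (simp add: X_def F_def a_def b_def)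
    then have "norm (vp_mean a b g x - f x) \<le> norm (X k) + norm (LBINT t. indicator {pi / \<alpha>..} t *\<^sub>R F t)"
      using norm_triangle_ineq by metis
    moreover have "norm (LBINT t. indicator {pi / \<alpha>..} t *\<^sub>R F t) \<le> Kt * w (pi / (real k + 1))"
      using Kt(2)[of k] by (simp add: F_def a_def b_def)
    moreover have "Kt * w (pi / (real k + 1)) \<le> Kt * w (pi / (real m + 1))"
      using k Kt(1) by (intro mult_left_mono mono_onD[OF mono] divide_left_mono) auto
    moreover have "norm (fourier_partial_sum f \<Lambda> a x - vp_mean a b g x) \<le> 2 * best_approx a g"
      unfolding a_def b_def by (rule partial_sum_vp_mean_diff[OF f1 \<Lambda> \<alpha> g fourier_coeff_ae_eq[OF neg]])
    moreover have "best_approx a g \<le> best_approx (\<alpha> * real m / 2) g"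
      unfolding a_def using k \<alpha> by (intro best_approx_antimono[OF g]) auto
    moreover have "norm (fourier_partial_sum f \<Lambda> a x - f x) \<le> norm (fourier_partial_sum f \<Lambda> a x - vp_mean a b g x) + norm (vp_mean a b g x - f x)"
      using norm_triangle_ineq[of "fourier_partial_sum f \<Lambda> a x - vp_mean a b g x" "vp_mean a b g x - f x"] by simp
    ultimately show ?thesis unfolding a_def by linarith
  qed
  define K where "K = 2 * Kh + 2 * (Kt + 2)\<^sup>2"
  have "(\<Sum>k=m..2 * m. (norm (fourier_partial_sum f \<Lambda> (\<alpha> * real k / 2) x - f x))\<^sup>2)
     \<le> K * (real m + 1) * (w (pi / (real m + 1)) + best_approx (\<alpha> * real m / 2) g)\<^sup>2" for m
  proof -
    define W where "W = w (pi / (real m + 1))"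
    define E where "E = best_approx (\<alpha> * real m / 2) g"
    have "W \<ge> 0" unfolding W_def by (rule nn) simp
    moreover have "E \<ge> 0" unfolding E_def by (rule best_approx_nonneg[OF g]) (use \<alpha> in simp)
    ultimately have WE: "W \<ge> 0" "E \<ge> 0" .
    have two: "(p + q)\<^sup>2 \<le> 2 * p\<^sup>2 + 2 * q\<^sup>2" for p q :: real
      using sum_squares_ge_zero[of "p - q" 0] by (simp add: power2_eq_square algebra_simps)
    have q: "Kt * W + 2 * E \<le> (Kt + 2) * (W + E)" using WE Kt(1) by (simp add: algebra_simps)
    have "(\<Sum>k=m..2 * m. (norm (fourier_partial_sum f \<Lambda> (\<alpha> * real k / 2) x - f x))\<^sup>2)
      \<le> (\<Sum>k=m..2 * m. 2 * (norm (X k))\<^sup>2 + 2 * ((Kt + 2) * (W + E))\<^sup>2)"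
    proof (rule sum_mono)
      fix k assume k: "k \<in> {m..2 * m}"
      have "norm (fourier_partial_sum f \<Lambda> (\<alpha> * real k / 2) x - f x) \<le> norm (X k) + (Kt + 2) * (W + E)"
        using dec[of m k] k q unfolding W_def E_def by auto
      then have "(norm (fourier_partial_sum f \<Lambda> (\<alpha> * real k / 2) x - f x))\<^sup>2 \<le> (norm (X k) + (Kt + 2) * (W + E))\<^sup>2"
        by (intro power_mono) auto
      also have "\<dots> \<le> 2 * (norm (X k))\<^sup>2 + 2 * ((Kt + 2) * (W + E))\<^sup>2" by (rule two)
      finally show "(norm (fourier_partial_sum f \<Lambda> (\<alpha> * real k / 2) x - f x))\<^sup>2 \<le> 2 * (norm (X k))\<^sup>2 + 2 * ((Kt + 2) * (W + E))\<^sup>2" .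
    qed
    also have "\<dots> = 2 * (\<Sum>k=m..2 * m. (norm (X k))\<^sup>2) + (real m + 1) * (2 * ((Kt + 2) * (W + E))\<^sup>2)"
      by (simp only: sum.distrib sum_distrib_left[symmetric]) simp
    also have "\<dots> \<le> 2 * (Kh * (real m + 1) * (W + E)\<^sup>2) + (real m + 1) * (2 * ((Kt + 2) * (W + E))\<^sup>2)"
    proof (intro add_right_mono mult_left_mono)
      have "Kh * (real m + 1) * W\<^sup>2 \<le> Kh * (real m + 1) * (W + E)\<^sup>2"
        using WE Kh by (intro mult_left_mono power_mono) auto
      then show "(\<Sum>k=m..2 * m. (norm (X k))\<^sup>2) \<le> Kh * (real m + 1) * (W + E)\<^sup>2"
        using head[of m] unfolding W_def by linarith
    qed simp
    also have "\<dots> = K * (real m + 1) * (W + E)\<^sup>2"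
    proof -
      have "2 * (Kh * n * z\<^sup>2) + n * (2 * (c * z)\<^sup>2) = (2 * Kh + 2 * c\<^sup>2) * n * z\<^sup>2" for n z c :: real
        by (simp add: power_mult_distrib algebra_simps)
      then show ?thesis unfolding K_def .
    qed
    finally show ?thesis by (simp only: W_def E_def)
  qed
  moreover have "K \<ge> 0" using Kh by (simp add: K_def)
  ultimately show ?thesis by blast
qed

theorem theorem6:
  fixes \<alpha> q x :: real and w :: "real \<Rightarrow> real" and f :: "real \<Rightarrow> complex"
    and \<Lambda> :: "int \<Rightarrow> real" and a :: "nat \<Rightarrow> nat \<Rightarrow> real"
  assumes "\<alpha> > 0" and "0 < q" and "q \<le> 2"
    and "modulus_type w"
    and "f \<in> Omega12 \<alpha> x w"
    and "fourier_exponents f \<Lambda>"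
    and "\<And>n k. a n k \<ge> 0"
    and "\<And>n. (\<lambda>k. a n k) sums 1"
    and "(\<lambda>n. a n 0) \<longlonglongrightarrow> 0"
    and "\<And>n. decseq (\<lambda>k. a n k)"
  shows "\<exists>K>0. \<forall>n.
    summable (\<lambda>k. a n k * norm (fourier_partial_sum f \<Lambda> (\<alpha> * real k / 2) x - f x) powr q) \<and>
    summable (\<lambda>k. a n k * (w (pi / (real k + 1)) + best_approx (\<alpha> * real k / 2) f) powr q) \<and>
    (\<Sum>k. a n k * norm (fourier_partial_sum f \<Lambda> (\<alpha> * real k / 2) x - f x) powr q) powr (1 / q)
      \<le> K * (\<Sum>k. a n k * (w (pi / (real k + 1)) + best_approx (\<alpha> * real k / 2) f) powr q) powr (1 / q)"
proof -
  have fs: "f \<in> stepanov_ap" "bounded (range f)" using assms(5) by (auto simp: Omega12_def Omega1_def)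
  obtain g B where gB: "g \<in> borel_measurable borel" "B > 0" "\<And>t. norm (g t) \<le> B" and neg: "negligible {t. f t \<noteq> g t}"
    using borel_representative[OF fs] by blast
  have g: "g \<in> stepanov_ap_borel" by (rule stepanov_ap_ae_eq[OF fs(1) gB(1,3) neg])
  obtain K where K: "K \<ge> 0" and sq: "\<And>m. (\<Sum>k=m..2 * m. (norm (fourier_partial_sum f \<Lambda> (\<alpha> * real k / 2) x - f x))\<^sup>2)
     \<le> K * (real m + 1) * (w (pi / (real m + 1)) + best_approx (\<alpha> * real m / 2) g)\<^sup>2"
    using strong_square_mean_bound[OF assms(1,4,5,6) g neg] by blast
  define \<beta> where "\<beta> = (\<lambda>k. w (pi / (real k + 1)) + best_approx (\<alpha> * real k / 2) f)"
  define y where "y = (\<lambda>k. norm (fourier_partial_sum f \<Lambda> (\<alpha> * real k / 2) x - f x))"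
  \<comment> \<open>Best approximation involves f only through integrals, so passing to the
    representative leaves it unchanged.\<close>
  have bg: "\<beta> k = w (pi / (real k + 1)) + best_approx (\<alpha> * real k / 2) g" for k
    by (simp add: \<beta>_def best_approx_ae_eq[OF neg])
  have nn: "\<And>\<delta>. \<delta> \<ge> 0 \<Longrightarrow> w \<delta> \<ge> 0" and mono: "mono_on {0..} w" using assms(4) by (auto simp: modulus_type_def)
  have b0: "\<beta> k \<ge> 0" for k
    unfolding bg using assms(1) by (intro add_nonneg_nonneg nn best_approx_nonneg[OF g]) auto
  have bdec: "\<beta> k \<le> \<beta> m" if "m \<le> k" for m k
    unfolding bg using that assms(1)
    by (intro add_mono mono_onD[OF mono] best_approx_antimono[OF g] divide_left_mono) auto
  have block: "(\<Sum>k=m..2 * m. y k powr q) \<le> (K + 1) * (real m + 1) * \<beta> m powr q" for m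
    by (rule powr_sum_from_square_sum[OF assms(2,3) _ b0 K]) (use sq[of m] in \<open>simp_all add: y_def bg\<close>)
  \<comment> \<open>The factor 4 comes from the dyadic blocks, and K + 1 from the passage from
    squares to powers q.\<close>
  define L where "L = 4 * (K + 1)"
  have main: "summable (\<lambda>k. a n k * y k powr q) \<and> summable (\<lambda>k. a n k * \<beta> k powr q) \<and>
      (\<Sum>k. a n k * y k powr q) \<le> L * (\<Sum>k. a n k * \<beta> k powr q)" for n
    unfolding L_def
  proof (rule monotone_weights_sum_le[OF assms(7,10) _ _ _ _ _ block])
    show "summable (a n)" using assms(8)[of n] by (rule sums_summable)
    show "decseq (\<lambda>k. \<beta> k powr q)"
      using bdec b0 assms(2) by (intro decseq_SucI powr_mono2) auto
  qed (use K in auto)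
  have L: "L > 0" using K by (simp add: L_def)
  show ?thesis
  proof (intro exI[of _ "L powr (1 / q)"] conjI allI)
    show "L powr (1 / q) > 0" using L by simp
    fix n
    show "summable (\<lambda>k. a n k * norm (fourier_partial_sum f \<Lambda> (\<alpha> * real k / 2) x - f x) powr q)"
      "summable (\<lambda>k. a n k * (w (pi / (real k + 1)) + best_approx (\<alpha> * real k / 2) f) powr q)"
      using main[of n] by (simp_all add: y_def \<beta>_def)
    have s0: "0 \<le> (\<Sum>k. a n k * y k powr q)" "0 \<le> (\<Sum>k. a n k * \<beta> k powr q)"
      using main[of n] assms(7) by (auto intro!: suminf_nonneg)
    have "(\<Sum>k. a n k * y k powr q) powr (1 / q) \<le> (L * (\<Sum>k. a n k * \<beta> k powr q)) powr (1 / q)"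
      using main[of n] s0 assms(2) by (intro powr_mono2) auto
    also have "\<dots> = L powr (1 / q) * (\<Sum>k. a n k * \<beta> k powr q) powr (1 / q)"
      using L s0 by (simp add: powr_mult)
    finally show "(\<Sum>k. a n k * norm (fourier_partial_sum f \<Lambda> (\<alpha> * real k / 2) x - f x) powr q) powr (1 / q)
      \<le> L powr (1 / q) * (\<Sum>k. a n k * (w (pi / (real k + 1)) + best_approx (\<alpha> * real k / 2) f) powr q) powr (1 / q)"
      by (simp add: y_def \<beta>_def)
  qed
qed

end
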